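(* Let $\mathfrak{g}$ be the Lie algebra of a compact simple matrix group, $\mathfrak{h}\subset\mathfrak{g}$ the Lie algebra of a maximal torus, $W$ the Weyl group, $\Phi$ the root system with a choice of positive roots, and $\rho=\frac12\sum_{\alpha>0}\alpha$. Let $\lambda$ be a dominant (generalised) weight and $V_\lambda$ the irreducible finite-dimensional representation with highest weight $\lambda$. Then $$\mathrm{ch}(V_\lambda)=\Pi^{-1}\sum_{\sigma\in W}\varepsilon(\sigma)\,e^{\sigma(\lambda+\rho)-\rho},\qquad \Pi=\prod_{\alpha>0}(1-e^{-\alpha}).$$
   Context: A root is a non-zero $\alpha\in\mathfrak{h}^*$ such that some non-zero $E\in\mathfrak{g}_{\mathbb{C}}$ satisfies $[T,E]=i\alpha(T)E$ for all $T\in\mathfrak{h}$. A generalised weight is $\lambda\in\mathfrak{h}^*$ with $2(\lambda,\alpha)/(\alpha,\alpha)\in\mathbb{Z}$ for all roots $\alpha$; it is dominant if $(\lambda,\alpha)\ge0$ for all positive roots $\alpha$. Here $(\cdot,\cdot)$ comes from an invariant inner product on $\mathfrak{g}$. $V_\lambda$ is a representation of $\mathfrak{g}$; its character is the formal sum $\mathrm{ch}(V_\lambda)=\sum_\mu\dim(V_\lambda)_\mu\,e^\mu$, where $(V_\lambda)_\mu=\{v: Tv=i\mu(T)v\ \forall T\in\mathfrak{h}\}$. The sign $\varepsilon(\sigma)=\det_{\mathfrak{h}}(\sigma)\in\{\pm1\}$. *)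

theory Defs
  imports
    "HOL-Analysis.Analysis"
    "HOL-Combinatorics.Permutations"
    "HOL-Library.Function_Algebras"
    "HOL-Library.Poly_Mapping"
begin

section \<open>Compact matrix groups and their Lie algebras\<close>

text \<open>Matrix groups consist of complex matrices; real ones are included through the inclusion of
  real into complex matrices. On \<open>complex ^ 'n ^ 'n\<close> the class operations \<open>*\<close>, \<open>^\<close>
  are componentwise, so the exponential is written out with the matrix product.\<close>

definition matrix_group :: "(complex ^ 'n ^ 'n) set \<Rightarrow> bool" where
  "matrix_group G \<longleftrightarrow> mat 1 \<in> G \<and> (\<forall>A\<in>G. \<forall>A'\<in>G. A ** A' \<in> G) \<and>
     (\<forall>A\<in>G. invertible A \<and> matrix_inv A \<in> G)"

definition compact_matrix_group :: "(complex ^ 'n ^ 'n) set \<Rightarrow> bool" where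
  "compact_matrix_group G \<longleftrightarrow> matrix_group G \<and> compact G"

definition mat_exp :: "complex ^ 'n ^ 'n \<Rightarrow> complex ^ 'n ^ 'n" where
  "mat_exp A = suminf (\<lambda>k. (1 / fact k) *\<^sub>R (((**) A ^^ k) (mat 1)))"

definition lie_algebra :: "(complex ^ 'n ^ 'n) set \<Rightarrow> (complex ^ 'n ^ 'n) set" where
  "lie_algebra G = {X. \<forall>t::real. mat_exp (t *\<^sub>R X) \<in> G}"

definition lie_bracket :: "complex ^ 'n ^ 'n \<Rightarrow> complex ^ 'n ^ 'n \<Rightarrow> complex ^ 'n ^ 'n" where
  "lie_bracket X Y = X ** Y - Y ** X"

definition lie_ideal :: "(complex ^ 'n ^ 'n) set \<Rightarrow> (complex ^ 'n ^ 'n) set \<Rightarrow> bool" where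
  "lie_ideal \<aa> \<gg> \<longleftrightarrow> \<aa> \<subseteq> \<gg> \<and> subspace \<aa> \<and> (\<forall>X\<in>\<gg>. \<forall>Y\<in>\<aa>. lie_bracket X Y \<in> \<aa>)"

definition simple_lie_algebra :: "(complex ^ 'n ^ 'n) set \<Rightarrow> bool" where
  "simple_lie_algebra \<gg> \<longleftrightarrow> (\<exists>X\<in>\<gg>. \<exists>Y\<in>\<gg>. lie_bracket X Y \<noteq> 0) \<and>
     (\<forall>\<aa>. lie_ideal \<aa> \<gg> \<longrightarrow> \<aa> = {0} \<or> \<aa> = \<gg>)"

text \<open>Connectedness is not demanded: a compact group and its identity component have the same Lie
  algebra and the same maximal tori.\<close>

definition simple_matrix_group :: "(complex ^ 'n ^ 'n) set \<Rightarrow> bool" where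
  "simple_matrix_group G \<longleftrightarrow> matrix_group G \<and> simple_lie_algebra (lie_algebra G)"

definition torus_in :: "(complex ^ 'n ^ 'n) set \<Rightarrow> (complex ^ 'n ^ 'n) set \<Rightarrow> bool" where
  "torus_in G S \<longleftrightarrow> S \<subseteq> G \<and> compact_matrix_group S \<and> connected S \<and>
     (\<forall>A\<in>S. \<forall>A'\<in>S. A ** A' = A' ** A)"

definition maximal_torus :: "(complex ^ 'n ^ 'n) set \<Rightarrow> (complex ^ 'n ^ 'n) set \<Rightarrow> bool" where
  "maximal_torus G S \<longleftrightarrow> torus_in G S \<and> (\<forall>S'. torus_in G S' \<and> S \<subseteq> S' \<longrightarrow> S' = S)"

definition invariant_inner_product ::
    "(complex ^ 'n ^ 'n) set \<Rightarrow> (complex ^ 'n ^ 'n \<Rightarrow> complex ^ 'n ^ 'n \<Rightarrow> real) \<Rightarrow> bool" where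
  "invariant_inner_product \<gg> B \<longleftrightarrow>
     (\<forall>X\<in>\<gg>. \<forall>Y\<in>\<gg>. B X Y = B Y X) \<and>
     (\<forall>X\<in>\<gg>. \<forall>Y\<in>\<gg>. \<forall>Z\<in>\<gg>. B (X + Y) Z = B X Z + B Y Z) \<and>
     (\<forall>c. \<forall>X\<in>\<gg>. \<forall>Y\<in>\<gg>. B (c *\<^sub>R X) Y = c * B X Y) \<and>
     (\<forall>X\<in>\<gg>. X \<noteq> 0 \<longrightarrow> B X X > 0) \<and>
     (\<forall>X\<in>\<gg>. \<forall>Y\<in>\<gg>. \<forall>Z\<in>\<gg>. B (lie_bracket X Y) Z + B Y (lie_bracket X Z) = 0)"

section \<open>Roots, weights and the Weyl group\<close>

text \<open>A functional on the real vector space \<open>\<hh>\<close> is extended by \<open>0\<close> outside \<open>\<hh>\<close>, so that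
  functionals are equal iff they agree on \<open>\<hh>\<close>. Addition of functionals is pointwise.\<close>

type_synonym 'n functional = "complex ^ 'n ^ 'n \<Rightarrow> real"

definition dual_space :: "(complex ^ 'n ^ 'n) set \<Rightarrow> 'n functional set" where
  "dual_space \<hh> = {\<mu>. (\<forall>X\<in>\<hh>. \<forall>Y\<in>\<hh>. \<mu> (X + Y) = \<mu> X + \<mu> Y) \<and>
     (\<forall>c. \<forall>X\<in>\<hh>. \<mu> (c *\<^sub>R X) = c * \<mu> X) \<and> (\<forall>X. X \<notin> \<hh> \<longrightarrow> \<mu> X = 0)}"

text \<open>The complexification of \<open>\<gg>\<close> is \<open>\<gg> \<times> \<gg>\<close>, the pair \<open>(X, Y)\<close> standing for
  \<open>X + iY\<close>.\<close>

type_synonym 'n complexified = "(complex ^ 'n ^ 'n) \<times> (complex ^ 'n ^ 'n)"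

definition complexify :: "(complex ^ 'n ^ 'n) set \<Rightarrow> 'n complexified set" where
  "complexify \<gg> = \<gg> \<times> \<gg>"

fun cscale :: "complex \<Rightarrow> ('n::finite) complexified \<Rightarrow> 'n complexified" where
  "cscale c (X, Y) = (Re c *\<^sub>R X - Im c *\<^sub>R Y, Im c *\<^sub>R X + Re c *\<^sub>R Y)"

fun cbracket :: "('n::finite) complexified \<Rightarrow> ('n::finite) complexified \<Rightarrow> 'n complexified" where
  "cbracket (X, Y) (X', Y') =
     (lie_bracket X X' - lie_bracket Y Y', lie_bracket X Y' + lie_bracket Y X')"

definition root_space ::
    "(complex ^ 'n ^ 'n) set \<Rightarrow> (complex ^ 'n ^ 'n) set \<Rightarrow> 'n functional \<Rightarrow> 'n complexified set" where
  "root_space \<gg> \<hh> \<alpha> =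
     {E \<in> complexify \<gg>. \<forall>H\<in>\<hh>. cbracket (H, 0) E = cscale (\<i> * complex_of_real (\<alpha> H)) E}"

definition roots :: "(complex ^ 'n ^ 'n) set \<Rightarrow> (complex ^ 'n ^ 'n) set \<Rightarrow> 'n functional set" where
  "roots \<gg> \<hh> = {\<alpha> \<in> dual_space \<hh>. \<alpha> \<noteq> 0 \<and> (\<exists>E\<in>root_space \<gg> \<hh> \<alpha>. E \<noteq> 0)}"

definition positive_roots :: "(complex ^ 'n ^ 'n) set \<Rightarrow> 'n functional set \<Rightarrow> 'n functional set \<Rightarrow> bool" where
  "positive_roots \<hh> \<Phi> P \<longleftrightarrow>
     (\<exists>H\<in>\<hh>. (\<forall>\<alpha>\<in>\<Phi>. \<alpha> H \<noteq> 0) \<and> P = {\<alpha> \<in> \<Phi>. \<alpha> H > 0})"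

definition riesz ::
    "(complex ^ 'n ^ 'n) set \<Rightarrow> (complex ^ 'n ^ 'n \<Rightarrow> complex ^ 'n ^ 'n \<Rightarrow> real) \<Rightarrow>
     'n functional \<Rightarrow> complex ^ 'n ^ 'n" where
  "riesz \<hh> B \<mu> = (THE H. H \<in> \<hh> \<and> (\<forall>X\<in>\<hh>. B H X = \<mu> X))"

definition dual_inner ::
    "(complex ^ 'n ^ 'n) set \<Rightarrow> (complex ^ 'n ^ 'n \<Rightarrow> complex ^ 'n ^ 'n \<Rightarrow> real) \<Rightarrow>
     'n functional \<Rightarrow> 'n functional \<Rightarrow> real" where
  "dual_inner \<hh> B \<mu> \<nu> = B (riesz \<hh> B \<mu>) (riesz \<hh> B \<nu>)"

definition generalised_weight ::
    "(complex ^ 'n ^ 'n) set \<Rightarrow> (complex ^ 'n ^ 'n \<Rightarrow> complex ^ 'n ^ 'n \<Rightarrow> real) \<Rightarrow>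
     'n functional set \<Rightarrow> 'n functional \<Rightarrow> bool" where
  "generalised_weight \<hh> B \<Phi> \<mu> \<longleftrightarrow> \<mu> \<in> dual_space \<hh> \<and>
     (\<forall>\<alpha>\<in>\<Phi>. 2 * dual_inner \<hh> B \<mu> \<alpha> / dual_inner \<hh> B \<alpha> \<alpha> \<in> \<int>)"

definition dominant ::
    "(complex ^ 'n ^ 'n) set \<Rightarrow> (complex ^ 'n ^ 'n \<Rightarrow> complex ^ 'n ^ 'n \<Rightarrow> real) \<Rightarrow>
     'n functional set \<Rightarrow> 'n functional \<Rightarrow> bool" where
  "dominant \<hh> B P \<mu> \<longleftrightarrow> (\<forall>\<alpha>\<in>P. dual_inner \<hh> B \<mu> \<alpha> \<ge> 0)"

text \<open>The orthogonal reflection of \<open>\<hh>\<close> in the kernel of \<open>\<alpha>\<close>; since \<open>\<alpha>\<close> vanishes outside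
  \<open>\<hh>\<close>, it is the identity there. Elements of the Weyl group are therefore bijections of the whole
  matrix space which are determined by their action on \<open>\<hh>\<close>. As reflections are involutions, the
  products of reflections form the group generated by them.\<close>

definition reflection ::
    "(complex ^ 'n ^ 'n) set \<Rightarrow> (complex ^ 'n ^ 'n \<Rightarrow> complex ^ 'n ^ 'n \<Rightarrow> real) \<Rightarrow>
     'n functional \<Rightarrow> complex ^ 'n ^ 'n \<Rightarrow> complex ^ 'n ^ 'n" where
  "reflection \<hh> B \<alpha> X = X - (2 * \<alpha> X / dual_inner \<hh> B \<alpha> \<alpha>) *\<^sub>R riesz \<hh> B \<alpha>"

inductive_set weyl_group ::
    "(complex ^ 'n ^ 'n) set \<Rightarrow> (complex ^ 'n ^ 'n \<Rightarrow> complex ^ 'n ^ 'n \<Rightarrow> real) \<Rightarrow>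
     'n functional set \<Rightarrow> (complex ^ 'n ^ 'n \<Rightarrow> complex ^ 'n ^ 'n) set"
  for \<hh> B \<Phi> where
  one: "id \<in> weyl_group \<hh> B \<Phi>"
| step: "\<sigma> \<in> weyl_group \<hh> B \<Phi> \<Longrightarrow> \<alpha> \<in> \<Phi> \<Longrightarrow> reflection \<hh> B \<alpha> \<circ> \<sigma> \<in> weyl_group \<hh> B \<Phi>"

definition dual_action ::
    "(complex ^ 'n ^ 'n \<Rightarrow> complex ^ 'n ^ 'n) \<Rightarrow> 'n functional \<Rightarrow> 'n functional" where
  "dual_action \<sigma> \<mu> = \<mu> \<circ> inv \<sigma>"

text \<open>Determinant of a linear endomorphism of a finite-dimensional subspace: the Leibniz formula for
  its matrix with respect to a basis, on the choice of which it does not depend.\<close>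

definition det_on :: "'a::real_vector set \<Rightarrow> ('a \<Rightarrow> 'a) \<Rightarrow> real" where
  "det_on S f = (let E = (SOME E. independent E \<and> span E = S) in
     \<Sum>p | p permutes E. of_int (sign p) * (\<Prod>b\<in>E. representation E (f b) (p b)))"

definition half_sum :: "'n functional set \<Rightarrow> 'n functional" where
  "half_sum P = (\<lambda>X. (1 / 2) * (\<Sum>\<alpha>\<in>P. \<alpha> X))"

section \<open>Representations\<close>

definition lie_representation ::
    "(complex ^ 'n ^ 'n) set \<Rightarrow> (complex ^ 'n ^ 'n \<Rightarrow> complex ^ 'm ^ 'm) \<Rightarrow> bool" where
  "lie_representation \<gg> \<pi> \<longleftrightarrow>
     (\<forall>X\<in>\<gg>. \<forall>Y\<in>\<gg>. \<pi> (X + Y) = \<pi> X + \<pi> Y) \<and>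
     (\<forall>c::real. \<forall>X\<in>\<gg>. \<pi> (c *\<^sub>R X) = c *\<^sub>R \<pi> X) \<and>
     (\<forall>X\<in>\<gg>. \<forall>Y\<in>\<gg>. \<pi> (lie_bracket X Y) = lie_bracket (\<pi> X) (\<pi> Y))"

definition irreducible_representation ::
    "(complex ^ 'n ^ 'n) set \<Rightarrow> (complex ^ 'n ^ 'n \<Rightarrow> complex ^ 'm ^ 'm) \<Rightarrow> bool" where
  "irreducible_representation \<gg> \<pi> \<longleftrightarrow> lie_representation \<gg> \<pi> \<and>
     (\<forall>U. vec.subspace U \<and> (\<forall>X\<in>\<gg>. \<forall>v\<in>U. \<pi> X *v v \<in> U) \<longrightarrow> U = {0} \<or> U = UNIV)"

definition weight_space ::
    "(complex ^ 'n ^ 'n) set \<Rightarrow> (complex ^ 'n ^ 'n \<Rightarrow> complex ^ 'm ^ 'm) \<Rightarrow>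
     'n functional \<Rightarrow> (complex ^ 'm) set" where
  "weight_space \<hh> \<pi> \<mu> = {v. \<forall>H\<in>\<hh>. \<pi> H *v v = (\<i> * complex_of_real (\<mu> H)) *s v}"

fun complexified_action ::
    "(complex ^ 'n ^ 'n \<Rightarrow> complex ^ 'm ^ 'm) \<Rightarrow> ('n::finite) complexified \<Rightarrow> complex ^ 'm \<Rightarrow> complex ^ 'm" where
  "complexified_action \<pi> (X, Y) v = \<pi> X *v v + \<i> *s (\<pi> Y *v v)"

definition has_highest_weight ::
    "(complex ^ 'n ^ 'n) set \<Rightarrow> (complex ^ 'n ^ 'n) set \<Rightarrow> 'n functional set \<Rightarrow>
     (complex ^ 'n ^ 'n \<Rightarrow> complex ^ 'm ^ 'm) \<Rightarrow> 'n functional \<Rightarrow> bool" where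
  "has_highest_weight \<gg> \<hh> P \<pi> \<mu> \<longleftrightarrow> \<mu> \<in> dual_space \<hh> \<and>
     (\<exists>v\<in>weight_space \<hh> \<pi> \<mu>. v \<noteq> 0 \<and>
        (\<forall>\<alpha>\<in>P. \<forall>E\<in>root_space \<gg> \<hh> \<alpha>. complexified_action \<pi> E v = 0))"

section \<open>Formal sums\<close>

text \<open>A formal sum of terms \<open>c\<^sub>\<mu> e\<^sup>\<mu>\<close> is the function from \<open>\<mu>\<close> to \<open>c\<^sub>\<mu>\<close>. Finite
  formal sums are elements of the group ring, \<open>'n functional \<Rightarrow>\<^sub>0 real\<close>, whose product is
  convolution; \<open>formal_times\<close> is the same product for possibly infinite formal sums, meaningful
  whenever only finitely many pairs of terms contribute to each exponent.\<close>

type_synonym 'n formal_sum = "'n functional \<Rightarrow> real"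

definition formal_exp :: "'n functional \<Rightarrow> ('n functional \<Rightarrow>\<^sub>0 real)" where
  "formal_exp \<mu> = Poly_Mapping.single \<mu> 1"

definition formal_times :: "'n formal_sum \<Rightarrow> 'n formal_sum \<Rightarrow> 'n formal_sum" where
  "formal_times f g = (\<lambda>\<mu>. \<Sum>\<nu> | f \<nu> \<noteq> 0 \<and> g (\<mu> - \<nu>) \<noteq> 0. f \<nu> * g (\<mu> - \<nu>))"

definition negative_cone :: "'n functional set \<Rightarrow> 'n functional set" where
  "negative_cone P = {\<mu>. \<exists>k :: 'n functional \<Rightarrow> nat. \<mu> = (\<lambda>X. - (\<Sum>\<alpha>\<in>P. real (k \<alpha>) * \<alpha> X))}"

text \<open>\<open>\<Prod>(1 - e\<^sup>-\<^sup>\<alpha>)\<close> is not a unit of the group ring. It is inverted among the formal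
  sums with exponents in the cone of the negative roots, where \<open>1 / (1 - e\<^sup>-\<^sup>\<alpha>)\<close> is the geometric
  series in \<open>e\<^sup>-\<^sup>\<alpha>\<close>.\<close>

definition formal_inverse :: "'n functional set \<Rightarrow> 'n formal_sum \<Rightarrow> 'n formal_sum" where
  "formal_inverse P f = (THE q. (\<forall>\<mu>. q \<mu> \<noteq> 0 \<longrightarrow> \<mu> \<in> negative_cone P) \<and>
     formal_times f q = Poly_Mapping.lookup (formal_exp 0))"

definition weyl_denominator :: "'n functional set \<Rightarrow> ('n functional \<Rightarrow>\<^sub>0 real)" where
  "weyl_denominator P = (\<Prod>\<alpha>\<in>P. 1 - formal_exp (- \<alpha>))"

definition character ::
    "(complex ^ 'n ^ 'n) set \<Rightarrow> (complex ^ 'n ^ 'n \<Rightarrow> complex ^ 'm ^ 'm) \<Rightarrow> 'n formal_sum" where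
  "character \<hh> \<pi> = (\<lambda>\<mu>. if \<mu> \<in> dual_space \<hh> then real (vec.dim (weight_space \<hh> \<pi> \<mu>)) else 0)"

end

(* The Casimir element acts on the irreducible representation as the scalar (mu, mu + 2 rho).
   Taking its trace on each weight space gives Freudenthal's identity, which says in the group ring
   that Den * ch is an eigenvector of the Laplacian D e^nu = (nu, nu) e^nu for |mu + rho|^2, where
   Den = e^rho * Pi; this uses that Den itself is an eigenvector for |rho|^2. The Laplacian picks out the
   exponents with |nu| = |mu + rho|. As Den is antisymmetric and ch is symmetric under reflections,
   every exponent of Den * ch is carried to a strictly dominant one, and mu + rho is the only such
   exponent below mu + rho of that length. Hence Den * ch is the alternating sum over the orbit.
   Symmetry of ch comes from half turns exp(t x), which realize reflections by inner automorphisms. *)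
theory Submission
  imports Defs "HOL-Computational_Algebra.Fundamental_Theorem_Algebra"
begin

section \<open>Exponentials and Lie algebras of compact matrix groups\<close>

subsection \<open>Endomorphisms as a Banach algebra\<close>

text \<open>A dominant generalised weight need not come from a character of the torus, so
  \<open>\<pi>\<close> need not integrate to \<open>G\<close>. The half turns are therefore
  exponentials of \<open>\<pi> (xv \<alpha>)\<close> on the representation space, not elements of
  \<open>G\<close>. What the group supplies is that \<open>\<gg>\<close> is a Lie algebra in which
  \<open>\<hh>\<close> is its own centralizer; hence the zero weight space of the complexification
  is that of \<open>\<hh>\<close>, and root strings follow. Solving Freudenthal's identity for
  multiplicities would mean dividing by \<open>1 - ee (- \<alpha>)\<close>, which is impossible in
  the group ring. The traces of \<open>up \<alpha> (dn \<alpha> v)\<close> on the weight spaces are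
  finitely supported and already are such quotients of derivatives of the character. Multiplied by
  \<open>Den\<close>, their contribution becomes the cross term in the Laplacian of the product
  \<open>Den * ch\<close>. That \<open>Den\<close> is an eigenvector rests on integrality: a
  strictly dominant exponent of \<open>Den\<close> lies below \<open>\<rho>\<close> and pairs with
  each simple coroot to a positive integer, while \<open>\<rho>\<close> pairs to 1, so it equals
  \<open>\<rho>\<close>; antisymmetry carries every exponent to a strictly dominant one of the same
  length.\<close>

typedef (overloaded) ('a::real_normed_vector) endo = "UNIV :: ('a \<Rightarrow>\<^sub>L 'a) set"
  morphisms endo_fun Endo by simp

setup_lifting type_definition_endo

instantiation endo :: (real_normed_vector) real_normed_vector
begin
lift_definition zero_endo :: "'a endo" is 0 .
lift_definition plus_endo :: "'a endo \<Rightarrow> 'a endo \<Rightarrow> 'a endo" is "(+)" .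
lift_definition minus_endo :: "'a endo \<Rightarrow> 'a endo \<Rightarrow> 'a endo" is "(-)" .
lift_definition uminus_endo :: "'a endo \<Rightarrow> 'a endo" is uminus .
lift_definition scaleR_endo :: "real \<Rightarrow> 'a endo \<Rightarrow> 'a endo" is scaleR .
lift_definition norm_endo :: "'a endo \<Rightarrow> real" is norm .
definition dist_endo :: "'a endo \<Rightarrow> 'a endo \<Rightarrow> real" where "dist_endo x y = norm (x - y)"
definition sgn_endo :: "'a endo \<Rightarrow> 'a endo" where "sgn_endo x = inverse (norm x) *\<^sub>R x"
definition uniformity_endo :: "('a endo \<times> 'a endo) filter" where
  "uniformity_endo = (INF e\<in>{0 <..}. principal {(x, y). dist x y < e})"
definition open_endo :: "'a endo set \<Rightarrow> bool" where
  "open_endo U = (\<forall>x\<in>U. \<forall>\<^sub>F (x', y) in uniformity. x' = x \<longrightarrow> y \<in> U)"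
instance
proof
  fix x y z :: "'a endo" and a b :: real
  show "x + y + z = x + (y + z)" by transfer (rule add.assoc)
  show "x + y = y + x" by transfer (rule add.commute)
  show "0 + x = x" "- x + x = 0" "x - y = x + - y" by (transfer; simp)+
  show "a *\<^sub>R (x + y) = a *\<^sub>R x + a *\<^sub>R y" by transfer (rule scaleR_add_right)
  show "(a + b) *\<^sub>R x = a *\<^sub>R x + b *\<^sub>R x" by transfer (rule scaleR_add_left)
  show "a *\<^sub>R b *\<^sub>R x = (a * b) *\<^sub>R x" "1 *\<^sub>R x = x" by (transfer; simp)+
  show "norm x = 0 \<longleftrightarrow> x = 0" by transfer simp
  show "norm (x + y) \<le> norm x + norm y" by transfer (rule norm_triangle_ineq)
  show "norm (a *\<^sub>R x) = \<bar>a\<bar> * norm x" by transfer simp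
qed (simp_all add: dist_endo_def sgn_endo_def uniformity_endo_def open_endo_def)
end

instance endo :: (banach) banach
proof
  fix X :: "nat \<Rightarrow> 'a endo"
  assume X: "Cauchy X"
  have d: "dist (endo_fun x) (endo_fun y) = dist x y" for x y :: "'a endo"
    unfolding dist_endo_def dist_norm by transfer simp
  have "Cauchy (\<lambda>n. endo_fun (X n))"
    using X unfolding Cauchy_def by (simp add: d)
  then obtain L where L: "(\<lambda>n. endo_fun (X n)) \<longlonglongrightarrow> L"
    by (auto simp: Cauchy_convergent_iff convergent_def)
  have "X \<longlonglongrightarrow> Endo L"
    using L unfolding lim_sequentially d[symmetric] by (simp add: Endo_inverse)
  then show "convergent X" by (auto simp: convergent_def)
qed

text \<open>The sort guarantees a non-zero vector, whence \<open>0 \<noteq> 1\<close> and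
  \<open>norm 1 = 1\<close>. With composition as product, the Banach algebra \<open>exp\<close> is
  the operator exponential.\<close>

instantiation endo :: (euclidean_space) real_normed_algebra_1
begin
lift_definition one_endo :: "'a endo" is id_blinfun .
lift_definition times_endo :: "'a endo \<Rightarrow> 'a endo \<Rightarrow> 'a endo" is "(o\<^sub>L)" .
instance
proof
  fix a b c :: "'a endo" and r :: real
  show "a * b * c = a * (b * c)" by transfer (rule blinfun_eqI, simp)
  show "1 * a = a" by transfer (rule blinfun_eqI, simp)
  show "a * 1 = a" by transfer (rule blinfun_eqI, simp)
  show "(a + b) * c = a * c + b * c" by transfer (rule bounded_bilinear.add_left[OF bounded_bilinear_blinfun_compose])
  show "a * (b + c) = a * b + a * c" by transfer (rule bounded_bilinear.add_right[OF bounded_bilinear_blinfun_compose])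
  show "r *\<^sub>R a * b = r *\<^sub>R (a * b)" by transfer (rule bounded_bilinear.scaleR_left[OF bounded_bilinear_blinfun_compose])
  show "a * r *\<^sub>R b = r *\<^sub>R (a * b)" by transfer (rule bounded_bilinear.scaleR_right[OF bounded_bilinear_blinfun_compose])
  have "norm (1 :: 'a endo) = 1" by transfer simp
  then show "norm (1 :: 'a endo) = 1" "(0 :: 'a endo) \<noteq> 1" by (metis norm_zero zero_neq_one)+
  show "norm (a * b) \<le> norm a * norm b" by transfer (rule norm_blinfun_compose)
qed
end

subsection \<open>The matrix exponential\<close>

text \<open>The class product of matrices is componentwise, so exponentials are studied in the image
  of this injective homomorphism, where \<open>*\<close> corresponds to \<open>**\<close>.\<close>

definition endo_of :: "complex ^ 'n ^ 'n \<Rightarrow> (complex ^ 'n) endo" where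
  "endo_of A = Endo (Blinfun (\<lambda>v. A *v v))"

lemma bounded_linear_matrix_vector [simp]:
  "bounded_linear (\<lambda>v. (A :: complex ^ 'n ^ 'm) *v v)"
proof -
  have "linear (\<lambda>v. A *v v)"
    by (rule linearI)
       (simp_all add: vec_eq_iff matrix_vector_mult_def scaleR_sum_right ring_distribs sum.distrib)
  then show ?thesis by (rule linear_conv_bounded_linear[THEN iffD1])
qed

lemma endo_of_apply: "blinfun_apply (endo_fun (endo_of A)) v = A *v v"
  by (simp add: endo_of_def Endo_inverse bounded_linear_Blinfun_apply)

lemma endo_eqI: "(\<And>v. blinfun_apply (endo_fun a) v = blinfun_apply (endo_fun b) v) \<Longrightarrow> a = b"
  by transfer (rule blinfun_eqI)

lemma endo_of_mult: "endo_of (A ** A') = endo_of A * endo_of A'"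
  by (rule endo_eqI) (simp add: endo_of_apply times_endo.rep_eq matrix_vector_mul_assoc)

lemma endo_of_1 [simp]: "endo_of (mat 1) = 1"
  by (rule endo_eqI) (simp add: endo_of_apply one_endo.rep_eq)

lemma linear_endo_of: "linear endo_of"
  by (rule linearI; rule endo_eqI)
     (simp_all add: endo_of_apply plus_endo.rep_eq scaleR_endo.rep_eq blinfun.bilinear_simps
        vec_eq_iff matrix_vector_mult_def scaleR_sum_right ring_distribs sum.distrib)

lemma bounded_linear_endo_of: "bounded_linear endo_of"
  by (rule linear_conv_bounded_linear[THEN iffD1, OF linear_endo_of])

lemma inj_endo_of: "inj endo_of"
proof (rule injI)
  fix A A' :: "complex ^ 'n ^ 'n"
  assume "endo_of A = endo_of A'"
  then have "A *v v = A' *v v" for v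
    by (metis endo_of_apply)
  then show "A = A'" by (metis matrix_eq)
qed

lemmas endo_of_simps = linear_add[OF linear_endo_of] linear_diff[OF linear_endo_of]
  linear_scale[OF linear_endo_of] linear_0[OF linear_endo_of] linear_neg[OF linear_endo_of]

lemma tendsto_endo_of: "(f \<longlongrightarrow> l) F \<Longrightarrow> ((\<lambda>x. endo_of (f x)) \<longlongrightarrow> endo_of l) F"
  by (rule bounded_linear.tendsto[OF bounded_linear_endo_of])

text \<open>An entry is a coordinate of the image of a basis vector, hence bounded by the operator
  norm; the constant counts the entries. Together with boundedness of \<open>endo_of\<close>, this
  transfers limits and summability in both directions.\<close>

lemma norm_le_norm_endo_of:
  "norm (A :: complex ^ 'n ^ 'n) \<le> real CARD('n) * real CARD('n) * norm (endo_of A)"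
proof -
  have e: "norm (A $ i $ j) \<le> norm (endo_of A)" for i j
  proof -
    have "A $ i $ j = (A *v axis j 1) $ i"
      by (simp add: matrix_vector_mult_def axis_def if_distrib cong: if_cong)
    also have "norm \<dots> \<le> norm (A *v axis j 1)" by (rule Finite_Cartesian_Product.norm_nth_le)
    also have "A *v axis j 1 = blinfun_apply (endo_fun (endo_of A)) (axis j 1)"
      by (simp add: endo_of_apply)
    also have "norm \<dots> \<le> norm (endo_of A) * norm (axis j 1 :: complex ^ 'n)"
      unfolding norm_endo.rep_eq by (rule norm_blinfun)
    finally show ?thesis by simp
  qed
  have "norm A \<le> (\<Sum>i\<in>UNIV. norm (A $ i))" by (simp add: norm_vec_def L2_set_le_sum)
  also have "\<dots> \<le> (\<Sum>i\<in>(UNIV::'n set). \<Sum>j\<in>(UNIV::'n set). norm (A $ i $ j))"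
    by (intro sum_mono) (simp add: norm_vec_def L2_set_le_sum)
  also have "\<dots> \<le> (\<Sum>i\<in>(UNIV::'n set). \<Sum>j\<in>(UNIV::'n set). norm (endo_of A))"
    by (intro sum_mono e)
  finally show ?thesis by (simp add: algebra_simps)
qed

lemma endo_of_mat_exp: "endo_of (mat_exp A) = exp (endo_of A)"
proof -
  let ?f = "\<lambda>k. (1 / fact k) *\<^sub>R (((**) A ^^ k) (mat 1))"
  have p: "endo_of (((**) A ^^ k) (mat 1)) = endo_of A ^ k" for k
    by (induction k) (simp_all add: endo_of_mult)
  have t: "endo_of (?f k) = (endo_of A ^ k) /\<^sub>R fact k" for k
    by (simp add: endo_of_simps p divide_inverse)
  let ?c = "real CARD('a) * real CARD('a)"
  have "summable (\<lambda>k. ?c * norm ((endo_of A ^ k) /\<^sub>R fact k))"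
    by (intro summable_mult summable_norm_exp)
  then have s: "summable ?f"
    by (rule summable_comparison_test'[where N = 0]) (use norm_le_norm_endo_of t in metis)
  show ?thesis
    unfolding mat_exp_def exp_def
    using bounded_linear.suminf[OF bounded_linear_endo_of s] by (simp add: t del: scaleR_scaleR)
qed

lemma matrix_inv_cancel:
  assumes "invertible A"
  shows "A ** matrix_inv A = mat 1" "matrix_inv A ** A = mat 1"
  using someI_ex[OF assms[unfolded invertible_def]] by (simp_all add: matrix_inv_def)

lemma matrix_left_right_inverse_unique:
  assumes "C ** A = mat 1" "A ** C' = mat 1"
  shows "C = C'"
proof -
  have "C ** (A ** C') = C ** A ** C'" by (rule matrix_mul_assoc)
  then show ?thesis by (simp add: assms)
qed

lemma endo_of_eqD: "endo_of A = endo_of A' \<Longrightarrow> A = A'"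
  using inj_endo_of by (auto dest: injD)

lemma mat_exp_0 [simp]: "mat_exp 0 = mat 1"
  by (rule endo_of_eqD) (simp add: endo_of_mat_exp endo_of_simps)

lemma mat_exp_add:
  assumes "A ** A' = A' ** A"
  shows "mat_exp (A + A') = mat_exp A ** mat_exp A'"
proof (rule endo_of_eqD)
  have "endo_of A * endo_of A' = endo_of A' * endo_of A"
    using assms by (metis endo_of_mult)
  then show "endo_of (mat_exp (A + A')) = endo_of (mat_exp A ** mat_exp A')"
    by (simp add: endo_of_mat_exp endo_of_simps endo_of_mult exp_add_commuting)
qed

lemma mat_exp_minus: "mat_exp A ** mat_exp (- A) = mat 1" "mat_exp (- A) ** mat_exp A = mat 1"
proof -
  have "exp (- endo_of A) * exp (endo_of A) = 1"
    using exp_minus_inverse[of "- endo_of A"] by simp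
  then show "mat_exp A ** mat_exp (- A) = mat 1" "mat_exp (- A) ** mat_exp A = mat 1"
    by (auto intro!: endo_of_eqD simp: endo_of_mat_exp endo_of_simps endo_of_mult exp_minus_inverse)
qed

lemma tendsto_endo_of_iff:
  "((\<lambda>x. endo_of (f x)) \<longlongrightarrow> endo_of l) F \<longleftrightarrow> (f \<longlongrightarrow> (l :: complex ^ 'n ^ 'n)) F"
proof
  assume "((\<lambda>x. endo_of (f x)) \<longlongrightarrow> endo_of l) F"
  then have "((\<lambda>x. norm (endo_of (f x - l))) \<longlongrightarrow> 0) F"
    by (simp add: endo_of_simps tendsto_norm_zero_iff LIM_zero_iff)
  then have "((\<lambda>x. (real CARD('n) * real CARD('n)) * norm (endo_of (f x - l))) \<longlongrightarrow> 0) F"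
    by (rule tendsto_mult_right_zero)
  then have "((\<lambda>x. f x - l) \<longlongrightarrow> 0) F"
    by (rule Lim_null_comparison[rotated]) (simp add: norm_le_norm_endo_of)
  then show "(f \<longlongrightarrow> l) F" by (simp add: LIM_zero_iff)
qed (rule tendsto_endo_of)

lemma tendsto_matrix_mult:
  fixes f g :: "'b \<Rightarrow> complex ^ 'n ^ 'n"
  assumes "(f \<longlongrightarrow> l) F" "(g \<longlongrightarrow> m) F"
  shows "((\<lambda>x. f x ** g x) \<longlongrightarrow> l ** m) F"
  using assms unfolding tendsto_endo_of_iff[symmetric] endo_of_mult by (rule tendsto_mult)

lemma closed_commutant_right: "closed {s. s ** X = X ** (s :: complex ^ 'n ^ 'n)}"
proof (intro closed_sequential_limits[THEN iffD2] allI impI, elim conjE)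
  fix s l
  assume s: "\<forall>n. s n \<in> {s. s ** X = X ** s}" "s \<longlonglongrightarrow> l"
  have "(\<lambda>n. s n ** X) \<longlonglongrightarrow> l ** X" "(\<lambda>n. X ** s n) \<longlonglongrightarrow> X ** l"
    by (intro tendsto_matrix_mult s(2) tendsto_const)+
  then show "l \<in> {s. s ** X = X ** s}" using s(1) LIMSEQ_unique by auto
qed

lemma closed_commutant_left: "closed {s. X ** s = (s :: complex ^ 'n ^ 'n) ** X}"
  using closed_commutant_right[of X] by (simp add: eq_commute)

lemma exp_conjugate:
  fixes p q y :: "'a :: {real_normed_algebra_1, banach}"
  assumes "q * p = 1" "p * q = 1"
  shows "exp (p * y * q) = p * exp y * q"
proof -
  have pw: "(p * y * q) ^ k = p * y ^ k * q" for k
  proof (induction k)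
    case (Suc k)
    have "(p * y * q) ^ Suc k = (p * y * q) * (p * y ^ k * q)" by (simp only: power_Suc Suc)
    also have "\<dots> = p * y * (q * p) * y ^ k * q" by (simp only: mult.assoc)
    finally show ?case using assms by (simp add: mult.assoc)
  qed (use assms in simp)
  have "bounded_linear (\<lambda>x. p * x * q)"
    by (intro bounded_linear_mult_const bounded_linear_const_mult bounded_linear_ident)
  from bounded_linear.suminf[OF this summable_exp_generic[of y]]
  show ?thesis by (simp add: exp_def pw)
qed

lemma exp_commute:
  fixes x a :: "'a :: {real_normed_algebra_1, banach}"
  assumes "x * a = a * x"
  shows "exp x * a = a * exp x"
proof -
  have pw: "x ^ k * a = a * x ^ k" for k
  proof (induction k)
    case (Suc k)
    have "x ^ Suc k * a = x * (x ^ k * a)" by (simp add: mult.assoc)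
    also have "\<dots> = x * a * x ^ k" by (simp add: Suc mult.assoc)
    finally show ?case using assms by (simp add: mult.assoc)
  qed simp
  show ?thesis
    unfolding exp_def
    using suminf_mult[OF summable_exp_generic[of x], of a] suminf_mult2[OF summable_exp_generic[of x], of a]
    by (simp add: pw)
qed

lemma exp_scaleR_difference_quotient:
  fixes x :: "'a :: {real_normed_algebra_1, banach}"
  assumes "e \<longlonglongrightarrow> 0" "\<And>n. e n > 0"
  shows "(\<lambda>n. (1 / e n) *\<^sub>R (exp (e n *\<^sub>R x) - 1)) \<longlonglongrightarrow> x"
proof -
  have "((\<lambda>t. exp (t *\<^sub>R x)) has_vector_derivative exp (0 *\<^sub>R x) * x) (at 0)"
    by (rule exp_scaleR_has_vector_derivative_right)
  then have "((\<lambda>h. norm (exp (h *\<^sub>R x) - 1 - h *\<^sub>R x) / norm h) \<longlongrightarrow> 0) (at 0)"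
    by (simp add: has_vector_derivative_def has_derivative_at)
  moreover have "filterlim e (at 0) sequentially"
    using assms by (auto simp: filterlim_at less_imp_neq[symmetric] intro: always_eventually)
  ultimately have "(\<lambda>n. norm (exp (e n *\<^sub>R x) - 1 - e n *\<^sub>R x) / norm (e n)) \<longlonglongrightarrow> 0"
    by (rule filterlim_compose)
  moreover have "norm (exp (e n *\<^sub>R x) - 1 - e n *\<^sub>R x) / norm (e n)
      = norm ((1 / e n) *\<^sub>R (exp (e n *\<^sub>R x) - 1) - x)" for n
  proof -
    have "(1 / e n) *\<^sub>R (exp (e n *\<^sub>R x) - 1) - x = (1 / e n) *\<^sub>R (exp (e n *\<^sub>R x) - 1 - e n *\<^sub>R x)"
      using assms(2)[of n] by (simp add: scaleR_diff_right)
    then show ?thesis using assms(2)[of n] by simp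
  qed
  ultimately show ?thesis by (simp add: tendsto_norm_zero_iff LIM_zero_iff)
qed

subsection \<open>The Lie algebra of a compact matrix group\<close>

text \<open>One factor is exchanged at a time: \<open>a ^ Suc k - b ^ Suc k = a * (a ^ k - b ^ k) +
  (a - b) * b ^ k\<close>. The bound \<open>M \<ge> 1\<close> allows \<open>M ^ k\<close> to be
  enlarged to \<open>M ^ Suc k\<close>.\<close>

lemma norm_power_diff_le:
  fixes a b :: "'a :: real_normed_algebra_1"
  assumes "norm a \<le> M" "norm b \<le> M" "M \<ge> 1"
  shows "norm (a ^ k - b ^ k) \<le> real k * norm (a - b) * M ^ k"
proof (induction k)
  case (Suc k)
  have bk: "norm (b ^ k) \<le> M ^ k"
    using norm_power_ineq[of b k] power_mono[OF assms(2), of k] by simp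
  have "norm (a ^ Suc k - b ^ Suc k) = norm (a * (a ^ k - b ^ k) + (a - b) * b ^ k)"
    by (simp add: algebra_simps)
  also have "\<dots> \<le> norm a * norm (a ^ k - b ^ k) + norm (a - b) * norm (b ^ k)"
    by (intro norm_triangle_le add_mono norm_mult_ineq)
  also have "\<dots> \<le> M * (real k * norm (a - b) * M ^ k) + norm (a - b) * M ^ k"
    by (intro add_mono mult_mono assms Suc bk) (use assms in auto)
  also have "norm (a - b) * M ^ k \<le> norm (a - b) * M ^ Suc k"
    using assms by (intro mult_left_mono power_increasing) auto
  finally show ?case by (simp add: algebra_simps)
qed simp

text \<open>With \<open>k = \<lfloor>t / \<epsilon>\<^sub>n\<rfloor>\<close>, the powers \<open>g\<^sub>n\<^sup>k\<close> stay in the group and approach \<open>exp (t D)\<close>.\<close>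

lemma exp_tangent_in_closed_monoid:
  fixes G :: "'a :: {real_normed_algebra_1, banach} set"
  assumes "closed G" "1 \<in> G" "\<And>a b. a \<in> G \<Longrightarrow> b \<in> G \<Longrightarrow> a * b \<in> G"
    and g: "\<And>n. g n \<in> G" and e: "e \<longlonglongrightarrow> 0" "\<And>n. e n > 0"
    and D: "(\<lambda>n. (1 / e n) *\<^sub>R (g n - 1)) \<longlonglongrightarrow> D" and t: "t \<ge> 0"
  shows "exp (t *\<^sub>R D) \<in> G"
proof -
  define k where "k n = nat \<lfloor>t / e n\<rfloor>" for n
  have k1: "real (k n) * e n \<le> t" for n
  proof -
    have "real (k n) \<le> t / e n" using e(2)[of n] t by (simp add: k_def)
    then show ?thesis using e(2)[of n] by (simp add: le_divide_eq)
  qed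
  have k2: "t - e n \<le> real (k n) * e n" for n
  proof -
    have "t / e n - 1 \<le> real (k n)"
      using e(2)[of n] t unfolding k_def by (simp; linarith)
    then have "(t / e n - 1) * e n \<le> real (k n) * e n"
      using e(2)[of n] by (intro mult_right_mono) auto
    moreover have "(t / e n - 1) * e n = t - e n" using e(2)[of n] by (simp add: left_diff_distrib)
    ultimately show ?thesis by simp
  qed
  have ke: "(\<lambda>n. real (k n) * e n) \<longlonglongrightarrow> t"
  proof (rule tendsto_sandwich)
    show "(\<lambda>n. t - e n) \<longlonglongrightarrow> t" using tendsto_diff[OF tendsto_const e(1), of t] by simp
    show "(\<lambda>_. t) \<longlonglongrightarrow> t" by (rule tendsto_const)
  qed (intro always_eventually allI k1 k2)+
  obtain C where C: "C > 0" "\<And>n. norm ((1 / e n) *\<^sub>R (g n - 1)) \<le> C" "norm D \<le> C"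
  proof -
    have "Bseq (\<lambda>n. (1 / e n) *\<^sub>R (g n - 1))"
      using D convergentI convergent_imp_Bseq by blast
    then obtain K where "K > 0" "\<forall>n. norm ((1 / e n) *\<^sub>R (g n - 1)) \<le> K"
      unfolding Bseq_def by blast
    then show ?thesis by (intro that[of "max K (norm D)"]) (auto intro: le_max_iff_disj[THEN iffD2])
  qed
  define d where "d n = norm ((1 / e n) *\<^sub>R (g n - 1) - (1 / e n) *\<^sub>R (exp (e n *\<^sub>R D) - 1))" for n
  have "d \<longlonglongrightarrow> norm (D - D)"
    unfolding d_def by (intro tendsto_intros D exp_scaleR_difference_quotient e)
  then have d0: "d \<longlonglongrightarrow> 0" by simp
  have dn: "norm (g n - exp (e n *\<^sub>R D)) = e n * d n" for n
  proof -
    have "(1 / e n) *\<^sub>R (g n - 1) - (1 / e n) *\<^sub>R (exp (e n *\<^sub>R D) - 1)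
        = (1 / e n) *\<^sub>R (g n - exp (e n *\<^sub>R D))" by (simp add: scaleR_diff_right)
    then show ?thesis using e(2)[of n] by (simp add: d_def)
  qed
  \<comment> \<open>Bounds of the form \<open>exp (e n * C)\<close> survive \<open>k n\<close>-th
    powers: as \<open>k n * e n \<le> t\<close>, the powers stay below \<open>exp (t * C)\<close>
    uniformly in \<open>n\<close>.\<close>
  have M1: "norm (g n) \<le> exp (e n * C)" for n
  proof -
    have "norm (g n - 1) \<le> e n * C"
      using C(2)[of n] e(2)[of n] unfolding norm_scaleR by (simp add: divide_le_eq mult.commute)
    then have "norm (g n) \<le> 1 + e n * C"
      using norm_triangle_ineq[of "g n - 1" 1] by simp
    also have "\<dots> \<le> exp (e n * C)" by (rule exp_ge_add_one_self)
    finally show ?thesis .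
  qed
  have M2: "norm (exp (e n *\<^sub>R D)) \<le> exp (e n * C)" for n
  proof -
    have "norm (exp (e n *\<^sub>R D)) \<le> exp (norm (e n *\<^sub>R D))" by (rule norm_exp)
    also have "\<dots> \<le> exp (e n * C)" using C(3) e(2)[of n] by simp
    finally show ?thesis .
  qed
  have bd: "norm (g n ^ k n - exp (e n *\<^sub>R D) ^ k n) \<le> t * exp (t * C) * d n" for n
  proof -
    have "norm (g n ^ k n - exp (e n *\<^sub>R D) ^ k n)
        \<le> real (k n) * norm (g n - exp (e n *\<^sub>R D)) * exp (e n * C) ^ k n"
      using C(1) e(2)[of n] by (intro norm_power_diff_le M1 M2) simp
    also have "\<dots> = (real (k n) * e n) * d n * exp (real (k n) * e n * C)"
      by (simp add: dn exp_of_nat_mult[symmetric] mult.assoc)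
    also have "\<dots> \<le> t * d n * exp (t * C)"
      using k1[of n] C(1) t by (intro mult_mono) (auto simp: d_def)
    finally show ?thesis by (simp add: mult_ac)
  qed
  have "(\<lambda>n. t * exp (t * C) * d n) \<longlonglongrightarrow> 0"
    by (rule tendsto_mult_right_zero[OF d0])
  then have "(\<lambda>n. g n ^ k n - exp (e n *\<^sub>R D) ^ k n) \<longlonglongrightarrow> 0"
    by (rule Lim_null_comparison[OF always_eventually[OF allI[OF bd]]])
  moreover have "(\<lambda>n. exp (e n *\<^sub>R D) ^ k n) \<longlonglongrightarrow> exp (t *\<^sub>R D)"
  proof -
    have "exp (e n *\<^sub>R D) ^ k n = exp ((real (k n) * e n) *\<^sub>R D)" for n
    proof -
      have "exp (real j *\<^sub>R x) = exp x ^ j" for j :: nat and x :: 'a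
      proof (induction j)
        case (Suc j)
        then show ?case
          using exp_add_commuting[of x "real j *\<^sub>R x"] by (simp add: scaleR_left_distrib)
      qed simp
      from this[of "k n" "e n *\<^sub>R D"] show ?thesis by simp
    qed
    moreover have "(\<lambda>n. exp ((real (k n) * e n) *\<^sub>R D)) \<longlonglongrightarrow> exp (t *\<^sub>R D)"
      by (rule isCont_tendsto_compose[OF has_vector_derivative_continuous[OF
            exp_scaleR_has_vector_derivative_right] ke])
    ultimately show ?thesis by simp
  qed
  ultimately have "(\<lambda>n. (g n ^ k n - exp (e n *\<^sub>R D) ^ k n) + exp (e n *\<^sub>R D) ^ k n) \<longlonglongrightarrow> 0 + exp (t *\<^sub>R D)"
    by (rule tendsto_add)
  then have lim: "(\<lambda>n. g n ^ k n) \<longlonglongrightarrow> exp (t *\<^sub>R D)" by simp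
  have "g n ^ j \<in> G" for n j
    by (induction j) (use assms(2,3) g in auto)
  then show ?thesis
    by (rule closed_sequentially[OF assms(1) _ lim])
qed

lemma compact_matrix_group_exp_minus:
  assumes "compact_matrix_group G" "mat_exp A \<in> G"
  shows "mat_exp (- A) \<in> G"
proof -
  have "invertible (mat_exp A)" "matrix_inv (mat_exp A) \<in> G"
    using assms by (auto simp: compact_matrix_group_def matrix_group_def)
  moreover have "matrix_inv (mat_exp A) = mat_exp (- A)"
    by (rule matrix_left_right_inverse_unique[OF matrix_inv_cancel(2) mat_exp_minus(1)]) fact
  ultimately show ?thesis by simp
qed

text \<open>This criterion replaces one-parameter subgroups by sequences: any limit of difference
  quotients at the identity generates a one-parameter subgroup of the closed group. Sums of Lie
  algebra elements need only a suitable sequence of products.\<close>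

lemma lie_algebra_tangent:
  fixes G :: "(complex ^ 'n ^ 'n) set"
  assumes G: "compact_matrix_group G"
    and g: "\<And>n. g n \<in> G" and e: "e \<longlonglongrightarrow> 0" "\<And>n. e n > 0"
    and D: "(\<lambda>n. (1 / e n) *\<^sub>R (g n - mat 1)) \<longlonglongrightarrow> D"
  shows "D \<in> lie_algebra G"
proof -
  let ?G = "endo_of ` G"
  have pos: "mat_exp (t *\<^sub>R D) \<in> G" if "t \<ge> 0" for t
  proof -
    have "exp (t *\<^sub>R endo_of D) \<in> ?G"
    proof (rule exp_tangent_in_closed_monoid[where g = "\<lambda>n. endo_of (g n)" and e = e])
      show "closed ?G"
        using G by (intro compact_imp_closed compact_continuous_image linear_continuous_on
            bounded_linear_endo_of) (simp add: compact_matrix_group_def)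
      show "1 \<in> ?G" using G by (auto simp: compact_matrix_group_def matrix_group_def image_iff
            intro!: bexI[of _ "mat 1"])
      show "a * b \<in> ?G" if "a \<in> ?G" "b \<in> ?G" for a b
        using that G by (auto simp: compact_matrix_group_def matrix_group_def endo_of_mult[symmetric])
      show "(\<lambda>n. (1 / e n) *\<^sub>R (endo_of (g n) - 1)) \<longlonglongrightarrow> endo_of D"
        using tendsto_endo_of[OF D] by (simp add: endo_of_simps)
    qed (use g e that in auto)
    then show ?thesis by (auto simp: endo_of_simps[symmetric] endo_of_mat_exp[symmetric] dest: endo_of_eqD)
  qed
  \<comment> \<open>The powers of \<open>g n\<close> only reach times \<open>t \<ge> 0\<close>;
    negative times come from inverses.\<close>
  have "mat_exp (t *\<^sub>R D) \<in> G" for t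
    using pos[of t] compact_matrix_group_exp_minus[OF G pos[of "- t"]] by (cases "t \<ge> 0") auto
  then show ?thesis by (simp add: lie_algebra_def)
qed

lemma lie_algebra_exp: "X \<in> lie_algebra G \<Longrightarrow> mat_exp (t *\<^sub>R X) \<in> G"
  by (simp add: lie_algebra_def)

lemma mat_exp_difference_quotient:
  assumes "e \<longlonglongrightarrow> 0" "\<And>n. e n > 0"
  shows "(\<lambda>n. (1 / e n) *\<^sub>R (mat_exp (e n *\<^sub>R X) - mat 1)) \<longlonglongrightarrow> X"
  unfolding tendsto_endo_of_iff[symmetric]
  using exp_scaleR_difference_quotient[OF assms, of "endo_of X"]
  by (simp add: endo_of_simps endo_of_mat_exp)

lemma tendsto_mat_exp_scaleR:
  assumes "(f \<longlongrightarrow> l) F"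
  shows "((\<lambda>x. mat_exp (f x *\<^sub>R X)) \<longlongrightarrow> mat_exp (l *\<^sub>R X)) F"
proof -
  have "isCont (\<lambda>t. exp (t *\<^sub>R endo_of X)) l"
    by (rule has_vector_derivative_continuous[OF exp_scaleR_has_vector_derivative_right])
  then show ?thesis
    unfolding tendsto_endo_of_iff[symmetric] endo_of_mat_exp endo_of_simps
    using assms by (rule isCont_tendsto_compose)
qed

lemma null_sequence: "(\<lambda>n. 1 / real (Suc n)) \<longlonglongrightarrow> 0" "1 / real (Suc n) > 0"
  using LIMSEQ_inverse_real_of_nat by (auto simp: divide_inverse)

lemma scaleR_matrix_mult:
  fixes A C :: "complex ^ 'n ^ 'n"
  shows "(r *\<^sub>R A) ** C = r *\<^sub>R (A ** C)" "A ** (r *\<^sub>R C) = r *\<^sub>R (A ** C)"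
  unfolding inj_eq[OF inj_endo_of, symmetric] by (simp_all add: endo_of_simps endo_of_mult)

lemma diff_matrix_mult:
  fixes A A' C :: "complex ^ 'n ^ 'n"
  shows "(A - A') ** C = A ** C - A' ** C" "C ** (A - A') = C ** A - C ** A'"
  unfolding inj_eq[OF inj_endo_of, symmetric] by (simp_all add: endo_of_simps endo_of_mult algebra_simps)

lemma subspace_lie_algebra:
  fixes G :: "(complex ^ 'n ^ 'n) set"
  assumes G: "compact_matrix_group G"
  shows "subspace (lie_algebra G)"
  unfolding subspace_def
proof (intro conjI ballI allI)
  have mG: "mat 1 \<in> G" "\<And>a b. a \<in> G \<Longrightarrow> b \<in> G \<Longrightarrow> a ** b \<in> G"
    using G by (auto simp: compact_matrix_group_def matrix_group_def)
  show "0 \<in> lie_algebra G" using mG by (simp add: lie_algebra_def)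
  show "c *\<^sub>R X \<in> lie_algebra G" if "X \<in> lie_algebra G" for c X
    using that by (simp add: lie_algebra_def)
  fix X Y
  assume X: "X \<in> lie_algebra G" and Y: "Y \<in> lie_algebra G"
  let ?e = "\<lambda>n. 1 / real (Suc n)"
  show "X + Y \<in> lie_algebra G"
  \<comment> \<open>To first order, \<open>exp (e X) ** exp (e Y)\<close> is
    \<open>1 + e (X + Y)\<close>.\<close>
  proof (rule lie_algebra_tangent[OF G, where e = ?e and g = "\<lambda>n. mat_exp (?e n *\<^sub>R X) ** mat_exp (?e n *\<^sub>R Y)"])
    have "(1 / ?e n) *\<^sub>R (mat_exp (?e n *\<^sub>R X) ** mat_exp (?e n *\<^sub>R Y) - mat 1)
        = ((1 / ?e n) *\<^sub>R (mat_exp (?e n *\<^sub>R X) - mat 1)) ** mat_exp (?e n *\<^sub>R Y)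
        + (1 / ?e n) *\<^sub>R (mat_exp (?e n *\<^sub>R Y) - mat 1)" for n
      by (simp add: scaleR_matrix_mult diff_matrix_mult scaleR_diff_right)
    moreover have "(\<lambda>n. ((1 / ?e n) *\<^sub>R (mat_exp (?e n *\<^sub>R X) - mat 1)) ** mat_exp (?e n *\<^sub>R Y)
        + (1 / ?e n) *\<^sub>R (mat_exp (?e n *\<^sub>R Y) - mat 1)) \<longlonglongrightarrow> X ** mat_exp (0 *\<^sub>R Y) + Y"
      by (intro tendsto_add tendsto_matrix_mult mat_exp_difference_quotient tendsto_mat_exp_scaleR
          tendsto_scaleR tendsto_const null_sequence)
    ultimately show "(\<lambda>n. (1 / ?e n) *\<^sub>R (mat_exp (?e n *\<^sub>R X) ** mat_exp (?e n *\<^sub>R Y) - mat 1)) \<longlonglongrightarrow> X + Y"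
      by simp
  qed (auto intro!: null_sequence mG lie_algebra_exp X Y simp del: of_nat_Suc)
qed

text \<open>Conjugation by \<open>exp (s X)\<close> preserves the Lie algebra, and the difference
  quotients of the conjugates of \<open>Y\<close> at \<open>s = 0\<close> converge to the bracket.
  They stay in a linear subspace, which is closed.\<close>

lemma lie_bracket_in_lie_algebra:
  fixes G :: "(complex ^ 'n ^ 'n) set"
  assumes G: "compact_matrix_group G" and X: "X \<in> lie_algebra G" and Y: "Y \<in> lie_algebra G"
  shows "lie_bracket X Y \<in> lie_algebra G"
proof -
  have mG: "mat 1 \<in> G" "\<And>a b. a \<in> G \<Longrightarrow> b \<in> G \<Longrightarrow> a ** b \<in> G"
    using G by (auto simp: compact_matrix_group_def matrix_group_def)
  note sub = subspace_lie_algebra[OF G]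
  let ?P = "\<lambda>s. mat_exp (s *\<^sub>R X)" and ?Q = "\<lambda>s. mat_exp (- (s *\<^sub>R X))"
  have Ad: "?P s ** Y ** ?Q s \<in> lie_algebra G" for s
    unfolding lie_algebra_def
  proof safe
    fix t :: real
    have "mat_exp (t *\<^sub>R (?P s ** Y ** ?Q s)) = ?P s ** mat_exp (t *\<^sub>R Y) ** ?Q s"
    proof (rule endo_of_eqD)
      have "exp (endo_of (?P s) * (t *\<^sub>R endo_of Y) * endo_of (?Q s))
          = endo_of (?P s) * exp (t *\<^sub>R endo_of Y) * endo_of (?Q s)"
        by (rule exp_conjugate) (simp_all add: endo_of_mult[symmetric] mat_exp_minus)
      then show "endo_of (mat_exp (t *\<^sub>R (?P s ** Y ** ?Q s)))
          = endo_of (?P s ** mat_exp (t *\<^sub>R Y) ** ?Q s)"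
        by (simp add: endo_of_mat_exp endo_of_simps endo_of_mult)
    qed
    moreover have "?P s ** mat_exp (t *\<^sub>R Y) ** ?Q s \<in> G"
      by (intro mG lie_algebra_exp X Y compact_matrix_group_exp_minus[OF G])
    ultimately show "mat_exp (t *\<^sub>R (?P s ** Y ** ?Q s)) \<in> G" by simp
  qed
  let ?e = "\<lambda>n. 1 / real (Suc n)"
  have "closed (lie_algebra G)" by (rule closed_subspace[OF sub])
  moreover have "(1 / ?e n) *\<^sub>R (?P (?e n) ** Y ** ?Q (?e n) - Y) \<in> lie_algebra G" for n
    by (intro subspace_scale[OF sub] subspace_diff[OF sub] Ad Y)
  moreover have "(\<lambda>n. (1 / ?e n) *\<^sub>R (?P (?e n) ** Y ** ?Q (?e n) - Y)) \<longlonglongrightarrow> lie_bracket X Y"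
  proof -
    have Qn: "?Q (?e n) = mat_exp (?e n *\<^sub>R (- X))" for n by simp
    have "(1 / ?e n) *\<^sub>R (?P (?e n) ** Y ** ?Q (?e n) - Y)
        = ((1 / ?e n) *\<^sub>R (?P (?e n) - mat 1)) ** Y ** mat_exp (?e n *\<^sub>R (- X))
        + Y ** ((1 / ?e n) *\<^sub>R (mat_exp (?e n *\<^sub>R (- X)) - mat 1))" for n
      by (simp add: scaleR_matrix_mult diff_matrix_mult scaleR_diff_right)
    moreover have "(\<lambda>n. ((1 / ?e n) *\<^sub>R (?P (?e n) - mat 1)) ** Y ** mat_exp (?e n *\<^sub>R (- X))
        + Y ** ((1 / ?e n) *\<^sub>R (mat_exp (?e n *\<^sub>R (- X)) - mat 1))) \<longlonglongrightarrow> X ** Y ** mat_exp (0 *\<^sub>R (- X)) + Y ** (- X)"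
      by (intro tendsto_add tendsto_matrix_mult mat_exp_difference_quotient tendsto_mat_exp_scaleR
          tendsto_scaleR tendsto_const tendsto_minus null_sequence)
    moreover have "X ** Y ** mat_exp (0 *\<^sub>R (- X)) + Y ** (- X) = lie_bracket X Y"
      by (rule endo_of_eqD) (simp add: lie_bracket_def endo_of_simps endo_of_mult)
    ultimately show ?thesis by simp
  qed
  ultimately show ?thesis by (rule closed_sequentially)
qed

lemma commute_of_exp_commute:
  fixes A X :: "complex ^ 'n ^ 'n"
  assumes "\<And>t. mat_exp (t *\<^sub>R X) ** A = A ** mat_exp (t *\<^sub>R X)"
  shows "X ** A = A ** X"
proof -
  let ?q = "\<lambda>n. (1 / (1 / real (Suc n))) *\<^sub>R (mat_exp ((1 / real (Suc n)) *\<^sub>R X) - mat 1)"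
  have q: "?q \<longlonglongrightarrow> X" by (rule mat_exp_difference_quotient) (rule null_sequence)+
  have "(\<lambda>n. ?q n ** A) \<longlonglongrightarrow> X ** A" "(\<lambda>n. A ** ?q n) \<longlonglongrightarrow> A ** X"
    by (intro tendsto_matrix_mult q tendsto_const)+
  moreover have "?q n ** A = A ** ?q n" for n
    by (simp only: scaleR_matrix_mult diff_matrix_mult assms matrix_mul_lid matrix_mul_rid)
  ultimately show ?thesis using LIMSEQ_unique by simp
qed

lemma exp_commute_of_commute:
  fixes A X :: "complex ^ 'n ^ 'n"
  assumes "X ** A = A ** X"
  shows "mat_exp (t *\<^sub>R X) ** A = A ** mat_exp (t *\<^sub>R X)"
proof (rule endo_of_eqD)
  have "endo_of X * endo_of A = endo_of A * endo_of X" using assms by (metis endo_of_mult)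
  then have "exp (t *\<^sub>R endo_of X) * endo_of A = endo_of A * exp (t *\<^sub>R endo_of X)"
    by (intro exp_commute) simp
  then show "endo_of (mat_exp (t *\<^sub>R X) ** A) = endo_of (A ** mat_exp (t *\<^sub>R X))"
    by (simp add: endo_of_mult endo_of_mat_exp endo_of_simps)
qed

section \<open>Maximal tori and their centralizers\<close>

subsection \<open>The Lie algebra of a maximal torus is its own centralizer\<close>

lemma lie_algebra_torus_abelian:
  assumes "torus_in G S" "X \<in> lie_algebra S" "Y \<in> lie_algebra S"
  shows "lie_bracket X Y = 0"
proof -
  have "mat_exp (s *\<^sub>R X) ** mat_exp (t *\<^sub>R Y) = mat_exp (t *\<^sub>R Y) ** mat_exp (s *\<^sub>R X)" for s t
    using assms by (simp add: torus_in_def lie_algebra_exp)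
  then have "X ** mat_exp (t *\<^sub>R Y) = mat_exp (t *\<^sub>R Y) ** X" for t
    by (rule commute_of_exp_commute)
  then have "Y ** X = X ** Y" by (metis commute_of_exp_commute)
  then show ?thesis by (simp add: lie_bracket_def)
qed

lemma matrix_group_inverse:
  assumes "compact_matrix_group G" "a \<in> G"
  obtains b where "b \<in> G" "a ** b = mat 1" "b ** a = mat 1"
  using assms that[of "matrix_inv a"] matrix_inv_cancel[of a]
  by (auto simp: compact_matrix_group_def matrix_group_def)

text \<open>Otherwise there are elements of \<open>S\<close> arbitrarily close to \<open>1\<close> that do not commute with \<open>X\<close>.
  Translating them by the closest element of the subgroup that commutes with \<open>X\<close>, their directions
  accumulate at a unit vector of the Lie algebra of \<open>S\<close>, along which they could be brought closer
  to \<open>1\<close>.\<close>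

lemma commutes_near_one:
  fixes S :: "(complex ^ 'n ^ 'n) set"
  assumes S: "compact_matrix_group S"
    and X: "\<And>H. H \<in> lie_algebra S \<Longrightarrow> X ** H = H ** X"
  shows "\<exists>d>0. \<forall>s\<in>S. dist s (mat 1) < d \<longrightarrow> s ** X = X ** s"
proof (rule ccontr)
  assume "\<not> ?thesis"
  then have "\<exists>s\<in>S. dist s (mat 1) < 1 / real (Suc n) \<and> s ** X \<noteq> X ** s" for n
    using null_sequence(2)[of n] by blast
  then obtain s where s: "\<And>n. s n \<in> S" "\<And>n. dist (s n) (mat 1) < 1 / real (Suc n)"
    "\<And>n. s n ** X \<noteq> X ** s n" by metis
  have mS: "mat 1 \<in> S" "\<And>a b. a \<in> S \<Longrightarrow> b \<in> S \<Longrightarrow> a ** b \<in> S" "compact S"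
    using S by (auto simp: compact_matrix_group_def matrix_group_def)
  define S0 where "S0 = S \<inter> {s. s ** X = X ** s}"
  have "closed {s. s ** X = X ** s}"
    by (rule closed_commutant_right)
  then have S0: "compact S0" unfolding S0_def using mS(3) by (rule compact_Int_closed[rotated])
  have S0m: "a ** b \<in> S0" if "a \<in> S0" "b \<in> S0" for a b
    using that mS(2) by (auto simp: S0_def) (metis matrix_mul_assoc)
  have "\<exists>t\<in>S0. \<forall>t'\<in>S0. norm (s n ** t - mat 1) \<le> norm (s n ** t' - mat 1)" for n
  proof (rule continuous_attains_inf[OF S0])
    show "S0 \<noteq> {}" using mS by (auto simp: S0_def intro!: exI[of _ "mat 1"])
    show "continuous_on S0 (\<lambda>t. norm (s n ** t - mat 1))"
      unfolding continuous_on_def by (intro ballI tendsto_intros tendsto_matrix_mult)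
  qed
  then obtain t where t: "\<And>n. t n \<in> S0"
    "\<And>n t'. t' \<in> S0 \<Longrightarrow> norm (s n ** t n - mat 1) \<le> norm (s n ** t' - mat 1)" by metis
  define g where "g n = s n ** t n" for n
  define e where "e n = norm (g n - mat 1)" for n
  have gS: "g n \<in> S" for n using s t mS by (auto simp: g_def S0_def)
  have "g n \<noteq> mat 1" for n
  proof
    assume g1: "g n = mat 1"
    obtain b where b: "b \<in> S" "t n ** b = mat 1" "b ** t n = mat 1"
      using matrix_group_inverse[OF S] t(1)[of n] unfolding S0_def by blast
    have "s n = b" using g1 b by (metis g_def matrix_mul_assoc matrix_mul_lid matrix_mul_rid)
    moreover have "t n ** X = X ** t n" using t(1)[of n] by (simp add: S0_def)
    then have "b ** X = X ** b"
      by (metis b(2,3) matrix_mul_assoc matrix_mul_lid matrix_mul_rid)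
    ultimately show False using s(3) by blast
  qed
  then have e0: "e n > 0" for n by (simp add: e_def)
  have "e n \<le> 1 / real (Suc n)" for n
    using t(2)[of "mat 1" n] s(2)[of n] mS(1)
    by (simp add: e_def g_def S0_def dist_norm del: of_nat_Suc)
  then have elim: "e \<longlonglongrightarrow> 0"
    by (intro tendsto_sandwich[OF _ _ tendsto_const null_sequence(1)])
       (auto intro!: always_eventually less_imp_le[OF e0])
  define d where "d n = (1 / e n) *\<^sub>R (g n - mat 1)" for n
  have "norm (d n) = 1" for n using e0[of n] by (simp add: d_def) (simp add: e_def)
  then have "\<forall>n. d n \<in> sphere 0 1" by simp
  then obtain D r where D: "D \<in> sphere 0 1" "strict_mono r" "(d \<circ> r) \<longlonglongrightarrow> D"
    using compact_sphere unfolding compact_def by metis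
  have er: "(\<lambda>n. e (r n)) \<longlonglongrightarrow> 0"
    using LIMSEQ_subseq_LIMSEQ[OF elim D(2)] by (simp add: o_def)
  have DS: "D \<in> lie_algebra S"
    by (rule lie_algebra_tangent[OF S, where g = "\<lambda>n. g (r n)" and e = "\<lambda>n. e (r n)"])
       (use gS er e0 D(3) in \<open>auto simp: d_def o_def\<close>)
  have ex: "mat_exp (c *\<^sub>R D) \<in> S0" for c
    using lie_algebra_exp[OF DS] exp_commute_of_commute[of D X] X[OF DS] by (simp add: S0_def)
  \<comment> \<open>\<open>exp (- e D)\<close> commutes with \<open>X\<close> and lies in
    \<open>S\<close>, so multiplying \<open>t n\<close> by it yields another competitor in
    \<open>S0\<close>; minimality keeps the distance at least \<open>e\<close>. The first-order
    expansion below instead tends to \<open>D - D = 0\<close>.\<close>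
  have ge: "norm ((1 / e (r n)) *\<^sub>R (g (r n) ** mat_exp (e (r n) *\<^sub>R (- D)) - mat 1)) \<ge> 1" for n
  proof -
    have "mat_exp (e (r n) *\<^sub>R (- D)) \<in> S0" using ex[of "- e (r n)"] by simp
    from t(2)[OF S0m[OF t(1)[of "r n"] this], of "r n"]
    have "e (r n) \<le> norm (g (r n) ** mat_exp (e (r n) *\<^sub>R (- D)) - mat 1)"
      unfolding e_def g_def by (simp add: matrix_mul_assoc)
    then show ?thesis
      using e0[of "r n"] unfolding norm_scaleR by (simp add: le_divide_eq)
  qed
  have "(1 / e (r n)) *\<^sub>R (g (r n) ** mat_exp (e (r n) *\<^sub>R (- D)) - mat 1)
      = d (r n) ** mat_exp (e (r n) *\<^sub>R (- D)) + (1 / e (r n)) *\<^sub>R (mat_exp (e (r n) *\<^sub>R (- D)) - mat 1)" for n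
    by (simp add: d_def scaleR_matrix_mult diff_matrix_mult scaleR_diff_right)
  moreover have "(\<lambda>n. d (r n) ** mat_exp (e (r n) *\<^sub>R (- D))
      + (1 / e (r n)) *\<^sub>R (mat_exp (e (r n) *\<^sub>R (- D)) - mat 1)) \<longlonglongrightarrow> D ** mat_exp (0 *\<^sub>R (- D)) + (- D)"
    by (intro tendsto_add tendsto_matrix_mult mat_exp_difference_quotient tendsto_mat_exp_scaleR
        tendsto_scaleR tendsto_const er e0 D(3)[unfolded o_def])
  ultimately have "(\<lambda>n. norm ((1 / e (r n)) *\<^sub>R (g (r n) ** mat_exp (e (r n) *\<^sub>R (- D)) - mat 1))) \<longlonglongrightarrow> 0"
    by (simp add: tendsto_norm_zero)
  then have "(0::real) \<ge> 1"
    by (rule Lim_bounded2[where N = 0]) (use ge in auto)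
  then show False by simp
qed

text \<open>The elements commuting with \<open>X\<close> form a closed subset. It is open as well:
  near any of its points \<open>a\<close>, translation by the inverse of \<open>a\<close> reduces to
  elements near 1. Connectedness does the rest.\<close>

lemma torus_commutes:
  fixes S :: "(complex ^ 'n ^ 'n) set"
  assumes S: "compact_matrix_group S" "connected S"
    and X: "\<And>H. H \<in> lie_algebra S \<Longrightarrow> X ** H = H ** X" and s: "s \<in> S"
  shows "s ** X = X ** s"
proof -
  have mS: "mat 1 \<in> S" "\<And>a b. a \<in> S \<Longrightarrow> b \<in> S \<Longrightarrow> a ** b \<in> S" "compact S"
    using S by (auto simp: compact_matrix_group_def matrix_group_def)
  define S0 where "S0 = S \<inter> {s. s ** X = X ** s}"
  obtain d where d: "d > 0" "\<And>s. s \<in> S \<Longrightarrow> dist s (mat 1) < d \<Longrightarrow> s ** X = X ** s"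
    using commutes_near_one[OF S(1) X] by blast
  have "closed {s. s ** X = X ** s}"
    by (rule closed_commutant_right)
  then have "closedin (top_of_set S) S0"
    unfolding S0_def by (rule closedin_closed_Int)
  moreover have "openin (top_of_set S) S0"
    unfolding openin_euclidean_subtopology_iff
  proof (intro conjI ballI)
    show "S0 \<subseteq> S" by (auto simp: S0_def)
    fix a
    assume a: "a \<in> S0"
    obtain b where b: "b \<in> S" "a ** b = mat 1" "b ** a = mat 1"
      using matrix_group_inverse[OF S(1)] a unfolding S0_def by blast
    have "((\<lambda>x. b ** x) \<longlongrightarrow> b ** a) (nhds a)"
      by (intro tendsto_matrix_mult tendsto_const) (rule filterlim_ident)
    then have "\<forall>\<^sub>F x in nhds a. dist (b ** x) (b ** a) < d"
      using d(1) by (rule tendstoD)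
    then obtain e where e: "e > 0" "\<And>x. dist x a < e \<Longrightarrow> dist (b ** x) (mat 1) < d"
      unfolding eventually_nhds_metric b(3) by blast
    have "x \<in> S0" if x: "x \<in> S" "dist x a < e" for x
    proof -
      have "(b ** x) ** X = X ** (b ** x)"
        by (rule d(2)) (use e x b mS in auto)
      moreover have "x = a ** (b ** x)" by (metis b(2) matrix_mul_assoc matrix_mul_lid)
      moreover have "a ** X = X ** a" using a by (simp add: S0_def)
      ultimately have "x ** X = X ** x" by (metis matrix_mul_assoc)
      then show ?thesis using x by (simp add: S0_def)
    qed
    then show "\<exists>e>0. \<forall>x'\<in>S. dist x' a < e \<longrightarrow> x' \<in> S0" using e(1) by blast
  qed
  moreover have "mat 1 \<in> S0" using mS by (simp add: S0_def)
  ultimately have "S0 = S" using S(2) unfolding connected_clopen by blast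
  then show ?thesis using s by (auto simp: S0_def)
qed

text \<open>Only inverses need an argument: the inverses of approximating elements accumulate in the
  compact group, and an accumulation point is inverse to the limit.\<close>

lemma compact_matrix_group_closure:
  fixes T G :: "(complex ^ 'n ^ 'n) set"
  assumes G: "compact_matrix_group G" and T: "T \<subseteq> G" "mat 1 \<in> T"
    and mult: "\<And>a b. a \<in> T \<Longrightarrow> b \<in> T \<Longrightarrow> a ** b \<in> T"
    and inverse: "\<And>a. a \<in> T \<Longrightarrow> \<exists>b\<in>T. a ** b = mat 1 \<and> b ** a = mat 1"
  shows "compact_matrix_group (closure T)"
proof -
  have cG: "compact G" using G by (simp add: compact_matrix_group_def)
  have sub: "closure T \<subseteq> G" using T(1) cG by (simp add: closure_minimal compact_imp_closed)
  have inv: "matrix_inv a \<in> closure T" "invertible a" if a: "a \<in> closure T" for a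
  proof -
    show ia: "invertible a"
      using a sub G by (auto simp: compact_matrix_group_def matrix_group_def)
    obtain x where x: "\<And>n. x n \<in> T" "x \<longlonglongrightarrow> a"
      using a unfolding closure_sequential by blast
    obtain y where y: "\<And>n. y n \<in> T" "\<And>n. x n ** y n = mat 1" "\<And>n. y n ** x n = mat 1"
      using inverse[OF x(1)] by metis
    have "\<forall>n. y n \<in> G" using y(1) T(1) by blast
    then obtain b r where b: "b \<in> G" "strict_mono r" "(y \<circ> r) \<longlonglongrightarrow> b"
      using cG unfolding compact_def by metis
    have "(\<lambda>n. (x \<circ> r) n ** (y \<circ> r) n) \<longlonglongrightarrow> a ** b"
      by (intro tendsto_matrix_mult LIMSEQ_subseq_LIMSEQ[OF x(2) b(2)] b(3))
    then have "a ** b = mat 1" by (simp add: y(2) LIMSEQ_const_iff)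
    then have "matrix_inv a = b"
      by (rule matrix_left_right_inverse_unique[OF matrix_inv_cancel(2)[OF ia]])
    moreover have "b \<in> closure T"
      unfolding closure_sequential using b(3) y(1) by (intro exI[of _ "y \<circ> r"]) auto
    ultimately show "matrix_inv a \<in> closure T" by simp
  qed
  have "a ** b \<in> closure T" if ab: "a \<in> closure T" "b \<in> closure T" for a b
  proof -
    obtain x y where "\<And>n. x n \<in> T" "x \<longlonglongrightarrow> a" "\<And>n. y n \<in> T" "y \<longlonglongrightarrow> b"
      using ab unfolding closure_sequential by blast
    then show ?thesis
      unfolding closure_sequential
      by (intro exI[of _ "\<lambda>n. x n ** y n"] conjI allI mult tendsto_matrix_mult)
  qed
  moreover have "compact (closure T)"
    using T(1) bounded_subset[OF compact_imp_bounded[OF cG]] by (simp add: compact_closure)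
  ultimately show ?thesis
    using inv closure_subset[of T] T(2) by (auto simp: compact_matrix_group_def matrix_group_def)
qed

text \<open>If \<open>X\<close> commutes with \<open>\<hh>\<close>, then \<open>S\<close> and the
  one-parameter group of \<open>X\<close> generate a connected abelian group. It need not be
  compact, but its closure is a torus containing \<open>S\<close>, hence \<open>S\<close>
  itself.\<close>

lemma maximal_torus_self_centralizing:
  fixes G S :: "(complex ^ 'n ^ 'n) set"
  assumes G: "compact_matrix_group G" and S: "maximal_torus G S"
    and X: "X \<in> lie_algebra G" and cent: "\<And>H. H \<in> lie_algebra S \<Longrightarrow> lie_bracket X H = 0"
  shows "X \<in> lie_algebra S"
proof -
  have mG: "mat 1 \<in> G" "\<And>a b. a \<in> G \<Longrightarrow> b \<in> G \<Longrightarrow> a ** b \<in> G" "compact G"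
    using G by (auto simp: compact_matrix_group_def matrix_group_def)
  have tS: "S \<subseteq> G" "compact_matrix_group S" "connected S" "\<And>a b. a \<in> S \<Longrightarrow> b \<in> S \<Longrightarrow> a ** b = b ** a"
    using S by (auto simp: maximal_torus_def torus_in_def)
  have mS: "mat 1 \<in> S" "\<And>a b. a \<in> S \<Longrightarrow> b \<in> S \<Longrightarrow> a ** b \<in> S"
    using tS by (auto simp: compact_matrix_group_def matrix_group_def)
  have sX: "mat_exp (t *\<^sub>R X) ** s = s ** mat_exp (t *\<^sub>R X)" if "s \<in> S" for s t
    using torus_commutes[OF tS(2,3), of X s] cent that
    by (intro exp_commute_of_commute) (auto simp: lie_bracket_def)
  have XX: "mat_exp (t *\<^sub>R X) ** mat_exp (u *\<^sub>R X) = mat_exp ((t + u) *\<^sub>R X)" for t u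
    by (simp add: mat_exp_add[symmetric] scaleR_left_distrib scaleR_matrix_mult mult.commute)
  define T where "T = (\<lambda>(s, t). s ** mat_exp (t *\<^sub>R X)) ` (S \<times> (UNIV :: real set))"
  have Tm: "(s ** mat_exp (t *\<^sub>R X)) ** (s' ** mat_exp (t' *\<^sub>R X)) = (s ** s') ** mat_exp ((t + t') *\<^sub>R X)"
    if "s \<in> S" "s' \<in> S" for s s' t t'
  proof -
    have "(s ** mat_exp (t *\<^sub>R X)) ** (s' ** mat_exp (t' *\<^sub>R X))
        = s ** (mat_exp (t *\<^sub>R X) ** s') ** mat_exp (t' *\<^sub>R X)" by (simp add: matrix_mul_assoc)
    also have "\<dots> = s ** s' ** (mat_exp (t *\<^sub>R X) ** mat_exp (t' *\<^sub>R X))"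
      by (simp add: sX[OF that(2)] matrix_mul_assoc)
    finally show ?thesis by (simp add: XX)
  qed
  have Ti: "s ** mat_exp (t *\<^sub>R X) \<in> T" if "s \<in> S" for s t
    unfolding T_def using that by (intro image_eqI[of _ _ "(s, t)"]) auto
  have Te: "\<exists>s\<in>S. \<exists>t. a = s ** mat_exp (t *\<^sub>R X)" if "a \<in> T" for a
    using that by (auto simp: T_def)
  have TG: "T \<subseteq> G" using tS(1) mG(2) lie_algebra_exp[OF X] by (auto simp: T_def)
  have ST: "S \<subseteq> T"
  proof
    fix s assume "s \<in> S"
    then show "s \<in> T" unfolding T_def by (intro image_eqI[of _ _ "(s, 0)"]) auto
  qed
  have XT: "mat_exp (t *\<^sub>R X) \<in> T" for t
    unfolding T_def using mS by (intro image_eqI[of _ _ "(mat 1, t)"]) auto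
  have Tc: "a ** b = b ** a" if "a \<in> T" "b \<in> T" for a b
    using Te[OF that(1)] Te[OF that(2)] Tm tS(4) by (metis add.commute)
  have "torus_in G (closure T)"
    unfolding torus_in_def
  proof (intro conjI)
    show "closure T \<subseteq> G" using TG mG(3) by (simp add: closure_minimal compact_imp_closed)
    show "compact_matrix_group (closure T)"
    proof (rule compact_matrix_group_closure[OF G TG])
      show "mat 1 \<in> T" using ST mS by blast
      show "a ** b \<in> T" if "a \<in> T" "b \<in> T" for a b
        using Te[OF that(1)] Te[OF that(2)] Tm Ti mS(2) by metis
      show "\<exists>b\<in>T. a ** b = mat 1 \<and> b ** a = mat 1" if "a \<in> T" for a
      proof -
        obtain s t where a: "a = s ** mat_exp (t *\<^sub>R X)" "s \<in> S" using \<open>a \<in> T\<close> by (auto simp: T_def)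
        obtain s' where s': "s' \<in> S" "s ** s' = mat 1" "s' ** s = mat 1"
          using matrix_group_inverse[OF tS(2) a(2)] by blast
        show ?thesis
          using Tm[OF a(2) s'(1), of t "- t"] Tm[OF s'(1) a(2), of "- t" t] a(1) s'(2,3) Ti[OF s'(1), of "- t"]
          by (intro bexI[of _ "s' ** mat_exp ((- t) *\<^sub>R X)"]) auto
      qed
    qed
    have "connected T"
      unfolding T_def
    proof (rule connected_continuous_image)
      show "connected (S \<times> (UNIV :: real set))" using tS(3) by (simp add: connected_Times)
      show "continuous_on (S \<times> UNIV) (\<lambda>(s, t). s ** mat_exp (t *\<^sub>R X))"
        unfolding continuous_on_def case_prod_unfold
        by (intro ballI tendsto_matrix_mult tendsto_mat_exp_scaleR tendsto_intros)
    qed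
    then show "connected (closure T)" by (rule connected_imp_connected_closure)
    have closed_cent: "closed {b. a ** b = b ** a}" for a :: "complex ^ 'n ^ 'n"
      by (rule closed_commutant_left)
    \<comment> \<open>Commutation passes to the closure in one factor at a time, as each commutant
      is closed.\<close>
    have 1: "closure T \<subseteq> {b. a ** b = b ** a}" if "a \<in> T" for a
      using Tc that by (intro closure_minimal closed_cent) auto
    have "closure T \<subseteq> {b. a ** b = b ** a}" if "a \<in> closure T" for a
    proof (intro closure_minimal closed_cent subsetI CollectI)
      show "a ** x = x ** a" if "x \<in> T" for x using 1[OF that] \<open>a \<in> closure T\<close> by auto
    qed
    then show "\<forall>a\<in>closure T. \<forall>b\<in>closure T. a ** b = b ** a" by blast
  qed
  moreover have "S \<subseteq> closure T" using ST closure_subset by blast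
  ultimately have "closure T = S" using S unfolding maximal_torus_def by blast
  then have "mat_exp (t *\<^sub>R X) \<in> S" for t using XT closure_subset by blast
  then show ?thesis by (simp add: lie_algebra_def)
qed

section \<open>Formal sums: module structure, inversion, derivations\<close>

subsection \<open>The group ring and its action on formal sums\<close>

abbreviation coef :: "('a \<Rightarrow>\<^sub>0 'b::zero) \<Rightarrow> 'a \<Rightarrow> 'b" where "coef \<equiv> Poly_Mapping.lookup"
abbreviation supp :: "('a \<Rightarrow>\<^sub>0 'b::zero) \<Rightarrow> 'a set" where "supp \<equiv> Poly_Mapping.keys"

text \<open>Convolution of a finite formal sum with an arbitrary one is a finite sum at each
  exponent. Formal sums thus form a module over the group ring, and associativity holds without
  conditions on supports.\<close>

definition action :: "('a::ab_group_add \<Rightarrow>\<^sub>0 real) \<Rightarrow> ('a \<Rightarrow> real) \<Rightarrow> 'a \<Rightarrow> real" where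
  "action p g \<mu> = (\<Sum>\<nu>\<in>supp p. coef p \<nu> * g (\<mu> - \<nu>))"

lemma action_superset:
  assumes "finite A" "supp p \<subseteq> A"
  shows "action p g \<mu> = (\<Sum>\<nu>\<in>A. coef p \<nu> * g (\<mu> - \<nu>))"
  unfolding action_def by (rule sum.mono_neutral_left) (use assms in \<open>auto simp: in_keys_iff\<close>)

lemma coef_times:
  fixes p q :: "'a :: ab_group_add \<Rightarrow>\<^sub>0 real"
  shows "coef (p * q) = action p (coef q)"
proof
  fix \<mu>
  have "(\<Sum>x. coef q x when \<mu> = \<nu> + x) = coef q (\<mu> - \<nu>)" for \<nu>
  proof -
    have "(\<mu> = \<nu> + x) = (x = \<mu> - \<nu>)" for x by (auto simp: algebra_simps)
    then show ?thesis by simp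
  qed
  then have "coef (p * q) \<mu> = (\<Sum>\<nu>. coef p \<nu> * coef q (\<mu> - \<nu>))" by (simp add: lookup_mult)
  also have "\<dots> = action p (coef q) \<mu>"
    unfolding action_def by (rule Sum_any.expand_superset) (auto simp: in_keys_iff)
  finally show "coef (p * q) \<mu> = action p (coef q) \<mu>" .
qed

lemma action_add: "action (p + q) g \<mu> = action p g \<mu> + action q g \<mu>"
proof -
  have "finite (supp p \<union> supp q)" by simp
  moreover have "supp (p + q) \<subseteq> supp p \<union> supp q" by (rule keys_add)
  ultimately show ?thesis
    by (simp add: action_superset[where A = "supp p \<union> supp q"] lookup_add ring_distribs sum.distrib)
qed

lemma action_single: "action (Poly_Mapping.single \<kappa> c) g \<mu> = c * g (\<mu> - \<kappa>)"
  by (subst action_superset[where A = "{\<kappa>}"]) auto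

lemma action_diff: "action (p - q) g \<mu> = action p g \<mu> - action q g \<mu>"
  using action_add[of "p - q" q g \<mu>] by simp

lemma action_one: "action 1 g = g"
  using action_single[of 0 1 g] by (auto simp: single_one)

lemma action_mult: "action (p * q) g = action p (action q g)"
proof
  fix \<mu>
  let ?C = "(\<lambda>(a, b). a + b) ` (supp p \<times> supp q)"
  have "supp (p * q) \<subseteq> ?C" using keys_mult[of p q] by auto
  then have "action (p * q) g \<mu> = (\<Sum>\<kappa>\<in>?C. coef (p * q) \<kappa> * g (\<mu> - \<kappa>))"
    by (intro action_superset) auto
  also have "\<dots> = (\<Sum>\<kappa>\<in>?C. \<Sum>\<nu>\<in>supp p. coef p \<nu> * (coef q (\<kappa> - \<nu>) * g (\<mu> - \<kappa>)))"
    unfolding coef_times action_def by (simp add: sum_distrib_right mult.assoc)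
  also have "\<dots> = (\<Sum>\<nu>\<in>supp p. coef p \<nu> * (\<Sum>\<kappa>\<in>?C. coef q (\<kappa> - \<nu>) * g (\<mu> - \<kappa>)))"
    by (subst sum.swap) (simp add: sum_distrib_left)
  also have "\<dots> = (\<Sum>\<nu>\<in>supp p. coef p \<nu> * action q g (\<mu> - \<nu>))"
  proof (intro sum.cong refl arg_cong2[where f = "(*)"])
    fix \<nu> assume \<nu>: "\<nu> \<in> supp p"
    have "(\<Sum>\<kappa>\<in>?C. coef q (\<kappa> - \<nu>) * g (\<mu> - \<kappa>)) = (\<Sum>\<kappa>\<in>(\<lambda>b. \<nu> + b) ` supp q. coef q (\<kappa> - \<nu>) * g (\<mu> - \<kappa>))"
    proof (rule sum.mono_neutral_right)
      show "\<forall>\<kappa>\<in>?C - (\<lambda>b. \<nu> + b) ` supp q. coef q (\<kappa> - \<nu>) * g (\<mu> - \<kappa>) = 0"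
      proof
        fix \<kappa> assume "\<kappa> \<in> ?C - (\<lambda>b. \<nu> + b) ` supp q"
        then have "\<kappa> - \<nu> \<notin> supp q" by (metis DiffD2 add.commute diff_add_cancel image_eqI)
        then show "coef q (\<kappa> - \<nu>) * g (\<mu> - \<kappa>) = 0" by (simp add: in_keys_iff)
      qed
    qed (use \<nu> in auto)
    also have "\<dots> = (\<Sum>b\<in>supp q. coef q b * g (\<mu> - \<nu> - b))"
      by (subst sum.reindex) (auto simp: inj_on_def algebra_simps)
    finally show "(\<Sum>\<kappa>\<in>?C. coef q (\<kappa> - \<nu>) * g (\<mu> - \<kappa>)) = action q g (\<mu> - \<nu>)"
      by (simp add: action_def)
  qed
  also have "\<dots> = action p (action q g) \<mu>" by (simp add: action_def)
  finally show "action (p * q) g \<mu> = action p (action q g) \<mu>" .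
qed

lemma formal_times_coef_left: "formal_times (coef p) g = action p g"
proof
  fix \<mu>
  show "formal_times (coef p) g \<mu> = action p g \<mu>"
    unfolding formal_times_def action_def
    by (rule sum.mono_neutral_left) (auto simp: in_keys_iff)
qed

lemma formal_times_coef_right: "formal_times g (coef p) = action p g"
proof
  fix \<mu>
  have "action p g \<mu> = (\<Sum>\<nu>\<in>{\<nu>\<in>supp p. g (\<mu> - \<nu>) \<noteq> 0}. coef p \<nu> * g (\<mu> - \<nu>))"
    unfolding action_def by (rule sum.mono_neutral_right) auto
  also have "\<dots> = (\<Sum>\<nu> | g \<nu> \<noteq> 0 \<and> coef p (\<mu> - \<nu>) \<noteq> 0. g \<nu> * coef p (\<mu> - \<nu>))"
    by (rule sum.reindex_bij_witness[where i = "\<lambda>\<nu>. \<mu> - \<nu>" and j = "\<lambda>\<nu>. \<mu> - \<nu>"])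
       (auto simp: in_keys_iff)
  finally show "formal_times g (coef p) \<mu> = action p g \<mu>" by (simp add: formal_times_def)
qed

subsection \<open>Inversion of the denominator\<close>

lemma negative_cone_minus_root:
  assumes "finite P" "\<alpha> \<in> P" "\<mu> + \<alpha> \<in> negative_cone P"
  shows "\<mu> \<in> negative_cone P"
proof -
  obtain k :: "_ \<Rightarrow> nat" where k: "\<mu> + \<alpha> = (\<lambda>X. - (\<Sum>\<beta>\<in>P. real (k \<beta>) * \<beta> X))"
    using assms(3) unfolding negative_cone_def by blast
  have "\<mu> = (\<lambda>X. - (\<Sum>\<beta>\<in>P. real ((k(\<alpha> := Suc (k \<alpha>))) \<beta>) * \<beta> X))"
  proof
    fix X
    have "(\<Sum>\<beta>\<in>P. real ((k(\<alpha> := Suc (k \<alpha>))) \<beta>) * \<beta> X) = (\<Sum>\<beta>\<in>P. real (k \<beta>) * \<beta> X + (if \<beta> = \<alpha> then \<alpha> X else 0))"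
      by (rule sum.cong) (auto simp: algebra_simps)
    also have "\<dots> = (\<Sum>\<beta>\<in>P. real (k \<beta>) * \<beta> X) + \<alpha> X"
      using assms(1,2) by (simp add: sum.distrib)
    finally show "\<mu> X = - (\<Sum>\<beta>\<in>P. real ((k(\<alpha> := Suc (k \<alpha>))) \<beta>) * \<beta> X)"
      using fun_cong[OF k, of X] by simp
  qed
  then show ?thesis unfolding negative_cone_def by blast
qed

lemma negative_cone_nonpos:
  assumes "\<forall>\<alpha>\<in>P. \<alpha> H0 > 0" "\<mu> \<in> negative_cone P"
  shows "\<mu> H0 \<le> 0"
proof -
  obtain k :: "_ \<Rightarrow> nat" where k: "\<mu> = (\<lambda>X. - (\<Sum>\<alpha>\<in>P. real (k \<alpha>) * \<alpha> X))"
    using assms(2) unfolding negative_cone_def by blast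
  have "(\<Sum>\<alpha>\<in>P. real (k \<alpha>) * \<alpha> H0) \<ge> 0"
    by (intro sum_nonneg mult_nonneg_nonneg of_nat_0_le_iff less_imp_le bspec[OF assms(1)])
  then show ?thesis by (simp add: k)
qed

lemma eventually_outside_halfspace:
  fixes \<alpha> \<mu> :: "'x \<Rightarrow> real"
  assumes "\<alpha> H0 > 0"
  obtains N where "\<And>k::nat. k \<ge> N \<Longrightarrow> (\<mu> + (\<lambda>X. real k * \<alpha> X)) H0 > 0"
proof -
  obtain N where N: "real N * \<alpha> H0 > - \<mu> H0" using reals_Archimedean3[OF assms] by blast
  show ?thesis
  proof (rule that[of N])
    fix k assume "N \<le> k"
    then have "real N * \<alpha> H0 \<le> real k * \<alpha> H0" using assms by (intro mult_right_mono) auto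
    then show "(\<mu> + (\<lambda>X. real k * \<alpha> X)) H0 > 0" using N by simp
  qed
qed

lemma action_geometric: "action (1 - formal_exp (- \<alpha>)) g \<mu> = g \<mu> - g (\<mu> + \<alpha>)"
  by (simp add: action_diff action_one formal_exp_def action_single)

text \<open>The equation makes \<open>g\<close> constant along \<open>\<mu> + k \<alpha>\<close>,
  and this ray eventually leaves the half-space that contains the support.\<close>

lemma action_geometric_inj:
  fixes \<alpha> :: "'n functional"
  assumes \<alpha>: "\<alpha> H0 > 0" and g: "\<And>\<mu>. g \<mu> \<noteq> 0 \<Longrightarrow> \<mu> H0 \<le> 0"
    and z: "action (1 - formal_exp (- \<alpha>)) g = (\<lambda>_. 0)"
  shows "g = (\<lambda>_. 0)"
proof
  fix \<mu>
  have step: "g \<nu> = g (\<nu> + \<alpha>)" for \<nu>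
    using fun_cong[OF z, of \<nu>] by (simp add: action_geometric)
  have "g \<mu> = g (\<mu> + (\<lambda>X. real k * \<alpha> X))" for k :: nat
  proof (induction k)
    case (Suc k)
    have "\<mu> + (\<lambda>X. real (Suc k) * \<alpha> X) = (\<mu> + (\<lambda>X. real k * \<alpha> X)) + \<alpha>"
      by (auto simp: fun_eq_iff algebra_simps)
    then show ?case using Suc step by metis
  qed (simp add: plus_fun_def)
  moreover obtain N where "\<And>k::nat. k \<ge> N \<Longrightarrow> (\<mu> + (\<lambda>X. real k * \<alpha> X)) H0 > 0"
    using eventually_outside_halfspace[of \<alpha> H0, OF \<alpha>] by metis
  ultimately show "g \<mu> = 0" using g[of "\<mu> + (\<lambda>X. real N * \<alpha> X)" for N] by (metis le_refl not_le)
qed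

lemma action_denominator_inj:
  fixes A :: "'n functional set"
  assumes "finite A" "\<forall>\<alpha>\<in>A. \<alpha> H0 > 0" "\<And>\<mu>. g \<mu> \<noteq> 0 \<Longrightarrow> \<mu> H0 \<le> 0"
    and "action (weyl_denominator A) g = (\<lambda>_. 0)"
  shows "g = (\<lambda>_. 0)"
  using assms
proof (induction A arbitrary: g rule: finite_induct)
  case empty
  then show ?case by (simp add: weyl_denominator_def action_one)
next
  case (insert \<alpha> A)
  let ?h = "action (1 - formal_exp (- \<alpha>)) g"
  have "weyl_denominator (insert \<alpha> A) = weyl_denominator A * (1 - formal_exp (- \<alpha>))"
    using insert by (simp add: weyl_denominator_def mult.commute)
  then have z: "action (weyl_denominator A) ?h = (\<lambda>_. 0)"
    using insert.prems(3) by (simp add: action_mult)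
  have le: "\<mu> H0 \<le> 0" if "?h \<mu> \<noteq> 0" for \<mu>
  proof -
    have "g \<mu> \<noteq> 0 \<or> g (\<mu> + \<alpha>) \<noteq> 0" using that by (auto simp: action_geometric)
    then show ?thesis
    proof
      assume "g (\<mu> + \<alpha>) \<noteq> 0"
      from insert.prems(2)[OF this] show ?thesis using insert.prems(1) by simp
    qed (rule insert.prems(2))
  qed
  have h0: "?h = (\<lambda>_. 0)"
  proof (rule insert.IH)
    show "\<forall>\<beta>\<in>A. \<beta> H0 > 0" using insert.prems(1) by simp
    show "\<mu> H0 \<le> 0" if "?h \<mu> \<noteq> 0" for \<mu> using that by (rule le)
  qed (rule z)
  show ?case
  proof (rule action_geometric_inj)
    show "\<alpha> H0 > 0" using insert.prems(1) by simp
    show "\<mu> H0 \<le> 0" if "g \<mu> \<noteq> 0" for \<mu> using that by (rule insert.prems(2))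
  qed (rule h0)
qed

text \<open>The solution is the geometric series, with coefficient at \<open>\<mu>\<close> the sum
  of \<open>g (\<mu> + k \<alpha>)\<close> over \<open>k\<close>. Only finitely many terms are
  non-zero because the cone lies in a half-space; the cut-off \<open>N\<close> depends on
  \<open>\<mu>\<close>.\<close>

lemma action_geometric_surj:
  fixes \<alpha> :: "'n functional"
  assumes P: "finite P" "\<alpha> \<in> P" "\<forall>\<alpha>\<in>P. \<alpha> H0 > 0"
    and g: "\<And>\<mu>. g \<mu> \<noteq> 0 \<Longrightarrow> \<mu> \<in> negative_cone P"
  obtains h where "\<And>\<mu>. h \<mu> \<noteq> 0 \<Longrightarrow> \<mu> \<in> negative_cone P" "action (1 - formal_exp (- \<alpha>)) h = g"
proof -
  define sh :: "'n functional \<Rightarrow> nat \<Rightarrow> 'n functional" where "sh \<mu> k = \<mu> + (\<lambda>X. real k * \<alpha> X)" for \<mu> k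
  have sh0: "sh \<mu> 0 = \<mu>" for \<mu> by (simp add: sh_def plus_fun_def)
  have shS: "sh \<mu> (Suc k) = sh (\<mu> + \<alpha>) k" "sh \<mu> (Suc k) = sh \<mu> k + \<alpha>" for \<mu> k
    by (auto simp: sh_def fun_eq_iff algebra_simps)
  have "\<exists>N. \<forall>k\<ge>N. g (sh \<mu> k) = 0" for \<mu>
  proof -
    obtain N where "\<And>k::nat. k \<ge> N \<Longrightarrow> sh \<mu> k H0 > 0"
      using eventually_outside_halfspace[of \<alpha> H0, OF bspec[OF P(3) P(2)]] unfolding sh_def by metis
    then show ?thesis using g negative_cone_nonpos[of P H0, OF P(3)] by (metis not_le)
  qed
  then obtain N where N: "\<And>\<mu> k. k \<ge> N \<mu> \<Longrightarrow> g (sh \<mu> k) = 0" by metis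
  define h where "h \<mu> = (\<Sum>k<N \<mu>. g (sh \<mu> k))" for \<mu>
  have h: "h \<mu> = (\<Sum>k<M. g (sh \<mu> k))" if "M \<ge> N \<mu>" for \<mu> M
    unfolding h_def by (rule sum.mono_neutral_left) (use that N in auto)
  show thesis
  proof (rule that[of h])
    fix \<mu> assume "h \<mu> \<noteq> 0"
    then obtain k where "g (sh \<mu> k) \<noteq> 0" unfolding h_def by (meson sum.not_neutral_contains_not_neutral)
    then have "sh \<mu> k \<in> negative_cone P" by (rule g)
    then show "\<mu> \<in> negative_cone P"
    proof (induction k)
      case (Suc k)
      have "sh \<mu> k + \<alpha> \<in> negative_cone P" using Suc.prems unfolding shS(2) .
      then show ?case by (rule Suc.IH[OF negative_cone_minus_root[OF P(1,2)]])
    qed (simp add: sh0)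
  next
    show "action (1 - formal_exp (- \<alpha>)) h = g"
    proof
      fix \<mu>
      define M where "M = max (N \<mu>) (N (\<mu> + \<alpha>))"
      have "h \<mu> = (\<Sum>k<Suc M. g (sh \<mu> k))" by (rule h) (simp add: M_def)
      also have "\<dots> = g \<mu> + (\<Sum>k<M. g (sh (\<mu> + \<alpha>) k))"
        by (subst sum.lessThan_Suc_shift) (simp add: sh0 shS(1))
      also have "(\<Sum>k<M. g (sh (\<mu> + \<alpha>) k)) = h (\<mu> + \<alpha>)" by (rule h[symmetric]) (simp add: M_def)
      finally show "action (1 - formal_exp (- \<alpha>)) h \<mu> = g \<mu>" by (simp add: action_geometric)
    qed
  qed
qed

text \<open>The cone is that of all of \<open>P\<close> while the product runs over
  \<open>A\<close>, so that the support condition stays fixed during the induction on the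
  factors.\<close>

lemma action_denominator_surj:
  fixes P :: "'n functional set"
  assumes P: "finite P" "\<forall>\<alpha>\<in>P. \<alpha> H0 > 0" and A: "A \<subseteq> P"
    and g: "\<And>\<mu>. g \<mu> \<noteq> 0 \<Longrightarrow> \<mu> \<in> negative_cone P"
  shows "\<exists>h. (\<forall>\<mu>. h \<mu> \<noteq> 0 \<longrightarrow> \<mu> \<in> negative_cone P) \<and> action (weyl_denominator A) h = g"
proof -
  have "finite A" using A P(1) finite_subset by blast
  then show ?thesis using A g
  proof (induction A arbitrary: g rule: finite_induct)
    case empty
    then show ?case by (intro exI[of _ g]) (simp add: weyl_denominator_def action_one)
  next
    case (insert \<alpha> A)
    obtain h where h: "\<And>\<mu>. h \<mu> \<noteq> 0 \<Longrightarrow> \<mu> \<in> negative_cone P" "action (1 - formal_exp (- \<alpha>)) h = g"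
      using action_geometric_surj[of P \<alpha> H0 g, OF P(1) _ P(2)] insert.prems by (metis insert_subset)
    have "A \<subseteq> P" using insert.prems(1) by simp
    from insert.IH[OF this, of h] h(1)
    obtain f where "\<forall>\<mu>. f \<mu> \<noteq> 0 \<longrightarrow> \<mu> \<in> negative_cone P" "action (weyl_denominator A) f = h"
      by metis
    moreover have "weyl_denominator (insert \<alpha> A) = (1 - formal_exp (- \<alpha>)) * weyl_denominator A"
      using insert by (simp add: weyl_denominator_def)
    ultimately show ?case using h(2) by (intro exI[of _ f]) (simp add: action_mult)
  qed
qed

text \<open>Unique existence turns the description in \<open>formal_inverse\<close> into an actual
  inverse \<open>q\<close>. Cancellation is then the module law: \<open>X\<close> acts on the result
  of the denominator acting on \<open>q\<close>, which is the unit.\<close>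

theorem formal_inverse_denominator_times:
  fixes P :: "'n functional set"
  assumes P: "finite P" "\<forall>\<alpha>\<in>P. \<alpha> H0 > 0"
  shows "formal_times (formal_inverse P (coef (weyl_denominator P))) (coef (weyl_denominator P * X)) = coef X"
proof -
  let ?\<delta> = "coef (formal_exp (0 :: 'n functional))"
  define good where "good q \<longleftrightarrow> (\<forall>\<mu>. q \<mu> \<noteq> 0 \<longrightarrow> \<mu> \<in> negative_cone P)
    \<and> formal_times (coef (weyl_denominator P)) q = ?\<delta>" for q
  have "\<mu> \<in> negative_cone P" if "?\<delta> \<mu> \<noteq> 0" for \<mu>
  proof -
    have "\<mu> = (\<lambda>X. - (\<Sum>\<alpha>\<in>P. real 0 * \<alpha> X))"
      using that by (auto simp: formal_exp_def lookup_single fun_eq_iff when_def simp del: single_one split: if_splits)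
    then show ?thesis unfolding negative_cone_def by (intro CollectI exI[of _ "\<lambda>_. 0"])
  qed
  then have ex: "\<exists>q. good q"
    unfolding good_def formal_times_coef_left
    by (intro action_denominator_surj[of P H0 P ?\<delta>, OF P subset_refl])
  have uniq: "q = q'" if "good q" "good q'" for q q'
  proof -
    have "action (weyl_denominator P) (\<lambda>\<mu>. q \<mu> - q' \<mu>) = (\<lambda>_. 0)"
    proof
      fix \<mu>
      have "action (weyl_denominator P) (\<lambda>\<mu>. q \<mu> - q' \<mu>) \<mu>
          = action (weyl_denominator P) q \<mu> - action (weyl_denominator P) q' \<mu>"
        by (simp add: action_def right_diff_distrib sum_subtractf)
      then show "action (weyl_denominator P) (\<lambda>\<mu>. q \<mu> - q' \<mu>) \<mu> = 0"
        using that by (simp add: good_def formal_times_coef_left)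
    qed
    moreover have "\<mu> H0 \<le> 0" if "q \<mu> - q' \<mu> \<noteq> 0" for \<mu>
    proof -
      have "q \<mu> \<noteq> 0 \<or> q' \<mu> \<noteq> 0" using that by auto
      then have "\<mu> \<in> negative_cone P" using \<open>good q\<close> \<open>good q'\<close> by (auto simp: good_def)
      then show ?thesis by (rule negative_cone_nonpos[of P H0, OF P(2)])
    qed
    ultimately have "(\<lambda>\<mu>. q \<mu> - q' \<mu>) = (\<lambda>_. 0)"
      by (intro action_denominator_inj[of P H0 "\<lambda>\<mu>. q \<mu> - q' \<mu>", OF P])
    then show ?thesis by (auto simp: fun_eq_iff)
  qed
  have "formal_inverse P (coef (weyl_denominator P)) = (THE q. good q)"
    by (simp add: formal_inverse_def good_def)
  then have "good (formal_inverse P (coef (weyl_denominator P)))"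
    using ex uniq by (metis theI)
  then have "action (weyl_denominator P) (formal_inverse P (coef (weyl_denominator P))) = ?\<delta>"
    by (simp add: good_def formal_times_coef_left)
  then have "formal_times (formal_inverse P (coef (weyl_denominator P))) (coef (weyl_denominator P * X))
      = action X ?\<delta>"
    unfolding formal_times_coef_right mult.commute[of _ X] action_mult by simp
  also have "\<dots> = coef (X * formal_exp 0)" by (simp add: coef_times)
  finally show ?thesis by (simp add: formal_exp_def single_one)
qed

subsection \<open>Derivations of the group ring\<close>

abbreviation const :: "real \<Rightarrow> (('x \<Rightarrow> real) \<Rightarrow>\<^sub>0 real)" where "const c \<equiv> Poly_Mapping.single 0 c"
abbreviation ee :: "('x \<Rightarrow> real) \<Rightarrow> (('x \<Rightarrow> real) \<Rightarrow>\<^sub>0 real)" where "ee \<nu> \<equiv> Poly_Mapping.single \<nu> 1"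

text \<open>Differentiation in the direction \<open>x\<close>, if \<open>ee \<nu>\<close> is read as
  the exponential of the linear function \<open>\<nu>\<close>.\<close>

definition gderiv :: "'x \<Rightarrow> (('x \<Rightarrow> real) \<Rightarrow>\<^sub>0 real) \<Rightarrow> (('x \<Rightarrow> real) \<Rightarrow>\<^sub>0 real)" where
  "gderiv x p = Poly_Mapping.mapp (\<lambda>\<nu> c. \<nu> x * c) p"

lemma coef_gderiv: "coef (gderiv x p) \<nu> = \<nu> x * coef p \<nu>"
  by (auto simp: gderiv_def lookup_mapp when_def in_keys_iff)

lemma supp_gderiv: "supp (gderiv x p) \<subseteq> supp p"
  by (auto simp: gderiv_def keys_mapp_subset[THEN subsetD])

lemma gderiv_add: "gderiv x (p + q) = gderiv x p + gderiv x q"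
  by (rule poly_mapping_eqI) (simp add: coef_gderiv lookup_add ring_distribs)

lemma gderiv_times: "gderiv x (p * q) = gderiv x p * q + p * gderiv x q"
proof (rule poly_mapping_eqI)
  fix \<mu>
  have "coef (gderiv x p * q) \<mu> = (\<Sum>\<nu>\<in>supp p. \<nu> x * coef p \<nu> * coef q (\<mu> - \<nu>))"
    unfolding coef_times by (subst action_superset[OF finite_keys supp_gderiv]) (simp add: coef_gderiv)
  moreover have "coef (p * gderiv x q) \<mu> = (\<Sum>\<nu>\<in>supp p. (\<mu> - \<nu>) x * coef p \<nu> * coef q (\<mu> - \<nu>))"
    unfolding coef_times action_def coef_gderiv by (simp add: mult_ac)
  moreover have "coef (gderiv x (p * q)) \<mu> = (\<Sum>\<nu>\<in>supp p. \<mu> x * coef p \<nu> * coef q (\<mu> - \<nu>))"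
    unfolding coef_gderiv coef_times action_def by (simp add: sum_distrib_left mult.assoc)
  ultimately show "coef (gderiv x (p * q)) \<mu> = coef (gderiv x p * q + p * gderiv x q) \<mu>"
    by (simp add: lookup_add sum.distrib[symmetric] algebra_simps)
qed

lemma gderiv_single: "gderiv x (Poly_Mapping.single \<nu> c) = const (\<nu> x) * Poly_Mapping.single \<nu> c"
  by (rule poly_mapping_eqI) (auto simp: coef_gderiv mult_single lookup_single when_def)

lemma gderiv_1: "gderiv x 1 = 0"
  by (rule poly_mapping_eqI) (auto simp: coef_gderiv lookup_one when_def)

lemma gderiv_diff: "gderiv x (p - q) = gderiv x p - gderiv x q"
  by (rule poly_mapping_eqI) (simp add: coef_gderiv lookup_minus right_diff_distrib)

lemma gderiv_prod:
  assumes "finite A"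
  shows "gderiv x (\<Prod>a\<in>A. f a) = (\<Sum>a\<in>A. gderiv x (f a) * (\<Prod>b\<in>A - {a}. f b))"
  using assms
proof (induction A rule: finite_induct)
  case (insert a A)
  have "(\<Sum>c\<in>A. gderiv x (f c) * (\<Prod>b\<in>insert a A - {c}. f b))
      = f a * (\<Sum>c\<in>A. gderiv x (f c) * (\<Prod>b\<in>A - {c}. f b))"
    unfolding sum_distrib_left
  proof (rule sum.cong)
    fix c assume "c \<in> A"
    then have "insert a A - {c} = insert a (A - {c})" using insert by auto
    then show "gderiv x (f c) * (\<Prod>b\<in>insert a A - {c}. f b) = f a * (gderiv x (f c) * (\<Prod>b\<in>A - {c}. f b))"
      using insert by (simp add: mult_ac)
  qed simp
  then show ?case using insert by (simp add: gderiv_times mult.commute)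
qed (simp add: gderiv_1)

text \<open>\<open>map_key f\<close> precomposes the coefficients with \<open>f\<close>; for
  additive bijective \<open>f\<close> this is a change of variables in the convolution. It
  transports the denominator along a reflection.\<close>

lemma map_key_times:
  fixes f :: "'a::ab_group_add \<Rightarrow> 'a"
  assumes "bij f" and "\<And>a b. f (a - b) = f a - f b"
  shows "Poly_Mapping.map_key f (p * q) = Poly_Mapping.map_key f p * (Poly_Mapping.map_key f q :: 'a \<Rightarrow>\<^sub>0 real)"
proof (rule poly_mapping_eqI)
  fix \<mu>
  note inj = bij_is_inj[OF assms(1)]
  note l = map_key.rep_eq[OF inj] keys_map_key[OF inj]
  have "coef (Poly_Mapping.map_key f p * Poly_Mapping.map_key f q) \<mu>
      = (\<Sum>\<nu>\<in>f -` supp p. coef p (f \<nu>) * coef q (f \<mu> - f \<nu>))"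
    by (simp add: coef_times action_def l assms(2))
  also have "\<dots> = (\<Sum>\<nu>\<in>supp p. coef p \<nu> * coef q (f \<mu> - \<nu>))"
    by (rule sum.reindex_bij_betw) (use assms(1) in \<open>auto simp: bij_betw_def inj_on_def surj_image_vimage_eq dest: injD bij_is_inj bij_is_surj\<close>)
  finally show "coef (Poly_Mapping.map_key f (p * q)) \<mu>
      = coef (Poly_Mapping.map_key f p * Poly_Mapping.map_key f q) \<mu>"
    by (simp add: l coef_times action_def)
qed

section \<open>Combinatorics of root systems and their reflections\<close>

subsection \<open>Root systems in spaces of functionals\<close>

definition scl :: "real \<Rightarrow> ('x \<Rightarrow> real) \<Rightarrow> 'x \<Rightarrow> real" where "scl c \<nu> = (\<lambda>x. c * \<nu> x)"

lemma scl_apply: "scl c \<nu> x = c * \<nu> x" by (simp add: scl_def)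

lemmas fun_apply = plus_fun_apply minus_apply uminus_apply zero_fun_apply scl_apply

text \<open>With these rules the simplifier would also expand unapplied sums of functionals.\<close>

declare fun_apply [simp del]

text \<open>The inner product is given in the coordinates of an orthonormal basis \<open>I\<close> of the torus algebra, so
  that the Laplacian of the group ring is the sum of the squared derivations \<open>gderiv x\<close>, \<open>x \<in> I\<close>.
  The set \<open>D\<close> is the dual space: functionals are total functions, and those outside \<open>D\<close> are junk.\<close>

locale root_data =
  fixes I :: "'x set" and D P :: "('x \<Rightarrow> real) set" and H0 :: 'x and ip :: "('x \<Rightarrow> real) \<Rightarrow> ('x \<Rightarrow> real) \<Rightarrow> real"
    and ref :: "('x \<Rightarrow> real) \<Rightarrow> ('x \<Rightarrow> real) \<Rightarrow> 'x \<Rightarrow> real"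
  defines "ip \<mu> \<nu> \<equiv> (\<Sum>x\<in>I. \<mu> x * \<nu> x)"
    and "ref \<alpha> \<nu> \<equiv> \<nu> - scl (2 * ip \<nu> \<alpha> / ip \<alpha> \<alpha>) \<alpha>"
  assumes finI: "finite I" and finP: "finite P" and PD: "P \<subseteq> D"
    and D_add: "\<mu> \<in> D \<Longrightarrow> \<nu> \<in> D \<Longrightarrow> \<mu> + \<nu> \<in> D" and D_0: "0 \<in> D"
    and posdef: "\<nu> \<in> D \<Longrightarrow> ip \<nu> \<nu> = 0 \<Longrightarrow> \<nu> = 0"
    and pos: "\<alpha> \<in> P \<Longrightarrow> \<alpha> H0 > 0"
    and root_string: "\<alpha> \<in> P \<union> uminus ` P \<Longrightarrow> \<beta> \<in> P \<union> uminus ` P \<Longrightarrow>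
      \<exists>n::int. 2 * ip \<beta> \<alpha> / ip \<alpha> \<alpha> = of_int n \<and>
        (\<forall>j::nat. int j \<le> n \<longrightarrow> \<beta> - scl (real j) \<alpha> \<in> P \<union> uminus ` P \<union> {0})"
    and no_multiple: "\<alpha> \<in> P \<Longrightarrow> k \<ge> 2 \<Longrightarrow> scl (real k) \<alpha> \<notin> P"
begin

abbreviation "\<Phi> \<equiv> P \<union> uminus ` P"

lemma ip_sym: "ip \<mu> \<nu> = ip \<nu> \<mu>" by (simp add: ip_def mult.commute)
lemma ip_add: "ip (\<mu> + \<mu>') \<nu> = ip \<mu> \<nu> + ip \<mu>' \<nu>" "ip \<nu> (\<mu> + \<mu>') = ip \<nu> \<mu> + ip \<nu> \<mu>'"
  by (simp_all add: ip_def fun_apply ring_distribs sum.distrib)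
lemma ip_diff: "ip (\<mu> - \<mu>') \<nu> = ip \<mu> \<nu> - ip \<mu>' \<nu>" "ip \<nu> (\<mu> - \<mu>') = ip \<nu> \<mu> - ip \<nu> \<mu>'"
  by (simp_all add: ip_def fun_apply left_diff_distrib right_diff_distrib sum_subtractf)
lemma ip_scl: "ip (scl c \<mu>) \<nu> = c * ip \<mu> \<nu>" "ip \<nu> (scl c \<mu>) = c * ip \<nu> \<mu>"
  by (simp_all add: ip_def scl_apply sum_distrib_left mult_ac)
lemma ip_minus: "ip (- \<mu>) \<nu> = - ip \<mu> \<nu>" "ip \<nu> (- \<mu>) = - ip \<nu> \<mu>"
  by (simp_all add: ip_def fun_apply sum_negf)
lemma ip_0: "ip 0 \<nu> = 0" "ip \<nu> 0 = 0" by (simp_all add: ip_def fun_apply)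
lemmas ip_simps = ip_add ip_diff ip_scl ip_minus ip_0

lemma ip_sum_list: "ip \<nu> (sum_list l) = (\<Sum>\<beta>\<leftarrow>l. ip \<nu> \<beta>)"
  by (induction l) (simp_all add: ip_simps)

lemma ip_nonneg: "ip \<nu> \<nu> \<ge> 0" by (simp add: ip_def sum_nonneg)

lemma root_nonzero: "\<alpha> \<in> \<Phi> \<Longrightarrow> \<alpha> H0 \<noteq> 0" using pos by (fastforce simp: fun_apply)

lemma ip_root: "\<alpha> \<in> \<Phi> \<Longrightarrow> ip \<alpha> \<alpha> > 0"
proof -
  have "ip \<alpha> \<alpha> > 0" if "\<alpha> \<in> P" for \<alpha>
  proof -
    have "\<alpha> \<noteq> 0" using pos[OF that] by (auto simp: fun_apply)
    then have "ip \<alpha> \<alpha> \<noteq> 0" using posdef PD that by blast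
    then show ?thesis using ip_nonneg[of \<alpha>] by simp
  qed
  then show "\<alpha> \<in> \<Phi> \<Longrightarrow> ip \<alpha> \<alpha> > 0" by (auto simp: ip_simps)
qed

lemma ref_add: "ref \<alpha> (\<mu> + \<nu>) = ref \<alpha> \<mu> + ref \<alpha> \<nu>"
  by (rule ext) (simp add: ref_def fun_apply ip_simps add_divide_distrib ring_distribs)
lemma ref_diff: "ref \<alpha> (\<mu> - \<nu>) = ref \<alpha> \<mu> - ref \<alpha> \<nu>"
  by (rule ext) (simp add: ref_def fun_apply ip_simps diff_divide_distrib left_diff_distrib right_diff_distrib)
lemma ref_scl: "ref \<alpha> (scl c \<nu>) = scl c (ref \<alpha> \<nu>)"
  by (rule ext) (simp add: ref_def fun_apply ip_simps right_diff_distrib)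
lemma ref_minus: "ref \<alpha> (- \<nu>) = - ref \<alpha> \<nu>"
  by (rule ext) (simp add: ref_def fun_apply ip_simps)
lemma ref_0: "ref \<alpha> 0 = 0"
  by (rule ext) (simp add: ref_def fun_apply ip_simps)
lemma ref_neg_root: "ref (- \<alpha>) = ref \<alpha>"
  by (intro ext) (simp add: ref_def fun_apply ip_simps)
lemma ref_sum: "ref \<alpha> (\<Sum>a\<in>A. f a) = (\<Sum>a\<in>A. ref \<alpha> (f a))"
  by (induction A rule: infinite_finite_induct) (simp_all add: ref_0 ref_add)

lemma ref_self: "\<alpha> \<in> \<Phi> \<Longrightarrow> ref \<alpha> \<alpha> = - \<alpha>"
  using ip_root[of \<alpha>] by (intro ext) (simp add: ref_def fun_apply)

lemma ip_ref_root: "\<alpha> \<in> \<Phi> \<Longrightarrow> ip (ref \<alpha> \<nu>) \<alpha> = - ip \<nu> \<alpha>"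
  using ip_root[of \<alpha>] by (simp add: ref_def ip_simps)

lemma ref_ref: "\<alpha> \<in> \<Phi> \<Longrightarrow> ref \<alpha> (ref \<alpha> \<nu>) = \<nu>"
  using ip_ref_root[of \<alpha> \<nu>] by (intro ext) (subst ref_def, simp add: fun_apply, simp add: ref_def fun_apply)

lemma ip_ref: "\<alpha> \<in> \<Phi> \<Longrightarrow> ip (ref \<alpha> \<mu>) (ref \<alpha> \<nu>) = ip \<mu> \<nu>"
proof -
  assume a: "\<alpha> \<in> \<Phi>"
  have "ip (ref \<alpha> \<mu>) (ref \<alpha> \<nu>) = ip (ref \<alpha> \<mu>) \<nu> - 2 * ip \<nu> \<alpha> / ip \<alpha> \<alpha> * ip (ref \<alpha> \<mu>) \<alpha>"
    by (simp add: ref_def[of \<alpha> \<nu>] ip_simps)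
  also have "\<dots> = ip \<mu> \<nu>"
    unfolding ip_ref_root[OF a] by (simp add: ref_def[of \<alpha> \<mu>] ip_simps ip_sym[of \<alpha> \<nu>])
  finally show ?thesis .
qed

lemma bij_ref: "\<alpha> \<in> \<Phi> \<Longrightarrow> bij (ref \<alpha>)"
  by (rule o_bij[of "ref \<alpha>"]) (auto simp: ref_ref fun_eq_iff)

text \<open>For \<open>ip \<beta> \<alpha> \<ge> 0\<close> the reflected root is a member of the
  descending string. The other sign reduces to this one, because \<open>- \<alpha>\<close> gives the
  same reflection.\<close>

lemma ref_root: "\<alpha> \<in> \<Phi> \<Longrightarrow> \<beta> \<in> \<Phi> \<Longrightarrow> ref \<alpha> \<beta> \<in> \<Phi>"
proof -
  have main: "ref \<alpha> \<beta> \<in> \<Phi>" if a: "\<alpha> \<in> \<Phi>" and b: "\<beta> \<in> \<Phi>" and le: "ip \<beta> \<alpha> \<ge> 0" for \<alpha> \<beta>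
  proof -
    obtain n :: int where n: "2 * ip \<beta> \<alpha> / ip \<alpha> \<alpha> = of_int n"
      "\<And>j::nat. int j \<le> n \<Longrightarrow> \<beta> - scl (real j) \<alpha> \<in> \<Phi> \<union> {0}"
      using root_string[OF a b] by blast
    have "2 * ip \<beta> \<alpha> / ip \<alpha> \<alpha> \<ge> 0" using le ip_root[OF a] by simp
    then have "n \<ge> 0" unfolding n(1) by simp
    then have "ref \<alpha> \<beta> = \<beta> - scl (real (nat n)) \<alpha>" by (simp add: ref_def n(1))
    then have "ref \<alpha> \<beta> \<in> \<Phi> \<union> {0}" using n(2)[of "nat n"] \<open>n \<ge> 0\<close> by simp
    moreover have "ref \<alpha> \<beta> \<noteq> 0"
    proof
      assume "ref \<alpha> \<beta> = 0"
      then have "\<beta> = 0" using ref_ref[OF a, of \<beta>] ref_0 by simp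
      then show False using root_nonzero[OF b] by (simp add: fun_apply)
    qed
    ultimately show ?thesis by blast
  qed
  assume a: "\<alpha> \<in> \<Phi>" and b: "\<beta> \<in> \<Phi>"
  show ?thesis
  proof (cases "ip \<beta> \<alpha> \<ge> 0")
    case False
    have "- \<alpha> \<in> \<Phi>" using a by auto
    from main[OF this b] False show ?thesis by (simp add: ip_simps ref_neg_root)
  qed (use main a b in blast)
qed

lemma root_pos_iff: "\<alpha> \<in> \<Phi> \<Longrightarrow> \<alpha> \<in> P \<longleftrightarrow> \<alpha> H0 > 0"
  using pos by (fastforce simp: fun_apply)

lemma root_cases: "\<alpha> \<in> \<Phi> \<Longrightarrow> \<alpha> \<in> P \<or> - \<alpha> \<in> P" by auto

definition simple :: "('x \<Rightarrow> real) \<Rightarrow> bool" where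
  "simple \<alpha> \<longleftrightarrow> \<alpha> \<in> P \<and> \<not> (\<exists>\<beta>\<in>P. \<exists>\<gamma>\<in>P. \<alpha> = \<beta> + \<gamma>)"

lemma simpleD: "simple \<alpha> \<Longrightarrow> \<alpha> \<in> P" by (simp add: simple_def)

text \<open>The real number \<open>\<alpha> H0\<close> serves as height. Finiteness of
  \<open>P\<close> makes the order well-founded, with the number of lower positive roots as
  measure.\<close>

lemma height_induct [consumes 1, case_names less]:
  assumes "\<alpha> \<in> P" "\<And>\<alpha>. \<alpha> \<in> P \<Longrightarrow> (\<And>\<beta>. \<beta> \<in> P \<Longrightarrow> \<beta> H0 < \<alpha> H0 \<Longrightarrow> Q \<beta>) \<Longrightarrow> Q \<alpha>"
  shows "Q \<alpha>"
  using assms(1)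
proof (induction "card {\<beta>\<in>P. \<beta> H0 < \<alpha> H0}" arbitrary: \<alpha> rule: less_induct)
  case less
  show ?case
  proof (rule assms(2)[OF less.prems])
    fix \<beta> assume b: "\<beta> \<in> P" "\<beta> H0 < \<alpha> H0"
    have "{\<gamma>\<in>P. \<gamma> H0 < \<beta> H0} \<subset> {\<gamma>\<in>P. \<gamma> H0 < \<alpha> H0}" using b by force
    then have "card {\<gamma>\<in>P. \<gamma> H0 < \<beta> H0} < card {\<gamma>\<in>P. \<gamma> H0 < \<alpha> H0}"
      using finP by (intro psubset_card_mono) auto
    then show "Q \<beta>" using less.hyps b(1) by blast
  qed
qed

lemma pos_induct [consumes 1, case_names simple add]:
  assumes "\<alpha> \<in> P" "\<And>\<alpha>. simple \<alpha> \<Longrightarrow> Q \<alpha>"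
    and "\<And>\<alpha> \<beta>. \<alpha> \<in> P \<Longrightarrow> \<beta> \<in> P \<Longrightarrow> Q \<alpha> \<Longrightarrow> Q \<beta> \<Longrightarrow> Q (\<alpha> + \<beta>)"
  shows "Q \<alpha>"
  using assms(1)
proof (induction rule: height_induct)
  case (less \<alpha>)
  show ?case
  proof (cases "simple \<alpha>")
    case False
    then obtain \<beta> \<gamma> where bg: "\<beta> \<in> P" "\<gamma> \<in> P" "\<alpha> = \<beta> + \<gamma>" using less.hyps by (auto simp: simple_def)
    then have "\<beta> H0 < \<alpha> H0" "\<gamma> H0 < \<alpha> H0" using pos[of \<beta>] pos[of \<gamma>] by (auto simp: fun_apply)
    then show ?thesis using bg less.IH assms(3) by blast
  qed (rule assms(2))
qed

text \<open>If the reflection lowers \<open>\<beta>\<close>, follow the string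
  \<open>\<beta> - j \<alpha>\<close>: the first member to turn negative would write
  \<open>\<alpha>\<close> as the sum of its predecessor and a positive root. Zero is avoided because
  \<open>\<beta>\<close> is no proper multiple of \<open>\<alpha>\<close>. Otherwise the reflection
  raises \<open>\<beta>\<close>, and positivity is immediate.\<close>

lemma simple_permutes:
  assumes a: "simple \<alpha>" and b: "\<beta> \<in> P" and ne: "\<beta> \<noteq> \<alpha>"
  shows "ref \<alpha> \<beta> \<in> P"
proof -
  have aP: "\<alpha> \<in> P" using a by (rule simpleD)
  obtain n :: int where n: "2 * ip \<beta> \<alpha> / ip \<alpha> \<alpha> = of_int n"
    "\<And>j::nat. int j \<le> n \<Longrightarrow> \<beta> - scl (real j) \<alpha> \<in> \<Phi> \<union> {0}"
    using root_string[of \<alpha> \<beta>] aP b by blast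
  have rf: "ref \<alpha> \<beta> = \<beta> - scl (of_int n) \<alpha>" by (simp add: ref_def n(1))
  show ?thesis
  proof (cases "n \<ge> 0")
    case True
    have "int j \<le> n \<Longrightarrow> \<beta> - scl (real j) \<alpha> \<in> P \<and> \<beta> - scl (real j) \<alpha> \<noteq> \<alpha>" for j
    proof (induction j)
      case 0
      have "\<beta> - scl (real 0) \<alpha> = \<beta>" by (rule ext) (simp add: fun_apply)
      then show ?case using b ne by simp
    next
      case (Suc j)
      let ?c = "\<beta> - scl (real j) \<alpha>" and ?d = "\<beta> - scl (real (Suc j)) \<alpha>"
      have dc: "?d = ?c - \<alpha>" by (rule ext) (simp add: fun_apply algebra_simps)
      have c: "?c \<in> P" "?c \<noteq> \<alpha>" using Suc by auto
      have "?d \<noteq> 0" using c(2) unfolding dc by simp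
      moreover have "?d \<in> \<Phi> \<union> {0}" using n(2) Suc.prems by blast
      moreover have "- ?d \<notin> P"
      proof
        assume "- ?d \<in> P"
        moreover have "\<alpha> = ?c + (- ?d)" unfolding dc by simp
        ultimately show False using a c(1) unfolding simple_def by blast
      qed
      ultimately have dP: "?d \<in> P" using root_cases by blast
      have "?d \<noteq> \<alpha>"
      proof
        assume "?d = \<alpha>"
        then have "\<beta> = scl (real (Suc (Suc j))) \<alpha>"
          by (auto simp: fun_eq_iff fun_apply algebra_simps)
        then show False using no_multiple[OF aP, of "Suc (Suc j)"] b by simp
      qed
      with dP show ?case by blast
    qed
    from this[of "nat n"] True show ?thesis by (simp add: rf)
  next
    case False
    have "ref \<alpha> \<beta> H0 = \<beta> H0 + (- of_int n) * \<alpha> H0" by (simp add: rf fun_apply)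
    also have "\<dots> > 0" using False pos[OF aP] pos[OF b] by (intro add_pos_nonneg mult_nonneg_nonneg) auto
    finally show ?thesis using ref_root[of \<alpha> \<beta>] aP b root_pos_iff by blast
  qed
qed

lemma simple_image: "simple \<alpha> \<Longrightarrow> ref \<alpha> ` (P - {\<alpha>}) = P - {\<alpha>}"
proof -
  assume a: "simple \<alpha>"
  then have aR: "\<alpha> \<in> \<Phi>" using simpleD by blast
  have sub: "ref \<alpha> ` (P - {\<alpha>}) \<subseteq> P - {\<alpha>}"
  proof (intro image_subsetI DiffI)
    fix \<beta> assume b: "\<beta> \<in> P - {\<alpha>}"
    then show "ref \<alpha> \<beta> \<in> P" using simple_permutes[OF a] by blast
    have "\<beta> = - \<alpha>" if "ref \<alpha> \<beta> = \<alpha>"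
      using that ref_ref[OF aR, of \<beta>] ref_self[OF aR] by simp
    then show "ref \<alpha> \<beta> \<notin> {\<alpha>}" using b pos[of \<beta>] pos[OF simpleD[OF a]] by (fastforce simp: fun_apply)
  qed
  then have "ref \<alpha> ` ref \<alpha> ` (P - {\<alpha>}) \<subseteq> ref \<alpha> ` (P - {\<alpha>})" by blast
  then show ?thesis using sub by (force simp: image_image ref_ref[OF aR])
qed

definition rho :: "'x \<Rightarrow> real" where "rho = scl (1 / 2) (\<Sum>\<alpha>\<in>P. \<alpha>)"

text \<open>The reflection permutes the positive roots other than \<open>\<alpha>\<close> and
  negates \<open>\<alpha>\<close>, so half the sum loses exactly \<open>\<alpha>\<close>.\<close>

lemma ref_rho: assumes a: "simple \<alpha>" shows "ref \<alpha> rho = rho - \<alpha>"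
proof -
  have aP: "\<alpha> \<in> P" using a by (rule simpleD)
  have inj: "inj_on (ref \<alpha>) A" for A using bij_ref[of \<alpha>] aP by (meson UnI1 bij_is_inj inj_on_subset subset_UNIV)
  have s: "(\<Sum>\<beta>\<in>P. \<beta>) = \<alpha> + (\<Sum>\<beta>\<in>P - {\<alpha>}. \<beta>)" by (rule sum.remove[OF finP aP])
  have "(\<Sum>\<beta>\<in>P - {\<alpha>}. ref \<alpha> \<beta>) = (\<Sum>\<beta>\<in>ref \<alpha> ` (P - {\<alpha>}). \<beta>)"
    by (simp add: sum.reindex[OF inj])
  then have "(\<Sum>\<beta>\<in>P - {\<alpha>}. ref \<alpha> \<beta>) = (\<Sum>\<beta>\<in>P - {\<alpha>}. \<beta>)" unfolding simple_image[OF a] .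
  then have "ref \<alpha> (\<Sum>\<beta>\<in>P. \<beta>) = - \<alpha> + (\<Sum>\<beta>\<in>P - {\<alpha>}. \<beta>)"
    unfolding s using aP by (simp add: ref_add ref_sum ref_self)
  then have "ref \<alpha> rho = scl (1 / 2) (- \<alpha> + (\<Sum>\<beta>\<in>P - {\<alpha>}. \<beta>))" by (simp add: rho_def ref_scl)
  then show ?thesis
    unfolding rho_def s by (intro ext) (simp add: fun_apply field_simps)
qed

lemma rho_coroot: "simple \<alpha> \<Longrightarrow> 2 * ip rho \<alpha> = ip \<alpha> \<alpha>"
proof -
  assume a: "simple \<alpha>"
  have "scl (2 * ip rho \<alpha> / ip \<alpha> \<alpha>) \<alpha> H0 = \<alpha> H0"
    using fun_cong[OF ref_rho[OF a], of H0] by (simp add: ref_def fun_apply)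
  then show ?thesis using pos[OF simpleD[OF a]] ip_root[of \<alpha>] simpleD[OF a] by (simp add: scl_apply field_simps)
qed

lemma pos_of_simple: "\<gamma> \<in> P \<Longrightarrow> (\<And>\<alpha>. simple \<alpha> \<Longrightarrow> ip \<nu> \<alpha> > 0) \<Longrightarrow> ip \<nu> \<gamma> > 0"
  by (induction rule: pos_induct) (auto simp: ip_simps intro: add_pos_pos)

lemma nonpos_of_simple: "\<gamma> \<in> P \<Longrightarrow> (\<And>\<alpha>. simple \<alpha> \<Longrightarrow> ip \<nu> \<alpha> \<le> 0) \<Longrightarrow> ip \<nu> \<gamma> \<le> 0"
  by (induction rule: pos_induct) (auto simp: ip_simps intro: add_nonpos_nonpos)

lemma rho_pos: "\<gamma> \<in> P \<Longrightarrow> ip rho \<gamma> > 0"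
proof (rule pos_of_simple)
  fix \<alpha> assume "simple \<alpha>"
  then show "ip rho \<alpha> > 0" using rho_coroot[of \<alpha>] ip_root[of \<alpha>] simpleD[of \<alpha>] by simp
qed

text \<open>Some simple root has positive product with \<open>\<gamma>\<close>: otherwise all
  positive roots would have non-positive product with it, including \<open>\<gamma>\<close>
  itself.\<close>

lemma nonsimple_descent:
  assumes "\<gamma> \<in> P" "\<not> simple \<gamma>"
  obtains \<alpha> where "simple \<alpha>" "ref \<alpha> \<gamma> \<in> P" "ref \<alpha> \<gamma> H0 < \<gamma> H0"
proof -
  obtain \<alpha> where a: "simple \<alpha>" "ip \<gamma> \<alpha> > 0"
    using nonpos_of_simple[OF assms(1), of \<gamma>] ip_root[of \<gamma>] assms(1) by force
  have "ref \<alpha> \<gamma> \<in> P" using simple_permutes[OF a(1) assms(1)] a(1) assms(2) by blast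
  moreover have "2 * ip \<gamma> \<alpha> / ip \<alpha> \<alpha> * \<alpha> H0 > 0"
    using a ip_root[of \<alpha>] simpleD[OF a(1)] pos[of \<alpha>] by simp
  then have "ref \<alpha> \<gamma> H0 < \<gamma> H0" by (simp add: ref_def fun_apply)
  ultimately show ?thesis using that a(1) by blast
qed

lemma ref_conj: "\<alpha> \<in> \<Phi> \<Longrightarrow> ref (ref \<alpha> \<gamma>) \<nu> = ref \<alpha> (ref \<gamma> (ref \<alpha> \<nu>))"
proof -
  assume a: "\<alpha> \<in> \<Phi>"
  have "ip \<nu> (ref \<alpha> \<gamma>) = ip (ref \<alpha> \<nu>) \<gamma>" using ip_ref[OF a, of "ref \<alpha> \<nu>" \<gamma>] by (simp add: ref_ref[OF a])
  then have "ref (ref \<alpha> \<gamma>) \<nu> = \<nu> - scl (2 * ip (ref \<alpha> \<nu>) \<gamma> / ip \<gamma> \<gamma>) (ref \<alpha> \<gamma>)"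
    by (subst ref_def) (simp add: ip_ref[OF a])
  also have "\<dots> = ref \<alpha> (ref \<alpha> \<nu> - scl (2 * ip (ref \<alpha> \<nu>) \<gamma> / ip \<gamma> \<gamma>) \<gamma>)"
    by (simp only: ref_diff ref_scl ref_ref[OF a])
  also have "\<dots> = ref \<alpha> (ref \<gamma> (ref \<alpha> \<nu>))" by (simp only: ref_def[of \<gamma>])
  finally show ?thesis .
qed

definition antisym :: "(('x \<Rightarrow> real) \<Rightarrow> real) \<Rightarrow> bool" where
  "antisym Q \<longleftrightarrow> (\<forall>\<alpha>\<in>P. \<forall>\<nu>. Q (ref \<alpha> \<nu>) = - Q \<nu>)"

text \<open>The reflection in a non-simple root is conjugate, by a simple reflection, to that in a
  lower root. Conjugation contributes two signs, which cancel.\<close>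

lemma antisymI:
  assumes "\<And>\<alpha> \<nu>. simple \<alpha> \<Longrightarrow> Q (ref \<alpha> \<nu>) = - Q \<nu>"
  shows "antisym Q"
proof -
  have "\<forall>\<nu>. Q (ref \<gamma> \<nu>) = - Q \<nu>" if "\<gamma> \<in> P" for \<gamma>
    using that
  proof (induction rule: height_induct)
    case (less \<gamma>)
    show ?case
    proof (cases "simple \<gamma>")
      case False
      then obtain \<alpha> where a: "simple \<alpha>" "ref \<alpha> \<gamma> \<in> P" "ref \<alpha> \<gamma> H0 < \<gamma> H0"
        using nonsimple_descent less.hyps by blast
      then have aR: "\<alpha> \<in> \<Phi>" using simpleD by blast
      have "ref \<gamma> \<nu> = ref \<alpha> (ref (ref \<alpha> \<gamma>) (ref \<alpha> \<nu>))" for \<nu>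
        using ref_conj[OF aR, of "ref \<alpha> \<gamma>" \<nu>] by (simp add: ref_ref[OF aR])
      then show ?thesis using assms[OF a(1)] less.IH[OF a(2,3)] by simp
    qed (use assms in blast)
  qed
  then show ?thesis by (simp add: antisym_def)
qed

subsection \<open>Words in reflections\<close>

text \<open>The last letter acts first. Words are kept instead of group elements because the sign is
  the parity of the length and cancellation removes letters.\<close>

definition act :: "('x \<Rightarrow> real) list \<Rightarrow> ('x \<Rightarrow> real) \<Rightarrow> 'x \<Rightarrow> real" where "act w \<nu> = foldr ref w \<nu>"

lemma act_simps [simp]: "act [] \<nu> = \<nu>" "act (\<alpha> # w) \<nu> = ref \<alpha> (act w \<nu>)" "act (u @ w) \<nu> = act u (act w \<nu>)"
  by (simp_all add: act_def)

lemma act_rev: "set w \<subseteq> \<Phi> \<Longrightarrow> act (rev w) (act w \<nu>) = \<nu>" "set w \<subseteq> \<Phi> \<Longrightarrow> act w (act (rev w) \<nu>) = \<nu>"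
proof -
  have "set w \<subseteq> \<Phi> \<Longrightarrow> act (rev w) (act w \<nu>) = \<nu>" for w
    by (induction w arbitrary: \<nu>) (simp_all add: ref_ref)
  from this[of w] this[of "rev w"] show "set w \<subseteq> \<Phi> \<Longrightarrow> act (rev w) (act w \<nu>) = \<nu>"
    "set w \<subseteq> \<Phi> \<Longrightarrow> act w (act (rev w) \<nu>) = \<nu>" by simp_all
qed

lemma act_minus: "act w (- \<nu>) = - act w \<nu>" by (induction w) (simp_all add: ref_minus)

lemma ip_act: "set w \<subseteq> \<Phi> \<Longrightarrow> ip (act w \<mu>) (act w \<nu>) = ip \<mu> \<nu>"
  by (induction w) (simp_all add: ip_ref)

lemma act_root: "set w \<subseteq> \<Phi> \<Longrightarrow> \<beta> \<in> \<Phi> \<Longrightarrow> act w \<beta> \<in> \<Phi>"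
  by (induction w) (simp_all add: ref_root del: Un_iff)

lemma ref_act_conj: "set w \<subseteq> \<Phi> \<Longrightarrow> ref (act w \<gamma>) (act w \<nu>) = act w (ref \<gamma> \<nu>)"
  by (induction w) (simp_all add: ref_conj ref_ref)

lemma antisym_act: "antisym Q \<Longrightarrow> set w \<subseteq> P \<Longrightarrow> Q (act w \<nu>) = (- 1) ^ length w * Q \<nu>"
  by (induction w) (simp_all add: antisym_def)

lemma reflection_simple_word:
  assumes "\<gamma> \<in> P" shows "\<exists>w. set w \<subseteq> {\<alpha>. simple \<alpha>} \<and> act w = ref \<gamma>"
  using assms
proof (induction rule: height_induct)
  case (less \<gamma>)
  show ?case
  proof (cases "simple \<gamma>")
    case True
    then show ?thesis by (intro exI[of _ "[\<gamma>]"]) (simp add: fun_eq_iff)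
  next
    case False
    then obtain \<alpha> where a: "simple \<alpha>" "ref \<alpha> \<gamma> \<in> P" "ref \<alpha> \<gamma> H0 < \<gamma> H0"
      using nonsimple_descent less.hyps by blast
    then have aR: "\<alpha> \<in> \<Phi>" using simpleD by blast
    obtain w where w: "set w \<subseteq> {\<alpha>. simple \<alpha>}" "act w = ref (ref \<alpha> \<gamma>)" using less.IH[OF a(2,3)] by blast
    have "act (\<alpha> # w @ [\<alpha>]) = ref \<gamma>"
    proof
      fix \<nu>
      show "act (\<alpha> # w @ [\<alpha>]) \<nu> = ref \<gamma> \<nu>"
        using ref_conj[OF aR, of "ref \<alpha> \<gamma>" \<nu>] by (simp add: ref_ref[OF aR] w(2))
    qed
    then show ?thesis using a(1) w(1) by (intro exI[of _ "\<alpha> # w @ [\<alpha>]"]) auto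
  qed
qed

lemma word_simple_word: "set w \<subseteq> P \<Longrightarrow> \<exists>u. set u \<subseteq> {\<alpha>. simple \<alpha>} \<and> act u = act w"
proof (induction w)
  case (Cons \<gamma> w)
  then obtain u v where "set u \<subseteq> {\<alpha>. simple \<alpha>}" "act u = act w" "set v \<subseteq> {\<alpha>. simple \<alpha>}" "act v = ref \<gamma>"
    using reflection_simple_word[of \<gamma>] by auto
  then have "act (v @ u) = act (\<gamma> # w)" by (intro ext) simp
  then show ?case using \<open>set u \<subseteq> _\<close> \<open>set v \<subseteq> _\<close> by (intro exI[of _ "v @ u"]) auto
qed (intro exI[of _ "[]"], simp)

text \<open>Apply the letters from the right until the image of \<open>\<beta>\<close> turns
  positive. A simple reflection permutes the positive roots other than its own, so the image just
  before the change is \<open>- \<alpha>\<close> for the letter \<open>\<alpha>\<close>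
  applied.\<close>

lemma sign_change:
  assumes w: "set w \<subseteq> {\<alpha>. simple \<alpha>}" and neg: "- \<beta> \<in> P" and p: "act w \<beta> \<in> P"
  shows "\<exists>u \<alpha> v. w = u @ \<alpha> # v \<and> act v \<beta> = - \<alpha>"
  using w p
proof (induction w)
  case Nil
  then have "\<beta> \<in> P" by simp
  then show ?case using pos[OF neg] pos[of \<beta>] by (simp add: fun_apply)
next
  case (Cons \<alpha> w)
  show ?case
  proof (cases "act w \<beta> \<in> P")
    case True
    moreover have "set w \<subseteq> {\<alpha>. simple \<alpha>}" using Cons.prems(1) by simp
    ultimately obtain u \<gamma> v where "w = u @ \<gamma> # v" "act v \<beta> = - \<gamma>" using Cons.IH by metis
    then show ?thesis by (intro exI[of _ "\<alpha> # u"] exI[of _ \<gamma>] exI[of _ v]) simp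
  next
    case False
    have "act w \<beta> \<in> \<Phi>"
      using Cons.prems neg simpleD by (intro act_root) (auto intro: image_eqI[of _ _ "- \<beta>"])
    then have nP: "- act w \<beta> \<in> P" using False root_cases by blast
    have "- act w \<beta> = \<alpha>"
    proof (rule ccontr)
      assume "- act w \<beta> \<noteq> \<alpha>"
      then have "ref \<alpha> (- act w \<beta>) \<in> P" using simple_permutes nP Cons.prems(1) by simp
      then have "- act (\<alpha> # w) \<beta> \<in> P" by (simp add: ref_minus)
      then show False using Cons.prems(2) pos[of "act (\<alpha> # w) \<beta>"] pos[of "- act (\<alpha> # w) \<beta>"] by (simp add: fun_apply)
    qed
    then show ?thesis by (intro exI[of _ "[]"] exI[of _ \<alpha>] exI[of _ w]) auto
  qed
qed

text \<open>The deletion condition: a word that preserves the positive roots sends its last letter \<open>\<beta>\<close> to a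
  positive root, so two of its letters cancel.\<close>

lemma simple_word_preserving_pos:
  assumes "set w \<subseteq> {\<alpha>. simple \<alpha>}" "\<And>\<beta>. \<beta> \<in> P \<Longrightarrow> act w \<beta> \<in> P"
  shows "act w = id"
  using assms
proof (induction "length w" arbitrary: w rule: less_induct)
  case less
  show ?case
  proof (cases w rule: rev_cases)
    case Nil
    then show ?thesis by (simp add: fun_eq_iff)
  next
    case (snoc w' \<beta>)
    have b: "simple \<beta>" "\<beta> \<in> P" "\<beta> \<in> \<Phi>" using less.prems(1) snoc simpleD by auto
    have w': "set w' \<subseteq> {\<alpha>. simple \<alpha>}" using less.prems(1) snoc by auto
    have "act w \<beta> \<in> P" using less.prems(2) b by blast
    then have "act w' (- \<beta>) \<in> P" using snoc ref_self[OF b(3)] by simp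
    moreover have "- (- \<beta>) \<in> P" using b(2) by simp
    ultimately obtain u \<alpha> v where uv: "w' = u @ \<alpha> # v" "act v (- \<beta>) = - \<alpha>"
      using sign_change[OF w'] by blast
    have vb: "act v \<beta> = \<alpha>" using uv(2) by (simp add: act_minus)
    have vR: "set v \<subseteq> \<Phi>" using w' uv(1) simpleD by auto
    have aR: "\<alpha> \<in> \<Phi>" using w' uv(1) simpleD by auto
    \<comment> \<open>As \<open>v\<close> takes \<open>\<beta>\<close> to \<open>\<alpha>\<close>,
      the reflection in \<open>\<alpha>\<close> after \<open>v\<close> is \<open>v\<close> after the
      reflection in \<open>\<beta>\<close>; it cancels against the final letter.\<close>
    have "act w \<nu> = act (u @ v) \<nu>" for \<nu>
    proof -
      have "ref \<alpha> (act v (ref \<beta> \<nu>)) = act v (ref \<beta> (ref \<beta> \<nu>))"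
        using ref_act_conj[OF vR, of \<beta> "ref \<beta> \<nu>"] vb by simp
      then show ?thesis by (simp add: snoc uv(1) ref_ref[OF b(3)])
    qed
    then have eq: "act w = act (u @ v)" by (simp add: fun_eq_iff del: act_simps)
    have "act (u @ v) = id"
    proof (rule less.hyps)
      show "length (u @ v) < length w" by (simp add: snoc uv(1))
      show "set (u @ v) \<subseteq> {\<alpha>. simple \<alpha>}" using w' uv(1) by auto
      show "act (u @ v) \<beta> \<in> P" if "\<beta> \<in> P" for \<beta> using less.prems(2)[OF that] unfolding eq .
    qed
    then show ?thesis by (simp add: eq)
  qed
qed

definition regular_dominant :: "('x \<Rightarrow> real) \<Rightarrow> bool" where
  "regular_dominant \<kappa> \<longleftrightarrow> (\<forall>\<alpha>\<in>P. ip \<kappa> \<alpha> > 0)"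

text \<open>Positive roots are the roots with positive product with \<open>\<kappa>\<close>. A word
  fixing \<open>\<kappa>\<close> preserves these products, hence the positive roots.\<close>

lemma stabilizer_trivial:
  assumes k: "regular_dominant \<kappa>" and w: "set w \<subseteq> P" "act w \<kappa> = \<kappa>"
  shows "act w = id"
proof -
  obtain u where u: "set u \<subseteq> {\<alpha>. simple \<alpha>}" "act u = act w" using word_simple_word[OF w(1)] by blast
  have uR: "set u \<subseteq> \<Phi>" using u(1) simpleD by blast
  have "act u \<beta> \<in> P" if b: "\<beta> \<in> P" for \<beta>
  proof -
    have "ip \<kappa> (act u \<beta>) = ip \<kappa> \<beta>" using ip_act[OF uR, of \<kappa> \<beta>] w(2) u(2) by simp
    then have "ip \<kappa> (act u \<beta>) > 0" using k b by (simp add: regular_dominant_def)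
    moreover have "act u \<beta> \<in> \<Phi>" using act_root[OF uR] b by blast
    moreover have "ip \<kappa> (act u \<beta>) < 0" if "- act u \<beta> \<in> P"
      using k that by (auto simp: regular_dominant_def ip_simps)
    ultimately show ?thesis using root_cases[of "act u \<beta>"] by argo
  qed
  then show ?thesis using simple_word_preserving_pos[OF u(1)] u(2) by simp
qed

text \<open>Choose a point of greatest height in the orbit, which is finite as part of the support.
  A negative product with a positive root would let its reflection raise the point; a zero product
  would make the reflection fix it, and antisymmetry would force \<open>Q\<close> to vanish
  there.\<close>

lemma orbit_regular_dominant:
  assumes Q: "antisym Q" "finite {\<nu>. Q \<nu> \<noteq> 0}" "Q \<nu> \<noteq> 0"
  obtains w where "set w \<subseteq> P" "regular_dominant (act w \<nu>)" "Q (act w \<nu>) \<noteq> 0"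
proof -
  define O' where "O' = {act w \<nu> | w. set w \<subseteq> P}"
  have sub: "O' \<subseteq> {\<nu>. Q \<nu> \<noteq> 0}" using antisym_act[OF Q(1)] Q(3) by (auto simp: O'_def)
  then have fin: "finite O'" using Q(2) finite_subset by blast
  have "act [] \<nu> \<in> O'" unfolding O'_def by (intro CollectI exI[of _ "[]"]) simp
  then have "Max ((\<lambda>\<mu>. \<mu> H0) ` O') \<in> (\<lambda>\<mu>. \<mu> H0) ` O'" using fin by (intro Max_in) auto
  then obtain \<kappa> where k1: "\<kappa> \<in> O'" "Max ((\<lambda>\<mu>. \<mu> H0) ` O') = \<kappa> H0" by blast
  have k: "\<kappa> \<in> O'" "\<mu> H0 \<le> \<kappa> H0" if "\<mu> \<in> O'" for \<mu>
    using that fin Max_ge[of "(\<lambda>\<mu>. \<mu> H0) ` O'" "\<mu> H0"] k1 by auto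
  from k1(1) obtain w where w: "set w \<subseteq> P" "\<kappa> = act w \<nu>" by (auto simp: O'_def)
  have "ip \<kappa> \<alpha> > 0" if a: "\<alpha> \<in> P" for \<alpha>
  proof (rule ccontr)
    assume "\<not> ip \<kappa> \<alpha> > 0"
    then have le: "ip \<kappa> \<alpha> \<le> 0" by simp
    have ro: "ref \<alpha> \<kappa> \<in> O'"
      unfolding O'_def using w a by (intro CollectI exI[of _ "\<alpha> # w"]) simp
    have "ip \<kappa> \<alpha> \<noteq> 0"
    proof
      assume "ip \<kappa> \<alpha> = 0"
      then have "ref \<alpha> \<kappa> = \<kappa>" by (intro ext) (simp add: ref_def fun_apply)
      moreover have "Q (ref \<alpha> \<kappa>) = - Q \<kappa>" using Q(1) a by (simp add: antisym_def)
      ultimately show False using k1(1) sub by auto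
    qed
    with le have "2 * ip \<kappa> \<alpha> < 0" by simp
    then have "2 * ip \<kappa> \<alpha> / ip \<alpha> \<alpha> < 0" using a by (intro divide_neg_pos ip_root) auto
    then have "2 * ip \<kappa> \<alpha> / ip \<alpha> \<alpha> * \<alpha> H0 < 0" using pos[OF a] by (rule mult_neg_pos)
    then have "ref \<alpha> \<kappa> H0 > \<kappa> H0" by (simp add: ref_def fun_apply)
    then show False using k(2)[OF ro] by simp
  qed
  then show ?thesis using that[OF w(1)] w(2) k1(1) sub by (auto simp: regular_dominant_def)
qed

end

section \<open>The Weyl denominator and the numerator in the group ring\<close>

context root_data
begin

subsection \<open>The denominator\<close>

text \<open>The cone of \<open>negative_cone\<close> with opposite sign; lists in place of
  coefficients suit induction over the summands.\<close>

definition pos_cone :: "('x \<Rightarrow> real) set" where "pos_cone = {sum_list l | l. set l \<subseteq> P}"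

lemma pos_cone_0: "0 \<in> pos_cone" unfolding pos_cone_def by (intro CollectI exI[of _ "[]"]) simp

lemma pos_cone_add: "\<mu> \<in> pos_cone \<Longrightarrow> \<nu> \<in> pos_cone \<Longrightarrow> \<mu> + \<nu> \<in> pos_cone"
proof -
  assume "\<mu> \<in> pos_cone" "\<nu> \<in> pos_cone"
  then obtain k l where "set k \<subseteq> P" "set l \<subseteq> P" "\<mu> = sum_list k" "\<nu> = sum_list l" by (auto simp: pos_cone_def)
  then show ?thesis unfolding pos_cone_def by (intro CollectI exI[of _ "k @ l"]) simp
qed

lemma pos_cone_root: "\<alpha> \<in> P \<Longrightarrow> \<alpha> \<in> pos_cone"
  unfolding pos_cone_def by (intro CollectI exI[of _ "[\<alpha>]"]) simp

lemma pos_cone_D: "\<mu> \<in> pos_cone \<Longrightarrow> \<mu> \<in> D"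
proof -
  have "set l \<subseteq> P \<Longrightarrow> sum_list l \<in> D" for l
    using PD by (induction l) (auto intro: D_0 D_add)
  then show "\<mu> \<in> pos_cone \<Longrightarrow> \<mu> \<in> D" by (auto simp: pos_cone_def)
qed

lemma pos_cone_height: "\<mu> \<in> pos_cone \<Longrightarrow> \<mu> = 0 \<or> \<mu> H0 > 0"
proof -
  have "set l \<subseteq> P \<Longrightarrow> l = [] \<or> sum_list l H0 > 0" for l
  proof (induction l)
    case (Cons \<alpha> l)
    then have "sum_list l H0 \<ge> 0" by (auto simp: fun_apply)
    then show ?case using Cons.prems pos[of \<alpha>] by (simp add: fun_apply)
  qed simp
  then show "\<mu> \<in> pos_cone \<Longrightarrow> \<mu> = 0 \<or> \<mu> H0 > 0" unfolding pos_cone_def by fastforce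
qed

lemma pos_cone_add_eq_0: "\<mu> \<in> pos_cone \<Longrightarrow> \<nu> \<in> pos_cone \<Longrightarrow> \<mu> + \<nu> = 0 \<Longrightarrow> \<mu> = 0"
proof -
  assume "\<mu> \<in> pos_cone" "\<nu> \<in> pos_cone" "\<mu> + \<nu> = 0"
  moreover from this have "\<mu> H0 + \<nu> H0 = 0" by (metis plus_fun_apply zero_fun_apply)
  ultimately show ?thesis using pos_cone_height[of \<mu>] pos_cone_height[of \<nu>] by (auto simp: fun_apply)
qed

text \<open>Leading term \<open>1\<close> and all other exponents below it: the shape that survives
  products and yields the top coefficient of the numerator.\<close>

definition unip :: "(('x \<Rightarrow> real) \<Rightarrow>\<^sub>0 real) \<Rightarrow> bool" where
  "unip p \<longleftrightarrow> coef p 0 = 1 \<and> (\<forall>\<nu>. coef p \<nu> \<noteq> 0 \<longrightarrow> - \<nu> \<in> pos_cone)"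

lemma unip_1: "unip 1" by (auto simp: unip_def lookup_one when_def pos_cone_0)

text \<open>A non-zero element of the positive cone has no negative in the cone, so only the two
  leading terms meet at exponent 0.\<close>

lemma unip_times: assumes p: "unip p" and q: "unip q" shows "unip (p * q)"
  unfolding unip_def
proof (intro conjI allI impI)
  have "coef (p * q) 0 = (\<Sum>\<nu>\<in>supp p. coef p \<nu> * coef q (0 - \<nu>))"
    by (simp add: coef_times action_def)
  also have "\<dots> = (\<Sum>\<nu>\<in>{0}. coef p \<nu> * coef q (0 - \<nu>))"
  proof (rule sum.mono_neutral_right)
    show "{0} \<subseteq> supp p" using p by (simp add: unip_def in_keys_iff)
    show "\<forall>\<nu>\<in>supp p - {0}. coef p \<nu> * coef q (0 - \<nu>) = 0"
    proof
      fix \<nu> assume n: "\<nu> \<in> supp p - {0}"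
      have "coef q (0 - \<nu>) = 0"
      proof (rule ccontr)
        assume "coef q (0 - \<nu>) \<noteq> 0"
        then have "\<nu> \<in> pos_cone" using q by (force simp: unip_def)
        moreover have "- \<nu> \<in> pos_cone" using p n by (simp add: unip_def in_keys_iff)
        ultimately show False using pos_cone_add_eq_0[of \<nu> "- \<nu>"] n by simp
      qed
      then show "coef p \<nu> * coef q (0 - \<nu>) = 0" by simp
    qed
  qed simp
  finally show "coef (p * q) 0 = 1" using p q by (simp add: unip_def)
next
  fix \<mu> assume "coef (p * q) \<mu> \<noteq> 0"
  then obtain \<nu> where "coef p \<nu> * coef q (\<mu> - \<nu>) \<noteq> 0"
    unfolding coef_times action_def by (meson sum.not_neutral_contains_not_neutral)
  then have "- \<nu> \<in> pos_cone" "- (\<mu> - \<nu>) \<in> pos_cone" using p q by (auto simp: unip_def)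
  from pos_cone_add[OF this] show "- \<mu> \<in> pos_cone" by simp
qed

lemma unip_factor: "\<alpha> \<in> P \<Longrightarrow> unip (1 - ee (- \<alpha>))"
  using root_nonzero[of \<alpha>]
  by (auto simp: unip_def lookup_minus lookup_one lookup_single when_def fun_apply pos_cone_0 pos_cone_root
      split: if_splits)

definition pi_prod :: "('x \<Rightarrow> real) set \<Rightarrow> (('x \<Rightarrow> real) \<Rightarrow>\<^sub>0 real)" where
  "pi_prod A = (\<Prod>\<alpha>\<in>A. 1 - ee (- \<alpha>))"

lemma unip_pi_prod: "A \<subseteq> P \<Longrightarrow> unip (pi_prod A)"
  unfolding pi_prod_def by (induction A rule: infinite_finite_induct) (simp_all add: unip_1 unip_times unip_factor)

definition den :: "('x \<Rightarrow> real) \<Rightarrow>\<^sub>0 real" where "den = ee rho * pi_prod P"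

lemma coef_ee_times: "coef (ee \<kappa> * p) \<nu> = coef p (\<nu> - \<kappa>)"
  by (simp add: coef_times action_single)

lemma pi_prod_remove: "\<alpha> \<in> P \<Longrightarrow> pi_prod P = (1 - ee (- \<alpha>)) * pi_prod (P - {\<alpha>})"
  unfolding pi_prod_def by (rule prod.remove[OF finP])

text \<open>A simple reflection permutes the factors other than that of \<open>\<alpha>\<close> and
  shifts \<open>rho\<close> by \<open>- \<alpha>\<close>. The sign arises from the one remaining
  factor.\<close>

lemma antisym_den: "antisym (coef den)"
proof (rule antisymI)
  fix \<alpha> \<nu> assume a: "simple \<alpha>"
  then have aP: "\<alpha> \<in> P" and aR: "\<alpha> \<in> \<Phi>" using simpleD by auto
  let ?m = "Poly_Mapping.map_key (ref \<alpha>) :: (('x \<Rightarrow> real) \<Rightarrow>\<^sub>0 real) \<Rightarrow> _"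
  note bij = bij_ref[OF aR] and inj = bij_is_inj[OF bij_ref[OF aR]]
  have me: "?m (ee \<mu>) = ee (ref \<alpha> \<mu>)" for \<mu>
    using map_key_single[OF inj, of "ref \<alpha> \<mu>" 1] by (simp add: ref_ref[OF aR])
  have m1: "?m 1 = 1" using me[of 0] by (simp add: ref_0)
  have mt: "?m (p * q) = ?m p * ?m q" for p q by (rule map_key_times[OF bij ref_diff])
  have mf: "?m (1 - ee (- \<beta>)) = 1 - ee (- ref \<alpha> \<beta>)" for \<beta>
  proof -
    have "?m (1 - ee (- \<beta>)) = ?m 1 - ?m (ee (- \<beta>))"
      by (rule poly_mapping_eqI) (simp add: map_key.rep_eq[OF inj] lookup_minus)
    then show ?thesis by (simp add: m1 me ref_minus)
  qed
  have "?m (\<Prod>\<beta>\<in>A. 1 - ee (- \<beta>)) = (\<Prod>\<beta>\<in>A. 1 - ee (- ref \<alpha> \<beta>))" for A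
    by (induction A rule: infinite_finite_induct) (simp_all add: m1 mt mf)
  then have "?m (pi_prod (P - {\<alpha>})) = (\<Prod>\<beta>\<in>P - {\<alpha>}. 1 - ee (- ref \<alpha> \<beta>))" by (simp add: pi_prod_def)
  also have "\<dots> = (\<Prod>\<beta>\<in>ref \<alpha> ` (P - {\<alpha>}). 1 - ee (- \<beta>))"
    by (subst prod.reindex) (use inj in \<open>auto intro: inj_on_subset\<close>)
  finally have mp: "?m (pi_prod (P - {\<alpha>})) = pi_prod (P - {\<alpha>})" by (simp add: simple_image[OF a] pi_prod_def)
  have "?m den = ee (rho - \<alpha>) * ((1 - ee \<alpha>) * pi_prod (P - {\<alpha>}))"
    unfolding den_def pi_prod_remove[OF aP] mt me mf mp by (simp add: ref_rho[OF a] ref_self[OF aR])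
  also have "\<dots> = - (ee rho * ((1 - ee (- \<alpha>)) * pi_prod (P - {\<alpha>})))"
  proof -
    \<comment> \<open>Here \<open>r'\<close> is \<open>ee (rho - \<alpha>)\<close> and
      \<open>a\<close> is \<open>ee \<alpha>\<close>: the shift of \<open>rho\<close> compensates
      for the inversion of the factor up to sign.\<close>
    have ring: "r' * ((1 - a) * p) = - (r * ((1 - e) * p))" if "r' * a = r" "r * e = r'"
      for r r' a e p :: "('x \<Rightarrow> real) \<Rightarrow>\<^sub>0 real"
    proof -
      have "r' * ((1 - a) * p) = (r' - r' * a) * p" "r * ((1 - e) * p) = (r - r * e) * p"
        by (simp_all add: algebra_simps)
      then show ?thesis unfolding that by (simp add: algebra_simps)
    qed
    show ?thesis by (rule ring) (simp_all add: mult_single)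
  qed
  finally have "?m den = - den" unfolding den_def pi_prod_remove[OF aP] .
  then have "coef (?m den) \<nu> = - coef den \<nu>" by simp
  then show "coef den (ref \<alpha> \<nu>) = - coef den \<nu>" by (simp add: map_key.rep_eq[OF inj])
qed

lemma coef_den_cone: "coef den \<nu> \<noteq> 0 \<Longrightarrow> rho - \<nu> \<in> pos_cone"
  using unip_pi_prod[OF subset_refl] by (auto simp: den_def coef_ee_times unip_def)

text \<open>On a simple root a regular dominant exponent \<open>\<rho> - \<Sum>l\<close> is a positive integer and \<open>\<rho>\<close> is \<open>1\<close>, so
  their difference is both dominated by \<open>0\<close> and a sum of positive roots.\<close>

lemma den_norm:
  assumes "coef den \<nu> \<noteq> 0" shows "ip \<nu> \<nu> = ip rho rho"
proof -
  have fin: "finite {\<nu>. coef den \<nu> \<noteq> 0}" by simp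
  obtain w where w: "set w \<subseteq> P" "regular_dominant (act w \<nu>)" "coef den (act w \<nu>) \<noteq> 0"
    using orbit_regular_dominant[OF antisym_den fin assms] by blast
  let ?k = "act w \<nu>"
  obtain l where l: "set l \<subseteq> P" "rho - ?k = sum_list l" using coef_den_cone[OF w(3)] by (auto simp: pos_cone_def)
  have "ip (sum_list l) \<alpha> \<le> 0" if a: "simple \<alpha>" for \<alpha>
  proof -
    have aP: "\<alpha> \<in> P" using a by (rule simpleD)
    have p: "ip \<alpha> \<alpha> > 0" using ip_root aP by blast
    have "\<exists>n::int. 2 * ip (sum_list l) \<alpha> / ip \<alpha> \<alpha> = of_int n"
      using l(1)
    proof (induction l)
      case (Cons \<beta> l)
      then obtain n m :: int where "2 * ip (sum_list l) \<alpha> / ip \<alpha> \<alpha> = of_int n" "2 * ip \<beta> \<alpha> / ip \<alpha> \<alpha> = of_int m"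
        using root_string[of \<alpha> \<beta>] aP by auto
      then show ?case by (intro exI[of _ "m + n"]) (simp add: ip_simps add_divide_distrib ring_distribs)
    qed (simp add: ip_simps)
    then obtain n :: int where n: "2 * ip (sum_list l) \<alpha> / ip \<alpha> \<alpha> = of_int n" by blast
    have "ip ?k \<alpha> > 0" using w(2) aP by (simp add: regular_dominant_def)
    moreover have "?k = rho - sum_list l" using l(2) by (simp add: algebra_simps)
    ultimately have "2 * ip (sum_list l) \<alpha> < ip \<alpha> \<alpha>" using rho_coroot[OF a] by (simp add: ip_simps)
    then have "of_int n < (1::real)" using p by (simp add: n[symmetric])
    then have "n \<le> 0" by simp
    then have "2 * ip (sum_list l) \<alpha> / ip \<alpha> \<alpha> \<le> 0" unfolding n by simp
    then show ?thesis using p by (simp add: divide_le_0_iff)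
  qed
  then have "ip (sum_list l) \<gamma> \<le> 0" if "\<gamma> \<in> P" for \<gamma> using nonpos_of_simple that by blast
  \<comment> \<open>\<open>sum_list l\<close> has non-positive product with every positive root, in
    particular with each of its own summands.\<close>
  then have "ip (sum_list l) (sum_list l) \<le> 0"
    unfolding ip_sum_list using l(1) by (intro sum_list_nonpos) auto
  then have "ip (sum_list l) (sum_list l) = 0" using ip_nonneg[of "sum_list l"] by simp
  moreover have "sum_list l \<in> D" using l by (intro pos_cone_D) (auto simp: pos_cone_def)
  ultimately have "sum_list l = 0" by (rule posdef[rotated])
  then have "?k = rho" using l(2) by simp
  moreover have "set w \<subseteq> \<Phi>" using w(1) by blast
  ultimately show ?thesis using ip_act[of w \<nu> \<nu>] by simp
qed

subsection \<open>Freudenthal's identity and the numerator\<close>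

definition lap :: "(('x \<Rightarrow> real) \<Rightarrow>\<^sub>0 real) \<Rightarrow> (('x \<Rightarrow> real) \<Rightarrow>\<^sub>0 real)" where
  "lap p = (\<Sum>x\<in>I. gderiv x (gderiv x p))"

lemma coef_lap: "coef (lap p) \<nu> = ip \<nu> \<nu> * coef p \<nu>"
  by (simp add: lap_def lookup_sum coef_gderiv ip_def sum_distrib_right mult.assoc)

lemma lap_times: "lap (p * q) = lap p * q + 2 * (\<Sum>x\<in>I. gderiv x p * gderiv x q) + p * lap q"
proof -
  have "gderiv x (gderiv x (p * q))
      = gderiv x (gderiv x p) * q + 2 * (gderiv x p * gderiv x q) + p * gderiv x (gderiv x q)" for x
    by (simp only: gderiv_times gderiv_add mult_2 ac_simps)
  then show ?thesis by (simp only: lap_def sum.distrib sum_distrib_left sum_distrib_right)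
qed

lemma const_add: "const (c + d) = const c + const d" by (simp add: single_add)
lemma const_sum: "const (\<Sum>a\<in>A. f a) = (\<Sum>a\<in>A. const (f a))"
  by (induction A rule: infinite_finite_induct) (simp_all add: const_add)

lemma coef_const_times: "coef (const c * p) \<nu> = c * coef p \<nu>"
  by (simp add: coef_times action_single)

lemma lap_den: "lap den = const (ip rho rho) * den"
  by (rule poly_mapping_eqI) (use den_norm in \<open>auto simp: coef_lap coef_const_times\<close>)

text \<open>This is the logarithmic derivative of \<open>den\<close>. A root contributes
  \<open>\<alpha> x / 2\<close> through \<open>rho\<close> and
  \<open>\<alpha> x * e / (1 - e)\<close> through its factor, where
  \<open>e = ee (- \<alpha>)\<close>; together they give
  \<open>\<alpha> x / 2 * (1 + e) / (1 - e)\<close>. Multiplication by \<open>2 * den\<close>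
  removes all fractions.\<close>

lemma two_gderiv_den:
  "2 * gderiv x den = (\<Sum>\<alpha>\<in>P. const (\<alpha> x) * (ee rho * (1 + ee (- \<alpha>)) * pi_prod (P - {\<alpha>})))"
proof -
  have f: "gderiv x (1 - ee (- \<alpha>)) = const (\<alpha> x) * ee (- \<alpha>)" for \<alpha> :: "'x \<Rightarrow> real"
    by (simp add: gderiv_diff gderiv_1 gderiv_single fun_apply single_uminus)
  have p: "gderiv x (pi_prod P) = (\<Sum>\<alpha>\<in>P. const (\<alpha> x) * ee (- \<alpha>) * pi_prod (P - {\<alpha>}))"
    unfolding pi_prod_def gderiv_prod[OF finP] f ..
  have "2 * rho x = (\<Sum>\<alpha>\<in>P. \<alpha> x)"
  proof -
    have "(\<Sum>\<alpha>\<in>A. \<alpha>) x = (\<Sum>\<alpha>\<in>A. \<alpha> x)" for A :: "('x \<Rightarrow> real) set"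
      by (induction A rule: infinite_finite_induct) (simp_all add: fun_apply)
    then show ?thesis by (simp add: rho_def scl_apply)
  qed
  then have c2: "2 * const (rho x) = (\<Sum>\<alpha>\<in>P. const (\<alpha> x))"
    unfolding const_sum[symmetric] mult_2 const_add[symmetric] by simp
  have r: "2 * gderiv x (ee rho) = (\<Sum>\<alpha>\<in>P. const (\<alpha> x)) * ee rho"
    unfolding gderiv_single mult.assoc[symmetric] c2 ..
  have "2 * gderiv x den = (2 * gderiv x (ee rho)) * pi_prod P + 2 * (ee rho * gderiv x (pi_prod P))"
    by (simp only: den_def gderiv_times distrib_left mult.assoc)
  also have "\<dots> = (\<Sum>\<alpha>\<in>P. const (\<alpha> x) * (ee rho * pi_prod P) + 2 * (ee rho * (const (\<alpha> x) * ee (- \<alpha>) * pi_prod (P - {\<alpha>}))))"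
    unfolding r p by (simp only: sum.distrib sum_distrib_left sum_distrib_right mult.assoc)
  also have "\<dots> = (\<Sum>\<alpha>\<in>P. const (\<alpha> x) * (ee rho * (1 + ee (- \<alpha>)) * pi_prod (P - {\<alpha>})))"
  proof (rule sum.cong)
    fix \<alpha> assume "\<alpha> \<in> P"
    have ring: "a * (r * ((1 - e) * p)) + 2 * (r * (a * e * p)) = a * (r * (1 + e) * p)"
      for a r e p :: "('x \<Rightarrow> real) \<Rightarrow>\<^sub>0 real" by (simp add: algebra_simps)
    show "const (\<alpha> x) * (ee rho * pi_prod P) + 2 * (ee rho * (const (\<alpha> x) * ee (- \<alpha>) * pi_prod (P - {\<alpha>})))
        = const (\<alpha> x) * (ee rho * (1 + ee (- \<alpha>)) * pi_prod (P - {\<alpha>}))"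
      unfolding pi_prod_remove[OF \<open>\<alpha> \<in> P\<close>] by (rule ring)
  qed simp
  finally show ?thesis .
qed

text \<open>The derivative along the vector dual to \<open>\<alpha>\<close>, which is what the cross
  term of the Laplacian produces for each root.\<close>

definition dder :: "('x \<Rightarrow> real) \<Rightarrow> (('x \<Rightarrow> real) \<Rightarrow>\<^sub>0 real) \<Rightarrow> (('x \<Rightarrow> real) \<Rightarrow>\<^sub>0 real)" where
  "dder \<alpha> p = (\<Sum>x\<in>I. const (\<alpha> x) * gderiv x p)"

lemma coef_dder: "coef (dder \<alpha> p) \<nu> = ip \<nu> \<alpha> * coef p \<nu>"
  unfolding dder_def lookup_sum coef_const_times coef_gderiv ip_def sum_distrib_right
  by (rule sum.cong) (simp_all only: mult_ac)

text \<open>By the logarithmic derivative, the cross term of the two gradients is \<open>den\<close>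
  times the root part of \<open>T2\<close>. It therefore joins \<open>den * lap X\<close> to form
  \<open>den * (const c * X)\<close>, and only the eigenvalue of \<open>den\<close> is
  added.\<close>

lemma lap_den_times:
  assumes T1: "\<And>\<alpha>. \<alpha> \<in> P \<Longrightarrow> (1 - ee (- \<alpha>)) * T \<alpha> = dder \<alpha> X"
    and T2: "const c * X = lap X + (\<Sum>\<alpha>\<in>P. (1 + ee (- \<alpha>)) * T \<alpha>)"
  shows "lap (den * X) = const (ip rho rho + c) * (den * X)"
proof -
  have "2 * (\<Sum>x\<in>I. gderiv x den * gderiv x X) = (\<Sum>x\<in>I. (2 * gderiv x den) * gderiv x X)"
    by (simp add: sum_distrib_left mult.assoc)
  also have "\<dots> = (\<Sum>x\<in>I. \<Sum>\<alpha>\<in>P. (ee rho * (1 + ee (- \<alpha>)) * pi_prod (P - {\<alpha>})) * (const (\<alpha> x) * gderiv x X))"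
    unfolding two_gderiv_den sum_distrib_right by (intro sum.cong refl) (simp only: mult_ac)
  also have "\<dots> = (\<Sum>\<alpha>\<in>P. (ee rho * (1 + ee (- \<alpha>)) * pi_prod (P - {\<alpha>})) * dder \<alpha> X)"
    by (subst sum.swap) (simp add: dder_def sum_distrib_left)
  also have "\<dots> = (\<Sum>\<alpha>\<in>P. den * ((1 + ee (- \<alpha>)) * T \<alpha>))"
  proof (rule sum.cong)
    fix \<alpha> assume a: "\<alpha> \<in> P"
    show "(ee rho * (1 + ee (- \<alpha>)) * pi_prod (P - {\<alpha>})) * dder \<alpha> X = den * ((1 + ee (- \<alpha>)) * T \<alpha>)"
      unfolding T1[OF a, symmetric] den_def pi_prod_remove[OF a] by (simp only: mult_ac)
  qed simp
  also have "\<dots> = den * (const c * X - lap X)" by (simp add: T2 sum_distrib_left)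
  finally have "lap (den * X) = const (ip rho rho) * den * X + den * (const c * X - lap X) + den * lap X"
    unfolding lap_times lap_den by simp
  also have "\<dots> = const (ip rho rho + c) * (den * X)" by (simp add: const_add algebra_simps)
  finally show ?thesis .
qed

lemma ip_sum_list_pos:
  assumes "\<And>\<beta>. \<beta> \<in> P \<Longrightarrow> ip \<kappa> \<beta> > 0" "set l \<subseteq> P"
  shows "l = [] \<or> ip \<kappa> (sum_list l) > 0"
  using assms(2)
proof (induction l)
  case (Cons \<beta> l)
  then have "ip \<kappa> (sum_list l) \<ge> 0" by (auto simp: ip_0)
  moreover have "ip \<kappa> \<beta> > 0" using Cons.prems by (intro assms(1)) simp
  ultimately show ?case by (simp add: ip_add)
qed simp

text \<open>The function \<open>t \<alpha>\<close> carries the part of the Casimir trace that belongs to \<open>\<plusminus>\<alpha>\<close>. By the telescoping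
  hypothesis \<open>t1\<close> it is the quotient of \<open>dder \<alpha> X\<close> by \<open>1 - ee (- \<alpha>)\<close>, so that multiplying \<open>t2\<close> by the
  denominator clears all quotients.\<close>

theorem numerator:
  fixes m :: "('x \<Rightarrow> real) \<Rightarrow> real" and t :: "('x \<Rightarrow> real) \<Rightarrow> ('x \<Rightarrow> real) \<Rightarrow> real"
  assumes dominant: "\<And>\<alpha>. \<alpha> \<in> P \<Longrightarrow> ip \<mu> \<alpha> \<ge> 0"
    and fin_m: "finite {\<nu>. m \<nu> \<noteq> 0}" and m_cone: "\<And>\<nu>. m \<nu> \<noteq> 0 \<Longrightarrow> \<mu> - \<nu> \<in> pos_cone" and m_top: "m \<mu> = 1"
    and m_ref: "\<And>\<alpha> \<nu>. \<alpha> \<in> P \<Longrightarrow> m (ref \<alpha> \<nu>) = m \<nu>"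
    and fin_t: "\<And>\<alpha>. \<alpha> \<in> P \<Longrightarrow> finite {\<nu>. t \<alpha> \<nu> \<noteq> 0}"
    and t1: "\<And>\<alpha> \<nu>. \<alpha> \<in> P \<Longrightarrow> t \<alpha> \<nu> - t \<alpha> (\<nu> + \<alpha>) = ip \<nu> \<alpha> * m \<nu>"
    and t2: "\<And>\<nu>. (ip \<mu> \<mu> + (\<Sum>\<alpha>\<in>P. ip \<mu> \<alpha>)) * m \<nu> = ip \<nu> \<nu> * m \<nu> + (\<Sum>\<alpha>\<in>P. t \<alpha> \<nu> + t \<alpha> (\<nu> + \<alpha>))"
  obtains X where "coef X = m" "regular_dominant (\<mu> + rho)"
    "\<And>w. set w \<subseteq> P \<Longrightarrow> coef (den * X) (act w (\<mu> + rho)) = (- 1) ^ length w"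
    "\<And>\<nu>. coef (den * X) \<nu> \<noteq> 0 \<Longrightarrow> \<exists>w. set w \<subseteq> P \<and> \<nu> = act w (\<mu> + rho)"
proof -
  define X where "X = Poly_Mapping.Abs_poly_mapping m"
  have X: "coef X = m" using fin_m by (simp add: X_def)
  define T where "T \<alpha> = Poly_Mapping.Abs_poly_mapping (t \<alpha>)" for \<alpha>
  have T: "coef (T \<alpha>) = t \<alpha>" if "\<alpha> \<in> P" for \<alpha> using fin_t[OF that] by (simp add: T_def)
  let ?Q = "den * X" and ?k = "\<mu> + rho"
  have shift: "coef (ee (- \<alpha>) * p) \<nu> = coef p (\<nu> + \<alpha>)" for \<alpha> \<nu> and p :: "('x \<Rightarrow> real) \<Rightarrow>\<^sub>0 real"
    by (simp add: coef_ee_times)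
  let ?c = "ip \<mu> \<mu> + (\<Sum>\<alpha>\<in>P. ip \<mu> \<alpha>)"
  have lapQ: "lap ?Q = const (ip rho rho + ?c) * ?Q"
  proof (rule lap_den_times)
    show "(1 - ee (- \<alpha>)) * T \<alpha> = dder \<alpha> X" if "\<alpha> \<in> P" for \<alpha>
      by (rule poly_mapping_eqI) (simp add: left_diff_distrib lookup_minus shift T that t1 coef_dder X)
    show "const ?c * X = lap X + (\<Sum>\<alpha>\<in>P. (1 + ee (- \<alpha>)) * T \<alpha>)"
    proof (rule poly_mapping_eqI)
      fix \<nu>
      have "coef (const ?c * X) \<nu> = ?c * m \<nu>" by (simp only: coef_const_times X)
      also have "\<dots> = ip \<nu> \<nu> * m \<nu> + (\<Sum>\<alpha>\<in>P. t \<alpha> \<nu> + t \<alpha> (\<nu> + \<alpha>))" by (rule t2)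
      also have "(\<Sum>\<alpha>\<in>P. t \<alpha> \<nu> + t \<alpha> (\<nu> + \<alpha>)) = (\<Sum>\<alpha>\<in>P. coef ((1 + ee (- \<alpha>)) * T \<alpha>) \<nu>)"
        by (intro sum.cong refl) (simp add: distrib_right lookup_add shift T)
      finally show "coef (const ?c * X) \<nu> = coef (lap X + (\<Sum>\<alpha>\<in>P. (1 + ee (- \<alpha>)) * T \<alpha>)) \<nu>"
        by (simp only: lookup_add lookup_sum coef_lap X)
    qed
  qed
  have "2 * ip \<mu> rho = (\<Sum>\<alpha>\<in>P. ip \<mu> \<alpha>)"
  proof -
    have "ip \<mu> (\<Sum>\<alpha>\<in>A. \<alpha>) = (\<Sum>\<alpha>\<in>A. ip \<mu> \<alpha>)" for A
      by (induction A rule: infinite_finite_induct) (simp_all add: ip_simps)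
    then show ?thesis by (simp add: rho_def ip_simps)
  qed
  then have kk: "ip ?k ?k = ip rho rho + ?c" by (simp add: ip_simps ip_sym[of rho \<mu>])
  have norm: "ip \<nu> \<nu> = ip ?k ?k" if "coef ?Q \<nu> \<noteq> 0" for \<nu>
  proof -
    have "ip \<nu> \<nu> * coef ?Q \<nu> = ip ?k ?k * coef ?Q \<nu>"
      using arg_cong[OF lapQ, of "\<lambda>p. coef p \<nu>"] unfolding coef_lap coef_const_times kk .
    then show ?thesis using that by simp
  qed
  \<comment> \<open>Shifted by \<open>- (\<mu> + rho)\<close>, the numerator is a product of two
    sums of this kind. This gives both its coefficient 1 at \<open>\<mu> + rho\<close> and the
    position of all other exponents.\<close>
  have "unip (ee (- \<mu>) * X)"
    unfolding unip_def shift X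
  proof (intro conjI allI impI)
    show "m (0 + \<mu>) = 1" using m_top by simp
    show "- \<nu> \<in> pos_cone" if "m (\<nu> + \<mu>) \<noteq> 0" for \<nu> using m_cone[OF that] by simp
  qed
  then have "unip (pi_prod P * (ee (- \<mu>) * X))" using unip_pi_prod[OF subset_refl] by (rule unip_times[rotated])
  moreover have "?Q = ee ?k * (pi_prod P * (ee (- \<mu>) * X))"
  proof -
    have "ee ?k * ee (- \<mu>) = ee rho" by (simp add: mult_single algebra_simps)
    moreover have "ee ?k * (pi_prod P * (ee (- \<mu>) * X)) = (ee ?k * ee (- \<mu>)) * pi_prod P * X"
      by (simp only: mult_ac)
    ultimately show ?thesis by (simp only: den_def)
  qed
  ultimately have u: "unip (pi_prod P * (ee (- \<mu>) * X))" "coef ?Q \<nu> = coef (pi_prod P * (ee (- \<mu>) * X)) (\<nu> - ?k)" for \<nu>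
    by (simp_all only: coef_ee_times)
  have top: "coef ?Q ?k = 1" using u(1) by (simp add: u(2) unip_def)
  have Qcone: "?k - \<nu> \<in> pos_cone" if "coef ?Q \<nu> \<noteq> 0" for \<nu>
  proof -
    have "- (\<nu> - ?k) \<in> pos_cone" using u(1) that unfolding u(2) unip_def by blast
    then show ?thesis by (simp only: minus_diff_eq)
  qed
  have anti: "antisym (coef ?Q)"
    unfolding antisym_def
  proof (intro ballI allI)
    fix \<alpha> \<nu> assume a: "\<alpha> \<in> P"
    then have aR: "\<alpha> \<in> \<Phi>" by blast
    have inv: "ref \<alpha> ` supp X = supp X"
    proof -
      have sub: "ref \<alpha> ` supp X \<subseteq> supp X" using m_ref[OF a] by (auto simp: in_keys_iff X)
      then have "ref \<alpha> ` ref \<alpha> ` supp X \<subseteq> ref \<alpha> ` supp X" by blast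
      then show ?thesis using sub by (force simp: image_image ref_ref[OF aR])
    qed
    have Q: "coef ?Q \<nu> = (\<Sum>\<kappa>\<in>supp X. m \<kappa> * coef den (\<nu> - \<kappa>))" for \<nu>
      unfolding mult.commute[of den] coef_times action_def X ..
    have "coef ?Q (ref \<alpha> \<nu>) = (\<Sum>\<kappa>\<in>ref \<alpha> ` supp X. m \<kappa> * coef den (ref \<alpha> \<nu> - \<kappa>))" unfolding Q inv ..
    also have "\<dots> = (\<Sum>\<kappa>\<in>supp X. m (ref \<alpha> \<kappa>) * coef den (ref \<alpha> \<nu> - ref \<alpha> \<kappa>))"
      by (subst sum.reindex) (use bij_is_inj[OF bij_ref[OF aR]] in \<open>auto intro: inj_on_subset\<close>)
    also have "\<dots> = (\<Sum>\<kappa>\<in>supp X. - (m \<kappa> * coef den (\<nu> - \<kappa>)))"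
      using antisym_den a by (simp add: m_ref[OF a] ref_diff[symmetric] antisym_def)
    finally show "coef ?Q (ref \<alpha> \<nu>) = - coef ?Q \<nu>" by (simp add: Q sum_negf)
  qed
  show thesis
  proof (rule that[OF X])
    show "regular_dominant ?k"
      unfolding regular_dominant_def ip_add
    proof
      show "ip \<mu> \<alpha> + ip rho \<alpha> > 0" if "\<alpha> \<in> P" for \<alpha>
        using dominant[OF that] rho_pos[OF that] by (rule add_nonneg_pos)
    qed
    show "coef ?Q (act w ?k) = (- 1) ^ length w" if "set w \<subseteq> P" for w
      using antisym_act[OF anti that, of ?k] top by simp
    fix \<nu> assume nz: "coef ?Q \<nu> \<noteq> 0"
    have fin: "finite {\<nu>. coef ?Q \<nu> \<noteq> 0}" by simp
    obtain w where w: "set w \<subseteq> P" "regular_dominant (act w \<nu>)" "coef ?Q (act w \<nu>) \<noteq> 0"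
      using orbit_regular_dominant[OF anti fin nz] by blast
    let ?n = "act w \<nu>"
    obtain l where l: "set l \<subseteq> P" "?k - ?n = sum_list l" using Qcone[OF w(3)] by (auto simp: pos_cone_def)
    \<comment> \<open>Equal lengths make \<open>?k + ?n\<close> orthogonal to
      \<open>?k - ?n\<close>, yet \<open>?k + ?n\<close> has positive product with every summand of
      that difference. No summand can exist.\<close>
    have pos_l: "ip (?k + ?n) \<beta> > 0" if "\<beta> \<in> P" for \<beta>
    proof -
      have "ip ?n \<beta> > 0" using w(2) that by (simp add: regular_dominant_def)
      then show ?thesis using dominant[OF that] rho_pos[OF that] by (simp add: ip_simps)
    qed
    have "ip (?k + ?n) (sum_list l) = ip ?k ?k - ip ?n ?n"
      unfolding l(2)[symmetric] ip_add ip_diff using ip_sym[of ?n ?k] by (simp add: ip_add)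
    then have "ip (?k + ?n) (sum_list l) = 0" using norm[OF w(3)] by simp
    moreover have "l = [] \<or> ip (?k + ?n) (sum_list l) > 0" by (rule ip_sum_list_pos[OF pos_l l(1)])
    ultimately have "l = []" by simp
    then have "?n = ?k" using l(2) by simp
    moreover have "act (rev w) ?n = \<nu>" using act_rev(1)[of w \<nu>] w(1) by blast
    ultimately show "\<exists>w. set w \<subseteq> P \<and> \<nu> = act w ?k"
      using w(1) by (intro exI[of _ "rev w"]) simp
  qed
qed

end

section \<open>Eigenvectors and complexification\<close>

subsection \<open>Common eigenvectors\<close>

text \<open>More iterates of \<open>u\<close> than the real dimension are dependent, which gives a
  polynomial in \<open>T\<close> killing \<open>u\<close>. Split off a root \<open>c\<close>: either
  the vector is already an eigenvector, or \<open>T v - scale c v\<close> is non-zero and killed by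
  a polynomial of lower degree. The parameter \<open>scale\<close> admits complex structures such as
  \<open>cscale\<close> on a real Euclidean space.\<close>

lemma eigenvector_exists:
  fixes scale :: "complex \<Rightarrow> 'v::euclidean_space \<Rightarrow> 'v" and T :: "'v \<Rightarrow> 'v"
  assumes vs: "vector_space scale" and re: "\<And>r v. scale (complex_of_real r) v = r *\<^sub>R v"
    and U: "module.subspace scale U" and TU: "\<And>u. u \<in> U \<Longrightarrow> T u \<in> U"
    and T_add: "\<And>u v. T (u + v) = T u + T v" and T_scale: "\<And>c v. T (scale c v) = scale c (T v)"
    and u: "u \<in> U" "u \<noteq> 0"
  shows "\<exists>v\<in>U. v \<noteq> 0 \<and> (\<exists>c. T v = scale c v)"
proof -
  interpret V: vector_space scale by (rule vs)
  have T0: "T 0 = 0" using T_add[of 0 0] by simp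
  \<comment> \<open>Horner evaluation of the polynomial \<open>p\<close> at the operator
    \<open>T\<close>, applied to \<open>v\<close>.\<close>
  define pT where "pT p v = fold_coeffs (\<lambda>a w. scale a v + T w) p 0" for p v
  have pC: "pT (pCons a p) v = scale a v + T (pT p v)" for a p v
    by (cases "a = 0 \<and> p = 0") (auto simp: pT_def T0)
  have p0: "pT 0 v = 0" for v by (simp add: pT_def)
  have p_add: "pT (p + q) v = pT p v + pT q v" for p q v
    by (induction p q rule: poly_induct2) (simp_all add: p0 pC T_add V.scale_left_distrib)
  have p_smult: "pT (smult a p) v = scale a (pT p v)" for a p v
    by (induction p) (simp_all add: p0 pC T_scale V.scale_right_distrib)
  have p_lin: "pT ([:- c, 1:] * q) v = pT q (T v - scale c v)" for c q v
  proof (induction q)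
    case (pCons a q)
    have "[:- c, 1:] * pCons a q = smult a [:- c, 1:] + pCons 0 ([:- c, 1:] * q)" by simp
    then have "pT ([:- c, 1:] * pCons a q) v = scale a (pT [:- c, 1:] v) + T (pT ([:- c, 1:] * q) v)"
      by (simp only: p_add p_smult) (simp add: pC)
    then show ?case using pCons by (simp add: pC p0 T0)
  qed (simp add: p0)
  have main: "\<exists>v\<in>U. v \<noteq> 0 \<and> (\<exists>c. T v = scale c v)"
    if "p \<noteq> 0" "v \<in> U" "v \<noteq> 0" "pT p v = 0" for p v
    using that
  proof (induction "Polynomial.degree p" arbitrary: p v rule: less_induct)
    case less
    show ?case
    proof (cases "Polynomial.degree p = 0")
      case True
      then obtain a where "p = [:a:]" using degree_eq_zeroE by blast
      then show ?thesis using less.prems by (simp add: pC p0 T0)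
    next
      case False
      then obtain c where "poly p c = 0"
        using fundamental_theorem_of_algebra[of p] constant_degree[of p] by auto
      then obtain q where q: "p = [:- c, 1:] * q" by (auto simp: poly_eq_0_iff_dvd elim: dvdE)
      define w where "w = T v - scale c v"
      show ?thesis
      proof (cases "w = 0")
        case True
        then show ?thesis using less.prems by (auto simp: w_def)
      next
        case w: False
        have "q \<noteq> 0" using less.prems(1) q by auto
        then have "Polynomial.degree p = Polynomial.degree [:- c, 1:] + Polynomial.degree q"
          unfolding q by (intro degree_mult_eq) auto
        then have "Polynomial.degree q < Polynomial.degree p" by simp
        moreover have "w \<in> U" unfolding w_def by (intro V.subspace_diff[OF U] V.subspace_scale[OF U] TU less.prems)
        moreover have "pT q w = 0" using less.prems(4) by (simp add: q p_lin w_def del: mult_pCons_left)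
        ultimately show ?thesis using less.hyps \<open>q \<noteq> 0\<close> w by blast
      qed
    qed
  qed
  let ?N = "DIM('v)"
  let ?f = "\<lambda>i. (T ^^ i) u"
  have pm: "pT (monom a i) v = scale a ((T ^^ i) v)" for a i v
    by (induction i) (simp_all add: monom_0 monom_Suc pC p0 T0 T_scale)
  show ?thesis
  \<comment> \<open>If two iterates coincide, the image has fewer elements and the dependence
    argument fails; the difference of two monomials then serves directly.\<close>
  proof (cases "inj_on ?f {..?N}")
    case False
    then obtain i j where ij: "?f i = ?f j" "i \<noteq> j" by (auto simp: inj_on_def)
    define p where "p = (monom 1 i - monom 1 j :: complex poly)"
    have "poly.coeff p i = 1" using ij(2) by (simp add: p_def)
    then have "p \<noteq> 0" by auto
    moreover have "p = monom 1 i + smult (- 1) (monom 1 j)" by (simp add: p_def)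
    then have "pT p u = 0" by (simp only: p_add p_smult pm ij(1)) simp
    ultimately show ?thesis using main u by blast
  next
    case inj: True
    have "\<not> independent (?f ` {..?N})"
    proof
      assume "independent (?f ` {..?N})"
      then have "card (?f ` {..?N}) \<le> DIM('v)" by (rule independent_bound[THEN conjunct2])
      then show False using card_image[OF inj] by simp
    qed
    then obtain a where a: "(\<Sum>v\<in>?f ` {..?N}. a v *\<^sub>R v) = 0" "\<exists>v\<in>?f ` {..?N}. a v \<noteq> 0"
      by (auto simp: dependent_finite)
    define p where "p = (\<Sum>i\<le>?N. monom (complex_of_real (a (?f i))) i)"
    have "pT (\<Sum>i\<in>A. monom (g i) i) u = (\<Sum>i\<in>A. scale (g i) (?f i))" for A and g :: "nat \<Rightarrow> complex"
      by (induction A rule: infinite_finite_induct) (simp_all add: p0 p_add pm)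
    then have "pT p u = (\<Sum>i\<le>?N. a (?f i) *\<^sub>R ?f i)" unfolding p_def by (simp add: re)
    also have "\<dots> = (\<Sum>v\<in>?f ` {..?N}. a v *\<^sub>R v)" by (simp add: sum.reindex[OF inj])
    finally have "pT p u = 0" using a(1) by simp
    moreover obtain i where i: "i \<le> ?N" "a (?f i) \<noteq> 0" using a(2) by auto
    have "poly.coeff p i = complex_of_real (a (?f i))" using i(1) by (simp add: p_def coeff_sum)
    then have "p \<noteq> 0" using i(2) by auto
    ultimately show ?thesis using main u by blast
  qed
qed

text \<open>An eigenspace of one operator inside \<open>U\<close> is preserved by those commuting
  with it, so the remaining operators can be treated there.\<close>

lemma common_eigenvector_exists:
  fixes scale :: "complex \<Rightarrow> 'v::euclidean_space \<Rightarrow> 'v" and T :: "'i \<Rightarrow> 'v \<Rightarrow> 'v"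
  assumes vs: "vector_space scale" and re: "\<And>r v. scale (complex_of_real r) v = r *\<^sub>R v"
    and A: "finite A"
    and T_add: "\<And>i u v. T i (u + v) = T i u + T i v" and T_scale: "\<And>i c v. T i (scale c v) = scale c (T i v)"
    and U: "module.subspace scale U" and TU: "\<And>i u. i \<in> A \<Longrightarrow> u \<in> U \<Longrightarrow> T i u \<in> U"
    and comm: "\<And>i j u. i \<in> A \<Longrightarrow> j \<in> A \<Longrightarrow> u \<in> U \<Longrightarrow> T i (T j u) = T j (T i u)"
    and u: "u \<in> U" "u \<noteq> 0"
  shows "\<exists>v\<in>U. v \<noteq> 0 \<and> (\<forall>i\<in>A. \<exists>c. T i v = scale c v)"
proof -
  interpret V: vector_space scale by (rule vs)
  show ?thesis using A U TU comm u
  proof (induction A arbitrary: U u rule: finite_induct)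
    case (insert a A)
    have "\<exists>v\<in>U. v \<noteq> 0 \<and> (\<exists>c. T a v = scale c v)"
    proof (rule eigenvector_exists[where u = u])
      show "T a w \<in> U" if "w \<in> U" for w by (rule insert.prems(2)[OF _ that]) simp
    qed (rule vs re insert.prems(1,4,5) T_add T_scale)+
    then obtain v c where v: "v \<in> U" "v \<noteq> 0" "T a v = scale c v" by blast
    define U' where "U' = {w \<in> U. T a w = scale c w}"
    have Ta0: "T a 0 = 0" using T_add[of a 0 0] by simp
    have sU': "V.subspace U'"
    proof (rule V.subspaceI)
      show "0 \<in> U'" using V.subspace_0[OF insert.prems(1)] Ta0 by (simp add: U'_def)
      show "x + y \<in> U'" if "x \<in> U'" "y \<in> U'" for x y
        using that V.subspace_add[OF insert.prems(1)] by (simp add: U'_def T_add V.scale_right_distrib)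
      show "scale z x \<in> U'" if "x \<in> U'" for z x
        using that V.subspace_scale[OF insert.prems(1)] by (simp add: U'_def T_scale mult.commute)
    qed
    have "\<exists>v\<in>U'. v \<noteq> 0 \<and> (\<forall>i\<in>A. \<exists>c. T i v = scale c v)"
    proof (rule insert.IH[OF sU'])
      show "T i w \<in> U'" if "i \<in> A" "w \<in> U'" for i w
        using that insert.prems(2)[of i w] insert.prems(3)[of a i w] by (simp add: U'_def T_scale)
      show "T i (T j w) = T j (T i w)" if "i \<in> A" "j \<in> A" "w \<in> U'" for i j w
        using that insert.prems(3)[of i j w] by (simp add: U'_def)
      show "v \<in> U'" "v \<noteq> 0" using v by (simp_all add: U'_def)
    qed
    then obtain w where "w \<in> U'" "w \<noteq> 0" "\<forall>i\<in>A. \<exists>c. T i w = scale c w" by blast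
    then show ?case by (intro bexI[of _ w]) (auto simp: U'_def)
  qed auto
qed

subsection \<open>The complexification\<close>

lemma lie_bracket_simps:
  fixes X Y Z :: "complex ^ 'n ^ 'n"
  shows "lie_bracket (X + Y) Z = lie_bracket X Z + lie_bracket Y Z"
    and "lie_bracket Z (X + Y) = lie_bracket Z X + lie_bracket Z Y"
    and "lie_bracket (X - Y) Z = lie_bracket X Z - lie_bracket Y Z"
    and "lie_bracket Z (X - Y) = lie_bracket Z X - lie_bracket Z Y"
    and "lie_bracket (- X) Z = - lie_bracket X Z"
    and "lie_bracket Z (- X) = - lie_bracket Z X"
    and "lie_bracket (c *\<^sub>R X) Z = c *\<^sub>R lie_bracket X Z"
    and "lie_bracket Z (c *\<^sub>R X) = c *\<^sub>R lie_bracket Z X"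
    and "lie_bracket 0 Z = 0" "lie_bracket Z 0 = 0" "lie_bracket X X = 0"
  unfolding inj_eq[OF inj_endo_of, symmetric] lie_bracket_def
  by (simp_all add: endo_of_simps endo_of_mult algebra_simps)

lemma lie_bracket_anticomm: "lie_bracket X Y = - lie_bracket Y (X :: complex ^ 'n ^ 'n)"
  by (simp add: lie_bracket_def)

lemma lie_bracket_jacobi:
  "lie_bracket X (lie_bracket Y Z) = lie_bracket (lie_bracket X Y) Z + lie_bracket Y (lie_bracket X (Z :: complex ^ 'n ^ 'n))"
  unfolding inj_eq[OF inj_endo_of, symmetric] lie_bracket_def
  by (simp add: endo_of_simps endo_of_mult algebra_simps)

lemma vector_space_cscale: "vector_space (cscale :: complex \<Rightarrow> 'n::finite complexified \<Rightarrow> 'n complexified)"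
proof
  fix a b :: complex and x y :: "'n complexified"
  show "cscale a (x + y) = cscale a x + cscale a y" by (cases x; cases y) (simp add: algebra_simps)
  show "cscale (a + b) x = cscale a x + cscale b x" by (cases x) (simp add: algebra_simps)
  show "cscale a (cscale b x) = cscale (a * b) x" by (cases x) (simp add: algebra_simps)
  show "cscale 1 x = x" by (cases x) simp
qed

interpretation C: vector_space "cscale :: complex \<Rightarrow> 'n::finite complexified \<Rightarrow> 'n complexified"
  by (rule vector_space_cscale)

lemma cscale_of_real: "cscale (complex_of_real r) x = r *\<^sub>R x" by (cases x) simp

lemma cbracket_simps:
  fixes a b c :: "'n::finite complexified"
  shows "cbracket (a + b) c = cbracket a c + cbracket b c" "cbracket c (a + b) = cbracket c a + cbracket c b"
    "cbracket (cscale z a) c = cscale z (cbracket a c)" "cbracket c (cscale z a) = cscale z (cbracket c a)"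
    "cbracket 0 c = 0" "cbracket c 0 = 0"
    "cbracket (a - b) c = cbracket a c - cbracket b c" "cbracket c (a - b) = cbracket c a - cbracket c b"
  by (cases a; cases b; cases c; simp add: lie_bracket_simps zero_prod_def algebra_simps)+

lemma cbracket_self: "cbracket a a = (0 :: 'n::finite complexified)"
proof (cases a)
  fix X Y assume "a = (X, Y)"
  then show ?thesis using lie_bracket_anticomm[of X Y] by (simp add: lie_bracket_simps zero_prod_def)
qed

lemma cbracket_anticomm: "cbracket a b = - cbracket b (a :: 'n::finite complexified)"
proof (cases a; cases b)
  fix X Y X' Y' assume "a = (X, Y)" "b = (X', Y')"
  then show ?thesis
    using lie_bracket_anticomm[of X X'] lie_bracket_anticomm[of Y Y'] lie_bracket_anticomm[of X Y']
      lie_bracket_anticomm[of Y X'] by simp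
qed

lemma cbracket_jacobi:
  "cbracket a (cbracket b c) = cbracket (cbracket a b) c + cbracket b (cbracket a (c :: 'n::finite complexified))"
proof (cases a; cases b; cases c)
  fix X Y X' Y' X'' Y''
  assume "a = (X, Y)" "b = (X', Y')" "c = (X'', Y'')"
  then show ?thesis
    by (simp add: lie_bracket_simps lie_bracket_jacobi[of X] lie_bracket_jacobi[of Y] algebra_simps)
qed

fun cconj :: "'n::finite complexified \<Rightarrow> 'n complexified" where "cconj (X, Y) = (X, - Y)"

lemma cconj_simps: "cconj (cconj a) = a" "cconj (cbracket a b) = cbracket (cconj a) (cconj b)"
  "cconj (cscale z a) = cscale (cnj z) (cconj a)" "cconj a = 0 \<longleftrightarrow> a = 0"
  by (cases a; cases b; simp add: lie_bracket_simps zero_prod_def)+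

section \<open>Root space decomposition of a compact Lie algebra\<close>

subsection \<open>Compact Lie algebras with a maximal abelian subalgebra\<close>

text \<open>The algebraic content of the group hypotheses; \<open>h_cent\<close> is maximality of
  the torus in infinitesimal form.\<close>

locale compact_lie =
  fixes \<gg> \<hh> :: "(complex ^ 'n ^ 'n) set" and B :: "complex ^ 'n ^ 'n \<Rightarrow> complex ^ 'n ^ 'n \<Rightarrow> real"
  assumes g_sub: "subspace \<gg>" and g_br: "X \<in> \<gg> \<Longrightarrow> Y \<in> \<gg> \<Longrightarrow> lie_bracket X Y \<in> \<gg>"
    and inv: "invariant_inner_product \<gg> B"
    and h_sub: "subspace \<hh>" and hg: "\<hh> \<subseteq> \<gg>"
    and h_ab: "X \<in> \<hh> \<Longrightarrow> Y \<in> \<hh> \<Longrightarrow> lie_bracket X Y = 0"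
    and h_cent: "X \<in> \<gg> \<Longrightarrow> (\<And>H. H \<in> \<hh> \<Longrightarrow> lie_bracket H X = 0) \<Longrightarrow> X \<in> \<hh>"
begin

lemma g_add: "X \<in> \<gg> \<Longrightarrow> Y \<in> \<gg> \<Longrightarrow> X + Y \<in> \<gg>" by (rule subspace_add[OF g_sub])
lemma g_diff: "X \<in> \<gg> \<Longrightarrow> Y \<in> \<gg> \<Longrightarrow> X - Y \<in> \<gg>" by (rule subspace_diff[OF g_sub])
lemma g_scale: "X \<in> \<gg> \<Longrightarrow> c *\<^sub>R X \<in> \<gg>" by (rule subspace_scale[OF g_sub])
lemma g_0: "0 \<in> \<gg>" by (rule subspace_0[OF g_sub])
lemma g_neg: "X \<in> \<gg> \<Longrightarrow> - X \<in> \<gg>" by (rule subspace_neg[OF g_sub])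
lemma hgD: "X \<in> \<hh> \<Longrightarrow> X \<in> \<gg>" using hg by blast

lemmas g_intros = g_add g_diff g_scale g_0 g_neg g_br

lemma B_sym: "X \<in> \<gg> \<Longrightarrow> Y \<in> \<gg> \<Longrightarrow> B X Y = B Y X"
  using inv by (simp add: invariant_inner_product_def)
lemma B_pos: "X \<in> \<gg> \<Longrightarrow> X \<noteq> 0 \<Longrightarrow> B X X > 0"
  using inv by (simp add: invariant_inner_product_def)
lemma B_add: "X \<in> \<gg> \<Longrightarrow> Y \<in> \<gg> \<Longrightarrow> Z \<in> \<gg> \<Longrightarrow> B (X + Y) Z = B X Z + B Y Z"
  using inv by (simp add: invariant_inner_product_def)
lemma B_scale: "X \<in> \<gg> \<Longrightarrow> Y \<in> \<gg> \<Longrightarrow> B (c *\<^sub>R X) Y = c * B X Y"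
  using inv by (simp add: invariant_inner_product_def)
lemma B_inv: "X \<in> \<gg> \<Longrightarrow> Y \<in> \<gg> \<Longrightarrow> Z \<in> \<gg> \<Longrightarrow> B (lie_bracket X Y) Z = - B Y (lie_bracket X Z)"
proof -
  assume "X \<in> \<gg>" "Y \<in> \<gg>" "Z \<in> \<gg>"
  then have "B (lie_bracket X Y) Z + B Y (lie_bracket X Z) = 0"
    using inv unfolding invariant_inner_product_def by blast
  then show ?thesis by simp
qed
lemma B_add2: "X \<in> \<gg> \<Longrightarrow> Y \<in> \<gg> \<Longrightarrow> Z \<in> \<gg> \<Longrightarrow> B Z (X + Y) = B Z X + B Z Y"
  by (simp add: B_sym[of Z] B_add g_add)
lemma B_scale2: "X \<in> \<gg> \<Longrightarrow> Y \<in> \<gg> \<Longrightarrow> B X (c *\<^sub>R Y) = c * B X Y"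
  by (simp add: B_sym[of X] B_scale g_scale)
lemma B_0: "X \<in> \<gg> \<Longrightarrow> B 0 X = 0" "X \<in> \<gg> \<Longrightarrow> B X 0 = 0"
  using B_scale[of X X 0] B_scale2[of X X 0] by simp_all
lemma B_neg: "X \<in> \<gg> \<Longrightarrow> Y \<in> \<gg> \<Longrightarrow> B (- X) Y = - B X Y" "X \<in> \<gg> \<Longrightarrow> Y \<in> \<gg> \<Longrightarrow> B X (- Y) = - B X Y"
  using B_scale[of X Y "- 1"] B_scale2[of X Y "- 1"] by simp_all
lemma B_diff: "X \<in> \<gg> \<Longrightarrow> Y \<in> \<gg> \<Longrightarrow> Z \<in> \<gg> \<Longrightarrow> B (X - Y) Z = B X Z - B Y Z"
  "X \<in> \<gg> \<Longrightarrow> Y \<in> \<gg> \<Longrightarrow> Z \<in> \<gg> \<Longrightarrow> B Z (X - Y) = B Z X - B Z Y"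
  using B_add[of X "- Y" Z] B_add2[of X "- Y" Z] by (simp_all add: B_neg g_neg)
lemmas B_simps = B_add B_add2 B_scale B_scale2 B_0 B_neg B_diff

lemma B_eq_0: "X \<in> \<gg> \<Longrightarrow> B X X = 0 \<Longrightarrow> X = 0" using B_pos by fastforce
lemma B_nonneg: "X \<in> \<gg> \<Longrightarrow> B X X \<ge> 0" using B_pos[of X] B_0 by (cases "X = 0") auto

lemma g_sum: "(\<And>i. i \<in> A \<Longrightarrow> f i \<in> \<gg>) \<Longrightarrow> sum f A \<in> \<gg>" by (rule subspace_sum[OF g_sub])

lemma B_sum: "(\<And>i. i \<in> A \<Longrightarrow> f i \<in> \<gg>) \<Longrightarrow> X \<in> \<gg> \<Longrightarrow> B (sum f A) X = (\<Sum>i\<in>A. B (f i) X)"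
  by (induction A rule: infinite_finite_induct) (simp_all add: B_0 B_add g_sum)

subsection \<open>Orthonormal bases\<close>

definition orthonormal :: "(complex ^ 'n ^ 'n) set \<Rightarrow> bool" where
  "orthonormal A \<longleftrightarrow> A \<subseteq> \<gg> \<and> (\<forall>x\<in>A. \<forall>y\<in>A. B x y = (if x = y then 1 else 0))"

lemma orthonormalD: "orthonormal A \<Longrightarrow> x \<in> A \<Longrightarrow> x \<in> \<gg>"
  "orthonormal A \<Longrightarrow> x \<in> A \<Longrightarrow> y \<in> A \<Longrightarrow> B x y = (if x = y then 1 else 0)"
  unfolding orthonormal_def by blast+

lemma orthonormal_comb:
  assumes A: "orthonormal A" and S: "finite S" "S \<subseteq> A" "a \<in> A"
  shows "B (\<Sum>v\<in>S. u v *\<^sub>R v) a = (if a \<in> S then u a else 0)"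
proof -
  have "B (\<Sum>v\<in>S. u v *\<^sub>R v) a = (\<Sum>v\<in>S. u v * B v a)"
    by (subst B_sum) (use S orthonormalD(1)[OF A] in \<open>auto intro!: g_scale sum.cong simp: B_scale subset_iff\<close>)
  also have "\<dots> = (\<Sum>v\<in>S. if v = a then u a else 0)"
    by (rule sum.cong) (use S orthonormalD(2)[OF A] in \<open>auto simp: subset_iff\<close>)
  finally show ?thesis using S(1) by simp
qed

lemma orthonormal_independent: assumes A: "orthonormal A" shows "independent A"
  unfolding dependent_explicit
proof clarify
  fix S u v assume S: "finite S" "S \<subseteq> A" "(\<Sum>v\<in>S. u v *\<^sub>R v) = 0" "v \<in> S" "u v \<noteq> 0"
  then have "v \<in> A" by blast
  then show False using orthonormal_comb[OF A S(1,2), of v u] S(3,4,5) orthonormalD(1)[OF A] by (simp add: B_0)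
qed

lemma orthonormal_finite: "orthonormal A \<Longrightarrow> finite A"
  using orthonormal_independent independent_imp_finite by blast

lemma orthonormal_span: "orthonormal A \<Longrightarrow> span A \<subseteq> \<gg>"
  using span_minimal[OF _ g_sub] by (auto simp: orthonormal_def)

lemma orthonormal_expand:
  assumes A: "orthonormal A" and x: "x \<in> span A"
  shows "x = (\<Sum>a\<in>A. B x a *\<^sub>R a)"
proof -
  obtain u where u: "x = (\<Sum>a\<in>A. u a *\<^sub>R a)"
    using x span_finite[OF orthonormal_finite[OF A]] by auto
  have "B x a = u a" if "a \<in> A" for a
    using orthonormal_comb[OF A orthonormal_finite[OF A] subset_refl that] that by (simp add: u)
  then show ?thesis using u by (auto intro: sum.cong)
qed

lemma orthonormal_extend:
  assumes A: "orthonormal A" and x: "x \<in> \<gg>" "x \<noteq> 0" and orth: "\<And>a. a \<in> A \<Longrightarrow> B x a = 0"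
  shows "orthonormal (insert ((1 / sqrt (B x x)) *\<^sub>R x) A)" "(1 / sqrt (B x x)) *\<^sub>R x \<notin> A"
proof -
  let ?z = "(1 / sqrt (B x x)) *\<^sub>R x"
  have p: "B x x > 0" using x by (rule B_pos)
  have z: "?z \<in> \<gg>" using x by (intro g_scale)
  have zz: "B ?z ?z = 1" using p x by (simp add: B_simps g_intros real_sqrt_mult[symmetric])
  have za: "B ?z a = 0" "B a ?z = 0" if "a \<in> A" for a
    using orth[OF that] orthonormalD(1)[OF A that] x B_sym[of a x] by (simp_all add: B_simps)
  show zA: "?z \<notin> A" using za(1)[of ?z] zz by auto
  show "orthonormal (insert ?z A)"
    unfolding orthonormal_def
  proof (intro conjI ballI)
    show "insert ?z A \<subseteq> \<gg>" using z orthonormalD(1)[OF A] by blast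
    fix v w assume "v \<in> insert ?z A" "w \<in> insert ?z A"
    then show "B v w = (if v = w then 1 else 0)"
      using zz za zA orthonormalD(2)[OF A, of v w] by (metis insertE)
  qed
qed

lemma orthonormal_perp_part:
  assumes A: "orthonormal A" and x: "x \<in> \<gg>" and a: "a \<in> A"
  shows "B (x - (\<Sum>a\<in>A. B x a *\<^sub>R a)) a = 0"
proof -
  have "(\<Sum>a\<in>A. B x a *\<^sub>R a) \<in> \<gg>" using orthonormalD(1)[OF A] by (intro g_sum g_scale)
  then show ?thesis
    using x orthonormalD(1)[OF A a] orthonormal_comb[OF A orthonormal_finite[OF A] subset_refl a] a
    by (simp add: B_diff)
qed

text \<open>An orthonormal subset of greatest cardinality spans: the part of a further vector
  perpendicular to it could be normalised and added.\<close>

lemma exists_orthonormal_basis: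
  assumes U: "subspace U" "U \<subseteq> \<gg>"
  obtains A where "orthonormal A" "A \<subseteq> U" "span A = U"
proof -
  define good where "good k \<longleftrightarrow> (\<exists>A. orthonormal A \<and> A \<subseteq> U \<and> card A = k)" for k
  have "orthonormal {}" by (simp add: orthonormal_def)
  then have "good 0" unfolding good_def by (intro exI[of _ "{}"]) simp
  moreover have "k \<le> DIM(complex ^ 'n ^ 'n)" if "good k" for k
    using that independent_bound[OF orthonormal_independent] unfolding good_def by blast
  ultimately obtain k where k: "good k" "\<And>j. good j \<Longrightarrow> j \<le> k"
    using Nat.ex_has_greatest_nat[of good 0 "DIM(complex ^ 'n ^ 'n)"] by blast
  then obtain A where A: "orthonormal A" "A \<subseteq> U" "card A = k" by (auto simp: good_def)
  have "x \<in> span A" if x: "x \<in> U" for x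
  proof (rule ccontr)
    assume nx: "x \<notin> span A"
    let ?p = "\<Sum>a\<in>A. B x a *\<^sub>R a"
    have p: "?p \<in> span A" by (intro span_sum span_scale span_base)
    have pU: "?p \<in> U" using p span_minimal[OF A(2) U(1)] by blast
    have "x - ?p \<in> U" by (intro subspace_diff[OF U(1)] x pU)
    moreover have "x - ?p \<noteq> 0" using nx p by auto
    moreover have "B (x - ?p) a = 0" if "a \<in> A" for a
      using orthonormal_perp_part[OF A(1) _ that] x U(2) by blast
    ultimately have o: "orthonormal (insert ((1 / sqrt (B (x - ?p) (x - ?p))) *\<^sub>R (x - ?p)) A)"
      "(1 / sqrt (B (x - ?p) (x - ?p))) *\<^sub>R (x - ?p) \<notin> A"
      using orthonormal_extend[OF A(1), of "x - ?p"] U(2) by blast+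
    have "good (Suc k)"
      unfolding good_def
      by (rule exI, rule conjI, rule o(1))
         (use o(2) A(2,3) orthonormal_finite[OF A(1)] subspace_scale[OF U(1) \<open>x - ?p \<in> U\<close>] in auto)
    then show False using k(2) by fastforce
  qed
  then have "span A = U" using span_minimal[OF A(2) U(1)] by blast
  then show ?thesis using that A by blast
qed

definition hb :: "(complex ^ 'n ^ 'n) set" where
  "hb = (SOME A. orthonormal A \<and> A \<subseteq> \<hh> \<and> span A = \<hh>)"

lemma hb: "orthonormal hb" "hb \<subseteq> \<hh>" "span hb = \<hh>"
proof -
  have "\<exists>A. orthonormal A \<and> A \<subseteq> \<hh> \<and> span A = \<hh>"
    using exists_orthonormal_basis[OF h_sub hg] by metis
  from someI_ex[OF this] show "orthonormal hb" "hb \<subseteq> \<hh>" "span hb = \<hh>" by (simp_all add: hb_def)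
qed

lemma hb_fin: "finite hb" by (rule orthonormal_finite[OF hb(1)])

subsection \<open>Functionals on the abelian subalgebra\<close>

lemma dual_linear:
  assumes "\<mu> \<in> dual_space \<hh>" "X \<in> \<hh>" "Y \<in> \<hh>"
  shows "\<mu> (X + Y) = \<mu> X + \<mu> Y" "\<mu> (c *\<^sub>R X) = c * \<mu> X"
  using assms by (auto simp: dual_space_def)

lemma dual_outside: "\<mu> \<in> dual_space \<hh> \<Longrightarrow> X \<notin> \<hh> \<Longrightarrow> \<mu> X = 0"
  by (auto simp: dual_space_def)

lemma dual_zero: "\<mu> \<in> dual_space \<hh> \<Longrightarrow> \<mu> 0 = 0"
  using dual_linear(2)[of \<mu> 0 0 0] subspace_0[OF h_sub] by simp

lemma dual_sum:
  assumes \<mu>: "\<mu> \<in> dual_space \<hh>" and f: "\<And>i. i \<in> A \<Longrightarrow> f i \<in> \<hh>"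
  shows "\<mu> (sum f A) = (\<Sum>i\<in>A. \<mu> (f i))"
  using f
proof (induction A rule: infinite_finite_induct)
  case (insert a A)
  then show ?case by (simp add: dual_linear(1)[OF \<mu>] subspace_sum[OF h_sub])
qed (simp_all add: dual_zero[OF \<mu>])

lemma h_expand: "X \<in> \<hh> \<Longrightarrow> X = (\<Sum>H\<in>hb. B X H *\<^sub>R H)"
  using orthonormal_expand[OF hb(1)] hb(3) by blast

lemma dual_expand: "\<mu> \<in> dual_space \<hh> \<Longrightarrow> X \<in> \<hh> \<Longrightarrow> \<mu> X = (\<Sum>H\<in>hb. B X H * \<mu> H)"
proof -
  assume \<mu>: "\<mu> \<in> dual_space \<hh>" and X: "X \<in> \<hh>"
  have "\<mu> X = \<mu> (\<Sum>H\<in>hb. B X H *\<^sub>R H)" using h_expand[OF X] by simp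
  also have "\<dots> = (\<Sum>H\<in>hb. \<mu> (B X H *\<^sub>R H))"
    using hb(2) by (intro dual_sum[OF \<mu>] subspace_scale[OF h_sub]) auto
  also have "\<dots> = (\<Sum>H\<in>hb. B X H * \<mu> H)"
    using hb(2) \<mu> by (intro sum.cong) (auto intro!: dual_linear(2))
  finally show ?thesis .
qed

text \<open>The vector dual to \<open>\<mu>\<close> under \<open>B\<close>, written in coordinates;
  on linear functionals it is \<open>riesz\<close>.\<close>

definition tt :: "'n functional \<Rightarrow> complex ^ 'n ^ 'n" where "tt \<mu> = (\<Sum>H\<in>hb. \<mu> H *\<^sub>R H)"

definition ipp :: "'n functional \<Rightarrow> 'n functional \<Rightarrow> real" where "ipp \<mu> \<nu> = (\<Sum>H\<in>hb. \<mu> H * \<nu> H)"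

lemma tt_h: "tt \<mu> \<in> \<hh>"
  unfolding tt_def using hb(2) by (intro subspace_sum[OF h_sub] subspace_scale[OF h_sub]) auto

lemma B_tt_hb: "H \<in> hb \<Longrightarrow> B (tt \<mu>) H = \<mu> H"
  unfolding tt_def using orthonormal_comb[OF hb(1) hb_fin subset_refl] by simp

lemma dual_tt: "\<mu> \<in> dual_space \<hh> \<Longrightarrow> \<mu> (tt \<nu>) = ipp \<mu> \<nu>"
  by (simp add: dual_expand tt_h B_tt_hb ipp_def mult.commute)

lemma B_tt: assumes \<mu>: "\<mu> \<in> dual_space \<hh>" and X: "X \<in> \<hh>" shows "B (tt \<mu>) X = \<mu> X"
proof -
  have g: "H \<in> \<gg>" if "H \<in> hb" for H using that hb(2) hgD by blast
  have "B (tt \<mu>) X = (\<Sum>H\<in>hb. B (\<mu> H *\<^sub>R H) X)" unfolding tt_def by (intro B_sum g_scale g hgD X)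
  also have "\<dots> = (\<Sum>H\<in>hb. \<mu> H * B H X)" by (intro sum.cong refl B_scale g hgD X)
  also have "\<dots> = (\<Sum>H\<in>hb. B X H * \<mu> H)"
    using hb(2) X by (intro sum.cong) (auto simp: B_sym[of X] hgD subset_iff)
  finally show ?thesis using dual_expand[OF \<mu> X] by simp
qed

lemma riesz_eq: "\<mu> \<in> dual_space \<hh> \<Longrightarrow> riesz \<hh> B \<mu> = tt \<mu>"
  unfolding riesz_def
proof (rule the_equality)
  assume \<mu>: "\<mu> \<in> dual_space \<hh>"
  show "tt \<mu> \<in> \<hh> \<and> (\<forall>X\<in>\<hh>. B (tt \<mu>) X = \<mu> X)" using tt_h B_tt[OF \<mu>] by blast
  fix H assume H: "H \<in> \<hh> \<and> (\<forall>X\<in>\<hh>. B H X = \<mu> X)"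
  have d: "H - tt \<mu> \<in> \<hh>" using H by (intro subspace_diff[OF h_sub] tt_h) simp
  have "B (H - tt \<mu>) (H - tt \<mu>) = B H (H - tt \<mu>) - B (tt \<mu>) (H - tt \<mu>)"
    using H d tt_h by (intro B_diff(1)) (auto intro: hgD)
  then have "B (H - tt \<mu>) (H - tt \<mu>) = 0" using H d B_tt[OF \<mu> d] by simp
  then show "H = tt \<mu>" using B_eq_0[OF hgD[OF d]] by simp
qed

lemma dual_inner_eq: "\<mu> \<in> dual_space \<hh> \<Longrightarrow> \<nu> \<in> dual_space \<hh> \<Longrightarrow> dual_inner \<hh> B \<mu> \<nu> = ipp \<mu> \<nu>"
  by (simp add: dual_inner_def riesz_eq B_tt tt_h dual_tt)

lemma dual_eqI:
  assumes "\<mu> \<in> dual_space \<hh>" "\<nu> \<in> dual_space \<hh>" "\<And>H. H \<in> \<hh> \<Longrightarrow> \<mu> H = \<nu> H"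
  shows "\<mu> = \<nu>"
  using assms dual_outside by (metis ext)

lemma dual_posdef: assumes \<mu>: "\<mu> \<in> dual_space \<hh>" and z: "ipp \<mu> \<mu> = 0" shows "\<mu> = 0"
proof -
  have "\<forall>H\<in>hb. \<mu> H * \<mu> H = 0"
    using z unfolding ipp_def by (subst (asm) sum_nonneg_eq_0_iff) (auto simp: hb_fin)
  then have "\<mu> X = 0" for X
    using dual_expand[OF \<mu>, of X] dual_outside[OF \<mu>, of X] by (cases "X \<in> \<hh>") auto
  then show ?thesis by (simp add: fun_eq_iff zero_fun_apply)
qed

lemma dual_closed: "\<mu> \<in> dual_space \<hh> \<Longrightarrow> \<nu> \<in> dual_space \<hh> \<Longrightarrow> \<mu> + \<nu> \<in> dual_space \<hh>"
  "\<mu> \<in> dual_space \<hh> \<Longrightarrow> \<nu> \<in> dual_space \<hh> \<Longrightarrow> \<mu> - \<nu> \<in> dual_space \<hh>"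
  "\<mu> \<in> dual_space \<hh> \<Longrightarrow> - \<mu> \<in> dual_space \<hh>" "0 \<in> dual_space \<hh>"
  "\<mu> \<in> dual_space \<hh> \<Longrightarrow> scl c \<mu> \<in> dual_space \<hh>"
  by (auto simp: dual_space_def fun_apply algebra_simps)

lemma ipp_simps: "ipp (\<mu> + \<mu>') \<nu> = ipp \<mu> \<nu> + ipp \<mu>' \<nu>" "ipp (\<mu> - \<mu>') \<nu> = ipp \<mu> \<nu> - ipp \<mu>' \<nu>"
  "ipp (scl c \<mu>) \<nu> = c * ipp \<mu> \<nu>" "ipp (- \<mu>) \<nu> = - ipp \<mu> \<nu>" "ipp \<mu> (- \<nu>) = - ipp \<mu> \<nu>"
  by (simp_all add: ipp_def fun_apply algebra_simps sum.distrib sum_subtractf sum_negf sum_distrib_left)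

subsection \<open>Root spaces\<close>

definition gC :: "'n complexified set" where "gC = complexify \<gg>"

text \<open>The complex bilinear, not Hermitian, extension of \<open>B\<close>. Bilinearity keeps
  invariance under the bracket, and positivity is recovered by pairing with
  \<open>cconj\<close>.\<close>

fun BC :: "'n complexified \<Rightarrow> 'n complexified \<Rightarrow> complex" where
  "BC (X, Y) (X', Y') = Complex (B X X' - B Y Y') (B X Y' + B Y X')"

lemma gC_iff: "(X, Y) \<in> gC \<longleftrightarrow> X \<in> \<gg> \<and> Y \<in> \<gg>" by (simp add: gC_def complexify_def)

lemma gC_subspace: "C.subspace gC"
  by (rule C.subspaceI) (auto simp: gC_def complexify_def zero_prod_def intro!: g_intros)

lemma gC_closed: "a \<in> gC \<Longrightarrow> b \<in> gC \<Longrightarrow> a + b \<in> gC" "a \<in> gC \<Longrightarrow> b \<in> gC \<Longrightarrow> a - b \<in> gC"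
  "a \<in> gC \<Longrightarrow> cscale z a \<in> gC" "a \<in> gC \<Longrightarrow> b \<in> gC \<Longrightarrow> cbracket a b \<in> gC" "a \<in> gC \<Longrightarrow> cconj a \<in> gC" "0 \<in> gC"
  using C.subspace_add[OF gC_subspace] C.subspace_diff[OF gC_subspace] C.subspace_scale[OF gC_subspace]
    C.subspace_0[OF gC_subspace]
  by (auto simp: gC_def complexify_def intro!: g_intros)

lemma BC_simps:
  assumes "a \<in> gC" "b \<in> gC" "c \<in> gC"
  shows "BC (a + b) c = BC a c + BC b c" "BC (a - b) c = BC a c - BC b c"
    "BC (cscale z a) c = z * BC a c" "BC a (cscale z c) = z * BC a c" "BC a c = BC c a"
    "BC (cbracket a b) c = - BC b (cbracket a c)"
proof -
  obtain X Y X' Y' X'' Y'' where [simp]: "a = (X, Y)" "b = (X', Y')" "c = (X'', Y'')"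
    by (cases a; cases b; cases c) blast
  have g: "X \<in> \<gg>" "Y \<in> \<gg>" "X' \<in> \<gg>" "Y' \<in> \<gg>" "X'' \<in> \<gg>" "Y'' \<in> \<gg>" using assms by (simp_all add: gC_iff)
  note simps = complex_eq_iff B_simps g_intros g algebra_simps
  show "BC (a + b) c = BC a c + BC b c" by (simp add: simps)
  show "BC (a - b) c = BC a c - BC b c" by (simp add: simps)
  show "BC (cscale z a) c = z * BC a c" by (simp add: simps)
  show "BC a (cscale z c) = z * BC a c" by (simp add: simps)
  show "BC a c = BC c a" using B_sym[of X X''] B_sym[of X Y''] B_sym[of Y X''] B_sym[of Y Y''] g by simp
  show "BC (cbracket a b) c = - BC b (cbracket a c)"
    using B_inv[of X X' X''] B_inv[of X X' Y''] B_inv[of X Y' X''] B_inv[of X Y' Y'']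
      B_inv[of Y X' X''] B_inv[of Y X' Y''] B_inv[of Y Y' X''] B_inv[of Y Y' Y''] by (simp add: simps)
qed

lemma BC_cconj:
  assumes "a \<in> gC"
  shows "BC a (cconj a) = complex_of_real (B (fst a) (fst a) + B (snd a) (snd a))"
    "a \<noteq> 0 \<Longrightarrow> B (fst a) (fst a) + B (snd a) (snd a) > 0"
proof -
  obtain X Y where a: "a = (X, Y)" by (cases a)
  have g: "X \<in> \<gg>" "Y \<in> \<gg>" using assms by (simp_all add: gC_iff a)
  show "BC a (cconj a) = complex_of_real (B (fst a) (fst a) + B (snd a) (snd a))"
    using B_sym[of X Y] g by (simp add: a complex_eq_iff B_simps)
  show "a \<noteq> 0 \<Longrightarrow> B (fst a) (fst a) + B (snd a) (snd a) > 0"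
    using B_pos[of X] B_pos[of Y] B_nonneg[of X] B_nonneg[of Y] g
    by (auto simp: a zero_prod_def intro: add_pos_nonneg add_nonneg_pos)
qed

abbreviation "gs \<equiv> root_space \<gg> \<hh>"

lemma gs_iff: "E \<in> gs \<alpha> \<longleftrightarrow> E \<in> gC \<and> (\<forall>H\<in>\<hh>. cbracket (H, 0) E = cscale (\<i> * complex_of_real (\<alpha> H)) E)"
  by (simp add: root_space_def gC_def)

lemma gs_gC: "E \<in> gs \<alpha> \<Longrightarrow> E \<in> gC" by (simp add: gs_iff)

lemma hC: "H \<in> \<hh> \<Longrightarrow> (H, 0) \<in> gC" by (simp add: gC_iff hgD g_0)

lemma gs_closed: "E \<in> gs \<alpha> \<Longrightarrow> E' \<in> gs \<alpha> \<Longrightarrow> E - E' \<in> gs \<alpha>" "E \<in> gs \<alpha> \<Longrightarrow> cscale z E \<in> gs \<alpha>" "0 \<in> gs \<alpha>"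
  by (auto simp: gs_iff gC_closed cbracket_simps C.scale_right_diff_distrib mult_ac)

lemma gs_cbracket: assumes "E \<in> gs \<alpha>" "E' \<in> gs \<beta>" shows "cbracket E E' \<in> gs (\<alpha> + \<beta>)"
  unfolding gs_iff
proof (intro conjI ballI)
  show "cbracket E E' \<in> gC" using assms by (auto intro: gC_closed gs_gC)
  fix H assume "H \<in> \<hh>"
  then show "cbracket (H, 0) (cbracket E E') = cscale (\<i> * complex_of_real ((\<alpha> + \<beta>) H)) (cbracket E E')"
    using assms by (subst cbracket_jacobi) (simp add: gs_iff cbracket_simps fun_apply C.scale_left_distrib[symmetric] ring_distribs)
qed

lemma gs_cconj: assumes "E \<in> gs \<alpha>" shows "cconj E \<in> gs (- \<alpha>)"
  unfolding gs_iff
proof (intro conjI ballI)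
  show "cconj E \<in> gC" using assms by (auto intro: gC_closed gs_gC)
  fix H assume "H \<in> \<hh>"
  then have "cconj (cbracket (H, 0) E) = cconj (cscale (\<i> * complex_of_real (\<alpha> H)) E)" using assms by (simp add: gs_iff)
  then show "cbracket (H, 0) (cconj E) = cscale (\<i> * complex_of_real ((- \<alpha>) H)) (cconj E)"
    by (simp add: cconj_simps fun_apply)
qed

lemma gs_zero: assumes "E \<in> gs 0" shows "fst E \<in> \<hh>" "snd E \<in> \<hh>"
proof -
  obtain X Y where E: "E = (X, Y)" by (cases E)
  have "lie_bracket H X = 0" "lie_bracket H Y = 0" if "H \<in> \<hh>" for H
    using assms that by (auto simp: gs_iff E fun_apply lie_bracket_simps)
  then show "fst E \<in> \<hh>" "snd E \<in> \<hh>" using h_cent assms by (auto simp: gs_iff E gC_iff)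
qed

text \<open>The operator of \<open>H\<close> is skew for \<open>BC\<close>, and its eigenvalues on
  the two vectors do not cancel.\<close>

lemma BC_orth:
  assumes E: "E \<in> gs \<alpha>" and E': "E' \<in> gs \<beta>" and H: "H \<in> \<hh>" "\<alpha> H + \<beta> H \<noteq> 0"
  shows "BC E E' = 0"
proof -
  have "BC (cbracket (H, 0) E) E' = - BC E (cbracket (H, 0) E')"
    by (rule BC_simps(6)[OF hC[OF H(1)] gs_gC[OF E] gs_gC[OF E']])
  then have "\<i> * complex_of_real (\<alpha> H + \<beta> H) * BC E E' = 0"
    using E E' H(1) BC_simps(3)[OF gs_gC[OF E] gs_gC[OF E] gs_gC[OF E']] BC_simps(4)[OF gs_gC[OF E] gs_gC[OF E] gs_gC[OF E']]
    by (simp add: gs_iff algebra_simps)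
  then show ?thesis using H(2) by (simp del: of_real_add)
qed

text \<open>The bracket has weight 0, so self-centralization places its two components in
  \<open>\<hh>\<close>. There they are determined by their products with \<open>\<hh>\<close>, which
  invariance reduces to \<open>BC E F\<close>.\<close>

lemma gs_bracket_opposite:
  assumes \<alpha>: "\<alpha> \<in> dual_space \<hh>" and E: "E \<in> gs \<alpha>" and F: "F \<in> gs (- \<alpha>)"
  shows "cbracket E F = cscale (\<i> * BC E F) (tt \<alpha>, 0)"
proof -
  have "cbracket E F \<in> gs 0" using gs_cbracket[OF E F] by simp
  note h = gs_zero[OF this]
  obtain U V where UV: "cbracket E F = (U, V)" by (cases "cbracket E F")
  have UVh: "U \<in> \<hh>" "V \<in> \<hh>" using h by (simp_all add: UV)
  define z where "z = \<i> * BC E F"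
  have t: "B U H = Re z * \<alpha> H" "B V H = Im z * \<alpha> H" if H: "H \<in> \<hh>" for H
  proof -
    note m = gs_gC[OF E] gs_gC[OF F] hC[OF H]
    have "BC (U, V) (H, 0) = BC (cbracket E F) (H, 0)" by (simp add: UV)
    also have "\<dots> = - BC F (cbracket E (H, 0))" by (rule BC_simps(6)[OF m])
    also have "cbracket E (H, 0) = cscale (- (\<i> * complex_of_real (\<alpha> H))) E"
      using E H by (subst cbracket_anticomm) (simp add: gs_iff)
    also have "- BC F (cscale (- (\<i> * complex_of_real (\<alpha> H))) E) = \<i> * complex_of_real (\<alpha> H) * BC E F"
      using BC_simps(4)[OF m(2) m(2) m(1)] BC_simps(5)[OF m(1) m(1) m(2)]
      by (simp del: C.scale_minus_left)
    finally have "BC (U, V) (H, 0) = z * complex_of_real (\<alpha> H)" by (simp add: z_def mult_ac)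
    then show "B U H = Re z * \<alpha> H" "B V H = Im z * \<alpha> H"
      using UVh H by (auto simp: complex_eq_iff B_0 hgD)
  qed
  have eq: "W = c *\<^sub>R tt \<alpha>" if W: "W \<in> \<hh>" "\<And>H. H \<in> \<hh> \<Longrightarrow> B W H = c * \<alpha> H" for W c
  proof -
    have "W = (\<Sum>H\<in>hb. B W H *\<^sub>R H)" by (rule h_expand[OF W(1)])
    also have "\<dots> = c *\<^sub>R tt \<alpha>"
      unfolding tt_def scaleR_sum_right using hb(2) W(2) by (intro sum.cong) auto
    finally show ?thesis .
  qed
  show ?thesis using eq[OF UVh(1) t(1)] eq[OF UVh(2) t(2)] by (simp add: UV z_def)
qed

end

context compact_lie
begin

lemma BC_0: "c \<in> gC \<Longrightarrow> BC 0 c = 0"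
  using BC_simps(3)[of c c c 0] by simp

lemma BC_sum:
  assumes "\<And>i. i \<in> A \<Longrightarrow> f i \<in> gC" "c \<in> gC"
  shows "BC (sum f A) c = (\<Sum>i\<in>A. BC (f i) c)"
proof -
  have "sum f A \<in> gC \<and> BC (sum f A) c = (\<Sum>i\<in>A. BC (f i) c)"
    using assms(1)
  proof (induction A rule: infinite_finite_induct)
    case (insert i A)
    then show ?case using BC_simps(1)[of "f i" "sum f A" c] assms(2) by (simp add: gC_closed)
  qed (use assms(2) in \<open>simp_all add: gC_closed BC_0\<close>)
  then show ?thesis by blast
qed

text \<open>Vectors of different weights are orthogonal for the Hermitian form
  \<open>BC a (cconj b)\<close>. One non-zero vector for each weight thus gives a linearly
  independent family in a finite-dimensional space.\<close>

lemma finite_weights_gs: "finite {\<alpha> \<in> dual_space \<hh>. \<exists>E\<in>gs \<alpha>. E \<noteq> 0}"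
proof -
  let ?F = "{\<alpha> \<in> dual_space \<hh>. \<exists>E\<in>gs \<alpha>. E \<noteq> 0}"
  define f where "f \<alpha> = (SOME E. E \<in> gs \<alpha> \<and> E \<noteq> 0)" for \<alpha>
  have f: "f \<alpha> \<in> gs \<alpha>" "f \<alpha> \<noteq> 0" if "\<alpha> \<in> ?F" for \<alpha>
    using someI_ex[of "\<lambda>E. E \<in> gs \<alpha> \<and> E \<noteq> 0"] that unfolding f_def by auto
  have orth: "BC (f \<beta>) (cconj (f \<alpha>)) = 0" if ab: "\<alpha> \<in> ?F" "\<beta> \<in> ?F" "\<alpha> \<noteq> \<beta>" for \<alpha> \<beta>
  proof -
    have "\<alpha> \<in> dual_space \<hh>" "\<beta> \<in> dual_space \<hh>" using ab(1,2) by blast+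
    then obtain H where H: "H \<in> \<hh>" "\<alpha> H \<noteq> \<beta> H" using dual_eqI ab(3) by blast
    show ?thesis
      by (rule BC_orth[OF f(1)[OF ab(2)] gs_cconj[OF f(1)[OF ab(1)]] H(1)]) (use H in \<open>simp add: fun_apply\<close>)
  qed
  have gf: "f \<alpha> \<in> gC" if "\<alpha> \<in> ?F" for \<alpha> using f(1)[OF that] by (rule gs_gC)
  have pos: "BC (f \<alpha>) (cconj (f \<alpha>)) \<noteq> 0" if "\<alpha> \<in> ?F" for \<alpha>
    unfolding BC_cconj(1)[OF gf[OF that]] of_real_eq_0_iff
    using BC_cconj(2)[OF gf[OF that] f(2)[OF that]] by simp
  have inj: "inj_on f ?F"
  proof (rule inj_onI, rule ccontr)
    fix \<alpha> \<beta> assume ab: "\<alpha> \<in> ?F" "\<beta> \<in> ?F" "f \<alpha> = f \<beta>" "\<alpha> \<noteq> \<beta>"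
    show False using orth[OF ab(1,2,4)] pos[OF ab(1)] unfolding ab(3) by simp
  qed
  have ind: "independent (f ` ?F)"
    unfolding dependent_explicit
  proof (rule notI, elim exE conjE bexE)
    fix S u w assume S: "finite S" "S \<subseteq> f ` ?F" "(\<Sum>v\<in>S. u v *\<^sub>R v) = 0" "w \<in> S" "u w \<noteq> 0"
    define A where "A = {\<alpha> \<in> ?F. f \<alpha> \<in> S}"
    have A: "A \<subseteq> ?F" "S = f ` A" using S(2) unfolding A_def by blast+
    have fA: "finite A"
      using S(1) unfolding A(2) by (rule finite_imageD[OF _ inj_on_subset[OF inj A(1)]])
    obtain \<alpha>' where a': "\<alpha>' \<in> A" "w = f \<alpha>'" using S(4) unfolding A(2) by (rule imageE)
    have aF: "\<alpha>' \<in> ?F" using A(1) a'(1) by (rule subsetD)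
    have c: "cconj (f \<alpha>') \<in> gC" using gf[OF aF] by (rule gC_closed)
    have g: "u (f \<beta>) *\<^sub>R f \<beta> \<in> gC" if "\<beta> \<in> A" for \<beta>
      unfolding cscale_of_real[symmetric] by (rule gC_closed(3)[OF gf[OF subsetD[OF A(1) that]]])
    have t: "BC (u (f \<beta>) *\<^sub>R f \<beta>) (cconj (f \<alpha>')) = (if \<beta> = \<alpha>' then u (f \<alpha>') * BC (f \<alpha>') (cconj (f \<alpha>')) else 0)"
      if "\<beta> \<in> A" for \<beta>
    proof -
      have bF: "\<beta> \<in> ?F" using A(1) that by (rule subsetD)
      have "BC (u (f \<beta>) *\<^sub>R f \<beta>) (cconj (f \<alpha>')) = u (f \<beta>) * BC (f \<beta>) (cconj (f \<alpha>'))"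
        unfolding cscale_of_real[symmetric] by (rule BC_simps(3)[OF gf[OF bF] gf[OF bF] c])
      then show ?thesis using orth[OF aF bF] by (cases "\<beta> = \<alpha>'") simp_all
    qed
    have "BC 0 (cconj (f \<alpha>')) = BC (\<Sum>\<beta>\<in>A. u (f \<beta>) *\<^sub>R f \<beta>) (cconj (f \<alpha>'))"
      using S(3) unfolding A(2) sum.reindex[OF inj_on_subset[OF inj A(1)]] by (simp add: o_def)
    also have "\<dots> = (\<Sum>\<beta>\<in>A. BC (u (f \<beta>) *\<^sub>R f \<beta>) (cconj (f \<alpha>')))" by (rule BC_sum[OF g c])
    also have "\<dots> = (\<Sum>\<beta>\<in>A. if \<beta> = \<alpha>' then u (f \<alpha>') * BC (f \<alpha>') (cconj (f \<alpha>')) else 0)"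
      by (rule sum.cong[OF refl t])
    also have "\<dots> = u (f \<alpha>') * BC (f \<alpha>') (cconj (f \<alpha>'))" using fA a'(1) by simp
    finally have "u (f \<alpha>') * BC (f \<alpha>') (cconj (f \<alpha>')) = 0" using BC_0[OF c] by simp
    then show False using pos[OF aF] S(5) a'(2) by simp
  qed
  have "finite (f ` ?F)" using ind by (rule independent_imp_finite)
  then show ?thesis using inj by (rule finite_imageD)
qed

subsection \<open>Root strings\<close>

abbreviation "\<R> \<equiv> roots \<gg> \<hh>"

lemma roots_iff: "\<alpha> \<in> \<R> \<longleftrightarrow> \<alpha> \<in> dual_space \<hh> \<and> \<alpha> \<noteq> 0 \<and> (\<exists>E\<in>gs \<alpha>. E \<noteq> 0)"
  by (simp add: roots_def)

lemma rootD: "\<alpha> \<in> \<R> \<Longrightarrow> \<alpha> \<in> dual_space \<hh>" "\<alpha> \<in> \<R> \<Longrightarrow> \<alpha> \<noteq> 0"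
  by (simp_all add: roots_iff)

lemma finite_roots: "finite \<R>"
  by (rule finite_subset[OF _ finite_weights_gs]) (auto simp: roots_iff)

lemma root_minus: "\<alpha> \<in> \<R> \<Longrightarrow> - \<alpha> \<in> \<R>"
proof -
  assume "\<alpha> \<in> \<R>"
  then obtain E where "\<alpha> \<in> dual_space \<hh>" "\<alpha> \<noteq> 0" "E \<in> gs \<alpha>" "E \<noteq> 0" by (auto simp: roots_iff)
  then show ?thesis
    unfolding roots_iff by (intro conjI bexI[of _ "cconj E"] dual_closed(3) gs_cconj) (simp_all add: cconj_simps)
qed

lemma ipp_nonneg: "ipp \<mu> \<mu> \<ge> 0" by (simp add: ipp_def sum_nonneg)

lemma ipp_root: "\<alpha> \<in> \<R> \<Longrightarrow> ipp \<alpha> \<alpha> > 0"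
  using dual_posdef[of \<alpha>] rootD[of \<alpha>] ipp_nonneg[of \<alpha>] by force

lemma cbracket_tt:
  "v \<in> gs \<gamma> \<Longrightarrow> \<gamma> \<in> dual_space \<hh> \<Longrightarrow> cbracket (tt \<alpha>, 0) v = cscale (\<i> * complex_of_real (ipp \<gamma> \<alpha>)) v"
  by (simp add: gs_iff tt_h dual_tt)

text \<open>Going up from a vector killed by the lowering operator, as in the representation theory of
  \<open>sl\<^sub>2\<close>.\<close>

lemma string_from_bottom:
  assumes \<alpha>: "\<alpha> \<in> \<R>" and E: "E \<in> gs \<alpha>" "E \<noteq> 0"
    and \<gamma>: "\<gamma> \<in> dual_space \<hh>" and v: "v \<in> gs \<gamma>" "v \<noteq> 0" and kill: "cbracket (cconj E) v = 0"
  shows "\<exists>N::nat. 2 * ipp \<gamma> \<alpha> = - real N * ipp \<alpha> \<alpha> \<and> (\<forall>j\<le>N. \<exists>w\<in>gs (\<gamma> + scl (real j) \<alpha>). w \<noteq> 0)"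
proof -
  let ?F = "cconj E"
  have F: "?F \<in> gs (- \<alpha>)" using E(1) by (rule gs_cconj)
  have \<alpha>d: "\<alpha> \<in> dual_space \<hh>" using \<alpha> by (rule rootD)
  define b where "b = B (fst E) (fst E) + B (snd E) (snd E)"
  have b: "BC E ?F = complex_of_real b" "b > 0" using BC_cconj[OF gs_gC[OF E(1)]] E(2) by (simp_all add: b_def)
  define e where "e n = (cbracket E ^^ n) v" for n
  define wt where "wt n = \<gamma> + scl (real n) \<alpha>" for n
  have wt_d: "wt n \<in> dual_space \<hh>" for n unfolding wt_def by (intro dual_closed \<gamma> \<alpha>d)
  have e_gs: "e n \<in> gs (wt n)" for n
  proof (induction n)
    case 0
    have "wt 0 = \<gamma>" by (auto simp: wt_def fun_eq_iff fun_apply)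
    then show ?case using v by (simp add: e_def)
  next
    case (Suc n)
    have "wt (Suc n) = \<alpha> + wt n" by (auto simp: wt_def fun_eq_iff fun_apply algebra_simps)
    then show ?case using gs_cbracket[OF E(1) Suc] by (simp add: e_def)
  qed
  have ip_wt: "ipp (wt n) \<alpha> = ipp \<gamma> \<alpha> + real n * ipp \<alpha> \<alpha>" for n by (simp add: wt_def ipp_simps)
  \<comment> \<open>Moving the lowering operator past \<open>n + 1\<close> raising operators adds up
    \<open>b * ipp (wt k) \<alpha>\<close> for \<open>k = 0, ..., n\<close>; \<open>c n\<close> is
    the closed form.\<close>
  define c where "c n = b * ((real n + 1) * ipp \<gamma> \<alpha> + real n * (real n + 1) / 2 * ipp \<alpha> \<alpha>)" for n
  have step: "cbracket ?F (e (Suc n)) = cbracket E (cbracket ?F (e n)) + cscale (complex_of_real (b * ipp (wt n) \<alpha>)) (e n)" for n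
  proof -
    have "cbracket (cbracket E ?F) (e n) = cscale (\<i> * complex_of_real b) (cbracket (tt \<alpha>, 0) (e n))"
      unfolding gs_bracket_opposite[OF \<alpha>d E(1) F] b(1) cbracket_simps ..
    also have "\<dots> = cscale (- complex_of_real (b * ipp (wt n) \<alpha>)) (e n)"
      unfolding cbracket_tt[OF e_gs wt_d] C.scale_scale by (simp add: algebra_simps flip: mult.assoc)
    finally have "cbracket E (cbracket ?F (e n)) = cscale (- complex_of_real (b * ipp (wt n) \<alpha>)) (e n) + cbracket ?F (cbracket E (e n))"
      unfolding cbracket_jacobi[of E ?F "e n"] by simp
    then show ?thesis by (simp add: e_def)
  qed
  have Fe: "cbracket ?F (e (Suc n)) = cscale (complex_of_real (c n)) (e n)" for n
  proof (induction n)
    case 0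
    have "e 0 = v" by (simp add: e_def)
    then show ?case using step[of 0] by (simp add: kill cbracket_simps c_def ip_wt)
  next
    case (Suc n)
    have "cbracket ?F (e (Suc (Suc n))) = cscale (complex_of_real (c n)) (e (Suc n))
        + cscale (complex_of_real (b * ipp (wt (Suc n)) \<alpha>)) (e (Suc n))"
      unfolding step[of "Suc n"] Suc cbracket_simps by (simp add: e_def)
    also have "\<dots> = cscale (complex_of_real (c n + b * ipp (wt (Suc n)) \<alpha>)) (e (Suc n))"
      by (simp add: C.scale_left_distrib)
    also have "c n + b * ipp (wt (Suc n)) \<alpha> = c (Suc n)" unfolding c_def ip_wt by (simp add: field_simps)
    finally show ?case .
  qed
  \<comment> \<open>The weights of the ladder are distinct, so finiteness of the set of weights
    stops it. At its last non-zero vector the coefficient \<open>c\<close> must vanish, which fixes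
    the product with \<open>\<alpha>\<close>.\<close>
  have "\<exists>n. e n = 0"
  proof (rule ccontr)
    assume "\<nexists>n. e n = 0"
    then have "range wt \<subseteq> {\<alpha> \<in> dual_space \<hh>. \<exists>E\<in>gs \<alpha>. E \<noteq> 0}" using wt_d e_gs by blast
    then have "finite (range wt)" using finite_weights_gs finite_subset by blast
    moreover have "inj wt"
    proof (rule injI)
      fix i j assume "wt i = wt j"
      then have "ipp (wt i) \<alpha> = ipp (wt j) \<alpha>" by (rule arg_cong)
      then have "real i * ipp \<alpha> \<alpha> = real j * ipp \<alpha> \<alpha>" unfolding ip_wt by linarith
      then show "i = j" using ipp_root[OF \<alpha>] by simp
    qed
    ultimately show False using finite_imageD infinite_UNIV_nat by blast
  qed
  define M where "M = (LEAST n. e n = 0)"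
  have M: "e M = 0" "\<And>n. n < M \<Longrightarrow> e n \<noteq> 0"
    using LeastI_ex[OF \<open>\<exists>n. e n = 0\<close>] not_less_Least unfolding M_def by blast+
  have "M \<noteq> 0" using M(1) v(2) by (cases M) (auto simp: e_def)
  then obtain N where N: "M = Suc N" using not0_implies_Suc by blast
  have "cscale (complex_of_real (c N)) (e N) = 0" using Fe[of N] M(1) by (simp add: N cbracket_simps)
  then have "c N = 0" using M(2)[of N] by (simp add: N)
  moreover have "c N = b * ((real N + 1) * (ipp \<gamma> \<alpha> + real N / 2 * ipp \<alpha> \<alpha>))"
    by (simp add: c_def algebra_simps)
  ultimately have "(real N + 1) * (ipp \<gamma> \<alpha> + real N / 2 * ipp \<alpha> \<alpha>) = 0" using b(2) by simp
  then have "ipp \<gamma> \<alpha> + real N / 2 * ipp \<alpha> \<alpha> = 0" by (simp add: add_eq_0_iff2)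
  then have "2 * ipp \<gamma> \<alpha> = - real N * ipp \<alpha> \<alpha>" by simp
  moreover have "\<forall>j\<le>N. \<exists>w\<in>gs (wt j). w \<noteq> 0" using M(2) e_gs unfolding N by (metis le_imp_less_Suc)
  ultimately show ?thesis unfolding wt_def by blast
qed

text \<open>This is ascent for \<open>- \<alpha>\<close>, whose root vector \<open>cconj E\<close>
  has \<open>E\<close> as its conjugate.\<close>

lemma string_from_top:
  assumes \<alpha>: "\<alpha> \<in> \<R>" and E: "E \<in> gs \<alpha>" "E \<noteq> 0"
    and \<gamma>: "\<gamma> \<in> dual_space \<hh>" and v: "v \<in> gs \<gamma>" "v \<noteq> 0" and kill: "cbracket E v = 0"
  shows "\<exists>N::nat. 2 * ipp \<gamma> \<alpha> = real N * ipp \<alpha> \<alpha> \<and> (\<forall>j\<le>N. \<exists>w\<in>gs (\<gamma> - scl (real j) \<alpha>). w \<noteq> 0)"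
proof -
  have "\<gamma> + scl (real j) (- \<alpha>) = \<gamma> - scl (real j) \<alpha>" for j by (auto simp: fun_eq_iff fun_apply)
  then show ?thesis
    using string_from_bottom[OF root_minus[OF \<alpha>] gs_cconj[OF E(1)] _ \<gamma> v] E(2) kill
    by (simp add: cconj_simps ipp_simps)
qed

text \<open>Subtracting a multiple of \<open>E\<close> makes the rest orthogonal to
  \<open>cconj E\<close>, hence killed by lowering. A non-zero rest would be the bottom of a string,
  but its weight \<open>\<alpha>\<close> has positive product with \<open>\<alpha>\<close>.\<close>

lemma root_space_one_dim:
  assumes \<alpha>: "\<alpha> \<in> \<R>" and E: "E \<in> gs \<alpha>" "E \<noteq> 0" and E': "E' \<in> gs \<alpha>"
  shows "\<exists>z. E' = cscale z E"
proof -
  let ?F = "cconj E"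
  have F: "?F \<in> gs (- \<alpha>)" using E(1) by (rule gs_cconj)
  note g = gs_gC[OF E(1)] gs_gC[OF E'] gs_gC[OF F]
  have b: "BC E ?F \<noteq> 0" using BC_cconj[OF g(1)] E(2) by (metis less_irrefl of_real_eq_0_iff)
  define z where "z = BC E' ?F / BC E ?F"
  define E'' where "E'' = E' - cscale z E"
  have E''gs: "E'' \<in> gs \<alpha>" unfolding E''_def by (intro gs_closed E' E)
  have "BC E'' ?F = BC E' ?F - z * BC E ?F"
    unfolding E''_def using BC_simps(2)[OF g(2) gC_closed(3)[OF g(1)] g(3)] BC_simps(3)[OF g(1) g(1) g(3)] by simp
  then have "BC E'' ?F = 0" using b by (simp add: z_def)
  then have "cbracket E'' ?F = 0" using gs_bracket_opposite[OF rootD(1)[OF \<alpha>] E''gs F]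
    by (simp add: zero_prod_def)
  then have k: "cbracket ?F E'' = 0" using cbracket_anticomm[of ?F E''] by simp
  have "E'' = 0"
  proof (rule ccontr)
    assume "E'' \<noteq> 0"
    from string_from_bottom[OF \<alpha> E rootD(1)[OF \<alpha>] E''gs this k]
    obtain N :: nat where "2 * ipp \<alpha> \<alpha> = - real N * ipp \<alpha> \<alpha>" by blast
    then have "(2 + real N) * ipp \<alpha> \<alpha> = 0" by (simp add: algebra_simps)
    then show False using ipp_root[OF \<alpha>] by (auto simp: add_nonneg_eq_0_iff)
  qed
  then show ?thesis unfolding E''_def by auto
qed

text \<open>Lowering is injective on the space of a positive multiple of \<open>\<alpha>\<close>,
  since no such weight is the bottom of a string. From \<open>2 \<alpha>\<close> it leads to a
  multiple of \<open>E\<close> with coefficient zero, as invariance turns its product with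
  \<open>cconj E\<close> into a bracket of \<open>cconj E\<close> with itself. Higher multiples
  descend to this case.\<close>

lemma no_root_multiple:
  assumes \<alpha>: "\<alpha> \<in> \<R>" and k: "k \<ge> (2::nat)"
  shows "scl (real k) \<alpha> \<notin> \<R>"
proof -
  obtain E where E: "E \<in> gs \<alpha>" "E \<noteq> 0" using \<alpha> by (auto simp: roots_iff)
  let ?F = "cconj E"
  have \<alpha>d: "\<alpha> \<in> dual_space \<hh>" using \<alpha> by (rule rootD)
  have F: "?F \<in> gs (- \<alpha>)" using E(1) by (rule gs_cconj)
  have b: "BC E ?F \<noteq> 0" using BC_cconj[OF gs_gC[OF E(1)]] E(2) by (metis less_irrefl of_real_eq_0_iff)
  have kill: "v = 0" if v: "v \<in> gs (scl (real (Suc k)) \<alpha>)" and Fv: "cbracket ?F v = 0" for v k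
  proof (rule ccontr)
    assume "v \<noteq> 0"
    from string_from_bottom[OF \<alpha> E dual_closed(5)[OF \<alpha>d] v this Fv]
    obtain N :: nat where "2 * ipp (scl (real (Suc k)) \<alpha>) \<alpha> = - real N * ipp \<alpha> \<alpha>" by blast
    then have "(2 * real (Suc k) + real N) * ipp \<alpha> \<alpha> = 0" by (simp add: ipp_simps algebra_simps)
    then show False using ipp_root[OF \<alpha>] by (auto simp: add_nonneg_eq_0_iff)
  qed
  have lower: "cbracket ?F v \<in> gs (scl (real k) \<alpha>)" if "v \<in> gs (scl (real (Suc k)) \<alpha>)" for v k
  proof -
    have "- \<alpha> + scl (real (Suc k)) \<alpha> = scl (real k) \<alpha>" by (auto simp: fun_eq_iff fun_apply algebra_simps)
    then show ?thesis using gs_cbracket[OF F that] by simp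
  qed
  have "v = 0" if "v \<in> gs (scl (real k) \<alpha>)" for v
    using k that
  proof (induction k arbitrary: v rule: dec_induct)
    case base
    have s1: "scl (real 1) \<alpha> = \<alpha>" by (auto simp: fun_eq_iff fun_apply)
    have v: "v \<in> gs (scl (real (Suc 1)) \<alpha>)" using base by (simp add: numeral_2_eq_2)
    from lower[OF v] have "cbracket ?F v \<in> gs \<alpha>" unfolding s1 .
    then obtain z where z: "cbracket ?F v = cscale z E" using root_space_one_dim[OF \<alpha> E] by blast
    note g = gs_gC[OF E(1)] gs_gC[OF F] gs_gC[OF v]
    have "z * BC E ?F = BC (cbracket ?F v) ?F" unfolding z by (rule BC_simps(3)[OF g(1,1,2), symmetric])
    also have "\<dots> = - BC v (cbracket ?F ?F)" by (rule BC_simps(6)[OF g(2,3,2)])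
    also have "\<dots> = 0" using BC_simps(4)[OF g(3,3,3), of 0] by (simp add: cbracket_self)
    finally have "z = 0" using b by simp
    then show ?case using kill[OF v] z by simp
  next
    case (step k)
    have "cbracket ?F v = 0" by (rule step.IH[OF lower[OF step.prems]])
    then show ?case by (rule kill[OF step.prems])
  qed
  then show ?thesis by (auto simp: roots_iff)
qed

text \<open>Climb \<open>s\<close> steps from \<open>\<beta>\<close> to the top, then descend. The
  top determines a string of length \<open>N\<close>, so the quotient for \<open>\<beta>\<close> is
  \<open>N - 2 s\<close>, and \<open>j \<le> N - 2 s\<close> keeps the depth \<open>s + j\<close>
  within \<open>N\<close>.\<close>

lemma root_string:
  assumes \<alpha>: "\<alpha> \<in> \<R>" and \<beta>: "\<beta> \<in> \<R>"
  shows "\<exists>n::int. 2 * ipp \<beta> \<alpha> / ipp \<alpha> \<alpha> = of_int n \<and> (\<forall>j::nat. int j \<le> n \<longrightarrow> \<beta> - scl (real j) \<alpha> \<in> \<R> \<union> {0})"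
proof -
  obtain E where E: "E \<in> gs \<alpha>" "E \<noteq> 0" using \<alpha> by (auto simp: roots_iff)
  obtain v where v: "v \<in> gs \<beta>" "v \<noteq> 0" using \<beta> by (auto simp: roots_iff)
  have d: "\<alpha> \<in> dual_space \<hh>" "\<beta> \<in> dual_space \<hh>" using \<alpha> \<beta> rootD by blast+
  have p: "ipp \<alpha> \<alpha> > 0" by (rule ipp_root[OF \<alpha>])
  define e where "e n = (cbracket E ^^ n) v" for n
  define wt where "wt n = \<beta> + scl (real n) \<alpha>" for n
  have wt_d: "wt n \<in> dual_space \<hh>" for n unfolding wt_def by (intro dual_closed d)
  have e_gs: "e n \<in> gs (wt n)" for n
  proof (induction n)
    case 0
    have "wt 0 = \<beta>" by (auto simp: wt_def fun_eq_iff fun_apply)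
    then show ?case using v by (simp add: e_def)
  next
    case (Suc n)
    have "wt (Suc n) = \<alpha> + wt n" by (auto simp: wt_def fun_eq_iff fun_apply algebra_simps)
    then show ?case using gs_cbracket[OF E(1) Suc] by (simp add: e_def)
  qed
  have ip_wt: "ipp (wt n) \<alpha> = ipp \<beta> \<alpha> + real n * ipp \<alpha> \<alpha>" for n by (simp add: wt_def ipp_simps)
  have "\<exists>n. e n = 0"
  proof (rule ccontr)
    assume "\<nexists>n. e n = 0"
    then have "range wt \<subseteq> {\<alpha> \<in> dual_space \<hh>. \<exists>E\<in>gs \<alpha>. E \<noteq> 0}" using wt_d e_gs by blast
    then have "finite (range wt)" using finite_weights_gs finite_subset by blast
    moreover have "inj wt"
    proof (rule injI)
      fix i j assume "wt i = wt j"
      then have "ipp (wt i) \<alpha> = ipp (wt j) \<alpha>" by (rule arg_cong)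
      then have "real i * ipp \<alpha> \<alpha> = real j * ipp \<alpha> \<alpha>" unfolding ip_wt by linarith
      then show "i = j" using p by simp
    qed
    ultimately show False using finite_imageD infinite_UNIV_nat by blast
  qed
  define M where "M = (LEAST n. e n = 0)"
  have M: "e M = 0" "\<And>n. n < M \<Longrightarrow> e n \<noteq> 0"
    using LeastI_ex[OF \<open>\<exists>n. e n = 0\<close>] not_less_Least unfolding M_def by blast+
  have "M \<noteq> 0" using M(1) v(2) by (cases M) (auto simp: e_def)
  then obtain s where s: "M = Suc s" using not0_implies_Suc by blast
  have "cbracket E (e s) = 0" using M(1) by (simp add: s e_def)
  then obtain N :: nat where N: "2 * ipp (wt s) \<alpha> = real N * ipp \<alpha> \<alpha>"
    "\<forall>j\<le>N. \<exists>w\<in>gs (wt s - scl (real j) \<alpha>). w \<noteq> 0"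
    using string_from_top[OF \<alpha> E wt_d e_gs M(2)] s by (metis lessI)
  have "2 * ipp \<beta> \<alpha> = (real N - 2 * real s) * ipp \<alpha> \<alpha>" using N(1) by (simp add: ip_wt algebra_simps)
  then have "2 * ipp \<beta> \<alpha> / ipp \<alpha> \<alpha> = of_int (int N - 2 * int s)" using p by (simp add: field_simps)
  moreover have "\<beta> - scl (real j) \<alpha> \<in> \<R> \<union> {0}" if j: "int j \<le> int N - 2 * int s" for j :: nat
  proof -
    have "s + j \<le> N" using j by linarith
    moreover have "wt s - scl (real (s + j)) \<alpha> = \<beta> - scl (real j) \<alpha>"
      by (auto simp: wt_def fun_eq_iff fun_apply algebra_simps)
    ultimately have "\<exists>w\<in>gs (\<beta> - scl (real j) \<alpha>). w \<noteq> 0" using N(2) by metis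
    moreover have "\<beta> - scl (real j) \<alpha> \<in> dual_space \<hh>" by (intro dual_closed d)
    ultimately show ?thesis unfolding roots_iff Un_iff by blast
  qed
  ultimately show ?thesis by blast
qed

end

subsection \<open>Positive roots and root vectors\<close>

locale compact_lie_pos = compact_lie +
  fixes P :: "'a functional set" and H0 :: "complex ^ 'a ^ 'a"
  assumes H0: "H0 \<in> \<hh>" and H0_reg: "\<alpha> \<in> \<R> \<Longrightarrow> \<alpha> H0 \<noteq> 0" and P_eq: "P = {\<alpha> \<in> \<R>. \<alpha> H0 > 0}"
begin

lemma PR: "\<alpha> \<in> P \<Longrightarrow> \<alpha> \<in> \<R>" by (simp add: P_eq)

lemma P_pos: "\<alpha> \<in> P \<Longrightarrow> \<alpha> H0 > 0" by (simp add: P_eq)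

lemma finite_P: "finite P" using finite_roots by (simp add: P_eq)

lemma roots_split: "P \<union> uminus ` P = \<R>"
proof (intro equalityI subsetI)
  fix \<alpha> assume a: "\<alpha> \<in> \<R>"
  show "\<alpha> \<in> P \<union> uminus ` P"
  proof (cases "\<alpha> H0 > 0")
    case False
    then have "- \<alpha> \<in> P" using root_minus[OF a] H0_reg[OF a] by (simp add: P_eq fun_apply)
    then show ?thesis by (intro UnI2 image_eqI[of _ _ "- \<alpha>"]) simp_all
  qed (simp add: P_eq a)
next
  fix \<alpha> assume "\<alpha> \<in> P \<union> uminus ` P"
  then show "\<alpha> \<in> \<R>" using PR root_minus by auto
qed

abbreviation "reff \<equiv> \<lambda>\<alpha> \<nu>. \<nu> - scl (2 * ipp \<nu> \<alpha> / ipp \<alpha> \<alpha>) \<alpha>"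

sublocale rd: root_data hb "dual_space \<hh>" P H0 ipp reff
proof unfold_locales
  show "finite hb" by (rule hb_fin)
  show "finite P" by (rule finite_P)
  show "P \<subseteq> dual_space \<hh>" using PR rootD by blast
  show "0 \<in> dual_space \<hh>" by (rule dual_closed)
  show "\<mu> + \<nu> \<in> dual_space \<hh>" if "\<mu> \<in> dual_space \<hh>" "\<nu> \<in> dual_space \<hh>" for \<mu> \<nu> using that by (rule dual_closed)
  show "\<nu> = 0" if "\<nu> \<in> dual_space \<hh>" "(\<Sum>x\<in>hb. \<nu> x * \<nu> x) = 0" for \<nu>
    using that unfolding ipp_def[symmetric] by (rule dual_posdef)
  show "\<alpha> H0 > 0" if "\<alpha> \<in> P" for \<alpha> using that by (rule P_pos)
  show "\<exists>n::int. 2 * (\<Sum>x\<in>hb. \<beta> x * \<alpha> x) / (\<Sum>x\<in>hb. \<alpha> x * \<alpha> x) = of_int n \<and>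
      (\<forall>j::nat. int j \<le> n \<longrightarrow> \<beta> - scl (real j) \<alpha> \<in> P \<union> uminus ` P \<union> {0})"
    if "\<alpha> \<in> P \<union> uminus ` P" "\<beta> \<in> P \<union> uminus ` P" for \<alpha> \<beta>
    using root_string that unfolding roots_split ipp_def[symmetric] by blast
  show "scl (real k) \<alpha> \<notin> P" if "\<alpha> \<in> P" "2 \<le> k" for \<alpha> k
    using no_root_multiple[OF PR[OF that(1)] that(2)] PR by blast
qed (simp_all add: ipp_def)

text \<open>One root vector \<open>x + i y\<close> for each positive root. Normalising its real part
  also normalises the imaginary part and makes the pair orthonormal, by
  \<open>gs_norms\<close>.\<close>

definition ev :: "'a functional \<Rightarrow> 'a complexified" where
  "ev \<alpha> = (SOME E. E \<in> gs \<alpha> \<and> B (fst E) (fst E) = 1)"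

definition xv :: "'a functional \<Rightarrow> complex ^ 'a ^ 'a" where "xv \<alpha> = fst (ev \<alpha>)"
definition yv :: "'a functional \<Rightarrow> complex ^ 'a ^ 'a" where "yv \<alpha> = snd (ev \<alpha>)"

text \<open>As \<open>2 \<alpha> H0\<close> is non-zero, \<open>BC E E = 0\<close>; its real and
  imaginary parts are the two claims.\<close>

lemma gs_norms:
  assumes a: "\<alpha> \<in> \<R>" and E: "(X, Y) \<in> gs \<alpha>"
  shows "B X X = B Y Y" "B X Y = 0"
proof -
  have "BC (X, Y) (X, Y) = 0" by (rule BC_orth[OF E E H0]) (use H0_reg[OF a] in simp)
  moreover have "B Y X = B X Y" using gs_gC[OF E] by (intro B_sym) (simp_all add: gC_iff)
  ultimately show "B X X = B Y Y" "B X Y = 0" by (simp_all add: complex_eq_iff)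
qed

lemma ev: assumes a: "\<alpha> \<in> P" shows "(xv \<alpha>, yv \<alpha>) \<in> gs \<alpha>" "B (xv \<alpha>) (xv \<alpha>) = 1"
proof -
  obtain X Y where E: "(X, Y) \<in> gs \<alpha>" "(X, Y) \<noteq> 0" using PR[OF a] by (auto simp: roots_iff)
  have g: "X \<in> \<gg>" "Y \<in> \<gg>" using gs_gC[OF E(1)] by (simp_all add: gC_iff)
  have "B X X > 0"
    using BC_cconj(2)[OF gs_gC[OF E(1)] E(2)] gs_norms(1)[OF PR[OF a] E(1)] by simp
  then have n: "B ((1 / sqrt (B X X)) *\<^sub>R X) ((1 / sqrt (B X X)) *\<^sub>R X) = 1"
    using g by (simp add: B_simps g_scale)
  have "cscale (complex_of_real (1 / sqrt (B X X))) (X, Y) \<in> gs \<alpha>" using E(1) by (rule gs_closed)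
  then have "\<exists>E. E \<in> gs \<alpha> \<and> B (fst E) (fst E) = 1"
    unfolding cscale_of_real using n by (intro exI[of _ "(1 / sqrt (B X X)) *\<^sub>R (X, Y)"]) simp
  from someI_ex[OF this] show "(xv \<alpha>, yv \<alpha>) \<in> gs \<alpha>" "B (xv \<alpha>) (xv \<alpha>) = 1"
    unfolding xv_def yv_def ev_def[symmetric] prod.collapse by blast+
qed

lemma xy_g: "\<alpha> \<in> P \<Longrightarrow> xv \<alpha> \<in> \<gg>" "\<alpha> \<in> P \<Longrightarrow> yv \<alpha> \<in> \<gg>"
proof -
  assume "\<alpha> \<in> P"
  then have "(xv \<alpha>, yv \<alpha>) \<in> gC" by (rule gs_gC[OF ev(1)])
  then show "xv \<alpha> \<in> \<gg>" "yv \<alpha> \<in> \<gg>" unfolding gC_iff by blast+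
qed

lemma xy_norm: "\<alpha> \<in> P \<Longrightarrow> B (xv \<alpha>) (xv \<alpha>) = 1" "\<alpha> \<in> P \<Longrightarrow> B (yv \<alpha>) (yv \<alpha>) = 1"
  "\<alpha> \<in> P \<Longrightarrow> B (xv \<alpha>) (yv \<alpha>) = 0" "\<alpha> \<in> P \<Longrightarrow> B (yv \<alpha>) (xv \<alpha>) = 0"
proof -
  assume a: "\<alpha> \<in> P"
  have "(xv \<alpha>, yv \<alpha>) \<in> gs \<alpha>" using ev(1)[OF a] by simp
  note n = gs_norms[OF PR[OF a] this]
  show "B (xv \<alpha>) (xv \<alpha>) = 1" "B (yv \<alpha>) (yv \<alpha>) = 1" "B (xv \<alpha>) (yv \<alpha>) = 0" "B (yv \<alpha>) (xv \<alpha>) = 0"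
    using ev(2)[OF a] n B_sym[OF xy_g[OF a]] by simp_all
qed

lemma h_bracket_xy:
  assumes "\<alpha> \<in> P" "H \<in> \<hh>"
  shows "lie_bracket H (xv \<alpha>) = - (\<alpha> H *\<^sub>R yv \<alpha>)" "lie_bracket H (yv \<alpha>) = \<alpha> H *\<^sub>R xv \<alpha>"
proof -
  have "cbracket (H, 0) (xv \<alpha>, yv \<alpha>) = cscale (\<i> * complex_of_real (\<alpha> H)) (xv \<alpha>, yv \<alpha>)"
    using ev(1)[OF assms(1)] assms(2) unfolding gs_iff by blast
  then show "lie_bracket H (xv \<alpha>) = - (\<alpha> H *\<^sub>R yv \<alpha>)" "lie_bracket H (yv \<alpha>) = \<alpha> H *\<^sub>R xv \<alpha>"
    by (simp_all add: lie_bracket_simps)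
qed

lemma xy_bracket: assumes a: "\<alpha> \<in> P" shows "lie_bracket (xv \<alpha>) (yv \<alpha>) = - tt \<alpha>"
proof -
  have E: "(xv \<alpha>, yv \<alpha>) \<in> gs \<alpha>" using ev(1)[OF a] by simp
  have "cbracket (xv \<alpha>, yv \<alpha>) (cconj (xv \<alpha>, yv \<alpha>)) = cscale (\<i> * BC (xv \<alpha>, yv \<alpha>) (cconj (xv \<alpha>, yv \<alpha>))) (tt \<alpha>, 0)"
    by (rule gs_bracket_opposite[OF rootD(1)[OF PR[OF a]] E gs_cconj[OF E]])
  moreover have "BC (xv \<alpha>, yv \<alpha>) (cconj (xv \<alpha>, yv \<alpha>)) = 2"
    using BC_cconj(1)[OF gs_gC[OF E]] xy_norm[OF a] by simp
  ultimately have "cbracket (xv \<alpha>, yv \<alpha>) (cconj (xv \<alpha>, yv \<alpha>)) = cscale (\<i> * 2) (tt \<alpha>, 0)" by (simp only:)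
  then have "lie_bracket (xv \<alpha>) (- yv \<alpha>) + lie_bracket (yv \<alpha>) (xv \<alpha>) = 2 *\<^sub>R tt \<alpha>" by simp
  then have "- (2 *\<^sub>R lie_bracket (xv \<alpha>) (yv \<alpha>)) = 2 *\<^sub>R tt \<alpha>"
    using lie_bracket_anticomm[of "yv \<alpha>" "xv \<alpha>"] by (simp add: lie_bracket_simps scaleR_2)
  then have "2 *\<^sub>R (- lie_bracket (xv \<alpha>) (yv \<alpha>)) = 2 *\<^sub>R tt \<alpha>" by simp
  then have "- lie_bracket (xv \<alpha>) (yv \<alpha>) = tt \<alpha>" unfolding scaleR_cancel_left by simp
  then show ?thesis by (metis minus_minus)
qed

lemma xy_orth:
  assumes a: "\<alpha> \<in> P" and b: "\<beta> \<in> P" and ne: "\<alpha> \<noteq> \<beta>"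
  shows "B (xv \<alpha>) (xv \<beta>) = 0" "B (xv \<alpha>) (yv \<beta>) = 0" "B (yv \<alpha>) (xv \<beta>) = 0" "B (yv \<alpha>) (yv \<beta>) = 0"
proof -
  have E: "(xv \<alpha>, yv \<alpha>) \<in> gs \<alpha>" "(xv \<beta>, yv \<beta>) \<in> gs \<beta>" using ev(1) a b by simp_all
  have "BC (xv \<alpha>, yv \<alpha>) (xv \<beta>, yv \<beta>) = 0"
    by (rule BC_orth[OF E H0]) (use P_pos[OF a] P_pos[OF b] in simp)
  moreover obtain H where H: "H \<in> \<hh>" "\<alpha> H \<noteq> \<beta> H"
    using dual_eqI[OF rootD(1)[OF PR[OF a]] rootD(1)[OF PR[OF b]]] ne by blast
  have "BC (xv \<alpha>, yv \<alpha>) (cconj (xv \<beta>, yv \<beta>)) = 0"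
    by (rule BC_orth[OF E(1) gs_cconj[OF E(2)] H(1)]) (use H(2) in \<open>simp add: fun_apply\<close>)
  ultimately show "B (xv \<alpha>) (xv \<beta>) = 0" "B (xv \<alpha>) (yv \<beta>) = 0" "B (yv \<alpha>) (xv \<beta>) = 0" "B (yv \<alpha>) (yv \<beta>) = 0"
    using xy_g[OF a] xy_g[OF b] by (simp_all add: complex_eq_iff B_neg)
qed

lemma h_xy_orth:
  assumes a: "\<alpha> \<in> P" and H: "H \<in> \<hh>"
  shows "B H (xv \<alpha>) = 0" "B H (yv \<alpha>) = 0" "B (xv \<alpha>) H = 0" "B (yv \<alpha>) H = 0"
proof -
  have E: "(xv \<alpha>, yv \<alpha>) \<in> gs \<alpha>" using ev(1)[OF a] by simp
  have H': "(H, 0) \<in> gs 0"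
    unfolding gs_iff using H h_ab by (simp add: hC fun_apply lie_bracket_simps)
  have "BC (H, 0) (xv \<alpha>, yv \<alpha>) = 0"
    by (rule BC_orth[OF H' E H0]) (use P_pos[OF a] in \<open>simp add: fun_apply\<close>)
  then show "B H (xv \<alpha>) = 0" "B H (yv \<alpha>) = 0" "B (xv \<alpha>) H = 0" "B (yv \<alpha>) H = 0"
    using xy_g[OF a] B_sym[of H "xv \<alpha>"] B_sym[of H "yv \<alpha>"] hgD[OF H] by (simp_all add: complex_eq_iff B_0)
qed

definition ob :: "(complex ^ 'a ^ 'a) set" where "ob = hb \<union> xv ` P \<union> yv ` P"

lemma ob_orthonormal: "orthonormal ob"
proof -
  have hh: "H \<in> \<hh>" if "H \<in> hb" for H using that hb(2) by blast
  have sub: "ob \<subseteq> \<gg>" unfolding ob_def using xy_g hh hgD by auto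
  have b: "B x y = (if x = y then 1 else 0)" if x: "x \<in> ob" and y: "y \<in> ob" for x y
  proof -
    have nz: "B x x = 1" if "x \<in> ob" for x
      using that orthonormalD(2)[OF hb(1)] xy_norm unfolding ob_def by auto
    have "B x y = 0" if "x \<noteq> y"
      using x y that unfolding ob_def
    proof (elim UnE imageE)
      show "B x y = 0" if "x \<in> hb" "y \<in> hb" "x \<noteq> y" using orthonormalD(2)[OF hb(1)] that by simp
      show "B x y = 0" if "x \<in> hb" "y = xv \<beta>" "\<beta> \<in> P" for \<beta> using h_xy_orth hh that by simp
      show "B x y = 0" if "x \<in> hb" "y = yv \<beta>" "\<beta> \<in> P" for \<beta> using h_xy_orth hh that by simp
      show "B x y = 0" if "y \<in> hb" "x = xv \<beta>" "\<beta> \<in> P" for \<beta> using h_xy_orth hh that by simp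
      show "B x y = 0" if "y \<in> hb" "x = yv \<beta>" "\<beta> \<in> P" for \<beta> using h_xy_orth hh that by simp
      show "B x y = 0" if "x = xv \<alpha>" "\<alpha> \<in> P" "y = xv \<beta>" "\<beta> \<in> P" "x \<noteq> y" for \<alpha> \<beta>
        using xy_orth(1)[of \<alpha> \<beta>] that by metis
      show "B x y = 0" if "x = xv \<alpha>" "\<alpha> \<in> P" "y = yv \<beta>" "\<beta> \<in> P" for \<alpha> \<beta>
        using xy_orth(2)[of \<alpha> \<beta>] xy_norm(3) that by metis
      show "B x y = 0" if "x = yv \<alpha>" "\<alpha> \<in> P" "y = xv \<beta>" "\<beta> \<in> P" for \<alpha> \<beta>
        using xy_orth(3)[of \<alpha> \<beta>] xy_norm(4) that by metis
      show "B x y = 0" if "x = yv \<alpha>" "\<alpha> \<in> P" "y = yv \<beta>" "\<beta> \<in> P" "x \<noteq> y" for \<alpha> \<beta>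
        using xy_orth(4)[of \<alpha> \<beta>] that by metis
    qed
    then show ?thesis using nz[OF x] by (cases "x = y") simp_all
  qed
  show ?thesis unfolding orthonormal_def using sub b by blast
qed

lemma sum_ob: "(\<Sum>Z\<in>ob. f Z) = (\<Sum>H\<in>hb. f H) + (\<Sum>\<alpha>\<in>P. f (xv \<alpha>) + f (yv \<alpha>))"
  for f :: "complex ^ 'a ^ 'a \<Rightarrow> 'b::ab_group_add"
proof -
  have hh: "H \<in> \<hh>" if "H \<in> hb" for H using that hb(2) by blast
  have injx: "inj_on xv P"
    by (rule inj_onI, rule ccontr) (use xy_orth(1) xy_norm(1) in \<open>metis zero_neq_one\<close>)
  have injy: "inj_on yv P"
    by (rule inj_onI, rule ccontr) (use xy_orth(4) xy_norm(2) in \<open>metis zero_neq_one\<close>)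
  have d1: "hb \<inter> xv ` P = {}"
  proof (rule ccontr)
    assume "hb \<inter> xv ` P \<noteq> {}"
    then obtain \<alpha> where "\<alpha> \<in> P" "xv \<alpha> \<in> hb" by auto
    then show False using h_xy_orth(1)[of \<alpha> "xv \<alpha>"] hh xy_norm(1) by simp
  qed
  have d2: "(hb \<union> xv ` P) \<inter> yv ` P = {}"
  proof (rule ccontr)
    assume "(hb \<union> xv ` P) \<inter> yv ` P \<noteq> {}"
    then obtain \<alpha> where a: "\<alpha> \<in> P" "yv \<alpha> \<in> hb \<or> yv \<alpha> \<in> xv ` P" by auto
    from a(2) show False
    proof
      assume "yv \<alpha> \<in> hb"
      then show False using h_xy_orth(2)[of \<alpha> "yv \<alpha>"] hh xy_norm(2) a(1) by simp
    next
      assume "yv \<alpha> \<in> xv ` P"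
      then obtain \<beta> where "\<beta> \<in> P" "yv \<alpha> = xv \<beta>" by auto
      then show False using xy_orth(2)[of \<beta> \<alpha>] xy_norm(1,3) a(1) by (metis zero_neq_one)
    qed
  qed
  have "(\<Sum>Z\<in>ob. f Z) = (\<Sum>Z\<in>hb \<union> xv ` P. f Z) + (\<Sum>Z\<in>yv ` P. f Z)"
    unfolding ob_def by (rule sum.union_disjoint) (use hb_fin finite_P d2 in auto)
  also have "(\<Sum>Z\<in>hb \<union> xv ` P. f Z) = (\<Sum>Z\<in>hb. f Z) + (\<Sum>Z\<in>xv ` P. f Z)"
    by (rule sum.union_disjoint) (use hb_fin finite_P d1 in auto)
  also have "(\<Sum>Z\<in>xv ` P. f Z) = (\<Sum>\<alpha>\<in>P. f (xv \<alpha>))" using sum.reindex[OF injx, of f] by (simp add: o_def)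
  also have "(\<Sum>Z\<in>yv ` P. f Z) = (\<Sum>\<alpha>\<in>P. f (yv \<alpha>))" using sum.reindex[OF injy, of f] by (simp add: o_def)
  finally show ?thesis by (simp add: sum.distrib add.assoc)
qed

text \<open>Invariance of the span makes its orthogonal complement invariant under
  \<open>\<hh>\<close> as well, so that eigenvectors can be sought in the complement.\<close>

lemma hob_bracket: assumes H: "H \<in> \<hh>" and z: "Z \<in> ob" shows "lie_bracket H Z \<in> span ob"
  using z unfolding ob_def
proof (elim UnE imageE)
  assume "Z \<in> hb"
  then have "lie_bracket H Z = 0" using h_ab[OF H] hb(2) by blast
  then show "lie_bracket H Z \<in> span (hb \<union> xv ` P \<union> yv ` P)" by (simp add: span_zero)
next
  fix \<alpha> assume a: "Z = xv \<alpha>" "\<alpha> \<in> P"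
  have "yv \<alpha> \<in> span (hb \<union> xv ` P \<union> yv ` P)" using a(2) by (intro span_base) simp
  then show "lie_bracket H Z \<in> span (hb \<union> xv ` P \<union> yv ` P)"
    unfolding a(1) h_bracket_xy(1)[OF a(2) H] by (intro span_neg span_scale)
next
  fix \<alpha> assume a: "Z = yv \<alpha>" "\<alpha> \<in> P"
  have "xv \<alpha> \<in> span (hb \<union> xv ` P \<union> yv ` P)" using a(2) by (intro span_base) simp
  then show "lie_bracket H Z \<in> span (hb \<union> xv ` P \<union> yv ` P)"
    unfolding a(1) h_bracket_xy(2)[OF a(2) H] by (intro span_scale)
qed

text \<open>A common eigenvector for the adjoint action on the orthogonal complement of the root vectors
  and \<open>\<hh>\<close> would be a further root vector or centralize \<open>\<hh>\<close>.\<close>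

lemma span_ob: "span ob = \<gg>"
proof (rule ccontr)
  assume "span ob \<noteq> \<gg>"
  then obtain z where z: "z \<in> \<gg>" "z \<notin> span ob" using orthonormal_span[OF ob_orthonormal] by blast
  have obg: "Z \<in> \<gg>" if "Z \<in> ob" for Z using that orthonormalD(1)[OF ob_orthonormal] by blast
  define N where "N = {Z \<in> \<gg>. \<forall>K\<in>ob. B Z K = 0}"
  define w where "w = z - (\<Sum>a\<in>ob. B z a *\<^sub>R a)"
  have "(\<Sum>a\<in>ob. B z a *\<^sub>R a) \<in> span ob" by (intro span_sum span_scale span_base)
  then have w0: "w \<noteq> 0" using z(2) by (auto simp: w_def)
  have wN: "w \<in> N"
    unfolding N_def w_def using orthonormal_perp_part[OF ob_orthonormal z(1)] obg z(1)
    by (auto intro!: g_intros g_sum)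
  have N_span: "B Z A = 0" if Z: "Z \<in> N" and A: "A \<in> span ob" for Z A
  proof -
    have "A = (\<Sum>K\<in>ob. B A K *\<^sub>R K)" by (rule orthonormal_expand[OF ob_orthonormal A])
    then have "B A Z = (\<Sum>K\<in>ob. B (B A K *\<^sub>R K) Z)"
      using B_sum[of ob "\<lambda>K. B A K *\<^sub>R K" Z] obg Z by (auto simp: N_def g_scale)
    also have "\<dots> = 0"
    proof (rule sum.neutral, rule ballI)
      fix O' assume o: "O' \<in> ob"
      then have "B O' Z = 0" using Z B_sym[OF obg[OF o], of Z] by (simp add: N_def)
      then show "B (B A O' *\<^sub>R O') Z = 0" using B_scale[OF obg[OF o], of Z] Z by (simp add: N_def)
    qed
    finally show ?thesis using B_sym[of A Z] A Z orthonormal_span[OF ob_orthonormal] by (auto simp: N_def)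
  qed
  have N_br: "lie_bracket H Z \<in> N" if H: "H \<in> \<hh>" and Z: "Z \<in> N" for H Z
    unfolding N_def
  proof (intro CollectI conjI ballI)
    show "lie_bracket H Z \<in> \<gg>" using Z H by (auto simp: N_def intro: g_br hgD)
    fix O' assume o: "O' \<in> ob"
    have "Z \<in> \<gg>" using Z by (simp add: N_def)
    then have "B (lie_bracket H Z) O' = - B Z (lie_bracket H O')"
      by (rule B_inv[OF hgD[OF H] _ obg[OF o]])
    then show "B (lie_bracket H Z) O' = 0" using N_span[OF Z hob_bracket[OF H o]] by simp
  qed
  have NN: "C.subspace (N \<times> N)"
  proof -
    have "subspace N"
      unfolding subspace_def N_def using obg by (auto intro: g_intros simp: B_simps)
    then show ?thesis
      by (intro C.subspaceI) (auto simp: zero_prod_def subspace_0 subspace_add subspace_diff subspace_scale)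
  qed
  have "\<exists>v\<in>N \<times> N. v \<noteq> 0 \<and> (\<forall>H\<in>hb. \<exists>c. cbracket (H, 0) v = cscale c v)"
  proof (rule common_eigenvector_exists[where U = "N \<times> N" and u = "(w, 0)"])
    show "cbracket (H, 0) v \<in> N \<times> N" if "H \<in> hb" "v \<in> N \<times> N" for H v
      using that N_br hb(2) by (cases v) (auto simp: lie_bracket_simps)
    show "cbracket (H, 0) (cbracket (H', 0) v) = cbracket (H', 0) (cbracket (H, 0) v)"
      if "H \<in> hb" "H' \<in> hb" for H H' v
    proof -
      have "cbracket (H, 0) (H', 0) = 0" using h_ab[of H H'] that hb(2) by (auto simp: lie_bracket_simps zero_prod_def)
      then show ?thesis by (subst cbracket_jacobi) (simp add: cbracket_simps)
    qed
    show "(w, 0) \<in> N \<times> N" using wN NN by (auto simp: C.subspace_def zero_prod_def)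
    show "(w, 0) \<noteq> (0 :: 'a complexified)" using w0 by (simp add: zero_prod_def)
  qed (simp_all add: vector_space_cscale cscale_of_real hb_fin cbracket_simps NN)
  then obtain v c where v: "v \<in> N \<times> N" "v \<noteq> 0" "\<And>H. H \<in> hb \<Longrightarrow> cbracket (H, 0) v = cscale (c H) v" by metis
  obtain X Y where XY: "v = (X, Y)" by (cases v)
  have N: "X \<in> N" "Y \<in> N" using v(1) by (simp_all add: XY)
  then have g: "X \<in> \<gg>" "Y \<in> \<gg>" by (simp_all add: N_def)
  \<comment> \<open>Bracketing with \<open>H\<close> is skew for \<open>B\<close>, so the
    eigenvalues are imaginary and define a real functional.\<close>
  have im: "Re (c H) = 0" if H: "H \<in> hb" for H
  proof -
    have e: "lie_bracket H X = Re (c H) *\<^sub>R X - Im (c H) *\<^sub>R Y" "lie_bracket H Y = Im (c H) *\<^sub>R X + Re (c H) *\<^sub>R Y"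
      using v(3)[OF H] by (simp_all add: XY lie_bracket_simps)
    have Hg: "H \<in> \<gg>" using H hb(2) hgD by blast
    have z: "B (lie_bracket H Z) Z = 0" if "Z \<in> \<gg>" for Z
      using B_inv[OF Hg that that] B_sym[OF that g_br[OF Hg that]] by simp
    have "Re (c H) * B X X - Im (c H) * B Y X = 0" "Im (c H) * B X Y + Re (c H) * B Y Y = 0"
      using z[OF g(1)] z[OF g(2)] g unfolding e by (simp_all add: B_simps g_intros)
    then have "Re (c H) * (B X X + B Y Y) = 0" using B_sym[OF g] by (simp add: algebra_simps)
    moreover have "B X X + B Y Y \<noteq> 0" using BC_cconj(2)[of v] v(2) g by (simp add: XY gC_iff)
    ultimately show ?thesis by simp
  qed
  \<comment> \<open>The eigenvalues on the basis are extended linearly to \<open>\<hh>\<close>, and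
    by 0 outside, as membership in \<open>dual_space\<close> demands.\<close>
  define \<alpha> :: "'a functional" where "\<alpha> H = (if H \<in> \<hh> then \<Sum>K\<in>hb. B H K * Im (c K) else 0)" for H
  have ad: "\<alpha> \<in> dual_space \<hh>"
  proof -
    have hbg: "K \<in> \<gg>" if "K \<in> hb" for K using that hb(2) hgD by blast
    show ?thesis
      unfolding dual_space_def \<alpha>_def
      by (auto simp: subspace_add[OF h_sub] subspace_scale[OF h_sub] B_add B_scale hbg hgD
          ring_distribs sum.distrib sum_distrib_left mult.assoc)
  qed
  have vg: "v \<in> gs \<alpha>"
    unfolding gs_iff
  proof (intro conjI ballI)
    show "v \<in> gC" using g by (simp add: XY gC_iff)
    fix H assume H: "H \<in> \<hh>"
    have Hs: "H = (\<Sum>K\<in>hb. B H K *\<^sub>R K)" by (rule h_expand[OF H])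
    have lin: "cbracket ((\<Sum>K\<in>A. b K *\<^sub>R K), 0) v = (\<Sum>K\<in>A. b K *\<^sub>R cbracket (K, 0) v)" for A and b :: "_ \<Rightarrow> real"
    proof (induction A rule: infinite_finite_induct)
      case (insert K A)
      have e: "((\<Sum>K\<in>insert K A. b K *\<^sub>R K), 0) = b K *\<^sub>R (K, 0) + ((\<Sum>K\<in>A. b K *\<^sub>R K), 0)"
        using insert by simp
      have "cbracket (b K *\<^sub>R (K, 0) + ((\<Sum>K\<in>A. b K *\<^sub>R K), 0)) v
          = b K *\<^sub>R cbracket (K, 0) v + cbracket ((\<Sum>K\<in>A. b K *\<^sub>R K), 0) v"
        by (simp only: cscale_of_real[symmetric] cbracket_simps)
      then show ?case unfolding e insert.IH using insert.hyps by simp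
    qed (simp_all add: cbracket_simps flip: zero_prod_def)
    have "cbracket (H, 0) v = (\<Sum>K\<in>hb. B H K *\<^sub>R cbracket (K, 0) v)" by (subst Hs) (rule lin)
    also have "\<dots> = (\<Sum>K\<in>hb. cscale (\<i> * complex_of_real (B H K * Im (c K))) v)"
    proof (rule sum.cong[OF refl])
      fix K assume K: "K \<in> hb"
      have "c K = \<i> * complex_of_real (Im (c K))" using im[OF K] by (simp add: complex_eq_iff)
      then show "B H K *\<^sub>R cbracket (K, 0) v = cscale (\<i> * complex_of_real (B H K * Im (c K))) v"
        unfolding v(3)[OF K] cscale_of_real[symmetric] by (subst \<open>c K = _\<close>) (simp add: mult_ac)
    qed
    also have "\<dots> = cscale (\<i> * complex_of_real (\<alpha> H)) v"
      using H by (simp add: \<alpha>_def C.scale_sum_left[symmetric] sum_distrib_left)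
    finally show "cbracket (H, 0) v = cscale (\<i> * complex_of_real (\<alpha> H)) v" .
  qed
  have N0: "Z = 0" if "Z \<in> N" "Z \<in> span ob" for Z
    using N_span[OF that] B_eq_0[of Z] that(1) by (simp add: N_def)
  \<comment> \<open>A root space is one-dimensional, so every root vector for a positive root
    already has both components in the span of \<open>ob\<close>. Negative roots are handled below
    by conjugation.\<close>
  have in_ob: "False" if a: "\<beta> \<in> P" and E: "(X', Y') \<in> gs \<beta>" "(X', Y') \<noteq> 0" "X' \<in> N" "Y' \<in> N" for \<beta> X' Y'
  proof -
    have n0: "(xv \<beta>, yv \<beta>) \<noteq> 0" using xy_norm(1)[OF a] B_0(1)[OF g_0] by (auto simp: zero_prod_def)
    obtain z where "(X', Y') = cscale z (xv \<beta>, yv \<beta>)"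
      using root_space_one_dim[OF PR[OF a] ev(1)[OF a] n0 E(1)] by blast
    then have "X' = Re z *\<^sub>R xv \<beta> - Im z *\<^sub>R yv \<beta>" "Y' = Im z *\<^sub>R xv \<beta> + Re z *\<^sub>R yv \<beta>" by simp_all
    moreover have "xv \<beta> \<in> span ob" "yv \<beta> \<in> span ob" using a by (auto simp: ob_def intro: span_base)
    ultimately have "X' \<in> span ob" "Y' \<in> span ob" by (simp_all add: span_add span_diff span_scale)
    then show False using N0 E by (simp add: zero_prod_def)
  qed
  show False
  proof (cases "\<alpha> = 0")
    case True
    then have "X \<in> \<hh>" "Y \<in> \<hh>" using gs_zero[of v] vg by (simp_all add: XY)
    moreover have "\<hh> \<subseteq> span ob" using span_mono[of hb ob] hb(3) by (auto simp: ob_def)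
    ultimately show False using N0 N v(2) by (auto simp: XY zero_prod_def)
  next
    case False
    then have "\<alpha> \<in> \<R>" using ad vg v(2) by (auto simp: roots_iff)
    then have "\<alpha> \<in> P \<or> - \<alpha> \<in> P" using roots_split by auto
    then show False
    proof
      assume "\<alpha> \<in> P"
      then show False using in_ob vg v(2) N by (simp add: XY)
    next
      assume m: "- \<alpha> \<in> P"
      have "(X, - Y) \<in> gs (- \<alpha>)" using gs_cconj[OF vg] by (simp add: XY)
      moreover have "- Y \<in> N" using N(2) g(2) obg by (auto simp: N_def g_neg B_neg)
      moreover have "(X, - Y) \<noteq> 0" using v(2) by (auto simp: XY zero_prod_def)
      ultimately show False using in_ob[OF m _ _ N(1)] by blast
    qed
  qed
qed

lemma g_induct:
  assumes Z: "Z \<in> \<gg>" and S: "subspace S" and h: "\<hh> \<subseteq> S" and xy: "\<And>\<alpha>. \<alpha> \<in> P \<Longrightarrow> xv \<alpha> \<in> S" "\<And>\<alpha>. \<alpha> \<in> P \<Longrightarrow> yv \<alpha> \<in> S"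
  shows "Z \<in> S"
proof -
  have "ob \<subseteq> S" using h hb(2) xy by (auto simp: ob_def)
  then have "span ob \<subseteq> S" using S by (rule span_minimal)
  then show ?thesis using Z span_ob by blast
qed

end

section \<open>Irreducible representations and their characters\<close>

subsection \<open>Weyl reflections as inner automorphisms\<close>

text \<open>The adjoint orbit of \<open>t\<close> under \<open>exp (s x)\<close> is a circle in the plane of \<open>t\<close> and \<open>y\<close>; half a turn
  takes \<open>t\<close> to \<open>- t\<close>.\<close>

lemma exp_half_turn:
  fixes x t y :: "'b :: {real_normed_algebra_1, banach}"
  assumes xy: "x * y - y * x = - t" and xt: "x * t - t * x = a\<^sup>2 *\<^sub>R y" and a: "a > 0"
  shows "exp ((pi / a) *\<^sub>R x) * t = - t * exp ((pi / a) *\<^sub>R x)"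
proof -
  define g where "g s = cos (a * s) *\<^sub>R t + (a * sin (a * s)) *\<^sub>R y" for s
  define g' where "g' s = (- (a * sin (a * s))) *\<^sub>R t + (a * (a * cos (a * s))) *\<^sub>R y" for s
  \<comment> \<open>\<open>g\<close> solves \<open>g' = [x, g]\<close> with \<open>g 0 = t\<close>,
    as does the conjugate of \<open>t\<close> by \<open>exp (s x)\<close>. To compare them,
    \<open>f\<close> conjugates \<open>g\<close> back; it turns out to be constant.\<close>
  define f where "f s = exp (s *\<^sub>R (- x)) * (g s * exp (s *\<^sub>R x))" for s
  have g: "(g has_vector_derivative g' s) (at s)" for s
  proof -
    have "((\<lambda>s. cos (a * s)) has_field_derivative - (a * sin (a * s))) (at s)"
      by (auto intro!: derivative_eq_intros)
    from has_vector_derivative_scaleR[OF this has_vector_derivative_const[of t]]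
    have 1: "((\<lambda>s. cos (a * s) *\<^sub>R t) has_vector_derivative (- (a * sin (a * s))) *\<^sub>R t) (at s)" by simp
    have "((\<lambda>s. a * sin (a * s)) has_field_derivative a * (a * cos (a * s))) (at s)"
      by (auto intro!: derivative_eq_intros)
    from has_vector_derivative_scaleR[OF this has_vector_derivative_const[of y]]
    have 2: "((\<lambda>s. (a * sin (a * s)) *\<^sub>R y) has_vector_derivative (a * (a * cos (a * s))) *\<^sub>R y) (at s)" by simp
    show ?thesis unfolding g_def g'_def by (rule has_vector_derivative_add[OF 1 2])
  qed
  have e1: "((\<lambda>s. exp (s *\<^sub>R (- x))) has_vector_derivative exp (s *\<^sub>R (- x)) * (- x)) (at s)" for s
    by (rule exp_scaleR_has_vector_derivative_right)
  have e2: "((\<lambda>s. exp (s *\<^sub>R x)) has_vector_derivative x * exp (s *\<^sub>R x)) (at s)" for s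
    by (rule exp_scaleR_has_vector_derivative_left)
  have comm: "x * g s - g s * x = g' s" for s
  proof -
    have "x * g s - g s * x = cos (a * s) *\<^sub>R (x * t - t * x) + (a * sin (a * s)) *\<^sub>R (x * y - y * x)"
      unfolding g_def distrib_left distrib_right mult_scaleR_left mult_scaleR_right scaleR_diff_right by simp
    then show ?thesis unfolding xy xt g'_def by (simp add: power2_eq_square mult_ac)
  qed
  have "(f has_vector_derivative 0) (at s)" for s
  proof -
    have "(f has_vector_derivative (exp (s *\<^sub>R (- x)) * (g s * (x * exp (s *\<^sub>R x)) + g' s * exp (s *\<^sub>R x))
        + exp (s *\<^sub>R (- x)) * (- x) * (g s * exp (s *\<^sub>R x)))) (at s)"
      unfolding f_def by (intro has_vector_derivative_mult e1 e2 g)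
    also have "exp (s *\<^sub>R (- x)) * (g s * (x * exp (s *\<^sub>R x)) + g' s * exp (s *\<^sub>R x))
        + exp (s *\<^sub>R (- x)) * (- x) * (g s * exp (s *\<^sub>R x))
        = exp (s *\<^sub>R (- x)) * (g' s - (x * g s - g s * x)) * exp (s *\<^sub>R x)"
      by (simp only: mult.assoc distrib_left distrib_right left_diff_distrib right_diff_distrib minus_mult_left[symmetric] minus_mult_right[symmetric] diff_conv_add_uminus minus_add_distrib minus_minus add_ac)
    finally show ?thesis by (simp add: comm)
  qed
  then obtain c where "\<And>s. f s = c"
    using has_vector_derivative_zero_constant[of UNIV f] by auto
  then have "f (pi / a) = f 0" by simp
  then have "exp (- ((pi / a) *\<^sub>R x)) * (- t * exp ((pi / a) *\<^sub>R x)) = t" using a by (simp add: f_def g_def)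
  then have "exp ((pi / a) *\<^sub>R x) * (exp (- ((pi / a) *\<^sub>R x)) * (- t * exp ((pi / a) *\<^sub>R x))) = exp ((pi / a) *\<^sub>R x) * t"
    by simp
  then show ?thesis by (simp add: mult.assoc[symmetric] exp_minus_inverse)
qed

lemma scaleR_matrix_vector: "((c::real) *\<^sub>R A) *v v = complex_of_real c *s (A *v (v :: complex ^ 'm))"
proof -
  have "((c *\<^sub>R A) *v v) $ i = (complex_of_real c *s (A *v v)) $ i" for i
    unfolding matrix_vector_mult_def vector_smult_component
    by (simp add: scaleR_conv_of_real[where 'a = complex] sum_distrib_left mult.assoc)
  then show ?thesis by (simp add: vec_eq_iff)
qed

lemma lie_bracket_vector: "lie_bracket A C *v v = A *v (C *v v) - C *v (A *v (v :: complex ^ 'm))"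
  by (simp add: lie_bracket_def matrix_vector_mult_diff_rdistrib matrix_vector_mul_assoc)

subsection \<open>Irreducible representations with a highest weight\<close>

locale highest_weight_rep = compact_lie_pos \<gg> \<hh> B P H0
  for \<gg> \<hh> :: "(complex ^ 'a ^ 'a) set" and B P H0 +
  fixes \<pi> :: "complex ^ 'a ^ 'a \<Rightarrow> complex ^ 'm ^ 'm" and \<mu> :: "'a functional" and v0 :: "complex ^ 'm"
  assumes irred: "irreducible_representation \<gg> \<pi>" and \<mu>: "\<mu> \<in> dual_space \<hh>"
    and v0: "v0 \<in> weight_space \<hh> \<pi> \<mu>" "v0 \<noteq> 0"
    and kill: "\<alpha> \<in> P \<Longrightarrow> E \<in> gs \<alpha> \<Longrightarrow> complexified_action \<pi> E v0 = 0"
begin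

abbreviation "ws \<equiv> weight_space \<hh> \<pi>"
abbreviation "ap Z v \<equiv> \<pi> Z *v v"

lemma ap_add: "X \<in> \<gg> \<Longrightarrow> Y \<in> \<gg> \<Longrightarrow> ap (X + Y) v = ap X v + ap Y v"
  using irred by (simp add: irreducible_representation_def lie_representation_def matrix_vector_mult_add_rdistrib)
lemma ap_scale: "X \<in> \<gg> \<Longrightarrow> ap (c *\<^sub>R X) v = complex_of_real c *s ap X v"
  using irred by (simp add: irreducible_representation_def lie_representation_def scaleR_matrix_vector)
lemma rep_br: "X \<in> \<gg> \<Longrightarrow> Y \<in> \<gg> \<Longrightarrow> \<pi> (lie_bracket X Y) = lie_bracket (\<pi> X) (\<pi> Y)"
  using irred by (simp add: irreducible_representation_def lie_representation_def)
lemma ap_br: "X \<in> \<gg> \<Longrightarrow> Y \<in> \<gg> \<Longrightarrow> ap (lie_bracket X Y) v = ap X (ap Y v) - ap Y (ap X v)"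
  by (simp add: rep_br lie_bracket_vector)
lemma ap_0: "ap 0 v = 0" using ap_scale[OF g_0, of 0 v] by simp
lemma ap_neg: "X \<in> \<gg> \<Longrightarrow> ap (- X) v = - ap X v" using ap_scale[of X "- 1" v] by simp
lemma ap_sum: "(\<And>i. i \<in> A \<Longrightarrow> f i \<in> \<gg>) \<Longrightarrow> ap (sum f A) v = (\<Sum>i\<in>A. ap (f i) v)"
  by (induction A rule: infinite_finite_induct) (simp_all add: ap_0 ap_add g_sum)

lemma ap_vec: "ap Z (u + v) = ap Z u + ap Z v" "ap Z (u - v) = ap Z u - ap Z v" "ap Z (c *s v) = c *s ap Z v"
  "ap Z 0 = 0" "ap Z (- v) = - ap Z v"
  using matrix_vector_mult_diff_distrib[of "\<pi> Z" 0 v]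
  by (simp_all add: matrix_vector_right_distrib matrix_vector_mult_diff_distrib vector_scalar_commute)

lemma ap_sum_vec: "ap Z (\<Sum>i\<in>A. f i) = (\<Sum>i\<in>A. ap Z (f i))"
  by (induction A rule: infinite_finite_induct) (simp_all add: ap_vec)

lemma wsD: "v \<in> ws \<nu> \<Longrightarrow> H \<in> \<hh> \<Longrightarrow> ap H v = (\<i> * complex_of_real (\<nu> H)) *s v"
  by (simp add: weight_space_def)

lemma ws_subspace: "vec.subspace (ws \<nu>)"
  by (rule vec.subspaceI) (auto simp: weight_space_def ap_vec vec.scale_right_distrib mult.commute)

text \<open>The complex-linear action of the root vector \<open>x + i y\<close>; \<open>dn\<close>
  is that of its conjugate \<open>x - i y\<close>.\<close>

definition up :: "'a functional \<Rightarrow> complex ^ 'm \<Rightarrow> complex ^ 'm" where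
  "up \<alpha> v = ap (xv \<alpha>) v + \<i> *s ap (yv \<alpha>) v"
definition dn :: "'a functional \<Rightarrow> complex ^ 'm \<Rightarrow> complex ^ 'm" where
  "dn \<alpha> v = ap (xv \<alpha>) v - \<i> *s ap (yv \<alpha>) v"

lemma updn_vec: "up \<alpha> (u + v) = up \<alpha> u + up \<alpha> v" "dn \<alpha> (u + v) = dn \<alpha> u + dn \<alpha> v"
  "up \<alpha> (c *s v) = c *s up \<alpha> v" "dn \<alpha> (c *s v) = c *s dn \<alpha> v" "up \<alpha> 0 = 0" "dn \<alpha> 0 = 0"
  by (simp_all add: up_def dn_def ap_vec vec.scale_right_distrib vec.scale_right_diff_distrib mult.commute algebra_simps)

lemma h_xy_commute:
  assumes "\<alpha> \<in> P" "H \<in> \<hh>"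
  shows "ap H (ap (xv \<alpha>) v) = ap (xv \<alpha>) (ap H v) - complex_of_real (\<alpha> H) *s ap (yv \<alpha>) v"
    "ap H (ap (yv \<alpha>) v) = ap (yv \<alpha>) (ap H v) + complex_of_real (\<alpha> H) *s ap (xv \<alpha>) v"
  using ap_br[OF hgD[OF assms(2)] xy_g(1)[OF assms(1)], of v] ap_br[OF hgD[OF assms(2)] xy_g(2)[OF assms(1)], of v]
  unfolding h_bracket_xy[OF assms]
  by (simp_all add: ap_neg ap_scale xy_g[OF assms(1)] g_scale algebra_simps)

lemma up_ws: assumes a: "\<alpha> \<in> P" and v: "v \<in> ws \<nu>" shows "up \<alpha> v \<in> ws (\<nu> + \<alpha>)"
  unfolding weight_space_def
proof (intro CollectI ballI)
  fix H assume H: "H \<in> \<hh>"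
  show "ap H (up \<alpha> v) = (\<i> * complex_of_real ((\<nu> + \<alpha>) H)) *s up \<alpha> v"
    unfolding up_def ap_vec h_xy_commute[OF a H] wsD[OF v H]
    by (simp add: vec_eq_iff fun_apply algebra_simps flip: mult.assoc)
qed

lemma dn_ws: assumes a: "\<alpha> \<in> P" and v: "v \<in> ws \<nu>" shows "dn \<alpha> v \<in> ws (\<nu> - \<alpha>)"
  unfolding weight_space_def
proof (intro CollectI ballI)
  fix H assume H: "H \<in> \<hh>"
  show "ap H (dn \<alpha> v) = (\<i> * complex_of_real ((\<nu> - \<alpha>) H)) *s dn \<alpha> v"
    unfolding dn_def ap_vec h_xy_commute[OF a H] wsD[OF v H]
    by (simp add: vec_eq_iff fun_apply algebra_simps flip: mult.assoc)
qed

lemma up_v0: "\<alpha> \<in> P \<Longrightarrow> up \<alpha> v0 = 0"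
  using kill[OF _ ev(1), of \<alpha>] by (simp add: up_def)

lemma xy_updn: "ap (xv \<alpha>) v = (1 / 2) *s (up \<alpha> v + dn \<alpha> v)" "ap (yv \<alpha>) v = (\<i> / 2) *s (dn \<alpha> v - up \<alpha> v)"
  by (simp_all add: up_def dn_def vec_eq_iff field_simps flip: mult.assoc)

text \<open>The bracket of \<open>x + i y\<close> with \<open>x - i y\<close> is \<open>2 i\<close>
  times \<open>tt \<alpha>\<close>, and \<open>tt \<alpha>\<close> acts by \<open>i\<close> times
  \<open>ipp \<nu> \<alpha>\<close>; the two factors \<open>i\<close> produce the minus
  sign.\<close>

lemma up_dn_commutator:
  assumes a: "\<alpha> \<in> P" and v: "v \<in> ws \<nu>" and \<nu>: "\<nu> \<in> dual_space \<hh>"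
  shows "up \<alpha> (dn \<alpha> v) = dn \<alpha> (up \<alpha> v) - complex_of_real (2 * ipp \<nu> \<alpha>) *s v"
proof -
  have "ap (lie_bracket (xv \<alpha>) (yv \<alpha>)) v = - (\<i> * complex_of_real (ipp \<nu> \<alpha>)) *s v"
    unfolding xy_bracket[OF a] by (simp add: ap_neg hgD tt_h wsD[OF v] dual_tt[OF \<nu>])
  then have "ap (xv \<alpha>) (ap (yv \<alpha>) v) - ap (yv \<alpha>) (ap (xv \<alpha>) v) = - (\<i> * complex_of_real (ipp \<nu> \<alpha>)) *s v"
    by (simp add: ap_br xy_g[OF a])
  then have "ap (xv \<alpha>) (ap (yv \<alpha>) v) = ap (yv \<alpha>) (ap (xv \<alpha>) v) - (\<i> * complex_of_real (ipp \<nu> \<alpha>)) *s v"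
    by (simp add: algebra_simps)
  then have e: "ap (xv \<alpha>) (ap (yv \<alpha>) v) $ i = ap (yv \<alpha>) (ap (xv \<alpha>) v) $ i - \<i> * complex_of_real (ipp \<nu> \<alpha>) * v $ i" for i
    by simp
  show ?thesis
    unfolding up_def dn_def ap_vec by (simp add: vec_eq_iff e algebra_simps complex_i_mult_minus)
qed

lemma xx_yy: "ap (xv \<alpha>) (ap (xv \<alpha>) v) + ap (yv \<alpha>) (ap (yv \<alpha>) v) = (1 / 2) *s (up \<alpha> (dn \<alpha> v) + dn \<alpha> (up \<alpha> v))"
  unfolding up_def dn_def ap_vec by (simp add: vec_eq_iff field_simps flip: mult.assoc)

subsection \<open>The representation space is spanned by lowered highest weight vectors\<close>

inductive_set lowset :: "(complex ^ 'm) set" where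
  base: "v0 \<in> lowset"
| step: "u \<in> lowset \<Longrightarrow> \<alpha> \<in> P \<Longrightarrow> dn \<alpha> u \<in> lowset"

lemma dn_span: assumes a: "\<alpha> \<in> P" and u: "u \<in> vec.span lowset" shows "dn \<alpha> u \<in> vec.span lowset"
  using u
proof (induction rule: vec.span_induct_alt)
  case (step c x y)
  then show ?case using a
    by (simp add: updn_vec vec.span_add vec.span_scale vec.span_base lowset.step)
qed (simp add: updn_vec vec.span_zero)

text \<open>Moving \<open>Z\<close> past a lowering operator leaves brackets acting on a vector with
  one lowering fewer. The claim must therefore hold for all \<open>Z\<close> simultaneously.\<close>

lemma lowset_invariant: "u \<in> lowset \<Longrightarrow> Z \<in> \<gg> \<Longrightarrow> ap Z u \<in> vec.span lowset"
proof (induction arbitrary: Z rule: lowset.induct)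
  case base
  let ?S = "{Z \<in> \<gg>. ap Z v0 \<in> vec.span lowset}"
  have "Z \<in> ?S"
  proof (rule g_induct[OF base])
    show "subspace ?S"
      unfolding subspace_def
      by (auto simp: g_0 ap_0 vec.span_zero g_add ap_add vec.span_add g_scale ap_scale vec.span_scale)
    have v: "v0 \<in> vec.span lowset" by (intro vec.span_base lowset.base)
    show "\<hh> \<subseteq> ?S" using v by (auto simp: hgD wsD[OF v0(1)] vec.span_scale)
    fix \<alpha> assume a: "\<alpha> \<in> P"
    have d: "dn \<alpha> v0 \<in> vec.span lowset" by (rule dn_span[OF a v])
    show "xv \<alpha> \<in> ?S" using d by (simp add: xy_g[OF a] xy_updn up_v0[OF a] vec.span_scale)
    show "yv \<alpha> \<in> ?S" using d by (simp add: xy_g[OF a] xy_updn up_v0[OF a] vec.span_scale)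
  qed
  then show ?case by simp
next
  case (step u \<alpha>)
  have g: "xv \<alpha> \<in> \<gg>" "yv \<alpha> \<in> \<gg>" using step.hyps xy_g by blast+
  have "ap Z (dn \<alpha> u) = dn \<alpha> (ap Z u) + ap (lie_bracket Z (xv \<alpha>)) u - \<i> *s ap (lie_bracket Z (yv \<alpha>)) u"
    unfolding dn_def ap_vec ap_br[OF step.prems g(1)] ap_br[OF step.prems g(2)]
    by (simp add: vec.scale_right_diff_distrib)
  moreover have "dn \<alpha> (ap Z u) \<in> vec.span lowset" by (rule dn_span[OF step.hyps(2) step.IH[OF step.prems]])
  moreover have "ap (lie_bracket Z (xv \<alpha>)) u \<in> vec.span lowset" "ap (lie_bracket Z (yv \<alpha>)) u \<in> vec.span lowset"
    by (intro step.IH g_br step.prems g)+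
  ultimately show ?case by (simp add: vec.span_add vec.span_diff vec.span_scale)
qed

lemma invariant_UNIV:
  assumes "vec.subspace U" "\<And>Z u. Z \<in> \<gg> \<Longrightarrow> u \<in> U \<Longrightarrow> ap Z u \<in> U" "v0 \<in> U"
  shows "U = UNIV"
  using irred assms v0(2) unfolding irreducible_representation_def by blast

lemma span_lowset: "vec.span lowset = UNIV"
proof (rule invariant_UNIV)
  show "v0 \<in> vec.span lowset" by (intro vec.span_base lowset.base)
  fix Z u assume Z: "Z \<in> \<gg>" and u: "u \<in> vec.span lowset"
  from u show "ap Z u \<in> vec.span lowset"
  proof (induction rule: vec.span_induct_alt)
    case (step c x y)
    then show ?case using Z
      by (simp add: ap_vec vec.span_add vec.span_scale lowset_invariant)
  qed (simp add: ap_vec vec.span_zero)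
qed (rule vec.subspace_span)

text \<open>The last clause records that any lowering moves strictly below \<open>\<mu>\<close>; it
  is the source of multiplicity one for the highest weight.\<close>

lemma lowset_weight:
  "u \<in> lowset \<Longrightarrow> \<exists>\<nu>\<in>dual_space \<hh>. u \<in> ws \<nu> \<and> \<mu> - \<nu> \<in> rd.pos_cone \<and> (u = v0 \<or> \<nu> \<noteq> \<mu>)"
proof (induction rule: lowset.induct)
  case base
  then show ?case using v0 \<mu> by (intro bexI[of _ \<mu>]) (simp_all add: rd.pos_cone_0)
next
  case (step u \<alpha>)
  then obtain \<nu> where n: "\<nu> \<in> dual_space \<hh>" "u \<in> ws \<nu>" "\<mu> - \<nu> \<in> rd.pos_cone" by blast
  have a: "\<alpha> \<in> dual_space \<hh>" using step.hyps PR rootD by blast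
  have e: "\<mu> - (\<nu> - \<alpha>) = (\<mu> - \<nu>) + \<alpha>" by (simp add: algebra_simps)
  have c: "\<mu> - (\<nu> - \<alpha>) \<in> rd.pos_cone"
    unfolding e by (rule rd.pos_cone_add[OF n(3) rd.pos_cone_root[OF step.hyps(2)]])
  have "\<nu> - \<alpha> \<noteq> \<mu>"
  proof
    assume "\<nu> - \<alpha> = \<mu>"
    then have z: "(\<mu> - \<nu>) + \<alpha> = 0" using e by simp
    have "\<mu> - \<nu> = 0" by (rule rd.pos_cone_add_eq_0[OF n(3) rd.pos_cone_root[OF step.hyps(2)] z])
    then have "\<alpha> = 0" using z by simp
    then show False using P_pos[OF step.hyps(2)] by (simp add: fun_apply)
  qed
  then show ?case using dn_ws[OF step.hyps(2) n(2)] c dual_closed(2)[OF n(1) a] by blast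
qed

subsection \<open>A basis of weight vectors and traces\<close>

definition bs :: "(complex ^ 'm) set" where
  "bs = (SOME S. S \<subseteq> lowset \<and> vec.independent S \<and> vec.span S = UNIV)"

lemma bs: "bs \<subseteq> lowset" "vec.independent bs" "vec.span bs = UNIV"
proof -
  obtain S where S: "S \<subseteq> lowset" "vec.independent S" "lowset \<subseteq> vec.span S"
    by (rule vec.maximal_independent_subset)
  have "vec.span lowset \<subseteq> vec.span S" using S(3) by (simp add: vec.span_minimal)
  then have "\<exists>S. S \<subseteq> lowset \<and> vec.independent S \<and> vec.span S = UNIV" using S span_lowset by blast
  from someI_ex[OF this] show "bs \<subseteq> lowset" "vec.independent bs" "vec.span bs = UNIV" by (simp_all add: bs_def)
qed

lemma bs_fin: "finite bs" by (rule vec.finiteI_independent[OF bs(2)])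

definition wt :: "complex ^ 'm \<Rightarrow> 'a functional" where
  "wt b = (SOME \<nu>. \<nu> \<in> dual_space \<hh> \<and> b \<in> ws \<nu> \<and> \<mu> - \<nu> \<in> rd.pos_cone \<and> (b = v0 \<or> \<nu> \<noteq> \<mu>))"

lemma wt: assumes "b \<in> bs" shows "wt b \<in> dual_space \<hh>" "b \<in> ws (wt b)" "\<mu> - wt b \<in> rd.pos_cone" "b = v0 \<or> wt b \<noteq> \<mu>"
proof -
  have "\<exists>\<nu>. \<nu> \<in> dual_space \<hh> \<and> b \<in> ws \<nu> \<and> \<mu> - \<nu> \<in> rd.pos_cone \<and> (b = v0 \<or> \<nu> \<noteq> \<mu>)"
    using lowset_weight[of b] bs(1) assms by blast
  from someI_ex[OF this] show "wt b \<in> dual_space \<hh>" "b \<in> ws (wt b)" "\<mu> - wt b \<in> rd.pos_cone" "b = v0 \<or> wt b \<noteq> \<mu>"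
    unfolding wt_def by blast+
qed

abbreviation "cf \<equiv> vec.representation bs"

lemma cf_lin: "cf (u + v) b = cf u b + cf v b" "cf (c *s v) b = c * cf v b" "cf (u - v) b = cf u b - cf v b"
  "cf (- v) b = - cf v b" "cf 0 b = 0"
  using bs by (simp_all add: vec.representation_add vec.representation_scale vec.representation_diff
      vec.representation_neg vec.representation_zero)

lemma cf_sum: "cf (\<Sum>i\<in>A. f i) b = (\<Sum>i\<in>A. cf (f i) b)"
  by (induction A rule: infinite_finite_induct) (simp_all add: cf_lin)

lemma cf_basis: "b \<in> bs \<Longrightarrow> cf b b' = (if b' = b then 1 else 0)"
  by (simp add: vec.representation_basis[OF bs(2)])

lemma cf_expand: "(\<Sum>b\<in>bs. cf v b *s b) = v"
proof -
  have "(\<Sum>b\<in>bs. cf v b *s b) = (\<Sum>b | cf v b \<noteq> 0. cf v b *s b)"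
    by (rule sum.mono_neutral_right) (use bs_fin vec.representation_ne_zero[of bs v] in auto)
  also have "\<dots> = v" using bs by (intro vec.sum_nonzero_representation_eq) auto
  finally show ?thesis .
qed

lemma cf_linear:
  assumes "\<And>u v. f (u + v) = f u + f v" "\<And>c v. f (c *s v) = c *s f v"
  shows "cf (f v) b = (\<Sum>b'\<in>bs. cf v b' * cf (f b') b)"
proof -
  have "f 0 = 0" using assms(2)[of 0 0] by simp
  then have s: "f (\<Sum>b\<in>A. c b *s b) = (\<Sum>b\<in>A. c b *s f b)" for A and c
    by (induction A rule: infinite_finite_induct) (simp_all add: assms)
  have "cf (f v) b = cf (f (\<Sum>b\<in>bs. cf v b *s b)) b" by (simp add: cf_expand)
  then show ?thesis by (simp add: s cf_sum cf_lin)
qed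

text \<open>Comparing the \<open>b\<close>-coordinate of \<open>ap H u\<close> computed from the
  weight of \<open>u\<close> and from that of \<open>b\<close> leaves no choice but zero.\<close>

lemma cf_ws: assumes u: "u \<in> ws \<nu>" and \<nu>: "\<nu> \<in> dual_space \<hh>" and b: "b \<in> bs" "wt b \<noteq> \<nu>" shows "cf u b = 0"
proof -
  obtain H where H: "H \<in> \<hh>" "wt b H \<noteq> \<nu> H" using dual_eqI[OF wt(1)[OF b(1)] \<nu>] b(2) by blast
  have "cf (ap H u) b = (\<Sum>b'\<in>bs. cf u b' * cf (ap H b') b)" by (rule cf_linear) (simp_all add: ap_vec)
  also have "\<dots> = (\<Sum>b'\<in>bs. if b' = b then \<i> * complex_of_real (wt b H) * cf u b else 0)"
    by (rule sum.cong) (simp_all add: wsD[OF wt(2) H(1)] cf_lin cf_basis)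
  also have "\<dots> = \<i> * complex_of_real (wt b H) * cf u b" using bs_fin b(1) by simp
  finally have "\<i> * complex_of_real (\<nu> H) * cf u b = \<i> * complex_of_real (wt b H) * cf u b"
    by (simp add: wsD[OF u H(1)] cf_lin)
  then show ?thesis using H(2) by simp
qed

definition mult :: "'a functional \<Rightarrow> real" where "mult \<nu> = real (card {b \<in> bs. wt b = \<nu>})"

lemma mult_dim: assumes \<nu>: "\<nu> \<in> dual_space \<hh>" shows "real (vec.dim (ws \<nu>)) = mult \<nu>"
proof -
  let ?S = "{b \<in> bs. wt b = \<nu>}"
  have eq: "ws \<nu> = vec.span ?S"
  proof (intro equalityI subsetI)
    fix u assume u: "u \<in> ws \<nu>"
    have "(\<Sum>b\<in>bs. cf u b *s b) = (\<Sum>b\<in>?S. cf u b *s b)"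
    proof (rule sum.mono_neutral_right[OF bs_fin])
      show "\<forall>b\<in>bs - ?S. cf u b *s b = 0" using cf_ws[OF u \<nu>] by simp
    qed blast
    then have e: "u = (\<Sum>b\<in>?S. cf u b *s b)" unfolding cf_expand .
    have "(\<Sum>b\<in>?S. cf u b *s b) \<in> vec.span ?S"
    proof (rule vec.span_sum)
      show "cf u b *s b \<in> vec.span ?S" if "b \<in> ?S" for b by (rule vec.span_scale[OF vec.span_base[OF that]])
    qed
    then show "u \<in> vec.span ?S" unfolding e[symmetric] .
  next
    fix u assume "u \<in> vec.span ?S"
    moreover have "?S \<subseteq> ws \<nu>" using wt(2) by blast
    ultimately show "u \<in> ws \<nu>" using vec.span_minimal[OF _ ws_subspace, of ?S \<nu>] by blast
  qed
  have "vec.independent ?S" by (rule vec.independent_mono[OF bs(2)]) auto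
  then show ?thesis unfolding mult_def eq by (rule arg_cong[OF vec.dim_span_eq_card_independent])
qed

lemma character_eq: "character \<hh> \<pi> = mult"
proof
  fix \<nu>
  show "character \<hh> \<pi> \<nu> = mult \<nu>"
  proof (cases "\<nu> \<in> dual_space \<hh>")
    case False
    then have e: "{b \<in> bs. wt b = \<nu>} = {}" using wt(1) by blast
    show ?thesis unfolding mult_def e using False by (simp add: character_def)
  qed (simp add: character_def mult_dim)
qed

lemma mult_nz: "mult \<nu> \<noteq> 0 \<Longrightarrow> \<exists>b\<in>bs. wt b = \<nu>"
  by (auto simp: mult_def card_eq_0_iff)

lemma mult_top: "mult \<mu> = 1"
proof -
  have "{b \<in> bs. wt b = \<mu>} \<subseteq> {v0}" using wt(4) by blast
  moreover have "{b \<in> bs. wt b = \<mu>} \<noteq> {}"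
  proof
    assume e: "{b \<in> bs. wt b = \<mu>} = {}"
    have "v0 = (\<Sum>b\<in>bs. cf v0 b *s b)" by (simp add: cf_expand)
    also have "\<dots> = 0"
    proof (rule sum.neutral, rule ballI)
      fix b assume b: "b \<in> bs"
      then have "wt b \<noteq> \<mu>" using e by blast
      then show "cf v0 b *s b = 0" by (simp add: cf_ws[OF v0(1) \<mu> b])
    qed
    finally show False using v0(2) by simp
  qed
  ultimately have "{b \<in> bs. wt b = \<mu>} = {v0}" by blast
  then show ?thesis by (simp add: mult_def)
qed

text \<open>For an operator preserving the weight space, this is its trace there.\<close>

definition tr :: "'a functional \<Rightarrow> (complex ^ 'm \<Rightarrow> complex ^ 'm) \<Rightarrow> complex" where
  "tr \<nu> f = (\<Sum>b | b \<in> bs \<and> wt b = \<nu>. cf (f b) b)"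

text \<open>The identity of the traces of \<open>AB\<close> and \<open>BA\<close>, for maps between
  two neighbouring weight spaces.\<close>

lemma tr_cyclic:
  assumes a: "\<alpha> \<in> P"
  shows "tr (\<nu> + \<alpha>) (\<lambda>v. up \<alpha> (dn \<alpha> v)) = tr \<nu> (\<lambda>v. dn \<alpha> (up \<alpha> v))"
proof -
  have ad: "\<alpha> \<in> dual_space \<hh>" using a PR rootD by blast
  let ?A = "{b \<in> bs. wt b = \<nu> + \<alpha>}" and ?C = "{b \<in> bs. wt b = \<nu>}"
  have 1: "cf (up \<alpha> (dn \<alpha> b)) b = (\<Sum>c\<in>?C. cf (dn \<alpha> b) c * cf (up \<alpha> c) b)" if b: "b \<in> ?A" for b
  proof -
    have "dn \<alpha> b \<in> ws (wt b - \<alpha>)" using dn_ws[OF a wt(2)] b by blast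
    then have "dn \<alpha> b \<in> ws \<nu>" using b by simp
    moreover have "\<nu> \<in> dual_space \<hh>" using dual_closed(2)[OF wt(1) ad, of b] b by simp
    ultimately have z: "cf (dn \<alpha> b) c = 0" if "c \<in> bs" "wt c \<noteq> \<nu>" for c using cf_ws that by blast
    have "cf (up \<alpha> (dn \<alpha> b)) b = (\<Sum>c\<in>bs. cf (dn \<alpha> b) c * cf (up \<alpha> c) b)"
      by (rule cf_linear) (simp_all add: updn_vec)
    also have "\<dots> = (\<Sum>c\<in>?C. cf (dn \<alpha> b) c * cf (up \<alpha> c) b)"
      by (rule sum.mono_neutral_right) (use bs_fin z in auto)
    finally show ?thesis .
  qed
  have 2: "cf (dn \<alpha> (up \<alpha> c)) c = (\<Sum>b\<in>?A. cf (up \<alpha> c) b * cf (dn \<alpha> b) c)" if c: "c \<in> ?C" for c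
  proof -
    have "up \<alpha> c \<in> ws (wt c + \<alpha>)" using up_ws[OF a wt(2)] c by blast
    then have "up \<alpha> c \<in> ws (\<nu> + \<alpha>)" using c by simp
    moreover have "\<nu> + \<alpha> \<in> dual_space \<hh>" using dual_closed(1)[OF wt(1) ad, of c] c by simp
    ultimately have z: "cf (up \<alpha> c) b = 0" if "b \<in> bs" "wt b \<noteq> \<nu> + \<alpha>" for b using cf_ws that by blast
    have "cf (dn \<alpha> (up \<alpha> c)) c = (\<Sum>b\<in>bs. cf (up \<alpha> c) b * cf (dn \<alpha> b) c)"
      by (rule cf_linear) (simp_all add: updn_vec)
    also have "\<dots> = (\<Sum>b\<in>?A. cf (up \<alpha> c) b * cf (dn \<alpha> b) c)"
      by (rule sum.mono_neutral_right) (use bs_fin z in auto)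
    finally show ?thesis .
  qed
  have "tr (\<nu> + \<alpha>) (\<lambda>v. up \<alpha> (dn \<alpha> v)) = (\<Sum>b\<in>?A. \<Sum>c\<in>?C. cf (dn \<alpha> b) c * cf (up \<alpha> c) b)"
    unfolding tr_def by (rule sum.cong) (simp_all add: 1)
  also have "\<dots> = (\<Sum>c\<in>?C. \<Sum>b\<in>?A. cf (up \<alpha> c) b * cf (dn \<alpha> b) c)"
    by (subst sum.swap) (simp add: mult.commute)
  also have "\<dots> = tr \<nu> (\<lambda>v. dn \<alpha> (up \<alpha> v))"
    unfolding tr_def by (rule sum.cong) (simp_all add: 2)
  finally show ?thesis .
qed

text \<open>The factor 1/2 comes from \<open>x^2 + y^2 = (up dn + dn up) / 2\<close>, the minus sign
  from that in \<open>cas\<close>. The trace of \<open>dn up\<close> is the same function one step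
  higher, by cyclicity.\<close>

definition tf :: "'a functional \<Rightarrow> 'a functional \<Rightarrow> real" where
  "tf \<alpha> \<nu> = - Re (tr \<nu> (\<lambda>v. up \<alpha> (dn \<alpha> v))) / 2"

lemma tf_shift: "\<alpha> \<in> P \<Longrightarrow> tf \<alpha> (\<nu> + \<alpha>) = - Re (tr \<nu> (\<lambda>v. dn \<alpha> (up \<alpha> v))) / 2"
  by (simp add: tf_def tr_cyclic)

lemma tf_diff: assumes a: "\<alpha> \<in> P" shows "tf \<alpha> \<nu> - tf \<alpha> (\<nu> + \<alpha>) = ipp \<nu> \<alpha> * mult \<nu>"
proof -
  have "tr \<nu> (\<lambda>v. up \<alpha> (dn \<alpha> v)) - tr \<nu> (\<lambda>v. dn \<alpha> (up \<alpha> v)) = (\<Sum>b | b \<in> bs \<and> wt b = \<nu>. cf (up \<alpha> (dn \<alpha> b)) b - cf (dn \<alpha> (up \<alpha> b)) b)"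
    by (simp add: tr_def sum_subtractf)
  also have "\<dots> = (\<Sum>b | b \<in> bs \<and> wt b = \<nu>. - complex_of_real (2 * ipp \<nu> \<alpha>))"
  proof (rule sum.cong[OF refl])
    fix b assume "b \<in> {b \<in> bs. wt b = \<nu>}"
    then have b: "b \<in> bs" "wt b = \<nu>" by auto
    show "cf (up \<alpha> (dn \<alpha> b)) b - cf (dn \<alpha> (up \<alpha> b)) b = - complex_of_real (2 * ipp \<nu> \<alpha>)"
      using up_dn_commutator[OF a wt(2)[OF b(1)] wt(1)[OF b(1)]] b by (simp add: cf_lin cf_basis)
  qed
  finally have "Re (tr \<nu> (\<lambda>v. up \<alpha> (dn \<alpha> v))) - Re (tr \<nu> (\<lambda>v. dn \<alpha> (up \<alpha> v))) = - (2 * ipp \<nu> \<alpha>) * mult \<nu>"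
    unfolding minus_complex.sel(1)[symmetric] by (simp add: mult_def)
  then show ?thesis unfolding tf_shift[OF a] by (simp add: tf_def field_simps)
qed

subsection \<open>The Casimir operator\<close>

text \<open>The real elements of \<open>\<hh>\<close> have imaginary eigenvalues, so their squares
  are negative; the sign makes this part contribute \<open>ipp \<nu> \<nu>\<close>.\<close>

definition cas :: "complex ^ 'm \<Rightarrow> complex ^ 'm" where "cas v = - (\<Sum>Z\<in>ob. ap Z (ap Z v))"

lemma ob_g: "Z \<in> ob \<Longrightarrow> Z \<in> \<gg>" using orthonormalD(1)[OF ob_orthonormal] by blast

text \<open>In an orthonormal basis, bracketing with \<open>Z\<close> has a skew matrix
  \<open>a\<close>. The two cross terms from moving \<open>Z\<close> past a square differ by
  transposing \<open>a\<close>, and cancel.\<close>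

lemma cas_commute: assumes Z: "Z \<in> \<gg>" shows "ap Z (cas v) = cas (ap Z v)"
proof -
  define a where "a K L = complex_of_real (B (lie_bracket Z K) L)" for K L
  have ap_ob: "ap (lie_bracket Z K) u = (\<Sum>L\<in>ob. a K L *s ap L u)" if K: "K \<in> ob" for K u
  proof -
    have "lie_bracket Z K \<in> span ob" using span_ob g_br[OF Z ob_g[OF K]] by blast
    then have e: "lie_bracket Z K = (\<Sum>L\<in>ob. B (lie_bracket Z K) L *\<^sub>R L)" by (rule orthonormal_expand[OF ob_orthonormal])
    show ?thesis
      unfolding a_def by (subst e) (simp add: ap_sum ap_scale ob_g g_scale)
  qed
  have skew: "a K L = - a L K" if "K \<in> ob" "L \<in> ob" for K L
    using B_inv[OF Z ob_g[OF that(1)] ob_g[OF that(2)]] B_sym[OF ob_g[OF that(1)] g_br[OF Z ob_g[OF that(2)]]]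
    by (simp add: a_def)
  have "ap Z (\<Sum>K\<in>ob. ap K (ap K v)) = (\<Sum>K\<in>ob. ap Z (ap K (ap K v)))"
    by (rule ap_sum_vec)
  also have "\<dots> = (\<Sum>K\<in>ob. ap K (ap K (ap Z v)) + (ap K (ap (lie_bracket Z K) v) + ap (lie_bracket Z K) (ap K v)))"
    by (rule sum.cong) (simp_all add: ap_br Z ob_g ap_vec)
  also have "\<dots> = (\<Sum>K\<in>ob. ap K (ap K (ap Z v))) + ((\<Sum>K\<in>ob. \<Sum>L\<in>ob. a K L *s ap K (ap L v)) + (\<Sum>K\<in>ob. \<Sum>L\<in>ob. a K L *s ap L (ap K v)))"
    by (simp add: sum.distrib ap_ob ap_sum_vec ap_vec)
  also have "(\<Sum>K\<in>ob. \<Sum>L\<in>ob. a K L *s ap L (ap K v)) = (\<Sum>L\<in>ob. \<Sum>K\<in>ob. a K L *s ap L (ap K v))"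
    by (rule sum.swap)
  also have "(\<Sum>L\<in>ob. \<Sum>K\<in>ob. a K L *s ap L (ap K v)) = - (\<Sum>L\<in>ob. \<Sum>K\<in>ob. a L K *s ap L (ap K v))"
    unfolding sum_negf[symmetric]
  proof (intro sum.cong refl)
    fix L K assume "L \<in> ob" "K \<in> ob"
    then show "a K L *s ap L (ap K v) = - (a L K *s ap L (ap K v))" using skew[of K L] by simp
  qed
  finally show ?thesis by (simp add: cas_def ap_vec)
qed

definition cval :: real where "cval = ipp \<mu> \<mu> + (\<Sum>\<alpha>\<in>P. ipp \<mu> \<alpha>)"

lemma cas_ws:
  assumes v: "v \<in> ws \<nu>"
  shows "cas v = complex_of_real (ipp \<nu> \<nu>) *s v - (\<Sum>\<alpha>\<in>P. (1 / 2) *s (up \<alpha> (dn \<alpha> v) + dn \<alpha> (up \<alpha> v)))"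
proof -
  have "(\<Sum>H\<in>hb. ap H (ap H v)) = (\<Sum>H\<in>hb. - complex_of_real (\<nu> H * \<nu> H) *s v)"
  proof (rule sum.cong[OF refl])
    fix H assume "H \<in> hb"
    then have H: "H \<in> \<hh>" using hb(2) by blast
    show "ap H (ap H v) = - complex_of_real (\<nu> H * \<nu> H) *s v"
      unfolding wsD[OF v H] ap_vec vec.scale_scale by (rule arg_cong[where f = "\<lambda>c. c *s v"]) (simp add: complex_eq_iff)
  qed
  also have "\<dots> = - complex_of_real (ipp \<nu> \<nu>) *s v"
    unfolding ipp_def of_real_sum sum_negf[symmetric] vec.scale_sum_left ..
  finally have h: "(\<Sum>H\<in>hb. ap H (ap H v)) = - (complex_of_real (ipp \<nu> \<nu>) *s v)" by simp
  show ?thesis unfolding cas_def sum_ob xx_yy h by simp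
qed

text \<open>The eigenspace for \<open>cval\<close> is invariant. It contains \<open>v0\<close>,
  where raising gives zero and only the commutators of the root operators remain.\<close>

lemma cas_scalar: "cas v = complex_of_real cval *s v"
proof -
  let ?U = "{v. cas v = complex_of_real cval *s v}"
  have lin: "cas (u + v) = cas u + cas v" "cas (c *s v) = c *s cas v" for u v c
    by (simp_all add: cas_def ap_vec sum.distrib vec.scale_sum_right)
  have "?U = UNIV"
  proof (rule invariant_UNIV)
    have "cas 0 = 0" using lin(2)[of 0 0] by simp
    then show "vec.subspace ?U"
      by (intro vec.subspaceI) (auto simp: lin vec.scale_right_distrib mult.commute)
    show "ap Z u \<in> ?U" if "Z \<in> \<gg>" "u \<in> ?U" for Z u
      using that cas_commute[OF that(1), of u] by (simp add: ap_vec)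
    have "(\<Sum>\<alpha>\<in>P. (1 / 2) *s (up \<alpha> (dn \<alpha> v0) + dn \<alpha> (up \<alpha> v0))) = (\<Sum>\<alpha>\<in>P. - complex_of_real (ipp \<mu> \<alpha>) *s v0)"
      by (rule sum.cong) (simp_all add: up_dn_commutator[OF _ v0(1) \<mu>] up_v0 updn_vec)
    also have "\<dots> = - complex_of_real (\<Sum>\<alpha>\<in>P. ipp \<mu> \<alpha>) *s v0"
      unfolding of_real_sum sum_negf[symmetric] vec.scale_sum_left ..
    finally have "cas v0 = complex_of_real (ipp \<mu> \<mu>) *s v0 - (- complex_of_real (\<Sum>\<alpha>\<in>P. ipp \<mu> \<alpha>)) *s v0"
      using cas_ws[OF v0(1)] by simp
    also have "\<dots> = complex_of_real cval *s v0"
      unfolding vec.scale_left_diff_distrib[symmetric] cval_def by simp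
    finally show "v0 \<in> ?U" by simp
  qed
  then show ?thesis by blast
qed

text \<open>Both sides are traces of the Casimir operator on one weight space: as a scalar, and by
  its expansion in raising and lowering operators.\<close>

lemma freudenthal: "cval * mult \<nu> = ipp \<nu> \<nu> * mult \<nu> + (\<Sum>\<alpha>\<in>P. tf \<alpha> \<nu> + tf \<alpha> (\<nu> + \<alpha>))"
proof -
  let ?S = "{b \<in> bs. wt b = \<nu>}"
  have b: "complex_of_real cval = complex_of_real (ipp \<nu> \<nu>) - (\<Sum>\<alpha>\<in>P. (1 / 2) * (cf (up \<alpha> (dn \<alpha> b)) b + cf (dn \<alpha> (up \<alpha> b)) b))"
    if "b \<in> ?S" for b
  proof -
    have "b \<in> bs" "b \<in> ws \<nu>" using that wt(2) by auto
    then have "cf (complex_of_real cval *s b) b = cf (complex_of_real (ipp \<nu> \<nu>) *s b - (\<Sum>\<alpha>\<in>P. (1 / 2) *s (up \<alpha> (dn \<alpha> b) + dn \<alpha> (up \<alpha> b)))) b"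
      using cas_scalar[of b] cas_ws[of b \<nu>] by simp
    then show ?thesis using \<open>b \<in> bs\<close> by (simp only: cf_lin cf_sum) (simp add: cf_basis)
  qed
  have "(\<Sum>b\<in>?S. complex_of_real cval) = (\<Sum>b\<in>?S. complex_of_real (ipp \<nu> \<nu>) - (\<Sum>\<alpha>\<in>P. (1 / 2) * (cf (up \<alpha> (dn \<alpha> b)) b + cf (dn \<alpha> (up \<alpha> b)) b)))"
    by (rule sum.cong[OF refl b])
  also have "\<dots> = (\<Sum>b\<in>?S. complex_of_real (ipp \<nu> \<nu>)) - (\<Sum>\<alpha>\<in>P. (1 / 2) * (tr \<nu> (\<lambda>v. up \<alpha> (dn \<alpha> v)) + tr \<nu> (\<lambda>v. dn \<alpha> (up \<alpha> v))))"
    unfolding sum_subtractf tr_def by (subst sum.swap) (simp add: sum_divide_distrib[symmetric] sum.distrib)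
  finally have "Re (\<Sum>b\<in>?S. complex_of_real cval) = Re ((\<Sum>b\<in>?S. complex_of_real (ipp \<nu> \<nu>)) - (\<Sum>\<alpha>\<in>P. (1 / 2) * (tr \<nu> (\<lambda>v. up \<alpha> (dn \<alpha> v)) + tr \<nu> (\<lambda>v. dn \<alpha> (up \<alpha> v)))))"
    by (rule arg_cong)
  then have "cval * mult \<nu> = ipp \<nu> \<nu> * mult \<nu> - (\<Sum>\<alpha>\<in>P. (Re (tr \<nu> (\<lambda>v. up \<alpha> (dn \<alpha> v))) + Re (tr \<nu> (\<lambda>v. dn \<alpha> (up \<alpha> v)))) / 2)"
    by (simp add: mult_def mult.commute)
  also have "\<dots> = ipp \<nu> \<nu> * mult \<nu> + (\<Sum>\<alpha>\<in>P. tf \<alpha> \<nu> + tf \<alpha> (\<nu> + \<alpha>))"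
    unfolding diff_conv_add_uminus sum_negf[symmetric]
  proof (intro arg_cong2[where f = "(+)"] refl sum.cong)
    fix \<alpha> assume a: "\<alpha> \<in> P"
    show "- ((Re (tr \<nu> (\<lambda>v. up \<alpha> (dn \<alpha> v))) + Re (tr \<nu> (\<lambda>v. dn \<alpha> (up \<alpha> v)))) / 2) = tf \<alpha> \<nu> + tf \<alpha> (\<nu> + \<alpha>)"
      unfolding tf_shift[OF a] by (simp add: tf_def add_divide_distrib)
  qed
  finally show ?thesis .
qed

lemma finite_mult: "finite {\<nu>. mult \<nu> \<noteq> 0}"
  by (rule finite_subset[of _ "wt ` bs"]) (use mult_nz bs_fin in auto)

lemma finite_tf: "finite {\<nu>. tf \<alpha> \<nu> \<noteq> 0}"
proof (rule finite_subset[of _ "wt ` bs"])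
  show "{\<nu>. tf \<alpha> \<nu> \<noteq> 0} \<subseteq> wt ` bs"
  proof (rule subsetI, rule ccontr)
    fix \<nu> assume "\<nu> \<in> {\<nu>. tf \<alpha> \<nu> \<noteq> 0}" "\<nu> \<notin> wt ` bs"
    then have e: "{b. b \<in> bs \<and> wt b = \<nu>} = {}" and nz: "tf \<alpha> \<nu> \<noteq> 0" by auto
    from nz show False unfolding tf_def tr_def e by simp
  qed
qed (simp add: bs_fin)

lemma mult_cone: "mult \<nu> \<noteq> 0 \<Longrightarrow> \<mu> - \<nu> \<in> rd.pos_cone"
  using mult_nz wt(3) by blast

end

context highest_weight_rep
begin

text \<open>The inner automorphism given by half a turn in the plane of \<open>tt \<alpha>\<close> and \<open>yv \<alpha>\<close> induces the reflection
  in \<open>\<alpha>\<close> on \<open>\<hh>\<close>, so it permutes the weight spaces accordingly.\<close>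

lemma dim_ws_ref:
  assumes a: "\<alpha> \<in> P" and \<nu>: "\<nu> \<in> dual_space \<hh>"
  shows "vec.dim (ws \<nu>) \<le> vec.dim (ws (reff \<alpha> \<nu>))"
proof -
  have ad: "\<alpha> \<in> dual_space \<hh>" using a PR rootD by blast
  have p: "ipp \<alpha> \<alpha> > 0" by (rule ipp_root[OF PR[OF a]])
  \<comment> \<open>Bracketing twice with \<open>xv \<alpha>\<close> multiplies
    \<open>tt \<alpha>\<close> by \<open>- ipp \<alpha> \<alpha>\<close>; the square root is the
    angular speed, and this parameter is half a period.\<close>
  define M where "M = mat_exp ((pi / sqrt (ipp \<alpha> \<alpha>)) *\<^sub>R \<pi> (xv \<alpha>))"
  have g: "xv \<alpha> \<in> \<gg>" "yv \<alpha> \<in> \<gg>" "tt \<alpha> \<in> \<gg>" using xy_g[OF a] tt_h hgD by blast+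
  have rs: "\<pi> (c *\<^sub>R X) = c *\<^sub>R \<pi> X" if "X \<in> \<gg>" for c X
    using irred that by (simp add: irreducible_representation_def lie_representation_def)
  let ?x = "endo_of (\<pi> (xv \<alpha>))" and ?y = "endo_of (\<pi> (yv \<alpha>))" and ?t = "endo_of (\<pi> (tt \<alpha>))"
  have xy: "?x * ?y - ?y * ?x = - ?t"
  proof -
    have "endo_of (lie_bracket (\<pi> (xv \<alpha>)) (\<pi> (yv \<alpha>))) = endo_of (\<pi> ((- 1) *\<^sub>R tt \<alpha>))"
      using rep_br[OF g(1,2)] xy_bracket[OF a] by simp
    then show ?thesis unfolding rs[OF g(3)] by (simp add: lie_bracket_def endo_of_simps endo_of_mult)
  qed
  have xt: "?x * ?t - ?t * ?x = (sqrt (ipp \<alpha> \<alpha>))\<^sup>2 *\<^sub>R ?y"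
  proof -
    have "lie_bracket (xv \<alpha>) (tt \<alpha>) = ipp \<alpha> \<alpha> *\<^sub>R yv \<alpha>"
      using lie_bracket_anticomm[of "xv \<alpha>" "tt \<alpha>"] h_bracket_xy(1)[OF a tt_h, of \<alpha>] dual_tt[OF ad, of \<alpha>] by simp
    then have "endo_of (lie_bracket (\<pi> (xv \<alpha>)) (\<pi> (tt \<alpha>))) = endo_of (\<pi> (ipp \<alpha> \<alpha> *\<^sub>R yv \<alpha>))"
      using rep_br[OF g(1,3)] by simp
    then show ?thesis using p unfolding rs[OF g(2)] by (simp add: lie_bracket_def endo_of_simps endo_of_mult)
  qed
  have "exp ((pi / sqrt (ipp \<alpha> \<alpha>)) *\<^sub>R ?x) * ?t = - ?t * exp ((pi / sqrt (ipp \<alpha> \<alpha>)) *\<^sub>R ?x)"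
    by (rule exp_half_turn[OF xy xt]) (use p in simp)
  then have "endo_of (M ** \<pi> (tt \<alpha>)) = endo_of (- (\<pi> (tt \<alpha>) ** M))"
    by (simp add: M_def endo_of_mult endo_of_mat_exp endo_of_simps)
  then have "M ** \<pi> (tt \<alpha>) = - (\<pi> (tt \<alpha>) ** M)" by (rule endo_of_eqD)
  then have Mt: "ap (tt \<alpha>) (M *v v) = - (M *v ap (tt \<alpha>) v)" for v
  proof -
    have "M *v ap (tt \<alpha>) v = (M ** \<pi> (tt \<alpha>)) *v v" by (simp add: matrix_vector_mul_assoc)
    also have "\<dots> = ((- 1 :: real) *\<^sub>R (\<pi> (tt \<alpha>) ** M)) *v v" using \<open>M ** \<pi> (tt \<alpha>) = _\<close> by simp
    also have "\<dots> = - ap (tt \<alpha>) (M *v v)" unfolding scaleR_matrix_vector by (simp add: matrix_vector_mul_assoc)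
    finally show ?thesis by simp
  qed
  have MK: "ap K (M *v v) = M *v ap K v" if K: "K \<in> \<hh>" "\<alpha> K = 0" for K v
  proof -
    have "lie_bracket K (xv \<alpha>) = 0" using h_bracket_xy(1)[OF a K(1)] K(2) by simp
    then have "lie_bracket (\<pi> K) (\<pi> (xv \<alpha>)) = \<pi> ((0::real) *\<^sub>R 0)" using rep_br[OF hgD[OF K(1)] g(1)] by simp
    then have "\<pi> (xv \<alpha>) ** \<pi> K = \<pi> K ** \<pi> (xv \<alpha>)" unfolding rs[OF g_0] by (simp add: lie_bracket_def)
    then have "M ** \<pi> K = \<pi> K ** M" unfolding M_def by (rule exp_commute_of_commute)
    then show ?thesis by (simp add: matrix_vector_mul_assoc)
  qed
  have sub: "(*v) M ` ws \<nu> \<subseteq> ws (reff \<alpha> \<nu>)"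
  proof (rule image_subsetI, unfold weight_space_def, intro CollectI ballI)
    fix v H assume "v \<in> {v. \<forall>H\<in>\<hh>. ap H v = (\<i> * complex_of_real (\<nu> H)) *s v}" and H: "H \<in> \<hh>"
    then have v: "v \<in> ws \<nu>" by (simp add: weight_space_def)
    define c where "c = \<alpha> H / ipp \<alpha> \<alpha>"
    \<comment> \<open>\<open>H\<close> splits into a part in the kernel of \<open>\<alpha>\<close>,
      which commutes with \<open>M\<close>, and a multiple of \<open>tt \<alpha>\<close>, which
      \<open>M\<close> reverses.\<close>
    define K where "K = H - c *\<^sub>R tt \<alpha>"
    have ct: "c *\<^sub>R tt \<alpha> \<in> \<hh>" by (intro subspace_scale[OF h_sub] tt_h)
    have Kh: "K \<in> \<hh>" unfolding K_def by (intro subspace_diff[OF h_sub] H ct)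
    have lin: "\<gamma> H = \<gamma> K + c * ipp \<gamma> \<alpha>" if "\<gamma> \<in> dual_space \<hh>" for \<gamma>
      using dual_linear(1)[OF that Kh ct] dual_linear(2)[OF that tt_h tt_h, of c] dual_tt[OF that, of \<alpha>] by (simp add: K_def)
    have "\<alpha> K = 0" using lin[OF ad] p by (simp add: c_def)
    note MK = MK[OF Kh this]
    have "ap H (M *v v) = ap K (M *v v) + complex_of_real c *s ap (tt \<alpha>) (M *v v)"
      using ap_add[OF hgD[OF Kh] hgD[OF ct], of "M *v v"] ap_scale[OF g(3)] by (simp add: K_def)
    also have "\<dots> = M *v ap K v - complex_of_real c *s (M *v ap (tt \<alpha>) v)" unfolding MK Mt by simp
    also have "\<dots> = (\<i> * complex_of_real (\<nu> K)) *s (M *v v) - (complex_of_real c * (\<i> * complex_of_real (ipp \<nu> \<alpha>))) *s (M *v v)"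
      unfolding wsD[OF v Kh] wsD[OF v tt_h] dual_tt[OF \<nu>] vector_scalar_commute vec.scale_scale ..
    also have "\<dots> = (\<i> * complex_of_real ((reff \<alpha> \<nu>) H)) *s (M *v v)"
      unfolding vec.scale_left_diff_distrib[symmetric]
      by (rule arg_cong[where f = "\<lambda>z. z *s (M *v v)"])
         (simp add: complex_eq_iff fun_apply lin[OF \<nu>] c_def)
    finally show "ap H (M *v v) = (\<i> * complex_of_real ((reff \<alpha> \<nu>) H)) *s (M *v v)" .
  qed
  have inj: "inj ((*v) M)"
  proof (rule injI)
    fix u v assume "M *v u = M *v v"
    then have "mat_exp (- ((pi / sqrt (ipp \<alpha> \<alpha>)) *\<^sub>R \<pi> (xv \<alpha>))) *v (M *v u) = mat_exp (- ((pi / sqrt (ipp \<alpha> \<alpha>)) *\<^sub>R \<pi> (xv \<alpha>))) *v (M *v v)"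
      by simp
    then show "u = v" unfolding M_def matrix_vector_mul_assoc mat_exp_minus by simp
  qed
  have "vec.dim (ws \<nu>) = vec.dim ((*v) M ` ws \<nu>)"
    by (rule vec.dim_image_eq[symmetric, OF matrix_vector_mul_linear_gen inj_on_subset[OF inj]]) simp
  also have "\<dots> \<le> vec.dim (ws (reff \<alpha> \<nu>))" by (rule vec.dim_subset[OF sub])
  finally show ?thesis .
qed

lemma reff_dual: "\<alpha> \<in> P \<Longrightarrow> \<nu> \<in> dual_space \<hh> \<Longrightarrow> reff \<alpha> \<nu> \<in> dual_space \<hh>"
  by (rule dual_closed(2)[OF _ dual_closed(5)[OF rootD(1)[OF PR]]])

text \<open>The inequality of dimensions, applied to \<open>\<nu>\<close> and to its reflection,
  gives equality since the reflection is an involution. Outside the dual space both multiplicities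
  are 0.\<close>

lemma mult_ref: assumes a: "\<alpha> \<in> P" shows "mult (reff \<alpha> \<nu>) = mult \<nu>"
proof -
  have rr: "reff \<alpha> (reff \<alpha> \<nu>) = \<nu>" using rd.ref_ref[of \<alpha> \<nu>] a by blast
  show ?thesis
  proof (cases "\<nu> \<in> dual_space \<hh>")
    case True
    have "vec.dim (ws (reff \<alpha> \<nu>)) = vec.dim (ws \<nu>)"
      using dim_ws_ref[OF a True] dim_ws_ref[OF a reff_dual[OF a True]] unfolding rr by simp
    then show ?thesis using mult_dim[OF True] mult_dim[OF reff_dual[OF a True]] by simp
  next
    case False
    then have F: "reff \<alpha> \<nu> \<notin> dual_space \<hh>" using reff_dual[OF a, of "reff \<alpha> \<nu>"] unfolding rr by blast
    have z: "mult \<nu> = 0" if "\<nu> \<notin> dual_space \<hh>" for \<nu>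
      using that mult_nz[of \<nu>] wt(1) by blast
    show ?thesis by (simp only: z[OF F] z[OF False])
  qed
qed

end

section \<open>Determinants and the Weyl group\<close>

subsection \<open>The determinant of a composition with a reflection\<close>

definition leib :: "'b set \<Rightarrow> ('b \<Rightarrow> 'b \<Rightarrow> real) \<Rightarrow> real" where
  "leib E R = (\<Sum>p | p permutes E. of_int (sign p) * (\<Prod>b\<in>E. R b (p b)))"

lemma leib_transpose: "finite E \<Longrightarrow> leib E (\<lambda>b c. R c b) = leib E R"
proof -
  assume E: "finite E"
  have "leib E (\<lambda>b c. R c b) = (\<Sum>p | p permutes E. of_int (sign (inv p)) * (\<Prod>b\<in>E. R (inv p b) b))"
    unfolding leib_def by (rule sum_permutations_inverse)
  also have "\<dots> = leib E R"
    unfolding leib_def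
  proof (rule sum.cong[OF refl])
    fix p assume "p \<in> {p. p permutes E}"
    then have p: "p permutes E" by simp
    have "(\<Prod>b\<in>E. R (inv p b) b) = (\<Prod>b\<in>E. R b (p b))"
      using prod.permutes_inv[OF p, of "\<lambda>x y. R y x"] by simp
    then show "of_int (sign (inv p)) * (\<Prod>b\<in>E. R (inv p b) b) = of_int (sign p) * (\<Prod>b\<in>E. R b (p b))"
      using sign_inverse[OF permutes_imp_permutation[OF E p]] by simp
  qed
  finally show ?thesis .
qed

lemma leib_row:
  assumes E: "finite E" "q \<in> E"
  shows "leib E (R(q := (\<lambda>s. u s + c * v s))) = leib E (R(q := u)) + c * leib E (R(q := v))"
proof -
  have s: "(\<Prod>b\<in>E. (R(q := w)) b (p b)) = w (p q) * (\<Prod>b\<in>E - {q}. R b (p b))" for w p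
  proof -
    have "(\<Prod>b\<in>E. (R(q := w)) b (p b)) = (R(q := w)) q (p q) * (\<Prod>b\<in>E - {q}. (R(q := w)) b (p b))"
      by (rule prod.remove[OF E])
    also have "(\<Prod>b\<in>E - {q}. (R(q := w)) b (p b)) = (\<Prod>b\<in>E - {q}. R b (p b))" by (rule prod.cong) auto
    finally show ?thesis by simp
  qed
  show ?thesis unfolding leib_def s by (simp add: sum_distrib_left sum.distrib[symmetric] algebra_simps)
qed

text \<open>Composing each permutation with the transposition of the two rows keeps the product and
  changes the sign.\<close>

lemma leib_same_rows:
  assumes E: "finite E" "i \<in> E" "j \<in> E" and ij: "i \<noteq> j" "R i = R j"
  shows "leib E R = 0"
proof -
  let ?t = "Transposition.transpose i j"
  have t: "?t permutes E" by (rule permutes_swap_id[OF E(2,3)])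
  have "leib E R = (\<Sum>p | p permutes E. of_int (sign (p \<circ> ?t)) * (\<Prod>b\<in>E. R b ((p \<circ> ?t) b)))"
    unfolding leib_def by (rule sum_permutations_compose_right[OF t])
  also have "\<dots> = (\<Sum>p | p permutes E. - (of_int (sign p) * (\<Prod>b\<in>E. R b (p b))))"
  proof (rule sum.cong[OF refl])
    fix p assume "p \<in> {p. p permutes E}"
    then have p: "p permutes E" by simp
    have "sign (p \<circ> ?t) = - sign p"
      using sign_compose[OF permutes_imp_permutation[OF E(1) p] permutes_imp_permutation[OF E(1) t]] ij(1)
      by (simp add: sign_swap_id)
    moreover have "(\<Prod>b\<in>E. R b ((p \<circ> ?t) b)) = (\<Prod>b\<in>E. R (?t b) (p b))"
    proof -
      have "(\<Prod>b\<in>E. R b ((p \<circ> ?t) b)) = (\<Prod>b\<in>?t ` E. R (?t b) (p b))"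
        by (subst prod.reindex) (auto simp: o_def)
      then show ?thesis by (simp add: permutes_image[OF t])
    qed
    moreover have "R (?t b) = R b" for b using ij(2) by (simp add: Transposition.transpose_def)
    ultimately show "of_int (sign (p \<circ> ?t)) * (\<Prod>b\<in>E. R b ((p \<circ> ?t) b)) = - (of_int (sign p) * (\<Prod>b\<in>E. R b (p b)))"
      by simp
  qed
  finally have "leib E R = - leib E R" by (simp add: leib_def sum_negf)
  then show ?thesis by simp
qed

text \<open>By linearity in the row, every summand other than the one with \<open>k = q\<close>
  repeats a row of the matrix.\<close>

lemma leib_row_combination:
  assumes E: "finite E" "q \<in> E" and K: "K \<subseteq> E"
  shows "leib E (R(q := (\<lambda>s. \<Sum>k\<in>K. \<phi> k * R k s))) = (if q \<in> K then \<phi> q * leib E R else 0)"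
proof -
  have "finite K" using K E(1) finite_subset by blast
  then show ?thesis using K
  proof (induction K rule: finite_induct)
    case empty
    have "leib E (R(q := (\<lambda>s. 0))) = 0" using leib_row[OF E, of R "\<lambda>_. 0" "- 1" "\<lambda>_. 0"] by simp
    then show ?case by (simp del: fun_upd_apply)
  next
    case (insert k K)
    have "(\<lambda>s. \<Sum>k\<in>insert k K. \<phi> k * R k s) = (\<lambda>s. (\<Sum>k\<in>K. \<phi> k * R k s) + \<phi> k * R k s)"
      using insert.hyps by (simp add: add.commute)
    then have "leib E (R(q := (\<lambda>s. \<Sum>k\<in>insert k K. \<phi> k * R k s)))
        = leib E (R(q := (\<lambda>s. \<Sum>k\<in>K. \<phi> k * R k s))) + \<phi> k * leib E (R(q := R k))"
      by (simp only: leib_row[OF E])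
    moreover have "leib E (R(q := R k)) = (if k = q then leib E R else 0)"
    proof (cases "k = q")
      case False
      then show ?thesis using leib_same_rows[of E q k "R(q := R k)"] E insert.prems by simp
    qed simp
    moreover have "leib E (R(q := (\<lambda>s. \<Sum>k\<in>K. \<phi> k * R k s))) = (if q \<in> K then \<phi> q * leib E R else 0)"
      by (rule insert.IH) (use insert.prems in simp)
    ultimately have e: "leib E (R(q := (\<lambda>s. \<Sum>k\<in>insert k K. \<phi> k * R k s)))
        = (if q \<in> K then \<phi> q * leib E R else 0) + \<phi> k * (if k = q then leib E R else 0)" by (simp only:)
    show ?case unfolding e using insert.hyps by auto
  qed
qed

text \<open>The matrix determinant lemma: the updated matrix is \<open>(1 - a \<phi>)\<close> times
  \<open>R\<close> with \<open>a\<close> a column and \<open>\<phi>\<close> a row, and the first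
  factor has determinant \<open>1 - \<phi> a\<close>.\<close>

lemma leib_rank_one_update:
  assumes E: "finite E"
  defines "w \<equiv> \<lambda>R \<phi> s. \<Sum>k\<in>E. \<phi> k * R k s"
  shows "leib E (\<lambda>q s. R q s - a q * w R \<phi> s) = (1 - (\<Sum>q\<in>E. a q * \<phi> q)) * leib E R"
proof -
  define W where "W = w R \<phi>"
  \<comment> \<open>Only the rows in \<open>A\<close> have been updated so far, always by the
    combination \<open>W\<close> of the original rows; the induction adds one row at a time.\<close>
  define RA where "RA A = (\<lambda>q s. if q \<in> A then R q s - a q * W s else R q s)" for A
  \<comment> \<open>Once row \<open>q\<close> is \<open>W\<close>, earlier updates only subtracted
    multiples of row \<open>q\<close> and do not change the determinant.\<close>
  have same: "leib E ((RA A)(q := W)) = leib E (R(q := W))" if "finite A" "A \<subseteq> E" "q \<in> E" "q \<notin> A" for A q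
    using that
  proof (induction A rule: finite_induct)
    case empty
    then show ?case by (simp add: RA_def)
  next
    case (insert p A)
    have pq: "p \<noteq> q" "p \<in> E" using insert.prems by auto
    have e: "(RA (insert p A))(q := W) = ((RA A)(q := W))(p := (\<lambda>s. R p s + (- a p) * W s))"
      using pq by (auto simp: RA_def fun_eq_iff)
    have e1: "((RA A)(q := W))(p := R p) = (RA A)(q := W)"
      using pq insert.hyps by (auto simp: RA_def fun_eq_iff)
    have e2: "leib E (((RA A)(q := W))(p := W)) = 0"
      by (rule leib_same_rows[of E p q]) (use E pq insert.prems in auto)
    have "leib E ((RA (insert p A))(q := W)) = leib E ((RA A)(q := W))"
      unfolding e leib_row[OF E pq(2)] e1 e2 by simp
    also have "\<dots> = leib E (R(q := W))" by (rule insert.IH) (use insert.prems in auto)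
    finally show ?case .
  qed
  have row: "leib E (R(q := W)) = \<phi> q * leib E R" if "q \<in> E" for q
    unfolding W_def w_def using leib_row_combination[OF E that subset_refl, of R \<phi>] that by simp
  have main: "leib E (RA A) = (1 - (\<Sum>q\<in>A. a q * \<phi> q)) * leib E R" if "finite A" "A \<subseteq> E" for A
    using that
  proof (induction A rule: finite_induct)
    case empty
    then show ?case by (simp add: RA_def)
  next
    case (insert q A)
    have qE: "q \<in> E" using insert.prems by simp
    have e: "RA (insert q A) = (RA A)(q := (\<lambda>s. R q s + (- a q) * W s))"
      by (auto simp: RA_def fun_eq_iff)
    have e1: "(RA A)(q := R q) = RA A" using insert.hyps by (auto simp: RA_def fun_eq_iff)
    have "leib E (RA (insert q A)) = leib E (RA A) - a q * (\<phi> q * leib E R)"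
      unfolding e leib_row[OF E qE] e1 using same[of A q] row[OF qE] insert qE by simp
    then show ?case using insert by (simp add: algebra_simps)
  qed
  have "leib E (\<lambda>q s. R q s - a q * W s) = leib E (RA E)"
    unfolding leib_def RA_def by (intro sum.cong refl arg_cong2[where f = "(*)"] prod.cong) auto
  then show ?thesis using main[OF E subset_refl] by (simp add: W_def)
qed

lemma det_on_basis:
  fixes S :: "'v::euclidean_space set"
  assumes S: "subspace S"
  obtains E where "independent E" "span E = S" "finite E"
    "\<And>f. det_on S f = leib E (\<lambda>b c. representation E (f b) c)"
proof -
  define E where "E = (SOME E. independent E \<and> span E = S)"
  obtain B where B: "B \<subseteq> S" "independent B" "S \<subseteq> span B" by (rule maximal_independent_subset)
  then have "independent B \<and> span B = S" using span_minimal[OF B(1) S] by blast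
  then have "\<exists>E. independent E \<and> span E = S" by blast
  from someI_ex[OF this] have E: "independent E" "span E = S" by (simp_all add: E_def)
  moreover have "finite E" using E(1) by (rule independent_imp_finite)
  moreover have "det_on S f = leib E (\<lambda>b c. representation E (f b) c)" for f
    unfolding det_on_def leib_def E_def Let_def ..
  ultimately show ?thesis by (rule that)
qed

lemma det_on_id:
  fixes S :: "'v::euclidean_space set"
  assumes S: "subspace S" shows "det_on S id = 1"
proof -
  obtain E where E: "independent E" "span E = S" "finite E"
    "\<And>f. det_on S f = leib E (\<lambda>b c. representation E (f b) c)" using det_on_basis[OF S] by metis
  have "leib E (\<lambda>b c. representation E (id b) c) = (\<Sum>p\<in>{id}. of_int (sign p) * (\<Prod>b\<in>E. representation E (id b) (p b)))"
    unfolding leib_def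
  proof (rule sum.mono_neutral_right)
    show "finite {p. p permutes E}" by (rule finite_permutations[OF E(3)])
    show "\<forall>p\<in>{p. p permutes E} - {id}. of_int (sign p) * (\<Prod>b\<in>E. representation E (id b) (p b)) = 0"
    proof
      fix p assume p: "p \<in> {p. p permutes E} - {id}"
      then obtain b where b: "p b \<noteq> b" by (auto simp: fun_eq_iff)
      then have "b \<in> E" using p permutes_not_in by fastforce
      then have "representation E (id b) (p b) = 0" using b by (simp add: representation_basis[OF E(1)])
      then have "(\<Prod>b\<in>E. representation E (id b) (p b)) = 0" using \<open>b \<in> E\<close> E(3) by (meson prod_zero_iff)
      then show "of_int (sign p) * (\<Prod>b\<in>E. representation E (id b) (p b)) = 0" by simp
    qed
  qed (auto simp: permutes_id)
  also have "\<dots> = 1" by (simp add: representation_basis[OF E(1)] sign_id)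
  finally show ?thesis by (simp add: E(4))
qed

text \<open>The reflection changes the matrix of \<open>f\<close> by a rank-one term with factor
  \<open>1 - \<phi> a = -1\<close>. In \<open>det_on\<close> the images form the rows, so the matrix
  is transposed before the row update and afterwards back.\<close>

lemma det_on_reflection_comp:
  fixes S :: "'v::euclidean_space set" and \<phi> :: "'v \<Rightarrow> real"
  assumes S: "subspace S" and f: "\<And>x. x \<in> S \<Longrightarrow> f x \<in> S" and a: "a \<in> S"
    and \<phi>: "\<And>x y. x \<in> S \<Longrightarrow> y \<in> S \<Longrightarrow> \<phi> (x + y) = \<phi> x + \<phi> y" "\<And>c x. x \<in> S \<Longrightarrow> \<phi> (c *\<^sub>R x) = c * \<phi> x"
    and two: "\<phi> a = 2"
  shows "det_on S (\<lambda>x. f x - \<phi> (f x) *\<^sub>R a) = - det_on S f"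
proof -
  obtain E where E: "independent E" "span E = S" "finite E"
    "\<And>f. det_on S f = leib E (\<lambda>b c. representation E (f b) c)" using det_on_basis[OF S] by metis
  let ?r = "representation E"
  have ES: "b \<in> S" if "b \<in> E" for b using that E(2) span_base by blast
  have ex: "\<phi> x = (\<Sum>k\<in>E. \<phi> k * ?r x k)" if x: "x \<in> S" for x
  proof -
    have s: "\<phi> (\<Sum>k\<in>A. c k *\<^sub>R k) = (\<Sum>k\<in>A. \<phi> k * c k) \<and> (\<Sum>k\<in>A. c k *\<^sub>R k) \<in> S" if "finite A" "A \<subseteq> E" for A c
      using that
    proof (induction A rule: finite_induct)
      case empty
      then show ?case using \<phi>(2)[OF a, of 0] subspace_0[OF S] by simp
    next
      case (insert k A)
      then have k: "k \<in> S" "c k *\<^sub>R k \<in> S" using ES subspace_scale[OF S] by auto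
      then show ?case using insert \<phi>(1)[OF k(2), of "\<Sum>k\<in>A. c k *\<^sub>R k"] \<phi>(2)[OF k(1), of "c k"] subspace_add[OF S k(2)]
        by (simp add: mult.commute)
    qed
    have "(\<Sum>k\<in>E. ?r x k *\<^sub>R k) = x" using E x by (intro sum_representation_eq) auto
    then show ?thesis using s[OF E(3) subset_refl, of "?r x"] by simp
  qed
  have rep: "?r (f b - \<phi> (f b) *\<^sub>R a) c = ?r (f b) c - ?r a c * (\<Sum>k\<in>E. \<phi> k * ?r (f b) k)" if "b \<in> E" for b c
  proof -
    have fb: "f b \<in> span E" "a \<in> span E" using f[OF ES[OF that]] a E(2) by simp_all
    show ?thesis
      using ex[OF f[OF ES[OF that]]]
      by (simp add: representation_diff[OF E(1) span_scale[OF fb(2)] fb(1)] representation_scale[OF E(1) fb(2)])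
  qed
  have "det_on S (\<lambda>x. f x - \<phi> (f x) *\<^sub>R a) = leib E (\<lambda>b c. ?r (f b) c - ?r a c * (\<Sum>k\<in>E. \<phi> k * ?r (f b) k))"
    unfolding E(4) leib_def using rep by (intro sum.cong refl arg_cong2[where f = "(*)"] prod.cong) auto
  also have "\<dots> = leib E (\<lambda>c b. ?r (f b) c - ?r a c * (\<Sum>k\<in>E. \<phi> k * ?r (f b) k))"
    by (rule leib_transpose[OF E(3), symmetric])
  also have "\<dots> = (1 - (\<Sum>q\<in>E. ?r a q * \<phi> q)) * leib E (\<lambda>c b. ?r (f b) c)"
    by (rule leib_rank_one_update[OF E(3), of "\<lambda>c b. ?r (f b) c"])
  also have "(\<Sum>q\<in>E. ?r a q * \<phi> q) = 2" using ex[OF a] two by (simp add: mult.commute)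
  also have "leib E (\<lambda>c b. ?r (f b) c) = leib E (\<lambda>b c. ?r (f b) c)"
    by (rule leib_transpose[OF E(3)])
  finally show ?thesis by (simp add: E(4))
qed

subsection \<open>The Weyl group acts by words in reflections\<close>

context compact_lie_pos
begin

lemma reflection_eq: "\<alpha> \<in> \<R> \<Longrightarrow> reflection \<hh> B \<alpha> X = X - (2 * \<alpha> X / ipp \<alpha> \<alpha>) *\<^sub>R tt \<alpha>"
  by (simp add: reflection_def riesz_eq dual_inner_eq rootD)

lemma reflection_h: "\<alpha> \<in> \<R> \<Longrightarrow> X \<in> \<hh> \<Longrightarrow> reflection \<hh> B \<alpha> X \<in> \<hh>"
  by (simp add: reflection_eq subspace_diff[OF h_sub] subspace_scale[OF h_sub] tt_h)

lemma reflection_outside: "\<alpha> \<in> \<R> \<Longrightarrow> X \<notin> \<hh> \<Longrightarrow> reflection \<hh> B \<alpha> X = X"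
  by (simp add: reflection_eq dual_outside[OF rootD(1)])

lemma dual_reflection:
  assumes a: "\<alpha> \<in> \<R>" and \<nu>: "\<nu> \<in> dual_space \<hh>"
  shows "\<nu> \<circ> reflection \<hh> B \<alpha> = reff \<alpha> \<nu>"
proof
  fix X
  show "(\<nu> \<circ> reflection \<hh> B \<alpha>) X = reff \<alpha> \<nu> X"
  proof (cases "X \<in> \<hh>")
    case True
    let ?c = "2 * \<alpha> X / ipp \<alpha> \<alpha>"
    have c: "?c *\<^sub>R tt \<alpha> \<in> \<hh>" by (intro subspace_scale[OF h_sub] tt_h)
    have "X - ?c *\<^sub>R tt \<alpha> \<in> \<hh>" by (intro subspace_diff[OF h_sub] True c)
    from dual_linear(1)[OF \<nu> this c] have "\<nu> X = \<nu> (X - ?c *\<^sub>R tt \<alpha>) + ?c * ipp \<nu> \<alpha>"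
      by (simp only: diff_add_cancel dual_linear(2)[OF \<nu> tt_h tt_h] dual_tt[OF \<nu>])
    then show ?thesis by (simp add: reflection_eq[OF a] fun_apply)
  next
    case False
    then show ?thesis
      by (simp add: reflection_outside[OF a] fun_apply dual_outside[OF \<nu>] dual_outside[OF rootD(1)[OF a]])
  qed
qed

lemma reflection_involution: assumes a: "\<alpha> \<in> \<R>" shows "reflection \<hh> B \<alpha> \<circ> reflection \<hh> B \<alpha> = id"
proof
  fix X
  have p: "ipp \<alpha> \<alpha> > 0" by (rule ipp_root[OF a])
  show "(reflection \<hh> B \<alpha> \<circ> reflection \<hh> B \<alpha>) X = id X"
  proof (cases "X \<in> \<hh>")
    case True
    have "\<alpha> (reflection \<hh> B \<alpha> X) = reff \<alpha> \<alpha> X"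
      using fun_cong[OF dual_reflection[OF a rootD(1)[OF a]], of X] by simp
    then have e: "\<alpha> (reflection \<hh> B \<alpha> X) = - \<alpha> X" using p by (simp add: fun_apply)
    have "reflection \<hh> B \<alpha> (reflection \<hh> B \<alpha> X) = reflection \<hh> B \<alpha> X + (2 * \<alpha> X / ipp \<alpha> \<alpha>) *\<^sub>R tt \<alpha>"
      using reflection_eq[OF a, of "reflection \<hh> B \<alpha> X"] unfolding e by simp
    also have "\<dots> = X" unfolding reflection_eq[OF a, of X] by simp
    finally show ?thesis by simp
  qed (simp add: reflection_outside[OF a])
qed

lemma det_reflection_comp:
  assumes a: "\<alpha> \<in> \<R>" and f: "\<And>X. X \<in> \<hh> \<Longrightarrow> f X \<in> \<hh>"
  shows "det_on \<hh> (reflection \<hh> B \<alpha> \<circ> f) = - det_on \<hh> f"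
proof -
  have p: "ipp \<alpha> \<alpha> > 0" by (rule ipp_root[OF a])
  have "reflection \<hh> B \<alpha> \<circ> f = (\<lambda>x. f x - (2 * \<alpha> (f x) / ipp \<alpha> \<alpha>) *\<^sub>R tt \<alpha>)"
    by (rule ext) (simp add: reflection_eq[OF a])
  moreover have "det_on \<hh> (\<lambda>x. f x - (2 * \<alpha> (f x) / ipp \<alpha> \<alpha>) *\<^sub>R tt \<alpha>) = - det_on \<hh> f"
    by (rule det_on_reflection_comp[OF h_sub f tt_h, where \<phi> = "\<lambda>x. 2 * \<alpha> x / ipp \<alpha> \<alpha>"])
       (use p in \<open>simp_all add: dual_linear[OF rootD(1)[OF a]] dual_tt[OF rootD(1)[OF a]] add_divide_distrib ring_distribs\<close>)
  ultimately show ?thesis by simp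
qed

abbreviation "W \<equiv> weyl_group \<hh> B \<R>"

lemma act_dual: "set w \<subseteq> P \<Longrightarrow> \<nu> \<in> dual_space \<hh> \<Longrightarrow> rd.act w \<nu> \<in> dual_space \<hh>"
proof (induction w)
  case (Cons \<alpha> w)
  then have "rd.act w \<nu> \<in> dual_space \<hh>" "\<alpha> \<in> dual_space \<hh>" using PR rootD(1) by auto
  then show ?case by (simp add: dual_closed(2,5))
qed simp

text \<open>Links a Weyl group element, a map of the whole matrix space, with a word acting on
  functionals. Fixing the complement of \<open>\<hh>\<close> pointwise is included so that the word
  determines the map.\<close>

definition realizes :: "(complex ^ 'a ^ 'a \<Rightarrow> complex ^ 'a ^ 'a) \<Rightarrow> 'a functional list \<Rightarrow> bool" where
  "realizes \<sigma> w \<longleftrightarrow> set w \<subseteq> P \<and> bij \<sigma> \<and> (\<forall>X\<in>\<hh>. \<sigma> X \<in> \<hh>) \<and> (\<forall>X. X \<notin> \<hh> \<longrightarrow> inv \<sigma> X = X) \<and>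
    (\<forall>\<nu>\<in>dual_space \<hh>. dual_action \<sigma> \<nu> = rd.act w \<nu>) \<and> det_on \<hh> \<sigma> = (- 1) ^ length w"

lemma realizes_id: "realizes id []"
  by (simp add: realizes_def dual_action_def det_on_id[OF h_sub] inv_id)

lemma realizes_step:
  assumes a: "\<alpha> \<in> P" and s: "realizes \<sigma> w"
  shows "realizes (reflection \<hh> B \<alpha> \<circ> \<sigma>) (\<alpha> # w)"
proof -
  let ?r = "reflection \<hh> B \<alpha>"
  have aR: "\<alpha> \<in> \<R>" by (rule PR[OF a])
  note inv = reflection_involution[OF aR]
  have br: "bij ?r" by (rule o_bij[OF inv inv])
  have bs: "bij \<sigma>" and w: "set w \<subseteq> P" using s by (simp_all add: realizes_def)
  have ir: "inv ?r = ?r" by (rule inv_unique_comp[OF inv inv])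
  have inv_comp: "inv (?r \<circ> \<sigma>) = inv \<sigma> \<circ> ?r" using o_inv_distrib[OF br bs] by (simp add: ir)
  show ?thesis
    unfolding realizes_def
  proof (intro conjI ballI allI impI)
    show "set (\<alpha> # w) \<subseteq> P" using a w by simp
    show "bij (?r \<circ> \<sigma>)" by (rule bij_comp[OF bs br])
    show "(?r \<circ> \<sigma>) X \<in> \<hh>" if "X \<in> \<hh>" for X
      using that s reflection_h[OF aR] by (simp add: realizes_def)
    show "inv (?r \<circ> \<sigma>) X = X" if "X \<notin> \<hh>" for X
      using that s by (simp add: inv_comp reflection_outside[OF aR] realizes_def)
    show "dual_action (?r \<circ> \<sigma>) \<nu> = rd.act (\<alpha> # w) \<nu>" if \<nu>: "\<nu> \<in> dual_space \<hh>" for \<nu>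
    proof -
      have "dual_action (?r \<circ> \<sigma>) \<nu> = dual_action \<sigma> \<nu> \<circ> ?r" by (simp add: dual_action_def inv_comp o_assoc)
      also have "dual_action \<sigma> \<nu> = rd.act w \<nu>" using s \<nu> by (simp add: realizes_def)
      also have "rd.act w \<nu> \<circ> ?r = reff \<alpha> (rd.act w \<nu>)" by (rule dual_reflection[OF aR act_dual[OF w \<nu>]])
      also have "\<dots> = rd.act (\<alpha> # w) \<nu>" by simp
      finally show ?thesis .
    qed
    have "det_on \<hh> (?r \<circ> \<sigma>) = - det_on \<hh> \<sigma>"
      by (rule det_reflection_comp[OF aR]) (use s in \<open>simp add: realizes_def\<close>)
    then show "det_on \<hh> (?r \<circ> \<sigma>) = (- 1) ^ length (\<alpha> # w)" using s by (simp add: realizes_def)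
  qed
qed

lemma reflection_minus: "\<alpha> \<in> \<R> \<Longrightarrow> reflection \<hh> B (- \<alpha>) = reflection \<hh> B \<alpha>"
proof
  fix X assume a: "\<alpha> \<in> \<R>"
  have "tt (- \<alpha>) = - tt \<alpha>" by (simp add: tt_def fun_apply sum_negf)
  then show "reflection \<hh> B (- \<alpha>) X = reflection \<hh> B \<alpha> X"
    by (simp add: reflection_eq[OF a] reflection_eq[OF root_minus[OF a]] ipp_simps fun_apply)
qed

lemma W_realizes: "\<sigma> \<in> W \<Longrightarrow> \<exists>w. realizes \<sigma> w"
proof (induction rule: weyl_group.induct)
  case one
  then show ?case using realizes_id by blast
next
  case (step \<sigma> \<alpha>)
  then obtain w where w: "realizes \<sigma> w" by blast
  have "\<alpha> \<in> P \<or> - \<alpha> \<in> P" using step.hyps(2) roots_split by auto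
  then show ?case
  proof
    assume "\<alpha> \<in> P"
    then show ?thesis using realizes_step w by blast
  next
    assume m: "- \<alpha> \<in> P"
    show ?thesis using realizes_step[OF m w] unfolding reflection_minus[OF step.hyps(2)] by blast
  qed
qed

lemma word_realized: "set w \<subseteq> P \<Longrightarrow> \<exists>\<sigma>\<in>W. realizes \<sigma> w"
proof (induction w)
  case Nil
  then show ?case using realizes_id weyl_group.one by blast
next
  case (Cons \<alpha> w)
  then obtain \<sigma> where s: "\<sigma> \<in> W" "realizes \<sigma> w" by auto
  have a: "\<alpha> \<in> P" using Cons.prems by simp
  show ?case using realizes_step[OF a s(2)] weyl_group.step[OF s(1) PR[OF a]] by blast
qed

lemma dual_separates:
  assumes X: "X \<in> \<hh>" and Y: "Y \<in> \<hh>" and eq: "\<And>\<nu>. \<nu> \<in> dual_space \<hh> \<Longrightarrow> \<nu> X = \<nu> Y"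
  shows "X = Y"
proof -
  define \<nu> :: "'a functional" where "\<nu> Z = (if Z \<in> \<hh> then B Z (X - Y) else 0)" for Z
  have d: "X - Y \<in> \<hh>" by (rule subspace_diff[OF h_sub X Y])
  have "\<nu> \<in> dual_space \<hh>"
    unfolding dual_space_def \<nu>_def
    by (auto simp: subspace_add[OF h_sub] subspace_scale[OF h_sub] B_add B_scale hgD d)
  from eq[OF this] have "B X (X - Y) = B Y (X - Y)" by (simp add: \<nu>_def X Y)
  then have "B (X - Y) (X - Y) = 0" using B_diff(1)[OF hgD[OF X] hgD[OF Y] hgD[OF d]] by simp
  then show ?thesis using B_eq_0[OF hgD[OF d]] by simp
qed

text \<open>Functionals separate the points of \<open>\<hh>\<close>, so the dual action determines
  the inverse there; elsewhere the inverse is the identity.\<close>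

lemma realizes_unique:
  assumes s: "realizes \<sigma> w" and s': "realizes \<sigma>' w'" and eq: "rd.act w = rd.act w'"
  shows "\<sigma> = \<sigma>'"
proof -
  have b: "bij \<sigma>" "bij \<sigma>'" using s s' by (simp_all add: realizes_def)
  have ih: "inv \<sigma> X \<in> \<hh>" if r: "realizes \<sigma> w" and X: "X \<in> \<hh>" for \<sigma> w X
  proof (rule ccontr)
    have b: "bij \<sigma>" using r by (simp add: realizes_def)
    assume n: "inv \<sigma> X \<notin> \<hh>"
    then have "inv \<sigma> (inv \<sigma> X) = inv \<sigma> X" using r by (simp add: realizes_def)
    then have "\<sigma> (inv \<sigma> (inv \<sigma> X)) = \<sigma> (inv \<sigma> X)" by simp
    then have "inv \<sigma> X = X" by (simp add: surj_f_inv_f[OF bij_is_surj[OF b]])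
    then show False using n X by simp
  qed
  have "inv \<sigma> X = inv \<sigma>' X" for X
  proof (cases "X \<in> \<hh>")
    case True
    show ?thesis
    proof (rule dual_separates[OF ih[OF s True] ih[OF s' True]])
      fix \<nu> assume \<nu>: "\<nu> \<in> dual_space \<hh>"
      have "dual_action \<sigma> \<nu> = dual_action \<sigma>' \<nu>" using s s' \<nu> eq by (simp add: realizes_def)
      then show "\<nu> (inv \<sigma> X) = \<nu> (inv \<sigma>' X)" unfolding dual_action_def by (metis comp_apply)
    qed
  next
    case False
    then show ?thesis using s s' by (simp add: realizes_def)
  qed
  then have "inv \<sigma> = inv \<sigma>'" by (rule ext)
  then show ?thesis using inv_inv_eq b by metis
qed

text \<open>The word of one element followed by the reversed word of the other fixes
  \<open>\<kappa>\<close>, hence acts trivially. This makes the terms of the alternating sum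
  distinct.\<close>

lemma W_free:
  assumes k: "rd.regular_dominant \<kappa>" and s: "realizes \<sigma> w" and s': "realizes \<sigma>' w'"
    and eq: "rd.act w \<kappa> = rd.act w' \<kappa>"
  shows "\<sigma> = \<sigma>'"
proof -
  have P: "set w \<subseteq> P" "set w' \<subseteq> P" using s s' by (simp_all add: realizes_def)
  then have PR': "set w' \<subseteq> P \<union> uminus ` P" by blast
  have "rd.act (rev w' @ w) \<kappa> = \<kappa>" using eq rd.act_rev(1)[OF PR'] by simp
  then have id: "rd.act (rev w' @ w) = id" by (rule rd.stabilizer_trivial[OF k, rotated]) (use P in auto)
  have "rd.act w \<nu> = rd.act w' \<nu>" for \<nu>
  proof -
    have "rd.act (rev w') (rd.act w \<nu>) = \<nu>" using fun_cong[OF id, of \<nu>] by simp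
    then have "rd.act w' (rd.act (rev w') (rd.act w \<nu>)) = rd.act w' \<nu>" by simp
    then show ?thesis using rd.act_rev(2)[OF PR'] by simp
  qed
  then have "rd.act w = rd.act w'" by (rule ext)
  then show ?thesis by (rule realizes_unique[OF s s'])
qed

lemma half_sum_eq: "half_sum P = rd.rho"
proof
  fix X
  have "(\<Sum>\<alpha>\<in>A. \<alpha>) X = (\<Sum>\<alpha>\<in>A. \<alpha> X)" for A :: "'a functional set"
    by (induction A rule: infinite_finite_induct) (simp_all add: fun_apply)
  then show "half_sum P X = rd.rho X" by (simp add: half_sum_def rd.rho_def scl_def)
qed

lemma half_sum_dual: "half_sum P \<in> dual_space \<hh>"
proof -
  have "(\<Sum>\<alpha>\<in>A. \<alpha>) \<in> dual_space \<hh>" if "A \<subseteq> P" for A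
    using that by (induction A rule: infinite_finite_induct) (auto simp: dual_closed PR rootD(1))
  then show ?thesis unfolding half_sum_eq rd.rho_def by (intro dual_closed) simp
qed

end

section \<open>Assembly of the character formula\<close>

context highest_weight_rep
begin

lemma weyl_denominator_eq: "weyl_denominator P = rd.pi_prod P"
  by (simp add: weyl_denominator_def rd.pi_prod_def formal_exp_def)

theorem character_formula:
  assumes dom: "\<And>\<alpha>. \<alpha> \<in> P \<Longrightarrow> ipp \<mu> \<alpha> \<ge> 0"
  shows "character \<hh> \<pi> = formal_times (formal_inverse P (coef (weyl_denominator P)))
    (coef (\<Sum>\<sigma>\<in>W. Poly_Mapping.single 0 (det_on \<hh> \<sigma>) * formal_exp (dual_action \<sigma> (\<mu> + half_sum P) - half_sum P)))"
proof -
  let ?k = "\<mu> + rd.rho"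
  obtain X where X: "coef X = mult" "rd.regular_dominant ?k"
    "\<And>w. set w \<subseteq> P \<Longrightarrow> coef (rd.den * X) (rd.act w ?k) = (- 1) ^ length w"
    "\<And>\<nu>. coef (rd.den * X) \<nu> \<noteq> 0 \<Longrightarrow> \<exists>w. set w \<subseteq> P \<and> \<nu> = rd.act w ?k"
    by (rule rd.numerator[of \<mu> mult tf])
       (use dom finite_mult mult_cone mult_top mult_ref finite_tf tf_diff freudenthal[unfolded cval_def] in auto)
  have kd: "?k \<in> dual_space \<hh>" using half_sum_dual unfolding half_sum_eq by (intro dual_closed \<mu>)
  let ?D = "\<lambda>\<sigma>. dual_action \<sigma> ?k"
  have Dw: "?D \<sigma> = rd.act w ?k" if "realizes \<sigma> w" for \<sigma> w using that kd by (simp add: realizes_def)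
  have coef_D: "coef (rd.den * X) (?D \<sigma>) = det_on \<hh> \<sigma>" if s: "\<sigma> \<in> W" for \<sigma>
  proof -
    obtain w where w: "realizes \<sigma> w" using W_realizes[OF s] by blast
    then have "set w \<subseteq> P" "det_on \<hh> \<sigma> = (- 1) ^ length w" by (simp_all add: realizes_def)
    then show ?thesis using X(3) Dw[OF w] by simp
  qed
  have inj: "inj_on ?D W"
  proof (rule inj_onI)
    fix \<sigma> \<sigma>' assume s: "\<sigma> \<in> W" "\<sigma>' \<in> W" "?D \<sigma> = ?D \<sigma>'"
    obtain w w' where w: "realizes \<sigma> w" "realizes \<sigma>' w'" using W_realizes s(1,2) by blast
    show "\<sigma> = \<sigma>'" using W_free[OF X(2) w] s(3) unfolding Dw[OF w(1)] Dw[OF w(2)] by blast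
  qed
  have det_nz: "det_on \<hh> \<sigma> \<noteq> 0" if "\<sigma> \<in> W" for \<sigma>
    using W_realizes[OF that] by (auto simp: realizes_def)
  \<comment> \<open>The orbit map is injective into the support of the numerator, which is finite;
    this is also where non-vanishing of the determinants enters.\<close>
  have finW: "finite W"
  proof (rule finite_imageD[OF _ inj])
    have "?D ` W \<subseteq> supp (rd.den * X)" using coef_D det_nz by (auto simp: in_keys_iff)
    then show "finite (?D ` W)" by (rule finite_subset) simp
  qed
  \<comment> \<open>Coefficients are compared after shifting by \<open>rd.rho\<close>. By freeness
    at most one Weyl group element contributes to an exponent, and exponents outside the orbit have
    coefficient 0.\<close>
  have num: "(\<Sum>\<sigma>\<in>W. Poly_Mapping.single 0 (det_on \<hh> \<sigma>) * formal_exp (?D \<sigma> - rd.rho)) = weyl_denominator P * X"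
  proof (rule poly_mapping_eqI)
    fix \<nu>
    have "ee (- rd.rho) * ee rd.rho = 1" by (simp add: mult_single)
    then have "weyl_denominator P * X = ee (- rd.rho) * (rd.den * X)"
      unfolding rd.den_def weyl_denominator_eq mult.assoc[symmetric] by simp
    then have r: "coef (weyl_denominator P * X) \<nu> = coef (rd.den * X) (\<nu> + rd.rho)"
      by (simp add: rd.coef_ee_times)
    have l: "coef (\<Sum>\<sigma>\<in>W. Poly_Mapping.single 0 (det_on \<hh> \<sigma>) * formal_exp (?D \<sigma> - rd.rho)) \<nu>
        = (\<Sum>\<sigma>\<in>W. if ?D \<sigma> = \<nu> + rd.rho then det_on \<hh> \<sigma> else 0)"
      unfolding lookup_sum
    proof (rule sum.cong[OF refl])
      fix \<sigma>
      have "(?D \<sigma> - rd.rho = \<nu>) = (?D \<sigma> = \<nu> + rd.rho)" by (metis add_diff_cancel diff_add_cancel)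
      then show "coef (Poly_Mapping.single 0 (det_on \<hh> \<sigma>) * formal_exp (?D \<sigma> - rd.rho)) \<nu>
          = (if ?D \<sigma> = \<nu> + rd.rho then det_on \<hh> \<sigma> else 0)"
        by (simp add: formal_exp_def mult_single lookup_single when_def)
    qed
    show "coef (\<Sum>\<sigma>\<in>W. Poly_Mapping.single 0 (det_on \<hh> \<sigma>) * formal_exp (?D \<sigma> - rd.rho)) \<nu> = coef (weyl_denominator P * X) \<nu>"
    proof (cases "\<exists>\<sigma>\<in>W. ?D \<sigma> = \<nu> + rd.rho")
      case True
      then obtain \<sigma> where s: "\<sigma> \<in> W" "?D \<sigma> = \<nu> + rd.rho" by blast
      have "(\<Sum>\<sigma>'\<in>W. if ?D \<sigma>' = \<nu> + rd.rho then det_on \<hh> \<sigma>' else 0) = (\<Sum>\<sigma>'\<in>W. if \<sigma>' = \<sigma> then det_on \<hh> \<sigma> else 0)"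
      proof (rule sum.cong[OF refl])
        fix \<sigma>' assume s': "\<sigma>' \<in> W"
        have "(?D \<sigma>' = \<nu> + rd.rho) = (\<sigma>' = \<sigma>)" using inj_onD[OF inj _ s' s(1)] s(2) by auto
        then show "(if ?D \<sigma>' = \<nu> + rd.rho then det_on \<hh> \<sigma>' else 0) = (if \<sigma>' = \<sigma> then det_on \<hh> \<sigma> else 0)" by simp
      qed
      also have "\<dots> = det_on \<hh> \<sigma>" using finW s(1) by simp
      finally show ?thesis unfolding l r s(2)[symmetric] coef_D[OF s(1)] by (simp add: s(2))
    next
      case False
      have "coef (rd.den * X) (\<nu> + rd.rho) = 0"
      proof (rule ccontr)
        assume "coef (rd.den * X) (\<nu> + rd.rho) \<noteq> 0"
        then obtain w where w: "set w \<subseteq> P" "\<nu> + rd.rho = rd.act w ?k" using X(4) by blast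
        obtain \<sigma> where "\<sigma> \<in> W" "realizes \<sigma> w" using word_realized[OF w(1)] by blast
        then show False using False Dw w(2) by metis
      qed
      moreover have "(\<Sum>\<sigma>\<in>W. if ?D \<sigma> = \<nu> + rd.rho then det_on \<hh> \<sigma> else 0) = 0"
        by (rule sum.neutral) (use False in auto)
      ultimately show ?thesis unfolding l r by simp
    qed
  qed
  have "formal_times (formal_inverse P (coef (weyl_denominator P))) (coef (weyl_denominator P * X)) = coef X"
    by (rule formal_inverse_denominator_times[OF finite_P]) (use P_pos in blast)
  then show ?thesis unfolding half_sum_eq num X(1) character_eq by simp
qed

end

theorem mainTheorem6:
  fixes G S \<gg> \<hh> :: "(complex ^ 'n ^ 'n) set"
    and B :: "complex ^ 'n ^ 'n \<Rightarrow> complex ^ 'n ^ 'n \<Rightarrow> real"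
    and \<Phi> P :: "'n functional set"
    and W :: "(complex ^ 'n ^ 'n \<Rightarrow> complex ^ 'n ^ 'n) set"
    and \<rho> \<mu> :: "'n functional"
    and \<pi> :: "complex ^ 'n ^ 'n \<Rightarrow> complex ^ 'm ^ 'm"
  assumes "compact_matrix_group G" and "simple_matrix_group G" and "\<gg> = lie_algebra G"
    and "maximal_torus G S" and "\<hh> = lie_algebra S"
    and "invariant_inner_product \<gg> B"
    and "\<Phi> = roots \<gg> \<hh>" and "positive_roots \<hh> \<Phi> P" and "\<rho> = half_sum P"
    and "W = weyl_group \<hh> B \<Phi>"
    and "generalised_weight \<hh> B \<Phi> \<mu>" and "dominant \<hh> B P \<mu>"
    and "irreducible_representation \<gg> \<pi>" and "has_highest_weight \<gg> \<hh> P \<pi> \<mu>"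
  shows "character \<hh> \<pi> =
    formal_times (formal_inverse P (Poly_Mapping.lookup (weyl_denominator P)))
      (Poly_Mapping.lookup
        (\<Sum>\<sigma>\<in>W. Poly_Mapping.single 0 (det_on \<hh> \<sigma>) * formal_exp (dual_action \<sigma> (\<mu> + \<rho>) - \<rho>)))"
proof -
  have S: "torus_in G S" "S \<subseteq> G" "compact_matrix_group S"
    using assms(4) by (auto simp: maximal_torus_def torus_in_def)
  interpret L: compact_lie \<gg> \<hh> B
  proof
    show "subspace \<gg>" unfolding assms(3) by (rule subspace_lie_algebra[OF assms(1)])
    show "lie_bracket X Y \<in> \<gg>" if "X \<in> \<gg>" "Y \<in> \<gg>" for X Y
      using that unfolding assms(3) by (rule lie_bracket_in_lie_algebra[OF assms(1)])
    show "invariant_inner_product \<gg> B" by fact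
    show "subspace \<hh>" unfolding assms(5) by (rule subspace_lie_algebra[OF S(3)])
    show "\<hh> \<subseteq> \<gg>" unfolding assms(3,5) using S(2) by (auto simp: lie_algebra_def)
    show "lie_bracket X Y = 0" if "X \<in> \<hh>" "Y \<in> \<hh>" for X Y
      using that unfolding assms(5) by (rule lie_algebra_torus_abelian[OF S(1)])
    \<comment> \<open>Here maximality of the torus enters.\<close>
    show "X \<in> \<hh>" if X: "X \<in> \<gg>" and c: "\<And>H. H \<in> \<hh> \<Longrightarrow> lie_bracket H X = 0" for X
      unfolding assms(5)
    proof (rule maximal_torus_self_centralizing[OF assms(1,4) X[unfolded assms(3)]])
      show "lie_bracket X H = 0" if "H \<in> lie_algebra S" for H
        using c[of H] that lie_bracket_anticomm[of X H] by (simp add: assms(5))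
    qed
  qed
  obtain H0 where H0: "H0 \<in> \<hh>" "\<forall>\<alpha>\<in>\<Phi>. \<alpha> H0 \<noteq> 0" "P = {\<alpha> \<in> \<Phi>. \<alpha> H0 > 0}"
    using assms(8) unfolding positive_roots_def by blast
  obtain v0 where v0: "\<mu> \<in> dual_space \<hh>" "v0 \<in> weight_space \<hh> \<pi> \<mu>" "v0 \<noteq> 0"
    "\<forall>\<alpha>\<in>P. \<forall>E\<in>root_space \<gg> \<hh> \<alpha>. complexified_action \<pi> E v0 = 0"
    using assms(14) unfolding has_highest_weight_def by blast
  interpret R: highest_weight_rep \<gg> \<hh> B P H0 \<pi> \<mu> v0
    by unfold_locales (use H0 v0 assms(7,13) in auto)
  have "L.ipp \<mu> \<alpha> \<ge> 0" if "\<alpha> \<in> P" for \<alpha>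
  proof -
    have "\<alpha> \<in> dual_space \<hh>" using L.rootD(1)[OF R.PR[OF that]] .
    moreover have "dual_inner \<hh> B \<mu> \<alpha> \<ge> 0" using assms(12) that by (simp add: dominant_def)
    ultimately show ?thesis using L.dual_inner_eq[OF v0(1)] by simp
  qed
  from R.character_formula[OF this] show ?thesis unfolding assms(7,9,10) .
qed

end
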